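(* Suppose that $V\in P_0(\mathcal T)$ is piecewise constant. For every $k\in\mathbb{N}$, the $k$-th exact eigenvalue $\lambda=\lambda_k$ of the Schrödinger eigenvalue problem and the $k$-th positive eigenvalue $\lambda_{\mathrm{es}}=\lambda_{\mathrm{es}(k)}$ of the extra-stabilised (sCR) eigenvalue problem satisfy, with $\varepsilon'':=\kappa_{\mathrm{eCR}}^2h_{\max}^2$ and $(\bullet)_+:=\max\{0,\bullet\}$, $$\mathrm{GLB}_{\mathrm{es}}:=\frac{\lambda_{\mathrm{es}}}{1+(\varepsilon''\lambda_{\mathrm{es}}-1)_+}\le\lambda .$$
   Context: Let $\Omega\subset\mathbb{R}^n$, $n\ge2$, be a polyhedral bounded Lipschitz domain and $V\in L^\infty(\Omega)$ with $\operatorname{ess\,inf}_\Omega V=0$. Write $(v,w)_V:=\int_\Omega V v w\,dx$. The exact eigenvalues $0<\lambda_1\le\lambda_2\le\dots$ (counted with multiplicity) are those of: find $(\lambda,u)\in\mathbb{R}_+\times H_0^1(\Omega)$, $u\ne0$, with $\int_\Omega\nabla u\cdot\nabla v\,dx+(u,v)_V=\lambda\int_\Omega uv\,dx$ for all $v\in H^1_0(\Omega)$. $\mathcal{T}$ is a regular (face-to-face) triangulation of $\Omega$ into non-degenerate compact $n$-simplices, $h_T:=\operatorname{diam}(T)$, $h_{\mathcal T}|_T:=h_T$, $h_{\max}:=\max_Th_T$, $\mathcal F$ is the set of all faces, $\mathcal F(\Omega)$ the set of interior faces, $\mathcal V(T)$ the set of vertices of $T$, $\operatorname{mid}(\cdot)$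 denotes the barycenter. The jump $[v]_F$ of a piecewise continuous function is the difference of the traces from the two adjacent simplices if $F$ is interior and the trace $v|_F$ if $F\subset\partial\Omega$. $P_m(\mathcal T)$ is the space of piecewise polynomials of total degree at most $m$ and $\Pi_0$ the $L^2$ projection onto $P_0(\mathcal T)$. Set $\mathrm{CR}_0^1(\mathcal T):=\{v\in P_1(\mathcal T): [v]_F(\operatorname{mid}(F))=0\ \forall F\in\mathcal F\}$. For $T\in\mathcal T$ the bubble is $$\flat_T(x):=\frac{n+2}{2}-\frac{n(n+1)^2(n+2)}{\sum_{P\ne Q\in\mathcal V(T)}|P-Q|^2}\,|x-\operatorname{mid}(T)|^2\quad(x\in T),$$ extended by zero outside $T$ (sum over ordered pairs, so that $\int_F\flat_T\,ds=0$ for each face $F$ of $T$ and $|T|^{-1}\int_T\flat_T\,dx=1$). Let $B(\mathcal T)$ be the span of all $\flat_T$, $\mathbb{V}_{\mathrm{nc}}:=\mathrm{eCR}_0^1(\mathcal T):=\mathrm{CR}_0^1(\mathcal T)\oplus B(\mathcal T)$, $\mathbb{V}_{\mathrm{pw}}:=P_1(\mathcal T)\oplus B(\mathcal T)$, and $\mathbb{V}_{\mathrm{es}}:=\mathbb{V}_{\mathrm{pw}}\times\mathbb{V}_{\mathrm{nc}}$. Let $a_{\mathrm{pw}}(v,w):=\sum_{T\in\mathcal T}\int_T\nabla v\cdot\nabla w\,dx$. Interpolation: for $F\in\mathcal F(\Omega)$ let $\psi_F\in\mathrm{CR}^1_0(\mathcal T)$ be equal to $1$ at $\operatorname{mid}(F)$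 and $0$ at the midpoints of all other faces, $I_{\mathrm{CR}}v:=\sum_{F\in\mathcal F(\Omega)}\big(|F|^{-1}\int_Fv\,ds\big)\psi_F$, and $I_{\mathrm{eCR}}v:=I_{\mathrm{CR}}v+\sum_{T\in\mathcal T}\big(|T|^{-1}\int_T(v-I_{\mathrm{CR}}v)\,dx\big)\flat_T$. The constant $\kappa_{\mathrm{eCR}}>0$ is such that $\|v-I_{\mathrm{eCR}}v\|_{L^2(T)}\le\kappa_{\mathrm{eCR}}h_T\|\nabla(v-I_{\mathrm{eCR}}v)\|_{L^2(T)}$ for all $v\in H_0^1(\Omega)$, $T\in\mathcal T$. sCR eigenvalue problem: find $(\lambda_{\mathrm{es}},u_{\mathrm{es}})\in\mathbb{R}_+\times(\mathbb{V}_{\mathrm{es}}\setminus\{0\})$ with $a_{\mathrm{es}}(u_{\mathrm{es}},v_{\mathrm{es}})=\lambda_{\mathrm{es}}b_{\mathrm{es}}(u_{\mathrm{es}},v_{\mathrm{es}})$ for all $v_{\mathrm{es}}\in\mathbb{V}_{\mathrm{es}}$, where for $u_{\mathrm{es}}=(u_{\mathrm{pw}},u_{\mathrm{nc}})$, $v_{\mathrm{es}}=(v_{\mathrm{pw}},v_{\mathrm{nc}})$, $$a_{\mathrm{es}}(u_{\mathrm{es}},v_{\mathrm{es}})=a_{\mathrm{pw}}(u_{\mathrm{nc}},v_{\mathrm{nc}})+(\Pi_0u_{\mathrm{nc}},\Pi_0v_{\mathrm{nc}})_V+\kappa_{\mathrm{eCR}}^{-2}\int_\Omega h_{\mathcal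 T}^{-2}(u_{\mathrm{pw}}-u_{\mathrm{nc}})(v_{\mathrm{pw}}-v_{\mathrm{nc}})\,dx,$$ $$b_{\mathrm{es}}(u_{\mathrm{es}},v_{\mathrm{es}})=\int_\Omega u_{\mathrm{pw}}v_{\mathrm{pw}}\,dx .$$ It has $N=\dim\mathbb{V}_{\mathrm{pw}}$ finite positive eigenvalues $0<\lambda_{\mathrm{es}(1)}\le\dots\le\lambda_{\mathrm{es}(N)}<\infty$ (with multiplicity); $\lambda_{\mathrm{es}(k)}:=+\infty$ for $k>N$, in which case $\mathrm{GLB}_{\mathrm{es}}$ is read as the limit $1/\varepsilon''$. *)

theory Defs
  imports "HOL-Analysis.Analysis" "HOL-Probability.Essential_Supremum"
begin

text \<open>
  The space R^n is a type \<open>'a::euclidean_space\<close> with n = \<open>DIM('a)\<close>.  Elements of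
  Lebesgue and Sobolev spaces, and piecewise polynomials, are functions on the whole type; their
  values outside the domain and on the skeleton of the triangulation are irrelevant, and
  dimensions of eigenspaces are counted modulo equality almost everywhere.
\<close>

section \<open>Domains and triangulations\<close>

definition lipschitz_domain :: "'a::euclidean_space set \<Rightarrow> bool" where
  "lipschitz_domain \<Omega> \<longleftrightarrow> open \<Omega> \<and> connected \<Omega> \<and> \<Omega> \<noteq> {} \<and>
     (\<forall>x\<in>frontier \<Omega>. \<exists>r>0. \<exists>e \<phi> L. norm e = 1 \<and> lipschitz_on L {y. y \<bullet> e = 0} \<phi> \<and>
        (\<forall>y\<in>ball x r. y \<in> \<Omega> \<longleftrightarrow> \<phi> (y - (y \<bullet> e) *\<^sub>R e) < y \<bullet> e))"

definition polyhedral_lipschitz_domain :: "'a::euclidean_space set \<Rightarrow> bool" where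
  "polyhedral_lipschitz_domain \<Omega> \<longleftrightarrow> lipschitz_domain \<Omega> \<and> bounded \<Omega> \<and>
     (\<exists>\<P>. finite \<P> \<and> (\<forall>P\<in>\<P>. polytope P) \<and> closure \<Omega> = \<Union>\<P>)"

definition regular_triangulation :: "'a::euclidean_space set set \<Rightarrow> 'a set \<Rightarrow> bool" where
  "regular_triangulation \<T> \<Omega> \<longleftrightarrow>
     triangulation \<T> \<and> (\<forall>T\<in>\<T>. int DIM('a) simplex T) \<and> \<Union>\<T> = closure \<Omega>"

definition vertices :: "'a::euclidean_space set \<Rightarrow> 'a set" where
  "vertices S = {x. x extreme_point_of S}"

definition mid :: "'a::euclidean_space set \<Rightarrow> 'a" where
  "mid S = (1 / real (card (vertices S))) *\<^sub>R (\<Sum>P\<in>vertices S. P)"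

definition faces :: "'a::euclidean_space set set \<Rightarrow> 'a set set" where
  "faces \<T> = {F. \<exists>T\<in>\<T>. F facet_of T}"

definition interior_faces :: "'a::euclidean_space set \<Rightarrow> 'a set set \<Rightarrow> 'a set set" where
  "interior_faces \<Omega> \<T> = {F \<in> faces \<T>. \<not> F \<subseteq> frontier \<Omega>}"

definition h_max :: "'a::euclidean_space set set \<Rightarrow> real" where
  "h_max \<T> = Max (diameter ` \<T>)"

text \<open>
  Surface measure on a face F contained in a hyperplane A: the points of distance at most 1/2
  from A that project orthogonally into F form a prism of height 1 over F, and the surface
  measure of a subset of F is the volume of the part of the prism lying over it.
\<close>

definition face_measure :: "'a::euclidean_space set \<Rightarrow> 'a measure" where
  "face_measure F =
     (let A = affine hull F
      in distr (lebesgue_on {x. closest_point A x \<in> F \<and> infdist x A \<le> 1/2}) borel (closest_point A))"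

section \<open>The space of H^1 functions with zero boundary values\<close>

definition gradient :: "('a::euclidean_space \<Rightarrow> real) \<Rightarrow> 'a \<Rightarrow> 'a" where
  "gradient f x = (THE D. GDERIV f x :> D)"

primrec times_cont_diff :: "nat \<Rightarrow> ('a::euclidean_space \<Rightarrow> real) \<Rightarrow> bool" where
  "times_cont_diff 0 f \<longleftrightarrow> continuous_on UNIV f"
| "times_cont_diff (Suc k) f \<longleftrightarrow> (\<forall>x. f differentiable (at x)) \<and>
     (\<forall>b\<in>Basis. times_cont_diff k (\<lambda>x. gradient f x \<bullet> b))"

definition test_function :: "'a::euclidean_space set \<Rightarrow> ('a \<Rightarrow> real) \<Rightarrow> bool" where
  "test_function \<Omega> \<phi> \<longleftrightarrow> (\<forall>k. times_cont_diff k \<phi>) \<and>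
     compact (closure {x. \<phi> x \<noteq> 0}) \<and> closure {x. \<phi> x \<noteq> 0} \<subseteq> \<Omega>"

definition square_integrable ::
    "'a::euclidean_space set \<Rightarrow> ('a \<Rightarrow> 'b::euclidean_space) \<Rightarrow> bool" where
  "square_integrable \<Omega> u \<longleftrightarrow> u \<in> borel_measurable (lebesgue_on \<Omega>) \<and>
     integrable (lebesgue_on \<Omega>) (\<lambda>x. (norm (u x))\<^sup>2)"

definition L2_norm :: "'a::euclidean_space set \<Rightarrow> ('a \<Rightarrow> 'b::euclidean_space) \<Rightarrow> real" where
  "L2_norm S u = sqrt (LINT x|lebesgue_on S. (norm (u x))\<^sup>2)"

definition weak_gradient ::
    "'a::euclidean_space set \<Rightarrow> ('a \<Rightarrow> real) \<Rightarrow> ('a \<Rightarrow> 'a) \<Rightarrow> bool" where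
  "weak_gradient \<Omega> u g \<longleftrightarrow> (\<forall>\<phi>. test_function \<Omega> \<phi> \<longrightarrow> (\<forall>b\<in>Basis.
     (LINT x|lebesgue_on \<Omega>. u x * (gradient \<phi> x \<bullet> b)) = - (LINT x|lebesgue_on \<Omega>. (g x \<bullet> b) * \<phi> x)))"

definition H1 :: "'a::euclidean_space set \<Rightarrow> ('a \<Rightarrow> real) \<Rightarrow> ('a \<Rightarrow> 'a) \<Rightarrow> bool" where
  "H1 \<Omega> u g \<longleftrightarrow> square_integrable \<Omega> u \<and> square_integrable \<Omega> g \<and> weak_gradient \<Omega> u g"

definition test_functions_tendsto ::
    "'a::euclidean_space set \<Rightarrow> (nat \<Rightarrow> 'a \<Rightarrow> real) \<Rightarrow> ('a \<Rightarrow> real) \<Rightarrow> ('a \<Rightarrow> 'a) \<Rightarrow> bool" where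
  "test_functions_tendsto \<Omega> \<phi> u g \<longleftrightarrow> (\<forall>j. test_function \<Omega> (\<phi> j)) \<and>
     (\<lambda>j. L2_norm \<Omega> (\<lambda>x. \<phi> j x - u x)) \<longlonglongrightarrow> 0 \<and>
     (\<lambda>j. L2_norm \<Omega> (\<lambda>x. gradient (\<phi> j) x - g x)) \<longlonglongrightarrow> 0"

text \<open>
  \<open>H01 \<Omega> u g\<close>: u belongs to the closure of the test functions in the H^1 norm, and g is its weak
  gradient.  As g is unique up to null sets, quantifying over g amounts to speaking of the
  weak gradient.
\<close>

definition H01 :: "'a::euclidean_space set \<Rightarrow> ('a \<Rightarrow> real) \<Rightarrow> ('a \<Rightarrow> 'a) \<Rightarrow> bool" where
  "H01 \<Omega> u g \<longleftrightarrow> H1 \<Omega> u g \<and> (\<exists>\<phi>. test_functions_tendsto \<Omega> \<phi> u g)"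

text \<open>
  The integral over F of the trace of v: the continuous extension, with respect to the H^1 norm,
  of the surface integral of test functions.
\<close>

definition face_integral :: "'a::euclidean_space set \<Rightarrow> 'a set \<Rightarrow> ('a \<Rightarrow> real) \<Rightarrow> real" where
  "face_integral \<Omega> F v = (THE m. \<forall>\<phi> g. H01 \<Omega> v g \<and> test_functions_tendsto \<Omega> \<phi> v g \<longrightarrow>
     (\<lambda>j. LINT x|face_measure F. \<phi> j x) \<longlonglongrightarrow> m)"

section \<open>Eigenvalues counted with multiplicity\<close>

text \<open>Values in \<open>real \<times> real\<close> are used for eigenfunctions that are pairs of functions.\<close>

definition ae_dim :: "'a::euclidean_space set \<Rightarrow> ('a \<Rightarrow> 'b::euclidean_space) set \<Rightarrow> enat" where
  "ae_dim \<Omega> E = Sup {enat m | m. \<exists>u. (\<forall>i<m. u i \<in> E) \<and>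
     (\<forall>c::nat \<Rightarrow> real. (AE x in lebesgue_on \<Omega>. (\<Sum>i<m. c i *\<^sub>R u i x) = 0) \<longrightarrow> (\<forall>i<m. c i = 0))}"

text \<open>
  For a family E of eigenspaces, the k-th smallest positive eigenvalue counted with multiplicity
  (k = 1, 2, ...), i.e. the smallest number \<open>\<mu>\<close> such that the eigenvalues in \<open>(0, \<mu>]\<close> have total
  multiplicity at least k.  It is \<open>\<infinity>\<close> if there are fewer than k such eigenvalues.
\<close>

definition kth_eigenvalue ::
    "'a::euclidean_space set \<Rightarrow> (real \<Rightarrow> ('a \<Rightarrow> 'b::euclidean_space) set) \<Rightarrow> nat \<Rightarrow> ereal" where
  "kth_eigenvalue \<Omega> E k = Inf {ereal \<mu> | \<mu>. \<exists>\<Lambda>. finite \<Lambda> \<and> \<Lambda> \<subseteq> {0<..\<mu>} \<and>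
     enat k \<le> (\<Sum>l\<in>\<Lambda>. ae_dim \<Omega> (E l))}"

definition schroedinger_eigenspace ::
    "'a::euclidean_space set \<Rightarrow> ('a \<Rightarrow> real) \<Rightarrow> real \<Rightarrow> ('a \<Rightarrow> real) set" where
  "schroedinger_eigenspace \<Omega> V l = {u. \<exists>g. H01 \<Omega> u g \<and> (\<forall>v h. H01 \<Omega> v h \<longrightarrow>
     (LINT x|lebesgue_on \<Omega>. g x \<bullet> h x) + (LINT x|lebesgue_on \<Omega>. V x * u x * v x)
       = l * (LINT x|lebesgue_on \<Omega>. u x * v x))}"

section \<open>Discrete spaces\<close>

definition P0 :: "'a::euclidean_space set set \<Rightarrow> ('a \<Rightarrow> real) set" where
  "P0 \<T> = {v. \<forall>T\<in>\<T>. \<exists>c. \<forall>x\<in>interior T. v x = c}"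

definition P1 :: "'a::euclidean_space set set \<Rightarrow> ('a \<Rightarrow> real) set" where
  "P1 \<T> = {v. \<forall>T\<in>\<T>. \<exists>a c. \<forall>x\<in>interior T. v x = a \<bullet> x + c}"

definition simplex_trace :: "'a::euclidean_space set \<Rightarrow> ('a \<Rightarrow> real) \<Rightarrow> 'a \<Rightarrow> real" where
  "simplex_trace T v x = Lim (at x within interior T) v"

definition CR01 :: "'a::euclidean_space set \<Rightarrow> 'a set set \<Rightarrow> ('a \<Rightarrow> real) set" where
  "CR01 \<Omega> \<T> = {v \<in> P1 \<T>.
     (\<forall>F\<in>interior_faces \<Omega> \<T>. \<forall>T\<in>\<T>. \<forall>T'\<in>\<T>. F facet_of T \<and> F facet_of T' \<longrightarrow>
        simplex_trace T v (mid F) - simplex_trace T' v (mid F) = 0) \<and>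
     (\<forall>F\<in>faces \<T> - interior_faces \<Omega> \<T>. \<forall>T\<in>\<T>. F facet_of T \<longrightarrow> simplex_trace T v (mid F) = 0)}"

definition bubble :: "'a::euclidean_space set \<Rightarrow> 'a \<Rightarrow> real" where
  "bubble T x =
     (let n = real DIM('a);
          s = (\<Sum>P\<in>vertices T. \<Sum>Q\<in>vertices T - {P}. (norm (P - Q))\<^sup>2)
      in if x \<in> T then (n + 2) / 2 - n * (n + 1)\<^sup>2 * (n + 2) / s * (norm (x - mid T))\<^sup>2 else 0)"

definition bubbles :: "'a::euclidean_space set set \<Rightarrow> ('a \<Rightarrow> real) set" where
  "bubbles \<T> = {\<lambda>x. \<Sum>T\<in>\<T>. c T * bubble T x | c. True}"

definition V_nc :: "'a::euclidean_space set \<Rightarrow> 'a set set \<Rightarrow> ('a \<Rightarrow> real) set" where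
  "V_nc \<Omega> \<T> = {\<lambda>x. v x + w x | v w. v \<in> CR01 \<Omega> \<T> \<and> w \<in> bubbles \<T>}"

definition V_pw :: "'a::euclidean_space set set \<Rightarrow> ('a \<Rightarrow> real) set" where
  "V_pw \<T> = {\<lambda>x. v x + w x | v w. v \<in> P1 \<T> \<and> w \<in> bubbles \<T>}"

text \<open>The pair \<open>(u_pw, u_nc)\<close> is represented by the function \<open>\<lambda>x. (u_pw x, u_nc x)\<close>.\<close>

definition V_es :: "'a::euclidean_space set \<Rightarrow> 'a set set \<Rightarrow> ('a \<Rightarrow> real \<times> real) set" where
  "V_es \<Omega> \<T> = {u. fst \<circ> u \<in> V_pw \<T> \<and> snd \<circ> u \<in> V_nc \<Omega> \<T>}"

text \<open>The L^2 projection onto the piecewise constants (unique on the interior of each simplex).\<close>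

definition Pi0 :: "'a::euclidean_space set \<Rightarrow> 'a set set \<Rightarrow> ('a \<Rightarrow> real) \<Rightarrow> 'a \<Rightarrow> real" where
  "Pi0 \<Omega> \<T> v = (SOME p. p \<in> P0 \<T> \<and>
     (\<forall>q\<in>P0 \<T>. (LINT x|lebesgue_on \<Omega>. (v x - p x) * q x) = 0))"

section \<open>Interpolation\<close>

definition psi :: "'a::euclidean_space set \<Rightarrow> 'a set set \<Rightarrow> 'a set \<Rightarrow> 'a \<Rightarrow> real" where
  "psi \<Omega> \<T> F = (SOME v. v \<in> CR01 \<Omega> \<T> \<and> (\<forall>F'\<in>faces \<T>. \<forall>T\<in>\<T>. F' facet_of T \<longrightarrow>
     simplex_trace T v (mid F') = (if F' = F then 1 else 0)))"

definition I_CR :: "'a::euclidean_space set \<Rightarrow> 'a set set \<Rightarrow> ('a \<Rightarrow> real) \<Rightarrow> 'a \<Rightarrow> real" where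
  "I_CR \<Omega> \<T> v x = (\<Sum>F\<in>interior_faces \<Omega> \<T>.
     face_integral \<Omega> F v / measure (face_measure F) F * psi \<Omega> \<T> F x)"

definition I_eCR :: "'a::euclidean_space set \<Rightarrow> 'a set set \<Rightarrow> ('a \<Rightarrow> real) \<Rightarrow> 'a \<Rightarrow> real" where
  "I_eCR \<Omega> \<T> v x = I_CR \<Omega> \<T> v x + (\<Sum>T\<in>\<T>.
     (LINT y|lebesgue_on T. v y - I_CR \<Omega> \<T> v y) / measure lebesgue T * bubble T x)"

definition eCR_constant :: "'a::euclidean_space set \<Rightarrow> 'a set set \<Rightarrow> real \<Rightarrow> bool" where
  "eCR_constant \<Omega> \<T> \<kappa> \<longleftrightarrow> 0 < \<kappa> \<and> (\<forall>v g. H01 \<Omega> v g \<longrightarrow> (\<forall>T\<in>\<T>.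
     L2_norm T (\<lambda>x. v x - I_eCR \<Omega> \<T> v x)
       \<le> \<kappa> * diameter T * L2_norm T (\<lambda>x. g x - gradient (I_eCR \<Omega> \<T> v) x)))"

section \<open>The extra-stabilised eigenvalue problem\<close>

definition a_pw :: "'a::euclidean_space set set \<Rightarrow> ('a \<Rightarrow> real) \<Rightarrow> ('a \<Rightarrow> real) \<Rightarrow> real" where
  "a_pw \<T> v w = (\<Sum>T\<in>\<T>. LINT x|lebesgue_on T. gradient v x \<bullet> gradient w x)"

definition a_es :: "'a::euclidean_space set \<Rightarrow> 'a set set \<Rightarrow> ('a \<Rightarrow> real) \<Rightarrow> real \<Rightarrow>
    ('a \<Rightarrow> real \<times> real) \<Rightarrow> ('a \<Rightarrow> real \<times> real) \<Rightarrow> real" where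
  "a_es \<Omega> \<T> V \<kappa> u v =
     a_pw \<T> (snd \<circ> u) (snd \<circ> v)
     + (LINT x|lebesgue_on \<Omega>. V x * Pi0 \<Omega> \<T> (snd \<circ> u) x * Pi0 \<Omega> \<T> (snd \<circ> v) x)
     + (1 / \<kappa>\<^sup>2) * (\<Sum>T\<in>\<T>. LINT x|lebesgue_on T.
         (1 / (diameter T)\<^sup>2) * (fst (u x) - snd (u x)) * (fst (v x) - snd (v x)))"

definition b_es :: "'a::euclidean_space set \<Rightarrow>
    ('a \<Rightarrow> real \<times> real) \<Rightarrow> ('a \<Rightarrow> real \<times> real) \<Rightarrow> real" where
  "b_es \<Omega> u v = (LINT x|lebesgue_on \<Omega>. fst (u x) * fst (v x))"

definition sCR_eigenspace :: "'a::euclidean_space set \<Rightarrow> 'a set set \<Rightarrow> ('a \<Rightarrow> real) \<Rightarrow> real \<Rightarrow>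
    real \<Rightarrow> ('a \<Rightarrow> real \<times> real) set" where
  "sCR_eigenspace \<Omega> \<T> V \<kappa> l =
     {u \<in> V_es \<Omega> \<T>. \<forall>v\<in>V_es \<Omega> \<T>. a_es \<Omega> \<T> V \<kappa> u v = l * b_es \<Omega> u v}"

definition GLB :: "real \<Rightarrow> ereal \<Rightarrow> ereal" where
  "GLB \<epsilon> l = (if l = \<infinity> then ereal (1 / \<epsilon>) else l / (1 + max 0 (ereal \<epsilon> * l - 1)))"

section \<open>The potential\<close>

definition ess_bounded :: "'a::euclidean_space set \<Rightarrow> ('a \<Rightarrow> real) \<Rightarrow> bool" where
  "ess_bounded \<Omega> V \<longleftrightarrow> V \<in> borel_measurable (lebesgue_on \<Omega>) \<and>
     esssup (lebesgue_on \<Omega>) (\<lambda>x. ereal \<bar>V x\<bar>) < \<infinity>"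

definition essinf :: "'a::euclidean_space set \<Rightarrow> ('a \<Rightarrow> real) \<Rightarrow> ereal" where
  "essinf \<Omega> V = - esssup (lebesgue_on \<Omega>) (\<lambda>x. - ereal (V x))"

end

theory Submission
  imports Defs
begin

text \<open>
  Let u be in the span of the exact eigenfunctions of the eigenvalues up to \<open>\<mu>\<close> with
  \<open>\<mu> < 1 / \<epsilon>\<close>, \<open>\<epsilon> = \<kappa>^2 h_max^2\<close>, and test the discrete problem with the pair
  \<open>(\<Pi> u, I_eCR u)\<close>, where \<open>\<Pi>\<close> is the L2 projection onto \<open>V_pw\<close>.  The interpolation preserves
  the integral means over simplices and faces; hence \<open>\<nabla> I_eCR u\<close> is the L2 projection of
  \<open>\<nabla> u\<close> and the potential term does not increase.  Two applications of the Pythagoras theorem and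
  the definition of \<open>\<kappa>\<close> bound the discrete energy by \<open>\<mu> (u, u) - \<epsilon>^-1 (u - \<Pi> u, u - \<Pi> u)\<close>,
  which is at most \<open>\<mu> (\<Pi> u, \<Pi> u)\<close>.  The min-max principle of the discrete problem then gives
  \<open>\<lambda>_es \<le> \<mu>\<close>, and \<open>GLB = min \<lambda>_es \<epsilon>^-1\<close>.

  On a simplex T, every gradient of a function in \<open>V_pw\<close> is a linear combination of the fields
  \<open>x - P\<close> for the vertices P of T, so that the divergence theorem is only needed for the fields
  \<open>f(x) (x - P)\<close>, where it is a formula for the cone with apex P over the face opposite to P.
\<close>

section \<open>The cone over a face\<close>

text \<open>The exact spectrum is never computed: the k-th exact eigenvalue is an infimum over
  numbers \<mu> up to which enough eigenfunctions exist, so each such \<mu> is treated on its own,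
  with finitely many eigenfunctions. The strict inequality \<mu> < 1 / \<epsilon> keeps \<Pi> u from
  vanishing, so that no dimension is lost on the way to the discrete space. Since V is a nonnegative
  constant on every simplex, the potential term only compares the square of a mean value with the
  mean of a square. Two obstacles shape the rest. Discrete functions are genuine functions with
  arbitrary values on the skeleton, and the right-hand form sees only one component of a pair; both
  forms are therefore merely semidefinite, and finite dimension enters as a bound on the length of
  orthonormal families. Face integrals of Sobolev functions are limits of surface integrals; they
  are rewritten as volume integrals over an adjacent simplex, which are continuous with respect to u
  and its gradient in L2, so that no trace theorem is used.\<close>

lemma emeasure_lborel_affine_vimage:
  fixes t :: "'a::euclidean_space"
  assumes "c \<noteq> 0" "B \<in> sets borel"
  shows "emeasure lborel B = ennreal (\<bar>c\<bar> ^ DIM('a)) * emeasure lborel ((\<lambda>x. t + c *\<^sub>R x) -` B)"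
proof -
  have "emeasure lborel B
      = emeasure (density (distr lborel borel (\<lambda>x. t + c *\<^sub>R x)) (\<lambda>_. ennreal (\<bar>c\<bar> ^ DIM('a)))) B"
    using lborel_affine[OF assms(1), of t] by simp
  also have "\<dots> = ennreal (\<bar>c\<bar> ^ DIM('a)) * emeasure (distr lborel borel (\<lambda>x. t + c *\<^sub>R x)) B"
    using assms(2) by (simp add: emeasure_density_const)
  also have "emeasure (distr lborel borel (\<lambda>x. t + c *\<^sub>R x)) B = emeasure lborel ((\<lambda>x. t + c *\<^sub>R x) -` B)"
    using assms(2) by (subst emeasure_distr) auto
  finally show ?thesis .
qed

lemma integral_lborel_affine:
  fixes t :: "'a::euclidean_space" and f :: "'a \<Rightarrow> real"
  assumes "c \<noteq> 0" and f: "f \<in> borel_measurable borel"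
  shows "(LINT x|lborel. f x) = \<bar>c\<bar> ^ DIM('a) * (LINT x|lborel. f (t + c *\<^sub>R x))"
proof -
  have "(LINT x|lborel. f x)
      = (LINT x|density (distr lborel borel (\<lambda>x. t + c *\<^sub>R x)) (\<lambda>_. ennreal (\<bar>c\<bar> ^ DIM('a))). f x)"
    using lborel_affine[OF assms(1), of t] by simp
  also have "\<dots> = (LINT x|distr lborel borel (\<lambda>x. t + c *\<^sub>R x). \<bar>c\<bar> ^ DIM('a) * f x)"
    using f by (subst integral_density) auto
  also have "\<dots> = (LINT x|lborel. \<bar>c\<bar> ^ DIM('a) * f (t + c *\<^sub>R x))"
    using f by (subst integral_distr) auto
  finally show ?thesis by simp
qed

lemma integral_lebesgue_on_borel:
  fixes f :: "'a::euclidean_space \<Rightarrow> real"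
  assumes "S \<in> sets borel" "f \<in> borel_measurable borel"
  shows "(LINT x|lebesgue_on S. f x) = (LINT x|lborel. indicator S x * f x)"
proof -
  have "(LINT x|lebesgue_on S. f x) = (LINT x|lebesgue. indicator S x *\<^sub>R f x)"
    using assms(1) by (subst integral_restrict_space) auto
  also have "\<dots> = (LINT x|lborel. indicator S x *\<^sub>R f x)"
    using assms by (subst integral_completion) auto
  finally show ?thesis by simp
qed

lemma integrable_indicator_times_continuous:
  fixes f :: "'a::euclidean_space \<Rightarrow> real"
  assumes "S \<in> sets borel" "bounded S" and f: "continuous_on UNIV f"
  shows "integrable lborel (\<lambda>x. indicator S x * f x)"
proof -
  obtain R where "\<And>x. x \<in> S \<Longrightarrow> norm x \<le> R" using assms(2) unfolding bounded_iff by blast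
  then have R: "S \<subseteq> cball 0 R" by auto
  have [measurable]: "f \<in> borel_measurable borel" using f by (simp add: borel_measurable_continuous_onI)
  have "compact (f ` cball 0 R)"
    by (intro compact_continuous_image continuous_on_subset[OF f]) auto
  then have "bounded (f ` cball 0 R)" by (rule compact_imp_bounded)
  then obtain K where K: "\<And>x. x \<in> cball 0 R \<Longrightarrow> \<bar>f x\<bar> \<le> K"
    unfolding bounded_iff by force
  have "integrable lborel (indicator (cball (0::'a) R) :: 'a \<Rightarrow> real)"
    using emeasure_lborel_cball_finite[of "0::'a" R] by (intro integrable_real_indicator) auto
  then have "integrable lborel (\<lambda>x. K * indicator (cball (0::'a) R) x :: real)" by simp
  then show ?thesis
    apply (rule Bochner_Integration.integrable_bound)
    using assms R K by (auto simp: indicator_def abs_mult intro!: AE_I2 intro: order_trans[OF _ abs_ge_self])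
qed

text \<open>The affine function \<open>a \<bullet> x + d\<close> is 1 at the apex P and 0 on the
  hyperplane of F. For a face of a simplex it is the barycentric coordinate of the opposite vertex,
  and \<open>1 / norm a\<close> is the height of P over the face.\<close>

locale cone =
  fixes a P :: "'a::euclidean_space" and d :: real and F :: "'a set"
  assumes a0: "a \<noteq> 0" and lamP: "a \<bullet> P + d = 1"
    and F_compact: "compact F" and affine_F: "affine hull F = {x. a \<bullet> x + d = 0}"
begin

definition "lam x = a \<bullet> x + d"
definition "rad x = P + (1 / (1 - lam x)) *\<^sub>R (x - P)"
definition "orth x = x - (lam x / (a \<bullet> a)) *\<^sub>R a"
text \<open>The cone over B with apex P, shrunk towards P by the factor t. The apex is left out
  because rays through it are undetermined.\<close>

definition "sector B t = {x. 0 < 1 - lam x \<and> 1 - lam x \<le> t \<and> rad x \<in> B}"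
text \<open>Half-open in \<open>lam\<close>, so that consecutive layers tile a prism without
  overlap.\<close>

definition "prism B l u = {x. l \<le> lam x \<and> lam x < u \<and> orth x \<in> B}"

lemma aa: "a \<bullet> a > 0" using a0 by simp

lemma lam_borel[measurable]: "lam \<in> borel_measurable borel"
  unfolding lam_def[abs_def] by measurable

lemma rad_borel[measurable]: "rad \<in> borel_measurable borel"
  unfolding rad_def[abs_def] by measurable

lemma orth_borel[measurable]: "orth \<in> borel_measurable borel"
  unfolding orth_def[abs_def] by measurable

lemma sector_borel[measurable]:
  assumes [measurable]: "B \<in> sets borel"
  shows "sector B t \<in> sets borel"
proof -
  have "{x \<in> space borel. 0 < 1 - lam x \<and> 1 - lam x \<le> t \<and> rad x \<in> B} \<in> sets borel" by measurable
  then show ?thesis by (simp add: sector_def)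
qed

lemma prism_borel[measurable]:
  assumes [measurable]: "B \<in> sets borel"
  shows "prism B l u \<in> sets borel"
proof -
  have "{x \<in> space borel. l \<le> lam x \<and> lam x < u \<and> orth x \<in> B} \<in> sets borel" by measurable
  then show ?thesis by (simp add: prism_def)
qed

lemma lam_homothety: "1 - lam (P + t *\<^sub>R (x - P)) = t * (1 - lam x)"
proof -
  have "lam (P + t *\<^sub>R (x - P)) = (a \<bullet> P + d) + t * (lam x - (a \<bullet> P + d))"
    by (simp add: lam_def inner_simps algebra_simps)
  then show ?thesis unfolding lamP by (simp add: algebra_simps)
qed

lemma rad_homothety: "t \<noteq> 0 \<Longrightarrow> rad (P + t *\<^sub>R (x - P)) = rad x"
  unfolding rad_def lam_homothety by (simp add: divide_simps)

lemma lam_rad: "lam x \<noteq> 1 \<Longrightarrow> lam (rad x) = 0"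
proof -
  assume x: "lam x \<noteq> 1"
  have "1 - lam (rad x) = 1"
    unfolding rad_def using x by (subst lam_homothety) auto
  then show ?thesis by simp
qed

lemma lam_orth: "lam (orth x) = 0"
  using aa by (simp add: orth_def lam_def inner_simps)

lemma eq_rad: "lam x \<noteq> 1 \<Longrightarrow> x = P + (1 - lam x) *\<^sub>R (rad x - P)"
  by (simp add: rad_def)

lemma F_ne: "F \<noteq> {}"
proof
  assume "F = {}"
  then have "{x. a \<bullet> x + d = 0} = {}" using affine_F by simp
  moreover have "orth 0 \<in> {x. a \<bullet> x + d = 0}" using lam_orth[of 0] by (simp add: lam_def)
  ultimately show False by blast
qed

lemma closest_point_F: "closest_point (affine hull F) x = orth x"
proof -
  have "orth x = closest_point {x. a \<bullet> x + d = 0} x"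
  proof (rule closest_point_unique)
    show "closed {x. a \<bullet> x + d = 0}"
      using affine_F closed_affine_hull by metis
    show "convex {x. a \<bullet> x + d = 0}"
      using affine_F affine_imp_convex affine_affine_hull by metis
    show "orth x \<in> {x. a \<bullet> x + d = 0}" using lam_orth by (simp add: lam_def)
    show "\<forall>z\<in>{x. a \<bullet> x + d = 0}. dist x (orth x) \<le> dist x z"
    proof
      fix z assume z: "z \<in> {x. a \<bullet> x + d = 0}"
      have "\<bar>lam x\<bar> = \<bar>a \<bullet> (x - z)\<bar>" using z by (simp add: lam_def inner_simps)
      also have "\<dots> \<le> norm a * norm (x - z)" by (rule Cauchy_Schwarz_ineq2)
      finally have "\<bar>lam x\<bar> / norm a \<le> norm (x - z)" using a0 by (simp add: field_simps)
      moreover have "norm (x - orth x) = \<bar>lam x\<bar> / norm a"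
        using a0 by (simp add: orth_def power2_norm_eq_inner[symmetric] power2_eq_square)
      ultimately show "dist x (orth x) \<le> dist x z" by (simp add: dist_norm)
    qed
  qed
  then show ?thesis using affine_F by simp
qed

lemma dist_orth: "dist x (orth x) = \<bar>lam x\<bar> / norm a"
  using a0 by (simp add: dist_norm orth_def power2_norm_eq_inner[symmetric] power2_eq_square)

lemma infdist_F: "infdist x (affine hull F) = \<bar>lam x\<bar> / norm a"
proof -
  have "affine hull F \<noteq> {}" using F_ne by simp
  then have "infdist x (affine hull F) = dist x (closest_point (affine hull F) x)"
    by (simp add: infdist_eq_setdist setdist_closest_point closed_affine_hull)
  then show ?thesis by (simp add: closest_point_F dist_orth)
qed

section \<open>Volumes of cones, prisms and thin layers\<close>

lemma emeasure_sector:
  assumes [measurable]: "B \<in> sets borel" and t: "0 < t"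
  shows "emeasure lborel (sector B t) = ennreal (t ^ DIM('a)) * emeasure lborel (sector B 1)"
proof -
  \<comment> \<open>The homothety with centre P and ratio t multiplies \<open>1 - lam\<close> by t
    and preserves rays, hence carries \<open>sector B 1\<close> onto
    \<open>sector B t\<close>.\<close>
  have "(\<lambda>x. (P - t *\<^sub>R P) + t *\<^sub>R x) -` sector B t = sector B 1"
  proof -
    have e: "(P - t *\<^sub>R P) + t *\<^sub>R x = P + t *\<^sub>R (x - P)" for x by (simp add: algebra_simps)
    have "P + t *\<^sub>R (x - P) \<in> sector B t \<longleftrightarrow> x \<in> sector B 1" for x
      using t unfolding sector_def mem_Collect_eq lam_homothety
      by (simp add: rad_homothety zero_less_mult_iff)
    then show ?thesis unfolding vimage_def e by auto
  qed
  then show ?thesis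
    using emeasure_lborel_affine_vimage[of t "sector B t" "P - t *\<^sub>R P"] t by simp
qed

lemma emeasure_prism_shift:
  assumes [measurable]: "B \<in> sets borel"
  shows "emeasure lborel (prism B (l + \<tau>) (u + \<tau>)) = emeasure lborel (prism B l u)"
proof -
  \<comment> \<open>The multiple of the normal vector along which \<open>lam\<close> grows by
    exactly \<tau>; the orthogonal projection does not notice it.\<close>
  define w where "w = (\<tau> / (a \<bullet> a)) *\<^sub>R a"
  have l: "lam (w + 1 *\<^sub>R x) = lam x + \<tau>" for x using aa by (simp add: w_def lam_def inner_simps)
  have o: "orth (w + 1 *\<^sub>R x) = orth x" for x
    unfolding orth_def l by (simp add: w_def algebra_simps add_divide_distrib)
  have "(\<lambda>x. w + 1 *\<^sub>R x) -` prism B (l + \<tau>) (u + \<tau>) = prism B l u"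
    unfolding prism_def vimage_def mem_Collect_eq l o by auto
  then show ?thesis
    using emeasure_lborel_affine_vimage[of 1 "prism B (l + \<tau>) (u + \<tau>)" w] by simp
qed

lemma emeasure_prism_multiple:
  assumes [measurable]: "B \<in> sets borel" and h: "0 \<le> h"
  shows "emeasure lborel (prism B l (l + real M * h)) = of_nat M * emeasure lborel (prism B 0 h)"
proof (induction M)
  case 0
  have "prism B l (l + real 0 * h) = {}" by (auto simp: prism_def)
  then show ?case by simp
next
  case (Suc M)
  have "0 \<le> real M * h" using h by simp
  then have "prism B l (l + real (Suc M) * h) = prism B l (l + real M * h) \<union> prism B (l + real M * h) (l + real (Suc M) * h)"
    using h unfolding prism_def set_eq_iff Un_iff mem_Collect_eq of_nat_Suc distrib_right
    by (smt (verit))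
  moreover have "prism B l (l + real M * h) \<inter> prism B (l + real M * h) (l + real (Suc M) * h) = {}"
    by (auto simp: prism_def)
  ultimately have "emeasure lborel (prism B l (l + real (Suc M) * h))
     = emeasure lborel (prism B l (l + real M * h)) + emeasure lborel (prism B (l + real M * h) (l + real (Suc M) * h))"
    by (simp add: plus_emeasure)
  also have "emeasure lborel (prism B (l + real M * h) (l + real (Suc M) * h)) = emeasure lborel (prism B 0 h)"
    using emeasure_prism_shift[of B 0 "l + real M * h" h] by (simp add: algebra_simps)
  finally show ?case using Suc by (simp add: algebra_simps distrib_right)
qed

text \<open>Both projections move a point of the layer by a multiple of its thickness \<delta>. The
  bound \<delta> \<le> 1/2 keeps the factor \<open>1 / (1 - lam x)\<close> below 2. The disjunction
  serves the two inclusions between layers: in one of them the radial projection is known to lie in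
  B, in the other the orthogonal one. The constant is that of the second, worse case.\<close>

lemma dist_rad_orth:
  assumes x: "0 \<le> lam x" "lam x < \<delta>" and \<delta>: "\<delta> \<le> 1/2" and R: "norm (orth x - P) \<le> R \<or> norm (rad x - P) \<le> R"
  shows "dist (rad x) (orth x) \<le> (3 / norm a + 2 * R) * \<delta>"
proof -
  have na: "norm a > 0" using a0 by simp
  have o: "dist x (orth x) \<le> \<delta> / norm a" using x na by (simp add: dist_orth divide_right_mono)
  have xr: "x - rad x = - (lam x *\<^sub>R (rad x - P))"
  proof -
    have "x = P + (1 - lam x) *\<^sub>R (rad x - P)" using eq_rad[of x] x \<delta> by simp
    then have "x - rad x = P + (1 - lam x) *\<^sub>R (rad x - P) - rad x" by simp
    also have "\<dots> = - (lam x *\<^sub>R (rad x - P))" by (simp add: algebra_simps)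
    finally show ?thesis .
  qed
  have xr': "rad x - x = (lam x / (1 - lam x)) *\<^sub>R (x - P)"
  proof -
    have "(1 - lam x) *\<^sub>R (rad x - x) = lam x *\<^sub>R (x - P)"
      using x \<delta> by (simp add: rad_def algebra_simps)
    then have "(1 / (1 - lam x)) *\<^sub>R (1 - lam x) *\<^sub>R (rad x - x) = (1 / (1 - lam x)) *\<^sub>R lam x *\<^sub>R (x - P)" by simp
    then show ?thesis using x \<delta> by simp
  qed
  from R show ?thesis
  proof
    assume R: "norm (rad x - P) \<le> R"
    have R0: "0 \<le> R" using R norm_ge_zero order_trans by blast
    have "norm (x - rad x) = lam x * norm (rad x - P)" using x by (simp add: xr)
    also have "\<dots> \<le> \<delta> * R" using x R by (intro mult_mono) auto
    finally have "dist (rad x) (orth x) \<le> \<delta> * R + \<delta> / norm a"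
      using o dist_triangle[of "rad x" "orth x" x] by (simp add: dist_norm norm_minus_commute)
    also have "\<dots> \<le> 3 * (\<delta> / norm a) + 2 * (\<delta> * R)"
    proof -
      have "0 \<le> \<delta> / norm a" "0 \<le> \<delta> * R" using x R0 by auto
      then show ?thesis by linarith
    qed
    also have "\<dots> = (3 / norm a + 2 * R) * \<delta>" by (simp add: algebra_simps)
    finally show ?thesis .
  next
    assume R: "norm (orth x - P) \<le> R"
    have R0: "0 \<le> R" using R norm_ge_zero order_trans by blast
    have "norm (x - P) \<le> norm (x - orth x) + norm (orth x - P)"
      using norm_triangle_ineq[of "x - orth x" "orth x - P"] by simp
    also have "\<dots> \<le> \<delta> / norm a + R" using o R by (simp add: dist_norm)
    also have "\<dots> \<le> 1 / norm a + R" using \<delta> na by (simp add: divide_right_mono)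
    finally have xP: "norm (x - P) \<le> 1 / norm a + R" .
    have "lam x / (1 - lam x) \<le> 2 * \<delta>"
    proof -
      have "lam x / (1 - lam x) \<le> lam x / (1/2)"
        using x \<delta> by (intro divide_left_mono) auto
      then show ?thesis using x by simp
    qed
    then have "norm (rad x - x) \<le> 2 * \<delta> * (1 / norm a + R)"
      using xP x \<delta> unfolding xr' norm_scaleR by (intro mult_mono) auto
    then have "dist (rad x) (orth x) \<le> 2 * \<delta> * (1 / norm a + R) + \<delta> / norm a"
      using o dist_triangle[of "rad x" "orth x" x] by (simp add: dist_norm norm_minus_commute)
    also have "\<dots> = (3 / norm a + 2 * R) * \<delta>" by (simp add: field_simps)
    finally show ?thesis .
  qed
qed

lemma bounded_sector:
  assumes "bounded B" shows "bounded (sector B 1)"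
proof -
  obtain R where R: "\<And>y. y \<in> B \<Longrightarrow> dist P y \<le> R"
    using assms bounded_any_center[of B P] by auto
  have "dist P x \<le> R" if x: "x \<in> sector B 1" for x
  proof -
    have "x - P = (1 - lam x) *\<^sub>R (rad x - P)"
      using x by (simp add: sector_def rad_def)
    then have "dist P x = norm ((1 - lam x) *\<^sub>R (rad x - P))"
      by (metis dist_commute dist_norm)
    also have "\<dots> \<le> 1 * norm (rad x - P)"
      using x unfolding norm_scaleR by (intro mult_right_mono) (auto simp: sector_def)
    also have "\<dots> \<le> R" using R[of "rad x"] x by (simp add: sector_def dist_norm norm_minus_commute)
    finally show ?thesis .
  qed
  then show ?thesis unfolding bounded_any_center[of _ P] by auto
qed

lemma bounded_prism:
  assumes "bounded B" shows "bounded (prism B l u)"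
proof -
  obtain R where R: "\<And>y. y \<in> B \<Longrightarrow> dist 0 y \<le> R"
    using assms bounded_any_center[of B 0] by auto
  have "dist 0 x \<le> R + (\<bar>l\<bar> + \<bar>u\<bar>) / norm a" if x: "x \<in> prism B l u" for x
  proof -
    have "dist x (orth x) \<le> (\<bar>l\<bar> + \<bar>u\<bar>) / norm a"
      using x unfolding dist_orth by (intro divide_right_mono) (auto simp: prism_def)
    moreover have "dist 0 (orth x) \<le> R" using R x by (simp add: prism_def)
    ultimately show ?thesis using dist_triangle[of 0 x "orth x"] by (simp add: dist_commute)
  qed
  then show ?thesis unfolding bounded_any_center[of _ 0] by auto
qed

lemma emeasure_bounded_ne_infinity: "bounded (S::'a set) \<Longrightarrow> emeasure lborel S \<noteq> \<infinity>"
  using emeasure_bounded_finite by (metis less_top infinity_ennreal_def)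

text \<open>The layer is the cone minus its homothetic copy of ratio \<open>1 - \<delta>\<close>.
  Writing \<open>1 - (1 - \<delta>) ^ n\<close> as \<delta> times a geometric sum separates the
  thickness from a factor that tends to the dimension n.\<close>

lemma measure_shell:
  assumes [measurable]: "B \<in> sets borel" and B: "bounded B" and \<delta>: "0 < \<delta>" "\<delta> < 1"
  shows "measure lborel {x. 0 \<le> lam x \<and> lam x < \<delta> \<and> rad x \<in> B}
       = \<delta> * (\<Sum>i<DIM('a). (1 - \<delta>) ^ i) * measure lborel (sector B 1)"
proof -
  have sub: "sector B (1 - \<delta>) \<subseteq> sector B 1" using \<delta> by (auto simp: sector_def)
  have fin: "emeasure lborel (sector B 1) \<noteq> \<infinity>"
    by (rule emeasure_bounded_ne_infinity[OF bounded_sector[OF B]])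
  have "{x. 0 \<le> lam x \<and> lam x < \<delta> \<and> rad x \<in> B} = sector B 1 - sector B (1 - \<delta>)"
    using \<delta> by (auto simp: sector_def)
  then have "measure lborel {x. 0 \<le> lam x \<and> lam x < \<delta> \<and> rad x \<in> B}
      = measure lborel (sector B 1) - measure lborel (sector B (1 - \<delta>))"
    using measure_Diff[OF fin _ _ sub] by simp
  also have "measure lborel (sector B (1 - \<delta>)) = (1 - \<delta>) ^ DIM('a) * measure lborel (sector B 1)"
    using emeasure_sector[of B "1 - \<delta>"] \<delta> by (simp add: measure_def enn2real_mult)
  also have "measure lborel (sector B 1) - (1 - \<delta>) ^ DIM('a) * measure lborel (sector B 1)
     = (1 - (1 - \<delta>) ^ DIM('a)) * measure lborel (sector B 1)" by (simp add: algebra_simps)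
  also have "1 - (1 - \<delta>) ^ DIM('a) = \<delta> * (\<Sum>i<DIM('a). (1 - \<delta>) ^ i)"
    using one_diff_power_eq[of "1 - \<delta>" "DIM('a)"] by simp
  finally show ?thesis .
qed

lemma measure_prism_multiple:
  assumes [measurable]: "B \<in> sets borel" and h: "0 \<le> h"
  shows "measure lborel (prism B l (l + real M * h)) = M * measure lborel (prism B 0 h)"
  using emeasure_prism_multiple[OF assms(1) h, of l M] by (simp add: measure_def enn2real_mult)

lemma sum_powers_tendsto: "(\<lambda>M. \<Sum>i<n. (1 - norm a / real (Suc M)) ^ i) \<longlonglongrightarrow> real n"
proof -
  have "(\<lambda>M. norm a / real (Suc M)) \<longlonglongrightarrow> 0"
    using tendsto_mult_right_zero[OF LIMSEQ_inverse_real_of_nat, of "norm a"] by (simp add: divide_inverse)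
  then have "(\<lambda>M. \<Sum>i<n. (1 - norm a / real (Suc M)) ^ i) \<longlonglongrightarrow> (\<Sum>i<n. (1 - 0) ^ i)"
    by (intro tendsto_intros)
  then show ?thesis by simp
qed

text \<open>\<open>lam\<close> is \<open>norm a\<close> times the signed distance from the
  hyperplane, so these bounds describe the prism of height 1 that underlies
  \<open>face_measure\<close>, up to one bounding plane.\<close>

definition "face_prism B = prism B (- (norm a / 2)) (norm a / 2)"

text \<open>These neighbourhoods make room for the displacement between the two projections in a
  layer of thickness \<open>norm a / real (Suc j)\<close>. They shrink to B because B is closed, and
  they are bounded, as continuity of the volume from above requires.\<close>

lemma closed_neighbourhoods:
  fixes D :: real and B :: "'a set"
  assumes B: "compact B" "B \<noteq> {}" and D: "D > 0"
    and N_def: "\<And>j. N j = {y. infdist y B \<le> D * (norm a / real (Suc j))}"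
  shows "decseq N" "(\<Inter>j. N j) = B" "\<And>j. closed (N j)" "\<And>j. bounded (N j)"
proof -
  show "closed (N j)" for j unfolding N_def
    by (intro closed_Collect_le continuous_intros)
  show "bounded (N j)" for j unfolding N_def
    using compact_infdist_le[OF B(2,1), of "D * (norm a / real (Suc j))"] D a0
    by (intro compact_imp_bounded) auto
  have "D * (norm a / real (Suc n)) \<le> D * (norm a / real (Suc m))" if "m \<le> n" for m n
    using that D by (intro mult_left_mono divide_left_mono) auto
  then show "decseq N" unfolding N_def decseq_def using order_trans by blast
  show "(\<Inter>j. N j) = B"
  proof
    show "B \<subseteq> (\<Inter>j. N j)" using D by (auto simp: N_def)
    show "(\<Inter>j. N j) \<subseteq> B"
    proof
      fix y assume y: "y \<in> (\<Inter>j. N j)"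
      have "(\<lambda>j. (D * norm a) * inverse (real (Suc j))) \<longlonglongrightarrow> 0"
        by (rule tendsto_mult_right_zero[OF LIMSEQ_inverse_real_of_nat])
      moreover have "\<forall>j. infdist y B \<le> (D * norm a) * inverse (real (Suc j))"
        using y by (auto simp: N_def divide_inverse mult.assoc)
      ultimately have "infdist y B \<le> 0" by (metis LIMSEQ_le_const)
      then have "infdist y B = 0" using infdist_nonneg[of y B] by linarith
      then show "y \<in> B" using B compact_imp_closed in_closed_iff_infdist_zero by blast
    qed
  qed
qed

text \<open>
  Thin layers next to the hyperplane, cut out by the cone over B with apex P and by the orthogonal
  prism over B, are contained in each other up to a small enlargement of B; the volumes of the layers
  are known by homothety and by translation invariance.
\<close>

lemma measure_cone_eq_prism:
  assumes B: "compact B"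
  shows "DIM('a) * measure lborel (sector B 1) = measure lborel (face_prism B) / norm a"
proof (cases "B = {}")
  case True
  then show ?thesis by (simp add: sector_def face_prism_def prism_def)
next
  case ne: False
  have na: "norm a > 0" using a0 by simp
  have bB: "bounded B" and [measurable]: "B \<in> sets borel"
    using B by (auto intro: compact_imp_bounded borel_compact)
  obtain R where R: "\<And>y. y \<in> B \<Longrightarrow> dist P y \<le> R"
    using bB bounded_any_center[of B P] by auto
  have R0: "R \<ge> 0" using R ne zero_le_dist order_trans by blast
  define D where "D = 3 / norm a + 2 * R"
  have D: "D > 0" using na R0 by (simp add: D_def add_pos_nonneg)
  define N where "N = (\<lambda>j. {y. infdist y B \<le> D * (norm a / real (Suc j))})"
  have "N j = {y. infdist y B \<le> D * (norm a / real (Suc j))}" for j by (simp add: N_def)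
  note nb = closed_neighbourhoods[OF B ne D this]
  have Nb[measurable]: "N j \<in> sets borel" for j by (rule borel_closed[OF nb(3)])
  \<comment> \<open>The thickness \<open>norm a / real (Suc j)\<close> is chosen such that exactly
    \<open>Suc j\<close> translated layers fill the prism of height 1. \<open>S j\<close> is the
    geometric sum of \<open>measure_shell\<close> for this thickness.\<close>
  define S where "S = (\<lambda>j. \<Sum>i<DIM('a). (1 - norm a / real (Suc j)) ^ i)"
  have Slim: "S \<longlonglongrightarrow> real DIM('a)" unfolding S_def by (rule sum_powers_tendsto)
  have d0: "(\<lambda>j. norm a / real (Suc j)) \<longlonglongrightarrow> 0"
    using tendsto_mult_right_zero[OF LIMSEQ_inverse_real_of_nat, of "norm a"] by (simp add: divide_inverse)
  have ev: "\<forall>\<^sub>F j in sequentially. norm a / real (Suc j) < 1/2"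
    by (rule order_tendstoD(2)[OF d0]) simp
  have prism: "measure lborel (prism C 0 (norm a / real (Suc j))) = (norm a / real (Suc j)) * (measure lborel (face_prism C) / norm a)"
    if [measurable]: "C \<in> sets borel" for C j
  proof -
    have "- (norm a / 2) + real (Suc j) * (norm a / real (Suc j)) = norm a / 2" by simp
    then have "measure lborel (face_prism C) = real (Suc j) * measure lborel (prism C 0 (norm a / real (Suc j)))"
      using measure_prism_multiple[OF that, of "norm a / real (Suc j)" "- (norm a / 2)" "Suc j"] na
      by (simp add: face_prism_def del: of_nat_Suc)
    then show ?thesis using na by (simp del: of_nat_Suc)
  qed
  let ?shell = "\<lambda>C \<delta>. {x. 0 \<le> lam x \<and> lam x < \<delta> \<and> rad x \<in> C}"
  have shellm[measurable]: "?shell C \<delta> \<in> sets borel" if [measurable]: "C \<in> sets borel" for C \<delta>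
  proof -
    have "{x \<in> space borel. 0 \<le> lam x \<and> lam x < \<delta> \<and> rad x \<in> C} \<in> sets borel" by measurable
    then show ?thesis by simp
  qed
  have near: "infdist y B \<le> D * \<delta>" if "z \<in> B" "dist z y \<le> D * \<delta>" for y z \<delta>
    using that infdist_le2[of z B y "D * \<delta>"] by (simp add: dist_commute)
  have I1: "S j * measure lborel (sector B 1) \<le> measure lborel (face_prism (N j)) / norm a"
    if j: "norm a / real (Suc j) < 1/2" for j
  proof -
    let ?\<delta> = "norm a / real (Suc j)"
    have "?shell B ?\<delta> \<subseteq> prism (N j) 0 ?\<delta>"
    proof
      fix x assume x: "x \<in> ?shell B ?\<delta>"
      then have "dist (rad x) (orth x) \<le> D * ?\<delta>"
        using dist_rad_orth[of x ?\<delta> R] j R[of "rad x"] by (simp add: D_def dist_norm norm_minus_commute)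
      then show "x \<in> prism (N j) 0 ?\<delta>"
        using x near[of "rad x" "orth x" ?\<delta>] by (simp add: prism_def N_def)
    qed
    then have "measure lborel (?shell B ?\<delta>) \<le> measure lborel (prism (N j) 0 ?\<delta>)"
      using emeasure_bounded_ne_infinity[OF bounded_prism[OF nb(4)]]
      by (intro measure_mono_fmeasurable) (auto simp: fmeasurable_def less_top)
    then have "?\<delta> * (S j * measure lborel (sector B 1)) \<le> ?\<delta> * (measure lborel (face_prism (N j)) / norm a)"
      using measure_shell[OF _ bB, of ?\<delta>] prism[OF Nb] j na by (simp add: S_def mult.assoc)
    then show ?thesis using na by (subst (asm) mult_le_cancel_left_pos) auto
  qed
  have I2: "measure lborel (face_prism B) / norm a \<le> S j * measure lborel (sector (N j) 1)"
    if j: "norm a / real (Suc j) < 1/2" for j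
  proof -
    let ?\<delta> = "norm a / real (Suc j)"
    have "prism B 0 ?\<delta> \<subseteq> ?shell (N j) ?\<delta>"
    proof
      fix x assume x: "x \<in> prism B 0 ?\<delta>"
      then have "dist (rad x) (orth x) \<le> D * ?\<delta>"
        using dist_rad_orth[of x ?\<delta> R] j R[of "orth x"] by (simp add: prism_def D_def dist_norm norm_minus_commute)
      then show "x \<in> ?shell (N j) ?\<delta>"
        using x near[of "orth x" "rad x" ?\<delta>] by (simp add: prism_def N_def dist_commute)
    qed
    moreover have "?shell (N j) ?\<delta> \<subseteq> sector (N j) 1"
    proof
      fix x assume x: "x \<in> ?shell (N j) ?\<delta>"
      then have "lam x < ?\<delta>" by blast
      with j have "lam x < 1" by linarith
      with x show "x \<in> sector (N j) 1" by (simp add: sector_def)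
    qed
    ultimately have "measure lborel (prism B 0 ?\<delta>) \<le> measure lborel (?shell (N j) ?\<delta>)"
      using emeasure_bounded_ne_infinity[OF bounded_subset[OF bounded_sector[OF nb(4)]]]
      by (intro measure_mono_fmeasurable) (auto simp: fmeasurable_def less_top)
    then have "?\<delta> * (measure lborel (face_prism B) / norm a) \<le> ?\<delta> * (S j * measure lborel (sector (N j) 1))"
      using measure_shell[OF _ nb(4), of j ?\<delta>] prism[OF \<open>B \<in> sets borel\<close>] j na by (simp add: S_def mult.assoc)
    then show ?thesis using na by (subst (asm) mult_le_cancel_left_pos) auto
  qed
  \<comment> \<open>Continuity from above along the shrinking neighbourhoods; it removes the
    enlargement of B from the two one-sided estimates.\<close>
  have L1: "(\<lambda>j. measure lborel (sector (N j) 1)) \<longlonglongrightarrow> measure lborel (sector B 1)"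
  proof -
    have "(\<Inter>j. sector (N j) 1) = sector (\<Inter>j. N j) 1" by (auto simp: sector_def)
    moreover have "decseq (\<lambda>j. sector (N j) 1)"
      using nb(1) unfolding decseq_def sector_def by blast
    ultimately show ?thesis
      using Lim_measure_decseq[of "\<lambda>j. sector (N j) 1" lborel] nb(2)
        emeasure_bounded_ne_infinity[OF bounded_sector[OF nb(4)]] by (simp add: image_subset_iff)
  qed
  have L2: "(\<lambda>j. measure lborel (face_prism (N j))) \<longlonglongrightarrow> measure lborel (face_prism B)"
  proof -
    have "(\<Inter>j. face_prism (N j)) = face_prism (\<Inter>j. N j)" by (auto simp: prism_def face_prism_def)
    moreover have "decseq (\<lambda>j. face_prism (N j))"
      using nb(1) unfolding decseq_def prism_def face_prism_def by blast
    ultimately show ?thesis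
      using Lim_measure_decseq[of "\<lambda>j. face_prism (N j)" lborel] nb(2)
        emeasure_bounded_ne_infinity[OF bounded_prism[OF nb(4)]] by (simp add: face_prism_def image_subset_iff)
  qed
  show ?thesis
  proof (rule antisym)
    show "real DIM('a) * measure lborel (sector B 1) \<le> measure lborel (face_prism B) / norm a"
      by (rule tendsto_le[OF _ tendsto_divide[OF L2 tendsto_const] tendsto_mult[OF Slim tendsto_const]])
        (use na in \<open>auto intro: eventually_mono[OF ev] I1\<close>)
    show "measure lborel (face_prism B) / norm a \<le> real DIM('a) * measure lborel (sector B 1)"
      by (rule tendsto_le[OF _ tendsto_mult[OF Slim L1] tendsto_const])
        (use na in \<open>auto intro: eventually_mono[OF ev] I2\<close>)
  qed
qed

section \<open>The surface measure as image of the volume of a cone\<close>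

lemma emeasure_face_measure:
  assumes [measurable]: "B \<in> sets borel"
  shows "emeasure (face_measure F) B = emeasure lborel (face_prism (B \<inter> F))"
proof -
  have Fb[measurable]: "F \<in> sets borel" using F_compact borel_compact by blast
  have na: "norm a > 0" using a0 by simp
  let ?Q = "{x. orth x \<in> F \<and> \<bar>lam x\<bar> / norm a \<le> 1/2}"
  have Q: "?Q \<in> sets borel"
  proof -
    have "{x \<in> space borel. orth x \<in> F \<and> \<bar>lam x\<bar> / norm a \<le> 1/2} \<in> sets borel" by measurable
    then show ?thesis by simp
  qed
  have QB: "?Q \<inter> orth -` B \<in> sets borel"
    using measurable_sets[OF orth_borel assms] Q by (simp add: sets.Int)
  have fm: "face_measure F = distr (lebesgue_on ?Q) borel orth"
    unfolding face_measure_def Let_def closest_point_F infdist_F by simp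
  have "orth \<in> borel_measurable lebesgue" using orth_borel by (intro measurable_completion) simp
  then have om: "orth \<in> borel_measurable (lebesgue_on ?Q)"
    by (rule measurable_restrict_space1)
  have "emeasure (face_measure F) B = emeasure (lebesgue_on ?Q) (?Q \<inter> orth -` B)"
    unfolding fm by (subst emeasure_distr[OF om]) (auto simp: Int_commute)
  also have "\<dots> = emeasure lebesgue (?Q \<inter> orth -` B)"
    using Q by (intro emeasure_restrict_space) auto
  also have "\<dots> = emeasure lborel (?Q \<inter> orth -` B)" using QB by simp
  \<comment> \<open>The prism of \<open>face_measure\<close> is closed on both sides while
    \<open>face_prism\<close> is half-open; the difference lies in a hyperplane parallel to F and is
    a null set.\<close>
  also have "?Q \<inter> orth -` B = face_prism (B \<inter> F) \<union> {x. lam x = norm a / 2 \<and> orth x \<in> B \<inter> F}"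
    using na by (auto simp: face_prism_def prism_def field_simps abs_if split: if_splits)
  also have "emeasure lborel \<dots> = emeasure lborel (face_prism (B \<inter> F))"
  proof (rule emeasure_Un_null_set)
    show "face_prism (B \<inter> F) \<in> sets lborel" unfolding face_prism_def by simp
    have "{x \<in> space borel. lam x = norm a / 2 \<and> orth x \<in> B \<inter> F} \<in> sets borel" by measurable
    moreover have "negligible {x. a \<bullet> x = norm a / 2 - d}" using a0 by (intro negligible_hyperplane) auto
    then have "{x. lam x = norm a / 2 \<and> orth x \<in> B \<inter> F} \<in> null_sets lebesgue"
      unfolding negligible_iff_null_sets[symmetric] by (rule negligible_subset) (auto simp: lam_def)
    ultimately show "{x. lam x = norm a / 2 \<and> orth x \<in> B \<inter> F} \<in> null_sets lborel"
      by (simp add: null_sets_def)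
  qed
  finally show ?thesis .
qed

text \<open>Two finite measures that agree on a generator stable under intersections are equal.
  Closed sets form such a generator, and intersected with the compact F they become compact, which
  is the case that \<open>measure_cone_eq_prism\<close> settles.\<close>

lemma cone_measure_eq:
  "density (distr (restrict_space lborel (sector F 1)) borel rad) (\<lambda>_. ennreal DIM('a))
   = density (face_measure F) (\<lambda>_. ennreal (1 / norm a))" (is "?M = ?N")
proof (rule measure_eqI_generator_eq[where E = "{S. closed S}" and \<Omega> = UNIV and A = "\<lambda>_. UNIV"])
  have Fb[measurable]: "F \<in> sets borel" using F_compact borel_compact by blast
  have sf: "sets (face_measure F) = sets borel"
    by (simp add: face_measure_def Let_def)
  show "Int_stable {S::'a set. closed S}" by (auto simp: Int_stable_def)
  show "sets ?M = sigma_sets UNIV {S. closed S}" "sets ?N = sigma_sets UNIV {S. closed S}"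
    using sf by (auto simp: borel_eq_closed)
  have rm: "rad \<in> borel_measurable (restrict_space lborel (sector F 1))"
    by (intro measurable_restrict_space1) simp
  have M: "emeasure ?M B = ennreal DIM('a) * emeasure lborel (sector (B \<inter> F) 1)"
    if [measurable]: "B \<in> sets borel" for B
  proof -
    have "emeasure ?M B = ennreal DIM('a) * emeasure (restrict_space lborel (sector F 1)) (rad -` B \<inter> sector F 1)"
      using that rm by (simp add: emeasure_density_const emeasure_distr space_restrict_space)
    also have "emeasure (restrict_space lborel (sector F 1)) (rad -` B \<inter> sector F 1) = emeasure lborel (rad -` B \<inter> sector F 1)"
      by (intro emeasure_restrict_space) auto
    also have "rad -` B \<inter> sector F 1 = sector (B \<inter> F) 1" by (auto simp: sector_def)
    finally show ?thesis .
  qed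
  have N: "emeasure ?N B = ennreal (1 / norm a) * emeasure lborel (face_prism (B \<inter> F))"
    if [measurable]: "B \<in> sets borel" for B
    using emeasure_face_measure[OF that] that sf by (simp add: emeasure_density_const)
  have fin: "emeasure lborel (sector (B \<inter> F) 1) \<noteq> \<infinity>" "emeasure lborel (face_prism (B \<inter> F)) \<noteq> \<infinity>" for B
  proof -
    have "bounded (B \<inter> F)" using F_compact compact_imp_bounded bounded_subset by blast
    then show "emeasure lborel (sector (B \<inter> F) 1) \<noteq> \<infinity>" "emeasure lborel (face_prism (B \<inter> F)) \<noteq> \<infinity>"
      unfolding face_prism_def by (intro emeasure_bounded_ne_infinity bounded_sector bounded_prism; assumption)+
  qed
  show "emeasure ?M X = emeasure ?N X" if "X \<in> {S. closed S}" for X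
  proof -
    have [measurable]: "X \<in> sets borel" using that borel_closed by blast
    have "compact (X \<inter> F)" using that F_compact by (simp add: closed_Int_compact)
    from measure_cone_eq_prism[OF this]
    have "ennreal DIM('a) * ennreal (measure lborel (sector (X \<inter> F) 1))
        = ennreal (1 / norm a) * ennreal (measure lborel (face_prism (X \<inter> F)))"
      by (subst (1 2) ennreal_mult'[symmetric]) auto
    moreover have "emeasure lborel (sector (X \<inter> F) 1) = ennreal (measure lborel (sector (X \<inter> F) 1))"
      "emeasure lborel (face_prism (X \<inter> F)) = ennreal (measure lborel (face_prism (X \<inter> F)))"
      using fin[of X] by (simp_all add: emeasure_eq_ennreal_measure)
    ultimately show ?thesis by (simp only: M[OF \<open>X \<in> sets borel\<close>] N[OF \<open>X \<in> sets borel\<close>])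
  qed
  show "emeasure ?M UNIV \<noteq> \<infinity>" for i::nat
    using fin[of UNIV] by (simp add: M ennreal_mult_eq_top_iff)
qed auto

lemma integral_rad:
  fixes f :: "'a \<Rightarrow> real"
  assumes f: "continuous_on UNIV f"
  shows "DIM('a) * (LINT x|lborel. indicator (sector F 1) x * f (rad x)) = (1 / norm a) * (LINT y|face_measure F. f y)"
proof -
  have [measurable]: "f \<in> borel_measurable borel" using f by (simp add: borel_measurable_continuous_onI)
  have Fb[measurable]: "F \<in> sets borel" using F_compact borel_compact by blast
  have sf: "sets (face_measure F) = sets borel"
    by (simp add: face_measure_def Let_def)
  have rm: "rad \<in> borel_measurable (restrict_space lborel (sector F 1))"
    by (intro measurable_restrict_space1) simp
  have "DIM('a) * (LINT x|restrict_space lborel (sector F 1). f (rad x)) = (1 / norm a) * (LINT y|face_measure F. f y)"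
    using arg_cong[OF cone_measure_eq, of "\<lambda>M. LINT x|M. f x"] rm sf
    by (simp add: integral_density integral_distr measurable_cong_sets[OF sf refl])
  also have "(LINT x|restrict_space lborel (sector F 1). f (rad x)) = (LINT x|lborel. indicator (sector F 1) x * f (rad x))"
    by (subst integral_restrict_space) auto
  finally show ?thesis by simp
qed

section \<open>The divergence formula on a cone\<close>

lemma lipschitz_on_ball:
  fixes f :: "'a \<Rightarrow> real" and g :: "'a \<Rightarrow> 'a"
  assumes f: "\<And>x. (f has_derivative (\<lambda>v. g x \<bullet> v)) (at x)" and g: "continuous_on UNIV g"
  obtains L where "0 \<le> L" "\<And>x y. x \<in> cball c r \<Longrightarrow> y \<in> cball c r \<Longrightarrow> \<bar>f x - f y\<bar> \<le> L * norm (x - y)"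
proof -
  have "compact (g ` cball c r)"
    by (intro compact_continuous_image continuous_on_subset[OF g]) auto
  then have "bounded (g ` cball c r)" by (rule compact_imp_bounded)
  then obtain L where L: "\<And>x. x \<in> cball c r \<Longrightarrow> norm (g x) \<le> L"
    unfolding bounded_iff by blast
  have "norm (f x - f y) \<le> max 0 L * norm (x - y)" if "x \<in> cball c r" "y \<in> cball c r" for x y
  proof (rule differentiable_bound[OF convex_cball[of c r] _ _ that])
    show "(f has_derivative (\<lambda>v. g z \<bullet> v)) (at z within cball c r)" for z
      using f has_derivative_at_withinI by blast
    show "onorm (\<lambda>v. g z \<bullet> v) \<le> max 0 L" if "z \<in> cball c r" for z
    proof (rule onorm_bound)
      fix v
      have "norm (g z \<bullet> v) \<le> norm (g z) * norm v" by (simp add: Cauchy_Schwarz_ineq2)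
      also have "\<dots> \<le> max 0 L * norm v" using L[OF that] by (intro mult_right_mono) auto
      finally show "norm (g z \<bullet> v) \<le> max 0 L * norm v" .
    qed auto
  qed
  then show ?thesis using that[of "max 0 L"] by auto
qed

lemma integrable_sector:
  fixes f :: "'a \<Rightarrow> real"
  assumes "continuous_on UNIV f"
  shows "integrable lborel (\<lambda>x. indicator (sector F 1) x * f x)"
  using F_compact borel_compact[of F]
  by (intro integrable_indicator_times_continuous assms bounded_sector compact_imp_bounded) auto

text \<open>The integrand is the derivative at t = 1 of
  \<open>t ^ n * f (P + t *\<^sub>R (x - P))\<close>, where n is the dimension. The difference
  quotients \<open>q j\<close> converge to it. By the substitution with the homothety of ratio
  \<open>1 - \<delta> j\<close>, the integral of \<open>q j\<close> is the integral of f over the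
  thin layer next to F, divided by \<open>\<delta> j\<close>; there f may be replaced by its value
  at the radial projection, at the price of a vanishing error.\<close>

lemma cone_formula_lborel:
  fixes f :: "'a \<Rightarrow> real" and g :: "'a \<Rightarrow> 'a"
  assumes f: "\<And>x. (f has_derivative (\<lambda>v. g x \<bullet> v)) (at x)" and g: "continuous_on UNIV g"
  shows "(LINT x|lborel. indicator (sector F 1) x * (g x \<bullet> (x - P) + DIM('a) * f x))
       = DIM('a) * (LINT x|lborel. indicator (sector F 1) x * f (rad x))"
proof -
  have Fb[measurable]: "F \<in> sets borel" using F_compact borel_compact by blast
  have cf: "continuous_on UNIV f"
    by (intro continuous_at_imp_continuous_on ballI has_derivative_continuous[OF f])
  have [measurable]: "f \<in> borel_measurable borel" using cf by (simp add: borel_measurable_continuous_onI)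
  have [measurable]: "g \<in> borel_measurable borel" using g by (simp add: borel_measurable_continuous_onI)
  let ?n = "DIM('a)" and ?T = "sector F 1"
  have "bounded (F \<union> ?T \<union> {P})"
    using F_compact compact_imp_bounded bounded_sector[of F] by auto
  then have "\<exists>R0. \<forall>x\<in>F \<union> ?T \<union> {P}. dist P x \<le> R0" by (simp only: bounded_any_center[of _ P])
  then obtain R0 where R0: "\<forall>x\<in>F \<union> ?T \<union> {P}. dist P x \<le> R0" ..
  define R where "R = max 0 R0"
  have "dist P x \<le> R" if "x \<in> F \<union> ?T" for x
    using R0[rule_format, of x] that by (auto simp: R_def)
  then have R: "R \<ge> 0" "\<And>x. x \<in> F \<union> ?T \<Longrightarrow> x \<in> cball P R"
    by (simp_all add: R_def)
  have Rn: "norm (x - P) \<le> R" if "x \<in> F \<union> ?T" for x using R(2)[OF that] by (simp add: dist_norm norm_minus_commute)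
  obtain L where L: "0 \<le> L" "\<And>x y. x \<in> cball P R \<Longrightarrow> y \<in> cball P R \<Longrightarrow> \<bar>f x - f y\<bar> \<le> L * norm (x - y)"
    using lipschitz_on_ball[OF f g] by blast
  define K where "K = \<bar>f P\<bar> + L * R"
  have K: "\<bar>f x\<bar> \<le> K" if "x \<in> cball P R" for x
  proof -
    have "\<bar>f x - f P\<bar> \<le> L * norm (x - P)" using L(2)[OF that, of P] R by simp
    also have "\<dots> \<le> L * R" using L(1) that by (intro mult_left_mono) (auto simp: dist_norm norm_minus_commute)
    finally show ?thesis by (simp add: K_def)
  qed
  have radF: "rad x \<in> F" if "x \<in> ?T" for x using that by (simp add: sector_def)
  let ?h = "\<lambda>t x. P + t *\<^sub>R (x - P)"
  define \<delta> where "\<delta> j = inverse (real (Suc (Suc j)))" for j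
  have \<delta>: "0 < \<delta> j" "\<delta> j < 1" for j by (auto simp: \<delta>_def field_simps)
  have \<delta>0: "\<delta> \<longlonglongrightarrow> 0"
    unfolding \<delta>_def[abs_def] using LIMSEQ_Suc[OF LIMSEQ_inverse_real_of_nat] by simp
  define S where "S j = (\<Sum>i<?n. (1 - \<delta> j) ^ i)" for j
  have S: "1 - (1 - \<delta> j) ^ ?n = \<delta> j * S j" for j
    using one_diff_power_eq[of "1 - \<delta> j" ?n] by (simp add: S_def)
  have "(\<lambda>j. (\<Sum>i<?n. (1 - \<delta> j) ^ i)) \<longlonglongrightarrow> (\<Sum>i<?n. (1 - 0) ^ i)"
    by (intro tendsto_intros \<delta>0)
  then have Slim: "S \<longlonglongrightarrow> real ?n" by (simp add: S_def[abs_def])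
  have S_le: "0 \<le> S j" "S j \<le> ?n" for j
  proof -
    show "0 \<le> S j" unfolding S_def using \<delta>[of j] by (intro sum_nonneg) auto
    have "S j \<le> (\<Sum>i<?n. 1)" unfolding S_def using \<delta>[of j] by (intro sum_mono power_le_one) auto
    then show "S j \<le> ?n" by simp
  qed
  have hT: "?h (1 - \<delta> j) x \<in> cball P R" if "x \<in> ?T" for x j
  proof -
    have "norm ((1 - \<delta> j) *\<^sub>R (x - P)) \<le> 1 * R"
      unfolding norm_scaleR using \<delta>[of j] Rn[of x] that by (intro mult_mono) auto
    then show ?thesis by (simp add: dist_norm)
  qed
  have sub: "sector F (1 - \<delta> j) \<subseteq> ?T" for j using \<delta>[of j] by (auto simp: sector_def)
  \<comment> \<open>Substitution with the homothety of ratio \<open>1 - \<delta> j\<close> about P,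
    which maps the whole cone onto its smaller copy.\<close>
  have change: "(LINT x|lborel. indicator (sector F (1 - \<delta> j)) x * u x)
      = (1 - \<delta> j) ^ ?n * (LINT x|lborel. indicator ?T x * u (?h (1 - \<delta> j) x))"
    if [measurable]: "u \<in> borel_measurable borel" for u :: "'a \<Rightarrow> real" and j
  proof -
    have e: "(P - (1 - \<delta> j) *\<^sub>R P) + (1 - \<delta> j) *\<^sub>R x = ?h (1 - \<delta> j) x" for x by (simp add: algebra_simps)
    have i: "?h (1 - \<delta> j) x \<in> sector F (1 - \<delta> j) \<longleftrightarrow> x \<in> ?T" for x
      using \<delta>[of j] unfolding sector_def mem_Collect_eq lam_homothety
      by (simp add: rad_homothety zero_less_mult_iff)
    have "(LINT x|lborel. indicator (sector F (1 - \<delta> j)) x * u x) = \<bar>1 - \<delta> j\<bar> ^ ?n *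
      (LINT x|lborel. indicator (sector F (1 - \<delta> j)) (?h (1 - \<delta> j) x) * u (?h (1 - \<delta> j) x))"
      using \<delta>[of j] integral_lborel_affine[of "1 - \<delta> j" "\<lambda>x. indicator (sector F (1 - \<delta> j)) x * u x" "P - (1 - \<delta> j) *\<^sub>R P"]
      unfolding e by simp
    also have "(\<lambda>x. indicator (sector F (1 - \<delta> j)) (?h (1 - \<delta> j) x) :: real) = indicator ?T"
      using i by (auto simp: indicator_def fun_eq_iff)
    finally show ?thesis using \<delta>[of j] by (simp add: fun_eq_iff)
  qed
  have [measurable]: "(\<lambda>x. f (rad x)) \<in> borel_measurable borel" by measurable
  have Tfin: "integrable lborel (\<lambda>x. indicator ?T x * c)" for c :: real
    using integrable_sector[of "\<lambda>_. c"] by simp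
  have int_bdd: "integrable lborel (\<lambda>x. indicator S x * u x)"
    if [measurable]: "S \<in> sets borel" "u \<in> borel_measurable borel" and "S \<subseteq> ?T" and b: "\<And>x. x \<in> S \<Longrightarrow> \<bar>u x\<bar> \<le> c"
    for u :: "'a \<Rightarrow> real" and c S
    using Tfin[of c] apply (rule Bochner_Integration.integrable_bound)
    using that by (auto simp: indicator_def intro!: AE_I2 order_trans[OF b abs_ge_self])
  have intf: "integrable lborel (\<lambda>x. indicator S x * f x)" "integrable lborel (\<lambda>x. indicator S x * f (rad x))"
    if "S \<in> sets borel" "S \<subseteq> ?T" for S
    using that R(2) radF by (auto intro!: int_bdd K)
  have inth: "integrable lborel (\<lambda>x. indicator ?T x * f (?h (1 - \<delta> j) x))" for j
    by (rule int_bdd[where c = K]) (auto intro!: K hT simp del: mem_cball)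
  have diffset: "(LINT x|lborel. indicator ?T x * u x) - (LINT x|lborel. indicator (sector F (1 - \<delta> j)) x * u x)
      = (LINT x|lborel. indicator (?T - sector F (1 - \<delta> j)) x * u x)"
    if "\<And>S. S \<in> sets borel \<Longrightarrow> S \<subseteq> ?T \<Longrightarrow> integrable lborel (\<lambda>x. indicator S x * u x)" for u :: "'a \<Rightarrow> real" and j
  proof -
    have "(LINT x|lborel. indicator ?T x * u x) - (LINT x|lborel. indicator (sector F (1 - \<delta> j)) x * u x)
       = (LINT x|lborel. indicator ?T x * u x - indicator (sector F (1 - \<delta> j)) x * u x)"
      using sub by (intro Bochner_Integration.integral_diff[symmetric] that) auto
    also have "(\<lambda>x. indicator ?T x * u x - indicator (sector F (1 - \<delta> j)) x * u x)
        = (\<lambda>x. indicator (?T - sector F (1 - \<delta> j)) x * u x)"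
      using sub[of j] by (auto simp: indicator_def fun_eq_iff)
    finally show ?thesis .
  qed
  define q where "q j x = (f x - (1 - \<delta> j) ^ ?n * f (?h (1 - \<delta> j) x)) / \<delta> j" for j x
  have key: "\<bar>(LINT x|lborel. indicator ?T x * q j x) - S j * (LINT x|lborel. indicator ?T x * f (rad x))\<bar>
      \<le> L * R * \<delta> j * S j * measure lborel ?T" for j
  proof -
    let ?A = "?T - sector F (1 - \<delta> j)"
    let ?I = "LINT x|lborel. indicator ?T x * f (rad x)"
    have "(LINT x|lborel. indicator ?T x * q j x)
      = ((LINT x|lborel. indicator ?T x * f x) - (1 - \<delta> j) ^ ?n * (LINT x|lborel. indicator ?T x * f (?h (1 - \<delta> j) x))) / \<delta> j"
    proof -
      have "(\<lambda>x. indicator ?T x * q j x)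
        = (\<lambda>x. (indicator ?T x * f x - (1 - \<delta> j) ^ ?n * (indicator ?T x * f (?h (1 - \<delta> j) x))) / \<delta> j)"
        by (auto simp: q_def indicator_def fun_eq_iff)
      moreover have "integrable lborel (\<lambda>x. (1 - \<delta> j) ^ ?n * (indicator ?T x * f (?h (1 - \<delta> j) x)))"
        using inth[of j] by (rule integrable_mult_right)
      ultimately show ?thesis using intf(1)[of ?T] by simp
    qed
    also have "\<dots> = (LINT x|lborel. indicator ?A x * f x) / \<delta> j"
      using change[of f j] diffset[of f j] intf by simp
    finally have e1: "(LINT x|lborel. indicator ?T x * q j x) = (LINT x|lborel. indicator ?A x * f x) / \<delta> j" .
    \<comment> \<open>The function \<open>f (rad x)\<close> is constant along rays, so for it the
      layer identity is exact; only the comparison of f with \<open>f (rad x)\<close> on the layer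
      leaves an error.\<close>
    have "(LINT x|lborel. indicator ?A x * f (rad x)) = ?I - (1 - \<delta> j) ^ ?n * (LINT x|lborel. indicator ?T x * f (rad (?h (1 - \<delta> j) x)))"
      using change[of "\<lambda>x. f (rad x)" j] diffset[of "\<lambda>x. f (rad x)" j] intf by simp
    also have "\<dots> = ?I - (1 - \<delta> j) ^ ?n * ?I"
      using \<delta>[of j] by (subst rad_homothety) auto
    also have "\<dots> = \<delta> j * S j * ?I" unfolding S[symmetric] by (simp add: algebra_simps)
    finally have e2: "S j * ?I = (LINT x|lborel. indicator ?A x * f (rad x)) / \<delta> j"
      using \<delta>[of j] by simp
    have "measure lborel ?A = measure lborel ?T - measure lborel (sector F (1 - \<delta> j))"
      using sub[of j] emeasure_bounded_ne_infinity[OF bounded_sector[of F]] F_compact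
      by (intro measure_Diff) (auto simp: compact_imp_bounded)
    also have "measure lborel (sector F (1 - \<delta> j)) = (1 - \<delta> j) ^ ?n * measure lborel ?T"
      using emeasure_sector[of F "1 - \<delta> j"] \<delta>[of j] by (simp add: measure_def enn2real_mult)
    finally have mA: "measure lborel ?A = \<delta> j * S j * measure lborel ?T"
      unfolding S[symmetric] by (simp add: algebra_simps)
    have iA: "integrable lborel (\<lambda>x. indicator ?A x * c)" for c :: real
      by (rule int_bdd[of _ _ "\<bar>c\<bar>"]) auto
    have pt: "\<bar>f x - f (rad x)\<bar> \<le> L * R * \<delta> j" if "x \<in> ?A" for x
    proof -
      have x: "x \<in> ?T" "1 - lam x > 1 - \<delta> j" "lam x < 1" "lam x \<ge> 0" using that by (auto simp: sector_def)
      have "x = P + (1 - lam x) *\<^sub>R (rad x - P)" using eq_rad[of x] x by simp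
      then have "x - rad x = P + (1 - lam x) *\<^sub>R (rad x - P) - rad x" by simp
      also have "\<dots> = - (lam x *\<^sub>R (rad x - P))" by (simp add: algebra_simps)
      finally have "norm (x - rad x) = lam x * norm (rad x - P)" using x by simp
      also have "\<dots> \<le> \<delta> j * R" using x Rn[of "rad x"] radF[of x] by (intro mult_mono) auto
      finally have "L * norm (x - rad x) \<le> L * (\<delta> j * R)" using L(1) by (intro mult_left_mono)
      moreover have "\<bar>f x - f (rad x)\<bar> \<le> L * norm (x - rad x)"
        using x radF[of x] by (intro L(2) R(2)) auto
      ultimately show ?thesis by (simp add: mult_ac)
    qed
    have A: "?A \<in> sets borel" "?A \<subseteq> ?T" by auto
    have "\<bar>(LINT x|lborel. indicator ?A x * f x) - (LINT x|lborel. indicator ?A x * f (rad x))\<bar>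
        = \<bar>LINT x|lborel. indicator ?A x * f x - indicator ?A x * f (rad x)\<bar>"
      using intf[OF A] by simp
    also have "\<dots> \<le> (LINT x|lborel. \<bar>indicator ?A x * f x - indicator ?A x * f (rad x)\<bar>)"
      by (rule integral_abs_bound)
    also have "\<dots> \<le> (LINT x|lborel. indicator ?A x * (L * R * \<delta> j))"
      using intf[OF A] iA[of "L * R * \<delta> j"] pt by (intro integral_mono) (auto simp: indicator_def)
    also have "\<dots> = L * R * \<delta> j * measure lborel ?A" by simp
    finally have "\<bar>(LINT x|lborel. indicator ?A x * f x) - (LINT x|lborel. indicator ?A x * f (rad x))\<bar>
        \<le> L * R * \<delta> j * (\<delta> j * S j * measure lborel ?T)" unfolding mA .
    then have "\<bar>(LINT x|lborel. indicator ?A x * f x) - (LINT x|lborel. indicator ?A x * f (rad x))\<bar> / \<delta> j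
        \<le> L * R * \<delta> j * (\<delta> j * S j * measure lborel ?T) / \<delta> j"
      using \<delta>[of j] by (intro divide_right_mono) auto
    then show ?thesis unfolding e1 e2 using \<delta>[of j] by (simp add: diff_divide_distrib[symmetric] mult_ac)
  qed
  have "(\<lambda>j. LINT x|lborel. indicator ?T x * q j x) \<longlonglongrightarrow>
      (LINT x|lborel. indicator ?T x * (g x \<bullet> (x - P) + ?n * f x))"
  proof (rule integral_dominated_convergence)
    show "(\<lambda>x. indicator ?T x * (g x \<bullet> (x - P) + ?n * f x)) \<in> borel_measurable lborel"
      by measurable
    show "(\<lambda>x. indicator ?T x * q j x) \<in> borel_measurable lborel" for j
      unfolding q_def by measurable
    \<comment> \<open>The majorant: the Lipschitz constant bounds the difference quotient of f along
      the ray, and K bounds the term from the derivative of the power.\<close>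
    show "integrable lborel (\<lambda>x. indicator ?T x * (L * R + ?n * K))" by (rule Tfin)
    show "AE x in lborel. norm (indicator ?T x * q j x) \<le> indicator ?T x * (L * R + ?n * K)" for j
    proof (intro AE_I2)
      fix x
      show "norm (indicator ?T x * q j x) \<le> indicator ?T x * (L * R + ?n * K)"
      proof (cases "x \<in> ?T")
        case True
        have q: "q j x = (f x - f (?h (1 - \<delta> j) x)) / \<delta> j + S j * f (?h (1 - \<delta> j) x)"
        proof -
          have "(1 - \<delta> j) ^ ?n = 1 - \<delta> j * S j" using S[of j] by simp
          moreover have "(u - (1 - e * s) * y) / e = (u - y) / e + s * y" if "e \<noteq> 0" for u e s y :: real
            using that by (simp add: field_simps)
          moreover have "\<delta> j \<noteq> 0" using \<delta>[of j] by simp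
          ultimately show ?thesis unfolding q_def by simp
        qed
        have "\<bar>f x - f (?h (1 - \<delta> j) x)\<bar> \<le> L * norm (x - ?h (1 - \<delta> j) x)"
          using True by (intro L(2) hT R(2)) auto
        also have "x - ?h (1 - \<delta> j) x = \<delta> j *\<^sub>R (x - P)" by (simp add: algebra_simps)
        also have "L * norm (\<delta> j *\<^sub>R (x - P)) \<le> L * (\<delta> j * R)"
          using \<delta>[of j] L(1) Rn[of x] True by (intro mult_left_mono) auto
        finally have "\<bar>f x - f (?h (1 - \<delta> j) x)\<bar> / \<delta> j \<le> L * R"
          using \<delta>[of j] by (simp add: field_simps)
        moreover have "\<bar>S j * f (?h (1 - \<delta> j) x)\<bar> \<le> ?n * K"
          unfolding abs_mult using S_le[of j] K[OF hT[OF True]] by (intro mult_mono) auto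
        ultimately have "\<bar>q j x\<bar> \<le> L * R + ?n * K"
          unfolding q using \<delta>[of j] abs_triangle_ineq[of "(f x - f (?h (1 - \<delta> j) x)) / \<delta> j" "S j * f (?h (1 - \<delta> j) x)"]
          by simp
        then show ?thesis using True by simp
      qed simp
    qed
    show "AE x in lborel. (\<lambda>j. indicator ?T x * q j x) \<longlonglongrightarrow> indicator ?T x * (g x \<bullet> (x - P) + ?n * f x)"
    proof (intro AE_I2 tendsto_mult tendsto_const)
      fix x
      have q: "q j x = (f (x + (- \<delta> j) *\<^sub>R (x - P)) - f x) / (- \<delta> j) + S j * f (x + (- \<delta> j) *\<^sub>R (x - P))" for j
      proof -
        have "(1 - \<delta> j) ^ ?n = 1 - \<delta> j * S j" using S[of j] by simp
        moreover have "?h (1 - \<delta> j) x = x + (- \<delta> j) *\<^sub>R (x - P)" by (simp add: algebra_simps)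
        moreover have "(u - (1 - e * s) * y) / e = (y - u) / (- e) + s * y" if "e \<noteq> 0" for u e s y :: real
          using that by (simp add: field_simps)
        moreover have "\<delta> j \<noteq> 0" using \<delta>[of j] by simp
        ultimately show ?thesis unfolding q_def by simp
      qed
      have "((\<lambda>t. f (x + t *\<^sub>R (x - P))) has_derivative (\<lambda>t. g (x + 0 *\<^sub>R (x - P)) \<bullet> (t *\<^sub>R (x - P)))) (at 0)"
        by (rule has_derivative_compose[of "\<lambda>t. x + t *\<^sub>R (x - P)" "\<lambda>t. t *\<^sub>R (x - P)" 0 UNIV f])
          (auto intro!: derivative_eq_intros f)
      then have "((\<lambda>t. f (x + t *\<^sub>R (x - P))) has_field_derivative g x \<bullet> (x - P)) (at 0)"
        unfolding has_field_derivative_def by (simp add: mult.commute[of _ "g x \<bullet> (x - P)"])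
      then have D: "((\<lambda>h. (f (x + h *\<^sub>R (x - P)) - f x) / h) \<longlongrightarrow> g x \<bullet> (x - P)) (at 0)"
        by (simp add: DERIV_def)
      have m\<delta>: "filterlim (\<lambda>j. - \<delta> j) (at 0) sequentially"
        unfolding filterlim_at using tendsto_minus[OF \<delta>0] \<delta>(1) by (auto intro!: always_eventually simp: less_imp_neq[symmetric])
      have A: "(\<lambda>j. (f (x + (- \<delta> j) *\<^sub>R (x - P)) - f x) / (- \<delta> j)) \<longlonglongrightarrow> g x \<bullet> (x - P)"
        by (rule filterlim_compose[OF D m\<delta>])
      have "(\<lambda>j. x + (- \<delta> j) *\<^sub>R (x - P)) \<longlonglongrightarrow> x + (- 0) *\<^sub>R (x - P)"
        by (intro tendsto_intros \<delta>0)
      then have "(\<lambda>j. f (x + (- \<delta> j) *\<^sub>R (x - P))) \<longlonglongrightarrow> f x"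
        using cf by (intro continuous_on_tendsto_compose[OF cf]) auto
      from tendsto_add[OF A tendsto_mult[OF Slim this]]
      show "(\<lambda>j. q j x) \<longlonglongrightarrow> g x \<bullet> (x - P) + ?n * f x" unfolding q .
    qed
  qed
  moreover have "(\<lambda>j. (LINT x|lborel. indicator ?T x * q j x) - S j * (LINT x|lborel. indicator ?T x * f (rad x))) \<longlonglongrightarrow> 0"
  proof (rule Lim_null_comparison)
    show "\<forall>\<^sub>F j in sequentially. norm ((LINT x|lborel. indicator ?T x * q j x) - S j * (LINT x|lborel. indicator ?T x * f (rad x)))
      \<le> L * R * \<delta> j * S j * measure lborel ?T" using key by simp
    have "(\<lambda>j. L * R * \<delta> j * S j * measure lborel ?T) \<longlonglongrightarrow> L * R * 0 * ?n * measure lborel ?T"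
      by (intro tendsto_intros \<delta>0 Slim)
    then show "(\<lambda>j. L * R * \<delta> j * S j * measure lborel ?T) \<longlonglongrightarrow> 0" by simp
  qed
  moreover have "(\<lambda>j. S j * (LINT x|lborel. indicator ?T x * f (rad x))) \<longlonglongrightarrow> ?n * (LINT x|lborel. indicator ?T x * f (rad x))"
    by (intro tendsto_intros Slim)
  ultimately have lim1: "(\<lambda>j. LINT x|lborel. indicator ?T x * q j x) \<longlonglongrightarrow>
      (LINT x|lborel. indicator ?T x * (g x \<bullet> (x - P) + ?n * f x))"
    and lim2: "(\<lambda>j. (LINT x|lborel. indicator ?T x * q j x) - S j * (LINT x|lborel. indicator ?T x * f (rad x))) \<longlonglongrightarrow> 0"
    and lim3: "(\<lambda>j. S j * (LINT x|lborel. indicator ?T x * f (rad x))) \<longlonglongrightarrow> ?n * (LINT x|lborel. indicator ?T x * f (rad x))"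
    by blast+
  show ?thesis
    using LIMSEQ_unique[OF lim1 tendsto_add[OF lim2 lim3, simplified]] .
qed

text \<open>The integrand on the left is the divergence of the field \<open>f(x) (x - P)\<close>.
  This field is tangential to the lateral surface of the cone, and its normal component on F is f
  times the height \<open>1 / norm a\<close>; hence only the integral over F survives.\<close>

lemma cone_formula:
  fixes f :: "'a \<Rightarrow> real" and g :: "'a \<Rightarrow> 'a"
  assumes f: "\<And>x. (f has_derivative (\<lambda>v. g x \<bullet> v)) (at x)" and g: "continuous_on UNIV g"
  shows "(LINT x|lebesgue_on (sector F 1). g x \<bullet> (x - P) + DIM('a) * f x)
       = (1 / norm a) * (LINT y|face_measure F. f y)"
proof -
  have Fb[measurable]: "F \<in> sets borel" using F_compact borel_compact by blast
  have cf: "continuous_on UNIV f"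
    by (intro continuous_at_imp_continuous_on ballI has_derivative_continuous[OF f])
  have [measurable]: "f \<in> borel_measurable borel" using cf by (simp add: borel_measurable_continuous_onI)
  have [measurable]: "g \<in> borel_measurable borel" using g by (simp add: borel_measurable_continuous_onI)
  show ?thesis
    unfolding integral_rad[OF cf, symmetric] cone_formula_lborel[OF f g, symmetric]
    by (rule integral_lebesgue_on_borel) auto
qed

end

section \<open>Simplices\<close>

text \<open>No measurability is assumed. Lebesgue measure is complete, so f is measurable on both
  sets or on neither; in the latter case both integrals have the default value 0.\<close>

lemma lebesgue_on_cong_negligible:
  fixes f :: "'a::euclidean_space \<Rightarrow> 'b::euclidean_space"
  assumes S: "S \<in> sets lebesgue" "S' \<in> sets lebesgue" and neg: "negligible (S - S')" "negligible (S' - S)"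
  shows borel_measurable_lebesgue_on_cong_negligible:
      "f \<in> borel_measurable (lebesgue_on S) \<longleftrightarrow> f \<in> borel_measurable (lebesgue_on S')"
    and integrable_lebesgue_on_cong_negligible: "integrable (lebesgue_on S) f \<longleftrightarrow> integrable (lebesgue_on S') f"
    and integral_lebesgue_on_cong_negligible: "(LINT x|lebesgue_on S. f x) = (LINT x|lebesgue_on S'. f x)"
proof -
  have N: "(S - S') \<union> (S' - S) \<in> null_sets lebesgue"
    using neg by (simp add: negligible_iff_null_sets[symmetric])
  have ae: "AE x in lebesgue. indicator S x *\<^sub>R f x = indicator S' x *\<^sub>R f x"
    by (rule AE_I'[OF N]) (auto simp: indicator_def split: if_splits)
  then have ae': "AE x in lebesgue. indicator S' x *\<^sub>R f x = indicator S x *\<^sub>R f x"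
    by (rule AE_mp) auto
  have m: "(\<lambda>x. indicator S x *\<^sub>R f x) \<in> borel_measurable lebesgue \<longleftrightarrow> (\<lambda>x. indicator S' x *\<^sub>R f x) \<in> borel_measurable lebesgue"
    using borel_measurable_AE[OF _ ae] borel_measurable_AE[OF _ ae'] by blast
  show "f \<in> borel_measurable (lebesgue_on S) \<longleftrightarrow> f \<in> borel_measurable (lebesgue_on S')"
    using m S by (simp add: borel_measurable_restrict_space_iff)
  have i: "integrable lebesgue (\<lambda>x. indicator S x *\<^sub>R f x) \<longleftrightarrow> integrable lebesgue (\<lambda>x. indicator S' x *\<^sub>R f x)"
  proof (cases "(\<lambda>x. indicator S x *\<^sub>R f x) \<in> borel_measurable lebesgue")
    case True then show ?thesis using m ae by (intro integrable_cong_AE) auto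
  next
    case False then show ?thesis using m borel_measurable_integrable by blast
  qed
  then show "integrable (lebesgue_on S) f \<longleftrightarrow> integrable (lebesgue_on S') f"
    using S by (simp add: integrable_restrict_space)
  have "(LINT x|lebesgue. indicator S x *\<^sub>R f x) = (LINT x|lebesgue. indicator S' x *\<^sub>R f x)"
  proof (cases "(\<lambda>x. indicator S x *\<^sub>R f x) \<in> borel_measurable lebesgue")
    case True then show ?thesis using m ae by (intro integral_cong_AE) auto
  next
    case False
    then have "\<not> integrable lebesgue (\<lambda>x. indicator S x *\<^sub>R f x)" "\<not> integrable lebesgue (\<lambda>x. indicator S' x *\<^sub>R f x)"
      using m borel_measurable_integrable by blast+
    then show ?thesis by (simp add: not_integrable_integral_eq)
  qed
  then show "(LINT x|lebesgue_on S. f x) = (LINT x|lebesgue_on S'. f x)"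
    using S by (simp add: integral_restrict_space)
qed

lemma integrable_on_compact_continuous:
  fixes f :: "'a::euclidean_space \<Rightarrow> 'b::euclidean_space"
  assumes "compact S" "continuous_on S f"
  shows "integrable (lebesgue_on S) f"
proof -
  have S: "S \<in> sets borel" using assms(1) by (simp add: borel_compact)
  have "integrable lborel (\<lambda>x. indicator S x *\<^sub>R f x)"
    by (rule borel_integrable_compact[OF assms])
  then have "integrable lebesgue (\<lambda>x. indicator S x *\<^sub>R f x)"
    by (simp add: integrable_completion)
  then show ?thesis using S by (simp add: integrable_restrict_space)
qed

text \<open>The surface measure is the image under the projection of a set of points that all
  project into F, so the values of the integrand elsewhere never enter.\<close>

lemma integral_face_measure_cong:
  fixes f h :: "'a::euclidean_space \<Rightarrow> real"
  assumes "f \<in> borel_measurable borel" "h \<in> borel_measurable borel" "\<And>x. x \<in> F \<Longrightarrow> f x = h x"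
    and cp: "closest_point (affine hull F) \<in> borel_measurable borel"
  shows "(LINT y|face_measure F. f y) = (LINT y|face_measure F. h y)"
proof -
  let ?Q = "{x. closest_point (affine hull F) x \<in> F \<and> infdist x (affine hull F) \<le> 1/2}"
  have "closest_point (affine hull F) \<in> borel_measurable lebesgue" using cp by (intro measurable_completion) simp
  then have om: "closest_point (affine hull F) \<in> borel_measurable (lebesgue_on ?Q)"
    by (rule measurable_restrict_space1)
  have "(LINT x|lebesgue_on ?Q. f (closest_point (affine hull F) x)) = (LINT x|lebesgue_on ?Q. h (closest_point (affine hull F) x))"
    using assms(3) by (intro Bochner_Integration.integral_cong) auto
  then show ?thesis
    unfolding face_measure_def Let_def using assms(1,2) om by (simp only: integral_distr)
qed

locale full_simplex =
  fixes C :: "'a::euclidean_space set"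
  assumes indep: "\<not> affine_dependent C" and card_C: "card C = Suc (DIM('a))"
begin

section \<open>Barycentric coordinates\<close>

definition "T = convex hull C"

text \<open>Slope and offset of the affine function that is 1 at P and 0 at the other vertices. In
  this form a barycentric coordinate is a smooth function on the whole space, to which the cone
  formula applies directly.\<close>

definition "bary_coeffs P = (SOME ad. \<forall>Q\<in>C. fst ad \<bullet> Q + snd ad = (if Q = P then 1 else (0::real)))"
definition "slope P = fst (bary_coeffs P)"
definition "offset P = snd (bary_coeffs P)"
definition "bary P x = slope P \<bullet> x + offset P"
definition "face P = convex hull (C - {P})"

lemma finite_C[simp]: "finite C"
  using card_C card.infinite by fastforce

lemma affine_C: "affine hull C = UNIV"
  using affine_independent_span_eq indep card_C by blast

lemma aff_dim_C: "aff_dim C = DIM('a)"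
  using aff_dim_affine_independent[OF indep] card_C by simp

text \<open>The remaining vertices span a hyperplane which, by affine independence, misses P. Its
  equation, normalised at P, is the affine function whose existence the choice in
  \<open>bary_coeffs\<close> requires.\<close>

lemma bary_vertex: 
  assumes "P \<in> C" "Q \<in> C"
  shows "bary P Q = (if Q = P then 1 else 0)"
proof -
  have ind: "\<not> affine_dependent (C - {P})" using indep affine_independent_subset by blast
  have "aff_dim (C - {P}) = int (card (C - {P})) - 1" using aff_dim_affine_independent[OF ind] by simp
  then have "aff_dim (affine hull (C - {P})) = DIM('a) - 1" using assms card_C by simp
  then obtain a b where ab: "a \<noteq> 0" "affine hull (C - {P}) = {x. a \<bullet> x = b}"
    using aff_dim_eq_hyperplane[of "C - {P}"] by auto
  have P: "a \<bullet> P \<noteq> b" using indep assms(1) ab(2) unfolding affine_dependent_def by auto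
  have Q: "a \<bullet> Q = b" if "Q \<in> C" "Q \<noteq> P" for Q
    using hull_subset[of "C - {P}" affine] ab that by auto
  have "\<exists>ad. \<forall>Q\<in>C. fst ad \<bullet> Q + snd ad = (if Q = P then 1 else (0::real))"
  proof (rule exI[of _ "((1 / (a \<bullet> P - b)) *\<^sub>R a, - b / (a \<bullet> P - b))"], intro ballI)
    fix Q assume "Q \<in> C"
    then show "fst ((1 / (a \<bullet> P - b)) *\<^sub>R a, - b / (a \<bullet> P - b)) \<bullet> Q + snd ((1 / (a \<bullet> P - b)) *\<^sub>R a, - b / (a \<bullet> P - b)) = (if Q = P then 1 else (0::real))"
      using P Q by (auto simp: diff_divide_distrib[symmetric])
  qed
  from someI_ex[OF this] assms show ?thesis
    unfolding bary_def slope_def offset_def bary_coeffs_def by blast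
qed

lemma bary_affine_sum:
  assumes "sum u C = 1"
  shows "bary P (\<Sum>Q\<in>C. u Q *\<^sub>R Q) = (\<Sum>Q\<in>C. u Q * bary P Q)"
proof -
  have "(\<Sum>Q\<in>C. u Q * bary P Q) = (\<Sum>Q\<in>C. u Q * (slope P \<bullet> Q)) + sum u C * offset P"
    by (simp add: bary_def distrib_left sum.distrib sum_distrib_right)
  then show ?thesis using assms by (simp add: bary_def inner_sum_right)
qed

lemma bary_unique:
  assumes "sum u C = 1" "P \<in> C"
  shows "bary P (\<Sum>Q\<in>C. u Q *\<^sub>R Q) = u P"
  using assms by (simp add: bary_affine_sum bary_vertex sum.delta if_distrib cong: if_cong)

lemma bary_sum: "(\<Sum>P\<in>C. bary P x) = 1" and bary_rep: "(\<Sum>P\<in>C. bary P x *\<^sub>R P) = x"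
proof -
  have "x \<in> affine hull C" by (simp add: affine_C)
  then obtain u where u: "sum u C = 1" "(\<Sum>v\<in>C. u v *\<^sub>R v) = x"
    unfolding affine_hull_finite[OF finite_C] by blast
  have b: "bary P x = u P" if "P \<in> C" for P using bary_unique[OF u(1) that] u(2) by simp
  show "(\<Sum>P\<in>C. bary P x) = 1" using u b by simp
  show "(\<Sum>P\<in>C. bary P x *\<^sub>R P) = x" using u b by simp
qed

text \<open>The linear parts of the identities \<open>bary_sum\<close> and \<open>bary_rep\<close>,
  obtained as differences of their values at v and at 0.\<close>

lemma slope_sum: "(\<Sum>P\<in>C. slope P \<bullet> v) = 0" and slope_rep: "(\<Sum>P\<in>C. (slope P \<bullet> v) *\<^sub>R P) = v"
proof -
  have s: "slope P \<bullet> v = bary P v - bary P 0" for P by (simp add: bary_def)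
  show "(\<Sum>P\<in>C. slope P \<bullet> v) = 0" unfolding s by (simp add: sum_subtractf bary_sum)
  show "(\<Sum>P\<in>C. (slope P \<bullet> v) *\<^sub>R P) = v" unfolding s by (simp add: algebra_simps sum_subtractf bary_rep)
qed

lemma T_iff: "x \<in> T \<longleftrightarrow> (\<forall>P\<in>C. 0 \<le> bary P x)"
proof
  assume "x \<in> T"
  then obtain u where u: "\<forall>x\<in>C. 0 \<le> u x" "sum u C = 1" "(\<Sum>v\<in>C. u v *\<^sub>R v) = x"
    unfolding T_def convex_hull_finite[OF finite_C] by blast
  then show "\<forall>P\<in>C. 0 \<le> bary P x" using bary_unique[OF u(2)] by auto
next
  assume "\<forall>P\<in>C. 0 \<le> bary P x"
  then show "x \<in> T" unfolding T_def convex_hull_finite[OF finite_C]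
    using bary_sum[of x] bary_rep[of x] by (auto intro!: exI[of _ "\<lambda>P. bary P x"])
qed

lemma interior_T_iff: "x \<in> interior T \<longleftrightarrow> (\<forall>P\<in>C. 0 < bary P x)"
proof -
  have i: "interior T = {y. \<exists>u. (\<forall>x\<in>C. 0 < u x) \<and> sum u C = 1 \<and> (\<Sum>x\<in>C. u x *\<^sub>R x) = y}"
    unfolding T_def using interior_convex_hull_explicit_minimal[OF indep] card_C by simp
  show ?thesis
  proof
    assume "x \<in> interior T"
    then obtain u where u: "\<forall>x\<in>C. 0 < u x" "sum u C = 1" "(\<Sum>v\<in>C. u v *\<^sub>R v) = x"
      unfolding i by blast
    then show "\<forall>P\<in>C. 0 < bary P x" using bary_unique[OF u(2)] by auto
  next
    assume "\<forall>P\<in>C. 0 < bary P x"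
    then show "x \<in> interior T" unfolding i
      using bary_sum[of x] bary_rep[of x] by (auto intro!: exI[of _ "\<lambda>P. bary P x"])
  qed
qed

text \<open>Coefficients over D, extended by zero, are coefficients over C, and those are unique;
  conversely, coordinates vanishing off D make the representation over C one over D.\<close>

lemma hull_subset_iff:
  assumes D: "D \<subseteq> C"
  shows "x \<in> convex hull D \<longleftrightarrow> (\<forall>P\<in>D. 0 \<le> bary P x) \<and> (\<forall>P\<in>C - D. bary P x = 0)"
    and "x \<in> affine hull D \<longleftrightarrow> (\<forall>P\<in>C - D. bary P x = 0)"
proof -
  have fin: "finite D" using D finite_C finite_subset by blast
  have ext: "(\<Sum>Q\<in>C. (if Q \<in> D then u Q else 0)) = sum u D"
    "(\<Sum>Q\<in>C. (if Q \<in> D then u Q else 0) *\<^sub>R Q) = (\<Sum>Q\<in>D. u Q *\<^sub>R Q)" for u :: "'a \<Rightarrow> real"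
    using D by (auto intro!: sum.mono_neutral_cong_right)
  have coord: "bary P (\<Sum>Q\<in>D. u Q *\<^sub>R Q) = (if P \<in> D then u P else 0)" if "P \<in> C" "sum u D = 1" for P u
    using bary_unique[of "\<lambda>Q. if Q \<in> D then u Q else 0" P] that ext[of u] by auto
  have rest: "sum (\<lambda>P. bary P x) D = 1 \<and> (\<Sum>P\<in>D. bary P x *\<^sub>R P) = x" if "\<forall>P\<in>C - D. bary P x = 0"
  proof -
    have "sum (\<lambda>P. bary P x) D = sum (\<lambda>P. bary P x) C" "(\<Sum>P\<in>D. bary P x *\<^sub>R P) = (\<Sum>P\<in>C. bary P x *\<^sub>R P)"
      using D that by (auto intro!: sum.mono_neutral_left)
    then show ?thesis by (simp add: bary_sum bary_rep)
  qed
  show "x \<in> convex hull D \<longleftrightarrow> (\<forall>P\<in>D. 0 \<le> bary P x) \<and> (\<forall>P\<in>C - D. bary P x = 0)"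
  proof
    assume "x \<in> convex hull D"
    then obtain u where "\<forall>x\<in>D. 0 \<le> u x" "sum u D = 1" "(\<Sum>v\<in>D. u v *\<^sub>R v) = x"
      unfolding convex_hull_finite[OF fin] by blast
    then show "(\<forall>P\<in>D. 0 \<le> bary P x) \<and> (\<forall>P\<in>C - D. bary P x = 0)" using coord D by auto
  next
    assume "(\<forall>P\<in>D. 0 \<le> bary P x) \<and> (\<forall>P\<in>C - D. bary P x = 0)"
    then show "x \<in> convex hull D" unfolding convex_hull_finite[OF fin]
      using rest by (auto intro!: exI[of _ "\<lambda>P. bary P x"])
  qed
  show "x \<in> affine hull D \<longleftrightarrow> (\<forall>P\<in>C - D. bary P x = 0)"
  proof
    assume "x \<in> affine hull D"
    then obtain u where "sum u D = 1" "(\<Sum>v\<in>D. u v *\<^sub>R v) = x"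
      unfolding affine_hull_finite[OF fin] by blast
    then show "\<forall>P\<in>C - D. bary P x = 0" using coord by auto
  next
    assume "\<forall>P\<in>C - D. bary P x = 0"
    then show "x \<in> affine hull D" unfolding affine_hull_finite[OF fin]
      using rest by (auto intro!: exI[of _ "\<lambda>P. bary P x"])
  qed
qed

lemma face_iff: "P \<in> C \<Longrightarrow> x \<in> face P \<longleftrightarrow> bary P x = 0 \<and> (\<forall>Q\<in>C. 0 \<le> bary Q x)"
  unfolding face_def hull_subset_iff(1)[OF Diff_subset] by auto

lemma affine_face: "P \<in> C \<Longrightarrow> affine hull (face P) = {x. slope P \<bullet> x + offset P = 0}"
  unfolding face_def affine_hull_convex_hull using hull_subset_iff(2)[OF Diff_subset, of _ "{P}"]
  by (auto simp: bary_def)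

lemma slope_ne: "P \<in> C \<Longrightarrow> slope P \<noteq> 0"
proof
  assume P: "P \<in> C" "slope P = 0"
  have "C - {P} \<noteq> {}"
    using card_C P by (metis card.empty card_Diff_singleton diff_Suc_1 DIM_positive less_irrefl_nat)
  then obtain Q where "Q \<in> C" "Q \<noteq> P" by auto
  with P bary_vertex[of P Q] bary_vertex[of P P] show False by (simp add: bary_def)
qed

lemma cone_face: "P \<in> C \<Longrightarrow> cone (slope P) P (offset P) (face P)"
  using slope_ne bary_vertex[of P P] affine_face
  by unfold_locales (auto simp: bary_def face_def intro: finite_imp_compact_convex_hull)

lemma compact_T: "compact T" unfolding T_def by (rule finite_imp_compact_convex_hull) simp
lemma convex_T: "convex T" unfolding T_def by simp

text \<open>The radial projection from P divides every other barycentric coordinate by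
  \<open>1 - bary P x\<close> and so preserves its sign. On T this number vanishes only at P, which
  is why exactly the apex is missing.\<close>

lemma sector_face:
  assumes P: "P \<in> C"
  shows "cone.sector (slope P) P (offset P) (face P) 1 = T - {P}"
proof -
  interpret cone "slope P" P "offset P" "face P" by (rule cone_face[OF P])
  have l: "lam x = bary P x" for x by (simp add: lam_def bary_def)
  have r: "bary Q (rad x) = bary Q x / (1 - bary P x)" if "bary P x < 1" "Q \<in> C" "Q \<noteq> P" for Q x
  proof -
    have "bary Q (rad x) = bary Q P + (1 / (1 - bary P x)) * (bary Q x - bary Q P)"
      unfolding rad_def l by (simp add: bary_def inner_simps)
    then show ?thesis using that P by (simp add: bary_vertex)
  qed
  show ?thesis
  proof (intro set_eqI iffI)
    fix x assume "x \<in> sector (face P) 1"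
    then have x: "bary P x < 1" "bary P x \<ge> 0" "rad x \<in> face P" by (auto simp: sector_def l)
    have "bary Q x \<ge> 0" if "Q \<in> C" for Q
      using x r[of x Q] that face_iff[OF P, of "rad x"] by (cases "Q = P") (auto simp: zero_le_divide_iff)
    moreover have "x \<noteq> P" using x bary_vertex[of P P] P by auto
    ultimately show "x \<in> T - {P}" by (simp add: T_iff)
  next
    fix x assume x: "x \<in> T - {P}"
    have b: "bary Q x \<ge> 0" if "Q \<in> C" for Q using x that by (auto simp: T_iff)
    have s: "bary P x + (\<Sum>Q\<in>C - {P}. bary Q x) = 1" using bary_sum[of x] P by (simp add: sum.remove)
    have "bary P x < 1"
    proof (rule ccontr)
      assume "\<not> bary P x < 1"
      moreover have "(\<Sum>Q\<in>C - {P}. bary Q x) \<ge> 0" using b by (intro sum_nonneg) auto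
      ultimately have "bary P x = 1" "(\<Sum>Q\<in>C - {P}. bary Q x) = 0" using s by auto
      then have "\<forall>Q\<in>C - {P}. bary Q x = 0" using b by (subst (asm) sum_nonneg_eq_0_iff) auto
      then have "(\<Sum>Q\<in>C. bary Q x *\<^sub>R Q) = P" using \<open>bary P x = 1\<close> P by (simp add: sum.remove)
      then show False using x bary_rep[of x] by simp
    qed
    moreover have "rad x \<in> face P"
      using \<open>bary P x < 1\<close> r b lam_rad[of x] P by (auto simp: face_iff l) (metis divide_nonneg_pos diff_gt_0_iff_gt order_refl)
    ultimately show "x \<in> sector (face P) 1" using b P by (simp add: sector_def l)
  qed
qed

text \<open>The divergence theorem for the fields f(x) (x - P): they are tangential to all faces through P.\<close>

lemma vertex_divergence:
  fixes f :: "'a \<Rightarrow> real"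
  assumes P: "P \<in> C" and f: "\<And>x. (f has_derivative (\<lambda>v. g x \<bullet> v)) (at x)" and g: "continuous_on UNIV g"
  shows "(LINT x|lebesgue_on T. g x \<bullet> (x - P) + DIM('a) * f x) = (1 / norm (slope P)) * (LINT y|face_measure (face P). f y)"
proof -
  interpret cone "slope P" P "offset P" "face P" by (rule cone_face[OF P])
  have "T \<in> sets lebesgue" using compact_T lmeasurable_compact by blast
  then have "(LINT x|lebesgue_on T. g x \<bullet> (x - P) + DIM('a) * f x) = (LINT x|lebesgue_on (T - {P}). g x \<bullet> (x - P) + DIM('a) * f x)"
    by (intro integral_lebesgue_on_cong_negligible) (auto intro: negligible_subset[of "{P}"])
  then show ?thesis using cone_formula[OF f g] by (simp add: sector_face[OF P])
qed

section \<open>Volume and moments of the barycentric coordinates\<close>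

definition "vol = measure lebesgue T"

lemma vol_pos: "vol > 0"
proof -
  have "interior T \<noteq> {}"
  proof -
    have "(\<Sum>P\<in>C. (1 / real (Suc DIM('a))) *\<^sub>R P) \<in> interior T"
      unfolding interior_T_iff by (auto simp: bary_unique card_C simp del: of_nat_Suc)
    then show ?thesis by blast
  qed
  moreover have "negligible T \<longleftrightarrow> vol = 0" unfolding vol_def
    using compact_T by (simp add: negligible_iff_measure lmeasurable_compact)
  ultimately have "vol \<noteq> 0" using negligible_convex_interior[OF convex_T] by blast
  then show ?thesis by (simp add: vol_def less_le)
qed

lemma T_sets[simp]: "T \<in> sets lebesgue" using compact_T lmeasurable_compact by blast

lemma integrable_T: "continuous_on UNIV f \<Longrightarrow> integrable (lebesgue_on T) (f :: 'a \<Rightarrow> real)"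
  using compact_T integrable_on_compact_continuous continuous_on_subset by blast

lemma measure_T[simp]: "measure (lebesgue_on T) T = vol"
  by (simp add: vol_def measure_restrict_space)

lemma cont_bary[continuous_intros]: "continuous_on S (bary P)"
  unfolding bary_def[abs_def] by (intro continuous_intros)

lemma bary_derivative: "(bary P has_derivative (\<lambda>v. slope P \<bullet> v)) (at x)"
  unfolding bary_def[abs_def] by (auto intro!: derivative_eq_intros)

lemma slope_diff: "slope Q \<bullet> (x - y) = bary Q x - bary Q y"
  by (simp add: bary_def inner_simps)

lemma closest_point_face_borel: "P \<in> C \<Longrightarrow> closest_point (affine hull (face P)) \<in> borel_measurable borel"
  by (intro borel_measurable_continuous_onI continuous_on_closest_point)
    (auto simp: affine_imp_convex closed_affine_hull affine_face[symmetric] cone.F_ne[OF cone_face])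

text \<open>Meant for products that contain \<open>bary P\<close>: they vanish on the opposite face,
  the boundary term drops out, and what remains is a recursion for moments.\<close>

lemma vertex_divergence_vanishing:
  fixes f :: "'a \<Rightarrow> real"
  assumes P: "P \<in> C" and f: "\<And>x. (f has_derivative (\<lambda>v. g x \<bullet> v)) (at x)" and g: "continuous_on UNIV g"
    and z: "\<And>x. x \<in> face P \<Longrightarrow> f x = 0"
  shows "(LINT x|lebesgue_on T. g x \<bullet> (x - P) + DIM('a) * f x) = 0"
proof -
  have cf: "continuous_on UNIV f"
    by (intro continuous_at_imp_continuous_on ballI has_derivative_continuous[OF f])
  have "(LINT y|face_measure (face P). f y) = (LINT y|face_measure (face P). 0)"
    using cf z by (intro integral_face_measure_cong closest_point_face_borel P) (auto simp: borel_measurable_continuous_onI)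
  then show ?thesis using vertex_divergence[OF P f g] by simp
qed

lemma bary_moment1:
  assumes P: "P \<in> C" shows "(LINT x|lebesgue_on T. bary P x) = vol / (real DIM('a) + 1)"
proof -
  have i: "integrable (lebesgue_on T) (bary P)" by (intro integrable_T continuous_intros)
  have "(LINT x|lebesgue_on T. slope P \<bullet> (x - P) + DIM('a) * bary P x) = 0"
    by (rule vertex_divergence_vanishing[OF P bary_derivative]) (auto simp: face_iff P)
  also have "(\<lambda>x. slope P \<bullet> (x - P) + DIM('a) * bary P x) = (\<lambda>x. (real DIM('a) + 1) * bary P x - 1)"
    using P unfolding slope_diff by (auto simp: bary_vertex algebra_simps)
  also have "(LINT x|lebesgue_on T. (real DIM('a) + 1) * bary P x - 1) = (real DIM('a) + 1) * (LINT x|lebesgue_on T. bary P x) - vol"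
    using i integrable_T[of "\<lambda>_. 1"] by simp
  finally show ?thesis by (simp add: field_simps)
qed

text \<open>The recursion for \<open>bary P x * bary Q x\<close>. Along \<open>x - P\<close> the
  coordinate of Q changes by \<open>bary Q x - bary Q P\<close>, which brings an additional
  \<open>bary P x\<close> precisely if P = Q; this is the factor 2 on the diagonal.\<close>

lemma bary_moment2:
  assumes P: "P \<in> C" and Q: "Q \<in> C"
  shows "(LINT x|lebesgue_on T. bary P x * bary Q x) = (if P = Q then 2 else 1) * vol / ((real DIM('a) + 1) * (real DIM('a) + 2))"
proof -
  have iP: "integrable (lebesgue_on T) (bary P)" and iQ: "integrable (lebesgue_on T) (bary Q)"
    and iPQ: "integrable (lebesgue_on T) (\<lambda>x. bary P x * bary Q x)"
    by (intro integrable_T continuous_intros)+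
  let ?g = "\<lambda>x. bary P x *\<^sub>R slope Q + bary Q x *\<^sub>R slope P" and ?c = "if P = Q then 2 else 1 :: real"
  have "(LINT x|lebesgue_on T. ?g x \<bullet> (x - P) + DIM('a) * (bary P x * bary Q x)) = 0"
  proof (rule vertex_divergence_vanishing[OF P])
    show "((\<lambda>x. bary P x * bary Q x) has_derivative (\<lambda>v. ?g x \<bullet> v)) (at x)" for x
      by (rule has_derivative_eq_rhs[OF has_derivative_mult[OF bary_derivative bary_derivative]])
        (auto simp: inner_simps)
    show "continuous_on UNIV ?g" by (intro continuous_intros)
  qed (auto simp: face_iff P)
  also have "(\<lambda>x. ?g x \<bullet> (x - P) + DIM('a) * (bary P x * bary Q x)) = (\<lambda>x. (real DIM('a) + 2) * (bary P x * bary Q x) - ?c * bary Q x)"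
    using P Q unfolding inner_add_left inner_scaleR_left slope_diff
    by (auto simp: bary_vertex algebra_simps)
  also have "(LINT x|lebesgue_on T. (real DIM('a) + 2) * (bary P x * bary Q x) - ?c * bary Q x)
      = (real DIM('a) + 2) * (LINT x|lebesgue_on T. bary P x * bary Q x) - ?c * (LINT x|lebesgue_on T. bary Q x)"
    using iPQ iQ by simp
  finally have eq: "(real DIM('a) + 2) * (LINT x|lebesgue_on T. bary P x * bary Q x) - ?c * (vol / (real DIM('a) + 1)) = 0"
    unfolding bary_moment1[OF Q] by (simp add: add.commute)
  have solve: "X = c * v / (B * A)" if "A * X - c * (v / B) = 0" "A > 0" "B > 0" for A B c v X :: real
    using that by (simp add: field_simps)
  have "(LINT x|lebesgue_on T. bary P x * bary Q x) = ?c * vol / ((real DIM('a) + 1) * (real DIM('a) + 2))"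
    by (rule solve[OF eq]) auto
  then show ?thesis by (simp add: algebra_simps)
qed

section \<open>Centroids and integrals of affine functions\<close>

definition "centroid = (1 / (real DIM('a) + 1)) *\<^sub>R (\<Sum>P\<in>C. P)"
definition "face_centroid P = (1 / real DIM('a)) *\<^sub>R (\<Sum>Q\<in>C - {P}. Q)"

lemma vertices_T: "vertices T = C"
  unfolding vertices_def T_def using extreme_point_of_convex_hull_affine_independent[OF indep] by auto

lemma mid_T: "mid T = centroid"
  by (simp add: mid_def vertices_T card_C centroid_def)

lemma vertices_face: "vertices (face P) = C - {P}"
  unfolding vertices_def face_def
  using extreme_point_of_convex_hull_affine_independent[OF affine_independent_subset[OF indep Diff_subset]] by auto

lemma mid_face: "P \<in> C \<Longrightarrow> mid (face P) = face_centroid P"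
  by (simp add: mid_def vertices_face card_C face_centroid_def)

lemma facet_iff: "F facet_of T \<longleftrightarrow> (\<exists>P\<in>C. F = face P)"
proof -
  have "face P \<noteq> {}" if "P \<in> C" for P by (rule cone.F_ne[OF cone_face[OF that]])
  then show ?thesis
    unfolding T_def facet_of_convex_hull_affine_independent[OF indep] face_def by blast
qed

lemma affine_bary: "b \<bullet> x + e = (\<Sum>P\<in>C. bary P x * (b \<bullet> P + e))" for e :: real
proof -
  have "b \<bullet> x + e = b \<bullet> (\<Sum>P\<in>C. bary P x *\<^sub>R P) + (\<Sum>P\<in>C. bary P x) * e" by (simp add: bary_rep bary_sum)
  also have "\<dots> = (\<Sum>P\<in>C. bary P x * (b \<bullet> P + e))"
    by (simp add: inner_sum_right sum.distrib distrib_left sum_distrib_right)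
  finally show ?thesis .
qed

lemma integral_affine: "(LINT x|lebesgue_on T. b \<bullet> x + e) = vol * (b \<bullet> centroid + e)"
proof -
  have i: "integrable (lebesgue_on T) (\<lambda>x. bary P x * c)" for P c by (intro integrable_T continuous_intros)
  have "(\<lambda>x. b \<bullet> x + e) = (\<lambda>x. \<Sum>P\<in>C. bary P x * (b \<bullet> P + e))" by (rule ext) (rule affine_bary)
  then have "(LINT x|lebesgue_on T. b \<bullet> x + e) = (LINT x|lebesgue_on T. (\<Sum>P\<in>C. bary P x * (b \<bullet> P + e)))"
    by (rule arg_cong)
  also have "\<dots> = (\<Sum>P\<in>C. vol / (real DIM('a) + 1) * (b \<bullet> P + e))"
    using i by (subst Bochner_Integration.integral_sum) (auto simp: bary_moment1)
  also have "\<dots> = vol * ((1 / (real DIM('a) + 1)) * (\<Sum>P\<in>C. b \<bullet> P) + e)"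
  proof -
    have factor: "(\<Sum>P\<in>C. c * (b \<bullet> P + e)) = c * ((\<Sum>P\<in>C. b \<bullet> P) + (real DIM('a) + 1) * e)" for c
      by (simp add: sum_distrib_left[symmetric] sum.distrib card_C add.commute)
    have "v / m * (s + m * e) = v * (1 / m * s + e)" if "m > 0" for m s v :: real
      using that by (simp add: field_simps)
    then show ?thesis unfolding factor by simp
  qed
  finally show ?thesis by (simp add: centroid_def inner_sum_right)
qed

lemma centroid_face: "P \<in> C \<Longrightarrow> (real DIM('a) + 1) *\<^sub>R centroid = real DIM('a) *\<^sub>R face_centroid P + P"
  by (simp add: centroid_def face_centroid_def sum.remove[of C P] add.commute)

text \<open>A face integral in the guise of a volume integral: together with
  \<open>vertex_divergence\<close> and \<open>face_area\<close> it says that the mean of an affine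
  function over the face opposite to P is its value at the centroid of that face.\<close>

lemma vertex_divergence_affine:
  assumes P: "P \<in> C"
  shows "(LINT x|lebesgue_on T. b \<bullet> (x - P) + DIM('a) * (b \<bullet> x + e)) = DIM('a) * vol * (b \<bullet> face_centroid P + e)"
proof -
  have "(\<lambda>x. b \<bullet> (x - P) + DIM('a) * (b \<bullet> x + e)) = (\<lambda>x. ((real DIM('a) + 1) *\<^sub>R b) \<bullet> x + (DIM('a) * e - b \<bullet> P))"
    by (auto simp: algebra_simps inner_simps)
  then have "(LINT x|lebesgue_on T. b \<bullet> (x - P) + DIM('a) * (b \<bullet> x + e)) = vol * (((real DIM('a) + 1) *\<^sub>R b) \<bullet> centroid + (DIM('a) * e - b \<bullet> P))"
    by (simp only: integral_affine)
  also have "\<dots> = vol * (b \<bullet> ((real DIM('a) + 1) *\<^sub>R centroid) + (DIM('a) * e - b \<bullet> P))" by simp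
  also have "\<dots> = DIM('a) * vol * (b \<bullet> face_centroid P + e)"
    unfolding centroid_face[OF P] by (simp add: inner_simps algebra_simps)
  finally show ?thesis .
qed

text \<open>The divergence formula with f = 1, that is, volume equals height times base over
  dimension with the height \<open>1 / norm (slope P)\<close>.\<close>

lemma face_area:
  assumes P: "P \<in> C"
  shows "(1 / norm (slope P)) * measure (face_measure (face P)) (face P) = DIM('a) * vol"
    and "measure (face_measure (face P)) (face P) > 0"
proof -
  interpret cone "slope P" P "offset P" "face P" by (rule cone_face[OF P])
  have F: "face P \<in> sets borel" using F_compact borel_compact by blast
  have "emeasure (face_measure (face P)) (face P) = emeasure (face_measure (face P)) UNIV"
    using emeasure_face_measure[of "face P"] emeasure_face_measure[of UNIV] F by simp
  then have "measure (face_measure (face P)) (face P) = measure (face_measure (face P)) (space (face_measure (face P)))"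
    by (simp add: measure_def face_measure_def Let_def)
  also have "\<dots> = (LINT y|face_measure (face P). 1)" by simp
  finally have m: "measure (face_measure (face P)) (face P) = (LINT y|face_measure (face P). 1)" .
  show 1: "(1 / norm (slope P)) * measure (face_measure (face P)) (face P) = DIM('a) * vol"
    unfolding m using vertex_divergence[OF P, of "\<lambda>_. 1" "\<lambda>_. 0"] vertex_divergence_affine[OF P, of 0 1]
    by simp
  then have "(1 / norm (slope P)) * measure (face_measure (face P)) (face P) > 0" using vol_pos by simp
  then show "measure (face_measure (face P)) (face P) > 0"
    using slope_ne[OF P] by (simp add: zero_less_divide_iff)
qed

section \<open>The bubble function of a simplex\<close>

definition "radii = (\<Sum>P\<in>C. (norm (P - centroid))\<^sup>2)"

lemma sum_C_centroid: "(\<Sum>P\<in>C. P - centroid) = 0"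
proof -
  have "(\<Sum>P\<in>C. P - centroid) = (\<Sum>P\<in>C. P) - (real DIM('a) + 1) *\<^sub>R centroid"
    by (simp add: sum_subtractf sum_constant_scaleR card_C add.commute)
  then show ?thesis by (simp add: centroid_def)
qed

text \<open>Each edge vector is expanded around the centroid; the mixed terms add up to zero because
  the vectors from the centroid to the vertices do. This links the normalisation of
  \<open>bubble\<close>, stated with edges, to the second moment about the centroid.\<close>

lemma edges_radii: "(\<Sum>P\<in>vertices T. \<Sum>Q\<in>vertices T - {P}. (norm (P - Q))\<^sup>2) = 2 * (real DIM('a) + 1) * radii"
proof -
  let ?p = "\<lambda>P. P - centroid"
  have "(\<Sum>P\<in>vertices T. \<Sum>Q\<in>vertices T - {P}. (norm (P - Q))\<^sup>2) = (\<Sum>P\<in>C. \<Sum>Q\<in>C. (norm (P - Q))\<^sup>2)"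
    unfolding vertices_T by (intro sum.cong refl sum.mono_neutral_left) auto
  also have "\<dots> = (\<Sum>P\<in>C. \<Sum>Q\<in>C. (norm (?p P))\<^sup>2 + (norm (?p Q))\<^sup>2 - 2 * (?p P \<bullet> ?p Q))"
  proof (intro sum.cong refl)
    fix P Q
    have "P - Q = ?p P - ?p Q" by simp
    then show "(norm (P - Q))\<^sup>2 = (norm (?p P))\<^sup>2 + (norm (?p Q))\<^sup>2 - 2 * (?p P \<bullet> ?p Q)"
      by (simp only: power2_norm_eq_inner inner_diff_left inner_diff_right) (simp add: inner_commute)
  qed
  also have "\<dots> = (real DIM('a) + 1) * radii + (real DIM('a) + 1) * radii - 2 * (\<Sum>P\<in>C. ?p P \<bullet> (\<Sum>Q\<in>C. ?p Q))"
    unfolding inner_sum_right sum_distrib_left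
    by (simp add: sum_subtractf sum.distrib card_C radii_def sum_distrib_left del: inner_diff_left inner_diff_right)
      (simp add: sum_distrib_left[symmetric] algebra_simps)
  also have "(\<Sum>P\<in>C. ?p P \<bullet> (\<Sum>Q\<in>C. ?p Q)) = 0" unfolding sum_C_centroid by simp
  finally show ?thesis by simp
qed

lemma radii_pos: "radii > 0"
proof -
  have "\<exists>P\<in>C. P \<noteq> centroid"
  proof (rule ccontr)
    assume "\<not> ?thesis"
    then have "C \<subseteq> {centroid}" by auto
    then have "card C \<le> 1" using card_mono[of "{centroid}" C] by simp
    then show False using card_C by simp
  qed
  then obtain P where P: "P \<in> C" "P \<noteq> centroid" by blast
  have "0 < (norm (P - centroid))\<^sup>2" using P by simp
  also have "\<dots> \<le> radii" unfolding radii_def using P by (intro member_le_sum) auto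
  finally show ?thesis .
qed

text \<open>With \<open>x - centroid\<close> expanded in barycentric coordinates, the part of
  \<open>bary_moment2\<close> that is the same for all pairs multiplies the square of the sum of all
  \<open>P - centroid\<close>, which is 0. Only the surplus on the diagonal remains.\<close>

lemma second_moment: "(LINT x|lebesgue_on T. (norm (x - centroid))\<^sup>2) = vol * radii / ((real DIM('a) + 1) * (real DIM('a) + 2))"
proof -
  let ?p = "\<lambda>P. P - centroid" and ?N = "(real DIM('a) + 1) * (real DIM('a) + 2)"
  have i: "integrable (lebesgue_on T) (\<lambda>x. bary P x * bary Q x * c)" for P Q c by (intro integrable_T continuous_intros)
  have x: "x - centroid = (\<Sum>P\<in>C. bary P x *\<^sub>R ?p P)" for x
    by (simp add: algebra_simps sum_subtractf bary_rep scaleR_sum_left[symmetric] bary_sum)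
  have "(norm (x - centroid))\<^sup>2 = (\<Sum>P\<in>C. \<Sum>Q\<in>C. bary P x * bary Q x * (?p P \<bullet> ?p Q))" for x
  proof -
    have "(norm (x - centroid))\<^sup>2 = (\<Sum>P\<in>C. bary P x *\<^sub>R ?p P) \<bullet> (\<Sum>Q\<in>C. bary Q x *\<^sub>R ?p Q)"
      unfolding power2_norm_eq_inner by (rule arg_cong2[OF x x])
    also have "\<dots> = (\<Sum>P\<in>C. \<Sum>Q\<in>C. bary P x * bary Q x * (?p P \<bullet> ?p Q))"
      unfolding inner_sum_left unfolding inner_sum_right
      by (intro sum.cong refl) (simp only: inner_scaleR_left inner_scaleR_right mult_ac)
    finally show ?thesis .
  qed
  then have "(LINT x|lebesgue_on T. (norm (x - centroid))\<^sup>2) = (\<Sum>P\<in>C. \<Sum>Q\<in>C. (LINT x|lebesgue_on T. bary P x * bary Q x * (?p P \<bullet> ?p Q)))"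
    using i by (simp add: Bochner_Integration.integral_sum)
  also have "\<dots> = (\<Sum>P\<in>C. \<Sum>Q\<in>C. vol / ?N * (?p P \<bullet> ?p Q) + (if P = Q then vol / ?N * (?p P \<bullet> ?p Q) else 0))"
  proof (intro sum.cong refl)
    fix P Q assume "P \<in> C" "Q \<in> C"
    then show "(LINT x|lebesgue_on T. bary P x * bary Q x * (?p P \<bullet> ?p Q)) = vol / ?N * (?p P \<bullet> ?p Q) + (if P = Q then vol / ?N * (?p P \<bullet> ?p Q) else 0)"
      using bary_moment2[of P Q] by (simp only: integral_mult_left_zero) (simp add: algebra_simps)
  qed
  also have "\<dots> = vol / ?N * ((\<Sum>P\<in>C. ?p P) \<bullet> (\<Sum>Q\<in>C. ?p Q)) + vol / ?N * radii"
    by (simp only: sum.distrib inner_sum_left inner_sum_right sum_distrib_left sum.delta' finite_C sum.delta)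
      (simp add: radii_def power2_norm_eq_inner sum_distrib_left inner_commute)
  finally show ?thesis unfolding sum_C_centroid by simp
qed

definition "bcoef = real DIM('a) * ((real DIM('a) + 1) * (real DIM('a) + 2)) / (2 * radii)"
definition "bub x = (real DIM('a) + 2) / 2 - bcoef * (norm (x - centroid))\<^sup>2"
definition "gbub x = - (2 * bcoef) *\<^sub>R (x - centroid)"

lemma bcoef_pos: "bcoef > 0"
  using radii_pos unfolding bcoef_def by (auto intro!: divide_pos_pos mult_pos_pos add_pos_pos)

lemma bubble_eq: "bubble T x = (if x \<in> T then bub x else 0)"
proof -
  have "n * (n + 1)\<^sup>2 * (n + 2) / (2 * (n + 1) * r) = n * ((n + 1) * (n + 2)) / (2 * r)" if "n \<ge> 0" for n r :: real
  proof -
    have "n * (n + 1)\<^sup>2 * (n + 2) / (2 * (n + 1) * r) = ((n + 1) * (n * ((n + 1) * (n + 2)))) / ((n + 1) * (2 * r))"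
      by (simp only: power2_eq_square mult_ac)
    also have "\<dots> = n * ((n + 1) * (n + 2)) / (2 * r)"
      using that by (intro mult_divide_mult_cancel_left) simp
    finally show ?thesis .
  qed
  from this[of "real DIM('a)" radii] show ?thesis
    unfolding bubble_def edges_radii mid_T Let_def bub_def bcoef_def by simp
qed

lemma bub_derivative: "(bub has_derivative (\<lambda>v. gbub x \<bullet> v)) (at x)"
  unfolding bub_def[abs_def] gbub_def power2_norm_eq_inner
  by (auto intro!: derivative_eq_intros simp: inner_commute)

lemma cont_bub: "continuous_on S bub" and cont_gbub: "continuous_on S gbub"
  unfolding bub_def[abs_def] gbub_def[abs_def] by (intro continuous_intros)+

text \<open>This is what the constant in the bubble is made for: subtracted from
  \<open>(n + 2) / 2\<close> times the volume, with n the dimension, it leaves mean value 1, and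
  \<open>vertex_divergence_bub\<close> uses the same balance on the faces.\<close>

lemma bcoef_moment: "bcoef * (LINT x|lebesgue_on T. (norm (x - centroid))\<^sup>2) = DIM('a) / 2 * vol"
proof -
  have "n * k / (2 * r) * (v * r / k) = n / 2 * v" if "r > 0" "k > 0" for n k r v :: real
    using that by simp
  from this[of radii "(real DIM('a) + 1) * (real DIM('a) + 2)"] show ?thesis
    unfolding second_moment bcoef_def using radii_pos by (simp only: mult_pos_pos of_nat_0_le_iff add_nonneg_pos zero_less_one zero_less_numeral)
qed

lemma integral_bub: "(LINT x|lebesgue_on T. bub x) = vol"
proof -
  have "integrable (lebesgue_on T) (\<lambda>x. (norm (x - centroid))\<^sup>2)" by (intro integrable_T continuous_intros)
  then have "(LINT x|lebesgue_on T. bub x) = (real DIM('a) + 2) / 2 * vol - bcoef * (LINT x|lebesgue_on T. (norm (x - centroid))\<^sup>2)"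
    unfolding bub_def using integrable_T[of "\<lambda>_. (real DIM('a) + 2) / 2"] by simp
  then show ?thesis unfolding bcoef_moment by (simp add: field_simps)
qed

text \<open>The bubble has mean zero on every face. Its gradient is radial about the centroid, so
  \<open>gbub x \<bullet> (x - P)\<close> is
  \<open>- 2 * bcoef * (norm (x - centroid))\<^sup>2\<close> plus an affine term that vanishes at
  the centroid. The former integrates to minus the dimension times the volume, the latter to 0, and
  the mean value 1 of the bubble balances the sum.\<close>

lemma vertex_divergence_bub: "(LINT x|lebesgue_on T. gbub x \<bullet> (x - P) + DIM('a) * bub x) = 0"
proof -
  let ?q = "(2 * bcoef) *\<^sub>R (P - centroid)"
  have i: "integrable (lebesgue_on T) (\<lambda>x. (norm (x - centroid))\<^sup>2)" "integrable (lebesgue_on T) bub"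
    "integrable (lebesgue_on T) (\<lambda>x. ?q \<bullet> x + - (?q \<bullet> centroid))" by (intro integrable_T continuous_intros cont_bub)+
  have "gbub x \<bullet> (x - P) = (?q \<bullet> x + - (?q \<bullet> centroid)) - 2 * (bcoef * (norm (x - centroid))\<^sup>2)" for x
    by (simp add: gbub_def power2_norm_eq_inner inner_simps algebra_simps inner_commute)
  then have "(LINT x|lebesgue_on T. gbub x \<bullet> (x - P) + DIM('a) * bub x)
    = (LINT x|lebesgue_on T. ?q \<bullet> x + - (?q \<bullet> centroid)) - 2 * (bcoef * (LINT x|lebesgue_on T. (norm (x - centroid))\<^sup>2))
      + DIM('a) * (LINT x|lebesgue_on T. bub x)"
    using i by simp
  then show ?thesis unfolding bcoef_moment integral_bub integral_affine by simp
qed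

text \<open>The fields \<open>v + \<alpha> *\<^sub>R x\<close> form the lowest-order Raviart-Thomas
  space, which contains the gradients of affine functions and of the bubble. Comparison of
  coefficients asks for weights with sum \<alpha> and weighted vertex sum - v; the coordinates of 0
  provide the first, the slopes correct the second.\<close>

lemma affine_field_rep:
  obtains c where "\<And>x. v + \<alpha> *\<^sub>R x = (\<Sum>P\<in>C. c P *\<^sub>R (x - P))"
proof
  define c where "c P = \<alpha> * bary P 0 - slope P \<bullet> v" for P
  have 1: "(\<Sum>P\<in>C. c P) = \<alpha>"
    by (simp add: c_def sum_subtractf sum_distrib_left[symmetric] bary_sum slope_sum)
  have "(\<Sum>P\<in>C. c P *\<^sub>R P) = \<alpha> *\<^sub>R (\<Sum>P\<in>C. bary P 0 *\<^sub>R P) - (\<Sum>P\<in>C. (slope P \<bullet> v) *\<^sub>R P)"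
    by (simp add: c_def algebra_simps sum_subtractf scaleR_sum_right)
  then have 2: "(\<Sum>P\<in>C. c P *\<^sub>R P) = - v" by (simp add: bary_rep slope_rep)
  show "v + \<alpha> *\<^sub>R x = (\<Sum>P\<in>C. c P *\<^sub>R (x - P))" for x
    by (simp add: algebra_simps sum_subtractf scaleR_sum_left[symmetric] 1 2)
qed

end

section \<open>Triangulations\<close>

context full_simplex
begin

lemma bary_face_centroid:
  assumes "P \<in> C" "Q \<in> C"
  shows "bary Q (face_centroid P) = (if Q = P then 0 else 1 / DIM('a))"
proof -
  let ?u = "\<lambda>Q. if Q = P then 0 else 1 / real DIM('a)"
  have "sum ?u C = sum ?u (C - {P})" by (intro sum.mono_neutral_right) auto
  also have "\<dots> = (\<Sum>Q\<in>C - {P}. 1 / real DIM('a))" by (intro sum.cong) auto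
  finally have s: "sum ?u C = 1" using assms card_C by simp
  have "(\<Sum>Q\<in>C. ?u Q *\<^sub>R Q) = (\<Sum>Q\<in>C - {P}. ?u Q *\<^sub>R Q)" by (intro sum.mono_neutral_right) auto
  also have "\<dots> = (\<Sum>Q\<in>C - {P}. (1 / real DIM('a)) *\<^sub>R Q)" by (intro sum.cong) auto
  also have "\<dots> = face_centroid P" by (simp add: face_centroid_def scaleR_sum_right)
  finally show ?thesis using bary_unique[OF s assms(2)] by simp
qed

lemma face_centroid_in: "P \<in> C \<Longrightarrow> face_centroid P \<in> face P"
  by (simp add: face_iff bary_face_centroid)

lemma face_subset: "P \<in> C \<Longrightarrow> face P \<subseteq> T"
  by (auto simp: face_iff T_iff)

lemma face_inj: "P \<in> C \<Longrightarrow> Q \<in> C \<Longrightarrow> face P = face Q \<Longrightarrow> P = Q"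
proof (rule ccontr)
  assume PQ: "P \<in> C" "Q \<in> C" "face P = face Q" "P \<noteq> Q"
  then have "face_centroid P \<in> face Q" using face_centroid_in[of P] by simp
  then have "bary Q (face_centroid P) = 0" using PQ by (simp add: face_iff)
  then show False using bary_face_centroid[of P Q] PQ by simp
qed

lemma aff_dim_face: "P \<in> C \<Longrightarrow> aff_dim (face P) = int DIM('a) - 1"
  using facet_iff[of "face P"] aff_dim_C unfolding facet_of_def T_def aff_dim_convex_hull by auto

lemma aff_dim_T: "aff_dim T = DIM('a)"
  using aff_dim_C by (simp add: T_def aff_dim_convex_hull)

lemma T_closure_interior: "closure (interior T) = T"
proof -
  have "interior T \<noteq> {}" using negligible_convex_interior[OF convex_T] vol_pos
    by (metis less_irrefl negligible_iff_measure vol_def)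
  then have "closure (interior T) = closure T" by (rule convex_closure_interior[OF convex_T])
  then show ?thesis using compact_T compact_imp_closed closure_closed by metis
qed

lemma islimpt_interior: "x \<in> T \<Longrightarrow> x islimpt interior T"
proof -
  assume "x \<in> T"
  then have "x \<in> interior T \<or> x islimpt interior T" using T_closure_interior unfolding closure_def by blast
  then show ?thesis by (metis interior_interior interior_limit_point)
qed

text \<open>T is the closure of its interior, so every point of T is a limit point of the interior
  and the limit defining the trace is unique.\<close>

lemma simplex_trace_affine:
  assumes "\<And>x. x \<in> interior T \<Longrightarrow> v x = b \<bullet> x + e" "z \<in> T"
  shows "simplex_trace T v z = b \<bullet> z + e"
  unfolding simplex_trace_def
proof (rule tendsto_Lim)
  show "at z within interior T \<noteq> bot" using islimpt_interior[OF assms(2)] trivial_limit_within by blast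
  have "((\<lambda>x. b \<bullet> x + e) \<longlongrightarrow> b \<bullet> z + e) (at z within interior T)" by (intro tendsto_intros)
  moreover have "\<forall>\<^sub>F x in at z within interior T. b \<bullet> x + e = v x"
    unfolding eventually_at_filter using assms(1) by (auto intro!: always_eventually)
  ultimately show "(v \<longlongrightarrow> b \<bullet> z + e) (at z within interior T)" by (rule Lim_transform_eventually)
qed

lemma bary_line: "bary Q (x + t *\<^sub>R (y - z)) = bary Q x + t * (bary Q y - bary Q z)"
  by (simp add: bary_def inner_simps algebra_simps)

end

lemma open_contains_line_point:
  fixes x w :: "'a::real_normed_vector"
  assumes "open W" "x \<in> W"
  obtains t where "t > 0" "x + t *\<^sub>R w \<in> W"
proof -
  obtain e where e: "e > 0" "ball x e \<subseteq> W" using assms open_contains_ball by blast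
  define t where "t = e / (2 * (norm w + 1))"
  have "norm w + 1 > 0" by (simp add: add_nonneg_pos)
  then have t: "t > 0" using e by (simp add: t_def)
  have "norm (t *\<^sub>R w) \<le> t * (norm w + 1)" using t by (simp add: algebra_simps)
  also have "\<dots> = e / 2"
  proof -
    have "e / (2 * m) * m = e / 2" if "m > 0" for m :: real using that by simp
    then show ?thesis using \<open>norm w + 1 > 0\<close> unfolding t_def by blast
  qed
  also have "\<dots> < e" using e by simp
  finally have "x + t *\<^sub>R w \<in> W" using e by (auto simp: dist_norm)
  with t that show ?thesis by blast
qed

text \<open>A Lipschitz domain lies on one side of its boundary and has no slits: from a boundary
  point an arbitrarily short step against e ends strictly below the graph, in an open set that
  misses \<Omega>. The result places the interiors of the simplices, which a priori lie in the
  closure, inside \<Omega>.\<close>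

lemma interior_closure_lipschitz_domain:
  assumes "lipschitz_domain \<Omega>"
  shows "interior (closure \<Omega>) = \<Omega>"
proof
  have op: "open \<Omega>" using assms by (simp add: lipschitz_domain_def)
  then show "\<Omega> \<subseteq> interior (closure \<Omega>)" by (simp add: closure_subset interior_maximal)
  show "interior (closure \<Omega>) \<subseteq> \<Omega>"
  proof (rule ccontr)
    assume "\<not> interior (closure \<Omega>) \<subseteq> \<Omega>"
    then obtain x where x: "x \<in> interior (closure \<Omega>)" "x \<notin> \<Omega>" by blast
    then have "x \<in> frontier \<Omega>" using op interior_subset by (auto simp: frontier_def interior_open)
    then obtain r e \<phi> L where r: "r > 0" and e: "norm e = 1" and lip: "lipschitz_on L {y. y \<bullet> e = 0} \<phi>"
      and iff: "\<forall>y\<in>ball x r. y \<in> \<Omega> \<longleftrightarrow> \<phi> (y - (y \<bullet> e) *\<^sub>R e) < y \<bullet> e"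
      using assms unfolding lipschitz_domain_def by blast
    have ee: "e \<bullet> e = 1" using e by (simp add: norm_eq_1)
    define p where "p y = y - (y \<bullet> e) *\<^sub>R e" for y
    have p0: "p y \<bullet> e = 0" for y by (simp add: p_def inner_simps ee)
    have cp: "continuous_on UNIV p" unfolding p_def[abs_def] by (intro continuous_intros)
    have "continuous_on UNIV (\<lambda>y. \<phi> (p y))"
      by (rule continuous_on_compose2[OF lipschitz_on_continuous_on[OF lip] cp]) (auto simp: p0)
    then have c: "continuous_on UNIV (\<lambda>y. \<phi> (p y) - y \<bullet> e)" by (intro continuous_intros)
    have x0: "\<phi> (p x) \<ge> x \<bullet> e" using iff r x(2) unfolding p_def by (metis centre_in_ball not_less)
    have "x \<in> interior (closure \<Omega>) \<inter> ball x r" "open (interior (closure \<Omega>) \<inter> ball x r)" using x r by auto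
    then obtain t where t: "t > 0" "x + t *\<^sub>R (- e) \<in> interior (closure \<Omega>) \<inter> ball x r"
      using open_contains_line_point by blast
    define y where "y = x + t *\<^sub>R (- e)"
    have "p y = p x" by (simp add: p_def y_def inner_simps ee algebra_simps)
    moreover have "y \<bullet> e = x \<bullet> e - t" by (simp add: y_def inner_simps ee)
    ultimately have "\<phi> (p y) - y \<bullet> e > 0" using x0 t(1) by simp
    have op': "open ({z. \<phi> (p z) - z \<bullet> e > 0} \<inter> ball x r)"
      using open_Collect_less[OF continuous_on_const c, of 0] by auto
    have y: "y \<in> {z. \<phi> (p z) - z \<bullet> e > 0} \<inter> ball x r" using t \<open>\<phi> (p y) - y \<bullet> e > 0\<close> by (auto simp: y_def)
    have "({z. \<phi> (p z) - z \<bullet> e > 0} \<inter> ball x r) \<inter> \<Omega> = {}" using iff unfolding p_def by auto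
    then have "({z. \<phi> (p z) - z \<bullet> e > 0} \<inter> ball x r) \<inter> closure \<Omega> = {}"
      using open_Int_closure_eq_empty[OF op'] by blast
    moreover have "y \<in> closure \<Omega>" using t(2) interior_subset by (auto simp: y_def)
    ultimately show False using y by blast
  qed
qed

section \<open>Adjacency in a face-to-face triangulation\<close>

locale mesh =
  fixes \<Omega> :: "'a::euclidean_space set" and \<T> :: "'a set set"
  assumes dom: "polyhedral_lipschitz_domain \<Omega>" and tri: "regular_triangulation \<T> \<Omega>"
begin

lemma finite_T[simp]: "finite \<T>"
  using tri by (auto simp: regular_triangulation_def triangulation_def)

lemma closure_\<Omega>: "closure \<Omega> = \<Union>\<T>"
  using tri by (auto simp: regular_triangulation_def)

lemma open_\<Omega>: "open \<Omega>" and bounded_\<Omega>: "bounded \<Omega>"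
  using dom by (auto simp: polyhedral_lipschitz_domain_def lipschitz_domain_def)

lemma \<Omega>_ne: "\<Omega> \<noteq> {}"
  using dom by (auto simp: polyhedral_lipschitz_domain_def lipschitz_domain_def)

lemma \<T>_ne: "\<T> \<noteq> {}" using \<Omega>_ne closure_\<Omega> by auto

lemma simplex:
  assumes "T \<in> \<T>"
  shows full_simplex: "full_simplex (vertices T)" and simplex_eq: "full_simplex.T (vertices T) = T"
proof -
  have "int DIM('a) simplex T" using assms tri by (auto simp: regular_triangulation_def)
  then obtain C where C: "\<not> affine_dependent C" "int (card C) = int DIM('a) + 1" "T = convex hull C"
    unfolding simplex_def by blast
  have "full_simplex C" using C by unfold_locales auto
  then interpret full_simplex C .
  have v: "vertices T = C" using vertices_T C(3) by (simp add: T_def)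
  show "full_simplex (vertices T)" unfolding v by (rule \<open>full_simplex C\<close>)
  show "full_simplex.T (vertices T) = T" unfolding v by (simp add: T_def C(3))
qed

lemma compact_simplex: "T \<in> \<T> \<Longrightarrow> compact T"
  using full_simplex.compact_T[OF full_simplex] simplex_eq by metis

lemma convex_simplex: "T \<in> \<T> \<Longrightarrow> convex T"
  using full_simplex.convex_T[OF full_simplex] simplex_eq by metis

lemma simplex_face: "T \<in> \<T> \<Longrightarrow> T' \<in> \<T> \<Longrightarrow> (T \<inter> T') face_of T \<and> (T \<inter> T') face_of T'"
  using tri unfolding regular_triangulation_def triangulation_def by (metis Int_commute)

lemma aff_dim_simplex_eq: "T \<in> \<T> \<Longrightarrow> aff_dim T = DIM('a)"
  using full_simplex.aff_dim_T[OF full_simplex] simplex_eq by metis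

text \<open>Otherwise T' would be a proper face of T and thus of smaller dimension.\<close>

lemma Int_ne:
  assumes "T \<in> \<T>" "T' \<in> \<T>" "T \<noteq> T'"
  shows "T \<inter> T' \<noteq> T'"
proof
  assume e: "T \<inter> T' = T'"
  then have "T' face_of T" "T' \<noteq> T" using simplex_face[OF assms(1,2)] assms(3) by auto
  then have "aff_dim T' < aff_dim T" using face_of_aff_dim_lt convex_simplex assms by blast
  then show False using aff_dim_simplex_eq assms by simp
qed

lemma interior_disjoint:
  assumes "T \<in> \<T>" "T' \<in> \<T>" "T \<noteq> T'" "x \<in> interior T'"
  shows "x \<notin> T"
proof
  assume "x \<in> T"
  have "(T \<inter> T') \<inter> interior T' = {}"
    using face_of_disjoint_interior[of "T \<inter> T'" T'] simplex_face Int_ne assms by blast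
  then show False using \<open>x \<in> T\<close> assms(4) interior_subset by blast
qed

lemma interior_subset_\<Omega>: "T \<in> \<T> \<Longrightarrow> interior T \<subseteq> \<Omega>"
proof -
  assume "T \<in> \<T>"
  then have "interior T \<subseteq> interior (closure \<Omega>)" unfolding closure_\<Omega> by (intro interior_mono) auto
  then show ?thesis using interior_closure_lipschitz_domain dom by (auto simp: polyhedral_lipschitz_domain_def)
qed

lemma negligible_frontier_simplex: "T \<in> \<T> \<Longrightarrow> negligible (T - interior T)"
  using negligible_convex_frontier[OF convex_simplex, of T] compact_imp_closed[OF compact_simplex, of T]
  by (simp add: frontier_def)

lemma negligible_skeleton: "negligible (\<Omega> - (\<Union>T\<in>\<T>. interior T))"
proof -
  have "negligible (\<Union>((\<lambda>T. T - interior T) ` \<T>))"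
    by (intro negligible_Union) (auto intro: negligible_frontier_simplex)
  moreover have "\<Omega> \<subseteq> \<Union>\<T>" using closure_\<Omega> closure_subset by blast
  then have "\<Omega> - (\<Union>T\<in>\<T>. interior T) \<subseteq> \<Union>((\<lambda>T. T - interior T) ` \<T>)" by blast
  ultimately show ?thesis by (rule negligible_subset)
qed

lemma facet_simplex:
  assumes "T \<in> \<T>" shows "F facet_of T \<longleftrightarrow> (\<exists>P\<in>vertices T. F = full_simplex.face (vertices T) P)"
  using full_simplex.facet_iff[OF full_simplex[OF assms]] simplex_eq[OF assms] by metis

text \<open>A point z' of \<Omega> in the relative interior of F is pushed slightly away from P: it
  stays in \<Omega> but leaves T. If z' lay in no other simplex, the push could avoid all of them,
  although they cover \<Omega>. The simplex T' found at z' meets T in a face that contains F and has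
  dimension less than that of T, hence in F.\<close>

lemma neighbour_exists:
  assumes T: "T \<in> \<T>" and F: "F facet_of T" and int: "\<not> F \<subseteq> frontier \<Omega>"
  obtains T' where "T' \<in> \<T>" "T' \<noteq> T" "F facet_of T'"
proof -
  interpret S: full_simplex "vertices T" by (rule full_simplex[OF T])
  note eq = simplex_eq[OF T]
  obtain P where P: "P \<in> vertices T" "F = S.face P" using F facet_simplex[OF T] by blast
  have FT: "F \<subseteq> T" using S.face_subset P eq by simp
  have fo: "F face_of T" using F facet_of_imp_face_of by blast
  obtain z where z: "z \<in> F" "z \<in> \<Omega>"
  proof -
    obtain z where z: "z \<in> F" "z \<notin> frontier \<Omega>" using int by blast
    then have "z \<in> closure \<Omega>" using FT T closure_\<Omega> by blast
    then show ?thesis using that z open_\<Omega> unfolding frontier_def by (simp add: interior_open)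
  qed
  have cF: "convex F" by (simp add: P(2) S.face_def)
  have "z \<in> closure (rel_interior F)" using z convex_closure_rel_interior[OF cF] closure_subset by blast
  then obtain z' where z': "z' \<in> rel_interior F" "z' \<in> \<Omega>"
    using open_Int_closure_eq_empty[OF open_\<Omega>, of "rel_interior F"] z(2) by blast
  have z'F: "z' \<in> F" using z' rel_interior_subset by blast
  have bz: "S.bary P z' = 0" using z'F P by (simp add: S.face_iff)
  have "z' \<in> \<Union>(\<T> - {T})"
  proof (rule ccontr)
    assume n: "z' \<notin> \<Union>(\<T> - {T})"
    have "closed (\<Union>(\<T> - {T}))" using compact_simplex compact_imp_closed by (intro closed_Union) auto
    then have "open (\<Omega> - \<Union>(\<T> - {T}))" using open_\<Omega> by (simp add: open_Diff)
    then obtain t where t: "t > 0" "z' + t *\<^sub>R (z' - P) \<in> \<Omega> - \<Union>(\<T> - {T})"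
      using open_contains_line_point[of "\<Omega> - \<Union>(\<T> - {T})" z' "z' - P"] z' n by blast
    then have "z' + t *\<^sub>R (z' - P) \<in> T" using closure_\<Omega> closure_subset[of \<Omega>] by blast
    then have "S.bary P (z' + t *\<^sub>R (z' - P)) \<ge> 0" using S.T_iff eq P by blast
    then show False using t bz S.bary_vertex[OF P(1) P(1)] by (simp add: S.bary_line)
  qed
  then obtain T' where T': "T' \<in> \<T>" "T' \<noteq> T" "z' \<in> T'" by blast
  have sub: "F \<subseteq> T \<inter> T'"
  proof (rule subset_of_face_of)
    show "(T \<inter> T') face_of T" using simplex_face[OF T T'(1)] by blast
    show "F \<subseteq> T" by (rule FT)
    have "z' \<in> T" using z'F FT by (rule subsetD[rotated])
    then show "(T \<inter> T') \<inter> rel_interior F \<noteq> {}" using z'(1) T'(3) by blast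
  qed
  have "aff_dim (T \<inter> T') < DIM('a)"
    using face_of_aff_dim_lt[of T "T \<inter> T'"] simplex_face[OF T T'(1)] Int_ne[OF T'(1) T T'(2)]
      convex_simplex[OF T] aff_dim_simplex_eq[OF T] by (simp add: Int_commute)
  moreover have "F face_of (T \<inter> T')" using face_of_subset[OF fo sub] by blast
  moreover have "aff_dim F = int DIM('a) - 1" using S.aff_dim_face P by simp
  moreover have "convex (T \<inter> T')" using convex_simplex T T' by (simp add: convex_Int)
  ultimately have "F = T \<inter> T'" using face_of_aff_dim_lt[of "T \<inter> T'" F] by fastforce
  then have "F facet_of T'"
    using simplex_face[OF T T'(1)] \<open>aff_dim F = _\<close> aff_dim_simplex_eq[OF T'(1)] z'F by (auto simp: facet_of_def)
  then show ?thesis using that T' by blast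
qed

text \<open>
  The barycentric coordinates of two neighbours that vanish on the common face are proportional; the
  factor is negative as otherwise the simplices would overlap.
\<close>

lemma neighbours_cover:
  assumes T: "T \<in> \<T>" "T' \<in> \<T>" "T \<noteq> T'" and P: "P \<in> vertices T"
    and F: "full_simplex.face (vertices T) P facet_of T'"
    and x: "full_simplex.bary (vertices T) P x = 0" "\<And>Q. Q \<in> vertices T \<Longrightarrow> Q \<noteq> P \<Longrightarrow> full_simplex.bary (vertices T) Q x > 0"
  shows "x \<in> interior (T \<union> T')"
proof -
  interpret S: full_simplex "vertices T" by (rule full_simplex[OF T(1)])
  interpret S': full_simplex "vertices T'" by (rule full_simplex[OF T(2)])
  obtain P' where P': "P' \<in> vertices T'" "S.face P = S'.face P'" using F facet_simplex[OF T(2)] by blast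
  define D where "D = vertices T - {P}"
  have D': "D = vertices T' - {P'}"
    using S.vertices_face[of P] S'.vertices_face[of P'] P'(2) by (simp add: D_def)
  define \<tau> where "\<tau> = S'.bary P' P"
  have D_C: "Q \<in> vertices T" "Q \<in> vertices T'" "Q \<noteq> P" "Q \<noteq> P'" if "Q \<in> D" for Q
    using that D' by (auto simp: D_def)
  have vT: "vertices T = insert P D" "P \<notin> D" using P by (auto simp: D_def)
  have fD: "finite D" by (simp add: D_def)
  have r1: "S'.bary Q y = (\<Sum>R\<in>vertices T. S.bary R y * S'.bary Q R)" for Q y
    using S.affine_bary[of "S'.slope Q" y "S'.offset Q"] by (simp add: S'.bary_def)
  \<comment> \<open>Two affine functions that agree at the vertices of T: both vanish at the common
    vertices D, and at P both are \<tau>.\<close>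
  have b1: "S'.bary P' y = \<tau> * S.bary P y" for y
  proof -
    have "(\<Sum>R\<in>insert P D. S.bary R y * S'.bary P' R) = \<tau> * S.bary P y"
      using vT(2) fD D_C P' by (simp add: \<tau>_def S'.bary_vertex mult.commute)
    then show ?thesis using r1[of P' y] vT(1) by simp
  qed
  have b2: "S'.bary Q y = S.bary Q y + S.bary P y * S'.bary Q P" if "Q \<in> D" for Q y
  proof -
    have "(\<Sum>R\<in>D. S.bary R y * S'.bary Q R) = (\<Sum>R\<in>D. if R = Q then S.bary R y else 0)"
      using that D_C by (intro sum.cong) (auto simp: S'.bary_vertex)
    then have "(\<Sum>R\<in>insert P D. S.bary R y * S'.bary Q R) = S.bary Q y + S.bary P y * S'.bary Q P"
      using vT(2) fD that by simp
    then show ?thesis using r1[of Q y] vT(1) by simp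
  qed
  \<comment> \<open>An open neighbourhood of x on which the coordinates of the common vertices are
    positive in both simplices. Membership in T or T' then depends only on the sign of the one
    remaining coordinate.\<close>
  define W where "W = (\<Inter>Q\<in>D. {y. 0 < S.bary Q y} \<inter> {y. 0 < S'.bary Q y})"
  have W: "open W" unfolding W_def
    by (intro open_INT[OF fD] ballI open_Int open_Collect_less continuous_on_const S.cont_bary S'.cont_bary)
  have "0 < S.bary Q x \<and> 0 < S'.bary Q x" if "Q \<in> D" for Q
    using x(2)[OF D_C(1)[OF that] D_C(3)[OF that]] b2[OF that, of x] x(1) by simp
  then have xW: "x \<in> W" by (simp add: W_def)
  have \<tau>: "\<tau> < 0"
  proof (rule ccontr)
    assume "\<not> \<tau> < 0"
    moreover have "\<tau> \<noteq> 0" using b1[of P'] S'.bary_vertex[OF P'(1) P'(1)] by auto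
    ultimately have "\<tau> > 0" by simp
    obtain t where t: "t > 0" "x + t *\<^sub>R (P - x) \<in> W" using open_contains_line_point[OF W xW] by blast
    define y where "y = x + t *\<^sub>R (P - x)"
    have bP: "S.bary P y > 0" using t x P by (simp add: y_def S.bary_line S.bary_vertex)
    have "y \<in> interior S.T" unfolding S.interior_T_iff using bP t vT by (auto simp: y_def W_def)
    moreover have "y \<in> interior S'.T"
    proof -
      have "S'.bary P' y > 0" using b1[of y] bP \<open>\<tau> > 0\<close> by simp
      moreover have "vertices T' = insert P' D" using P' D' by auto
      ultimately show ?thesis unfolding S'.interior_T_iff using t by (auto simp: y_def W_def)
    qed
    ultimately show False
      using interior_disjoint[OF T] simplex_eq T interior_subset by (metis subset_iff)
  qed
  have "W \<subseteq> T \<union> T'"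
  proof
    fix y assume y: "y \<in> W"
    show "y \<in> T \<union> T'"
    proof (cases "S.bary P y \<ge> 0")
      case True
      then have "y \<in> S.T" unfolding S.T_iff using y vT by (auto simp: W_def less_imp_le)
      then show ?thesis using simplex_eq[OF T(1)] by simp
    next
      case False
      then have "S'.bary P' y \<ge> 0" using b1[of y] \<tau> by (simp add: mult_nonpos_nonpos)
      moreover have "vertices T' = insert P' D" using P' D' by auto
      ultimately have "y \<in> S'.T" unfolding S'.T_iff using y by (auto simp: W_def less_imp_le)
      then show ?thesis using simplex_eq[OF T(2)] by simp
    qed
  qed
  then show ?thesis using W xW interior_maximal by blast
qed

lemma face_mem_faces: "T \<in> \<T> \<Longrightarrow> F facet_of T \<Longrightarrow> F \<in> faces \<T>"
  by (auto simp: faces_def)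

lemma simplex_trace_eq:
  assumes T: "T \<in> \<T>" and "\<And>x. x \<in> interior T \<Longrightarrow> v x = b \<bullet> x + e" "z \<in> T"
  shows "simplex_trace T v z = b \<bullet> z + e"
  using full_simplex.simplex_trace_affine[OF full_simplex[OF T]] simplex_eq[OF T] assms by metis

lemma mid_facet:
  assumes "T \<in> \<T>" "F facet_of T" shows "mid F \<in> F" "mid F \<in> T"
proof -
  interpret S: full_simplex "vertices T" by (rule full_simplex[OF assms(1)])
  obtain P where P: "P \<in> vertices T" "F = S.face P" using assms facet_simplex by blast
  show "mid F \<in> F" using P S.mid_face S.face_centroid_in by simp
  then show "mid F \<in> T" using P S.face_subset simplex_eq[OF assms(1)] by blast
qed

text \<open>
  A segment in general position leaves the support through the relative interior of a face, which
  contradicts the continuity or boundary condition there.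
\<close>

lemma CR01_const_zero:
  assumes v: "v \<in> CR01 \<Omega> \<T>" and c: "\<And>T x. T \<in> \<T> \<Longrightarrow> x \<in> interior T \<Longrightarrow> v x = c T" and T0: "T0 \<in> \<T>"
  shows "c T0 = 0"
proof (rule ccontr)
  assume c0: "c T0 \<noteq> 0"
  \<comment> \<open>The simplices on which v does not vanish. Their union is compact, and the
    contradiction arises at a point of its frontier.\<close>
  define N where "N = {T \<in> \<T>. c T \<noteq> 0}"
  have finN: "finite N" by (simp add: N_def)
  have K: "compact (\<Union>N)" using compact_simplex finN by (intro compact_Union) (auto simp: N_def)
  have trace: "simplex_trace T v (mid F) = c T" if "T \<in> \<T>" "F facet_of T" for T F
    using simplex_trace_eq[OF that(1), of v 0 "c T" "mid F"] c that mid_facet by simp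
  obtain p where p: "p \<in> interior T0"
    using full_simplex.islimpt_interior[OF full_simplex[OF T0]] simplex_eq[OF T0] mid_facet
    by (metis bot.extremum_uniqueI ex_in_conv full_simplex full_simplex.T_closure_interior full_simplex.vol_pos T0
        full_simplex.vol_def closure_empty measure_empty order_less_irrefl)
  have TK: "interior T \<subseteq> interior (\<Union>N)" if "T \<in> N" for T using that by (intro interior_mono) auto
  have pK: "p \<in> interior (\<Union>N)" using p TK[of T0] T0 c0 by (auto simp: N_def)
  \<comment> \<open>General position: \<open>H\<close> lists the affine hulls of p with the faces of
    codimension 2. Each has dimension less than that of the space and is negligible. A line from p
    through a point of such a face stays in the hull, so a q outside all of them yields a segment
    that avoids these faces.\<close>
  define H where "H = (\<lambda>(T, P, Q). affine hull (insert p (convex hull (vertices T - {P, Q}))))"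
  define I where "I = {(T, P, Q). T \<in> \<T> \<and> P \<in> vertices T \<and> Q \<in> vertices T \<and> P \<noteq> Q}"
  have finv: "finite (vertices T)" if "T \<in> \<T>" for T using full_simplex.finite_C[OF full_simplex[OF that]] .
  have "I \<subseteq> (\<Union>T\<in>\<T>. {T} \<times> (vertices T \<times> vertices T))" by (auto simp: I_def)
  then have finI: "finite I" by (rule finite_subset) (auto intro: finv)
  have "negligible (H i)" if i: "i \<in> I" for i
  proof -
    obtain T P Q where TPQ: "i = (T, P, Q)" "T \<in> \<T>" "P \<in> vertices T" "Q \<in> vertices T" "P \<noteq> Q"
      using i by (auto simp: I_def)
    interpret S: full_simplex "vertices T" by (rule full_simplex[OF TPQ(2)])
    have "card (vertices T - {P, Q}) = DIM('a) - 1"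
      using TPQ S.card_C by (simp add: card_Diff_subset)
    moreover have "aff_dim (vertices T - {P, Q}) \<le> int (card (vertices T - {P, Q})) - 1"
      by (rule aff_dim_le_card) simp
    ultimately have "aff_dim (vertices T - {P, Q}) \<le> int DIM('a) - 2" using DIM_positive[where 'a='a] by linarith
    then have "aff_dim (H i) < DIM('a)"
      by (simp add: H_def TPQ(1) aff_dim_insert aff_dim_convex_hull)
    then have "interior (H i) = {}" using aff_dim_nonempty_interior by fastforce
    moreover have "convex (H i)" by (simp add: H_def TPQ(1) affine_imp_convex)
    ultimately show ?thesis using negligible_convex_interior by blast
  qed
  then have negH: "negligible (\<Union>(H ` I))" using finI by (intro negligible_Union) auto
  have "- \<Union>N \<noteq> {}" using K compact_imp_bounded not_bounded_UNIV by (metis Compl_UNIV_eq double_complement)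
  then have "\<not> negligible (- \<Union>N)"
    using K compact_imp_closed by (intro open_not_negligible) auto
  then have "\<not> - \<Union>N \<subseteq> \<Union>(H ` I)" using negligible_subset[OF negH, of "- \<Union>N"] by auto
  then obtain q where q: "q \<notin> \<Union>N" "q \<notin> \<Union>(H ` I)" by (meson ComplD subsetI)
  \<comment> \<open>The segment starts in the interior of the support and ends outside, so it
    crosses the frontier.\<close>
  have "closed_segment p q \<inter> \<Union>N \<noteq> {}" "closed_segment p q - \<Union>N \<noteq> {}"
    using pK q(1) interior_subset by (blast, auto)
  then obtain x where x: "x \<in> closed_segment p q" "x \<in> frontier (\<Union>N)"
    using connected_Int_frontier[of "closed_segment p q" "\<Union>N"] by auto
  then have xK: "x \<in> \<Union>N" "x \<notin> interior (\<Union>N)"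
    using closure_closed[OF compact_imp_closed[OF K]] by (simp_all add: frontier_def)
  obtain T where T: "T \<in> \<T>" "c T \<noteq> 0" "x \<in> T" using xK by (auto simp: N_def)
  interpret S: full_simplex "vertices T" by (rule full_simplex[OF T(1)])
  note eqT = simplex_eq[OF T(1)]
  have bx: "S.bary P x \<ge> 0" if "P \<in> vertices T" for P using T(3) S.T_iff eqT that by blast
  have "x \<notin> interior T" using xK TK[of T] T by (auto simp: N_def)
  then obtain P where P: "P \<in> vertices T" "S.bary P x = 0"
    using S.interior_T_iff eqT bx by (metis order_le_less)
  have others: "S.bary Q x > 0" if Q: "Q \<in> vertices T" "Q \<noteq> P" for Q
  proof (rule ccontr)
    assume "\<not> S.bary Q x > 0"
    then have "S.bary Q x = 0" using bx[OF Q(1)] by simp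
    then have "x \<in> convex hull (vertices T - {P, Q})"
      using S.hull_subset_iff(1)[OF Diff_subset, of x "{P, Q}"] P bx by auto
    then have xH: "x \<in> H (T, P, Q)" "p \<in> H (T, P, Q)"
      by (auto simp: H_def hull_inc)
    obtain t where t: "x = (1 - t) *\<^sub>R p + t *\<^sub>R q" using x(1) by (auto simp: closed_segment_def)
    have "t \<noteq> 0" using t xK pK by auto
    have "q = (1 - 1 / t) *\<^sub>R p + (1 / t) *\<^sub>R x"
    proof -
      have "(1 / t) *\<^sub>R x = (1 / t - 1) *\<^sub>R p + q"
        using \<open>t \<noteq> 0\<close> by (simp add: t scaleR_add_right diff_divide_distrib)
      then show ?thesis by (simp add: algebra_simps)
    qed
    then have "q \<in> H (T, P, Q)"
      using xH affine_affine_hull[of "insert p (convex hull (vertices T - {P, Q}))"]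
      unfolding H_def by (auto simp: mem_affine)
    moreover have "(T, P, Q) \<in> I" using T P Q by (auto simp: I_def)
    ultimately show False using q by blast
  qed
  let ?F = "S.face P"
  have F: "?F facet_of T" using facet_simplex[OF T(1)] P by blast
  show False
  proof (cases "?F \<subseteq> frontier \<Omega>")
    case True
    then have "?F \<in> faces \<T> - interior_faces \<Omega> \<T>" using face_mem_faces[OF T(1) F] by (auto simp: interior_faces_def)
    then have "simplex_trace T v (mid ?F) = 0" using v T(1) F by (auto simp: CR01_def)
    then show False using trace[OF T(1) F] T by simp
  next
    case False
    then have Fi: "?F \<in> interior_faces \<Omega> \<T>" using face_mem_faces[OF T(1) F] by (auto simp: interior_faces_def)
    obtain T' where T': "T' \<in> \<T>" "T' \<noteq> T" "?F facet_of T'" using neighbour_exists[OF T(1) F False] by blast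
    have "simplex_trace T v (mid ?F) - simplex_trace T' v (mid ?F) = 0"
      using v Fi T(1) T'(1,3) F unfolding CR01_def by blast
    then have "c T' \<noteq> 0" using trace[OF T(1) F] trace[OF T'(1,3)] T(2) by simp
    then have "T \<union> T' \<subseteq> \<Union>N" using T T'(1) by (auto simp: N_def)
    moreover have "x \<in> interior (T \<union> T')"
      using neighbours_cover[OF T(1) T'(1) _ P(1) T'(3) P(2) others] T'(2) by blast
    ultimately show False using xK interior_mono by blast
  qed
qed

end

section \<open>Square integrable functions\<close>

lemma square_integrable_inner:
  assumes "square_integrable S u" "square_integrable S v"
  shows "integrable (lebesgue_on S) (\<lambda>x. u x \<bullet> v x)"
proof -
  have "integrable (lebesgue_on S) (\<lambda>x. (norm (u x))\<^sup>2 + (norm (v x))\<^sup>2)"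
    using assms by (auto simp: square_integrable_def)
  then show ?thesis
  proof (rule Bochner_Integration.integrable_bound)
    show "(\<lambda>x. u x \<bullet> v x) \<in> borel_measurable (lebesgue_on S)"
      using assms by (auto simp: square_integrable_def)
    show "AE x in lebesgue_on S. norm (u x \<bullet> v x) \<le> norm ((norm (u x))\<^sup>2 + (norm (v x))\<^sup>2)"
    proof (intro AE_I2)
      fix x
      have "0 \<le> (norm (u x) - norm (v x))\<^sup>2" by simp
      then have "2 * (norm (u x) * norm (v x)) \<le> (norm (u x))\<^sup>2 + (norm (v x))\<^sup>2"
        by (simp add: power2_diff)
      moreover have "\<bar>u x \<bullet> v x\<bar> \<le> norm (u x) * norm (v x)" by (rule Cauchy_Schwarz_ineq2)
      moreover have "0 \<le> norm (u x) * norm (v x)" by simp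
      ultimately show "norm (u x \<bullet> v x) \<le> norm ((norm (u x))\<^sup>2 + (norm (v x))\<^sup>2)" by simp
    qed
  qed
qed

lemma square_integrable_mult:
  fixes u v :: "'a::euclidean_space \<Rightarrow> real"
  assumes "square_integrable S u" "square_integrable S v"
  shows "integrable (lebesgue_on S) (\<lambda>x. u x * v x)"
  using square_integrable_inner[OF assms] by simp

lemma square_integrable_add:
  assumes u: "square_integrable S u" and v: "square_integrable S v"
  shows "square_integrable S (\<lambda>x. u x + v x)"
  unfolding square_integrable_def
proof
  show m: "(\<lambda>x. u x + v x) \<in> borel_measurable (lebesgue_on S)"
    using assms by (auto simp: square_integrable_def)
  have "(norm (u x + v x))\<^sup>2 = (norm (u x))\<^sup>2 + 2 * (u x \<bullet> v x) + (norm (v x))\<^sup>2" for x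
    by (simp add: power2_norm_eq_inner inner_add_left inner_add_right inner_commute)
  then show "integrable (lebesgue_on S) (\<lambda>x. (norm (u x + v x))\<^sup>2)"
    using assms square_integrable_inner[OF assms] by (simp add: square_integrable_def)
qed

lemma square_integrable_scaleR:
  assumes "square_integrable S u"
  shows "square_integrable S (\<lambda>x. c *\<^sub>R u x)"
  using assms by (auto simp: square_integrable_def power_mult_distrib)

lemma square_integrable_cmult:
  fixes u :: "'a::euclidean_space \<Rightarrow> real"
  assumes "square_integrable S u"
  shows "square_integrable S (\<lambda>x. c * u x)"
  using square_integrable_scaleR[OF assms, of c] by simp

lemma square_integrable_diff:
  assumes "square_integrable S u" "square_integrable S v"
  shows "square_integrable S (\<lambda>x. u x - v x)"
  using square_integrable_add[OF assms(1) square_integrable_scaleR[OF assms(2), of "-1"]] by simp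

lemma square_integrable_zero: "square_integrable S (\<lambda>x. 0)"
  by (simp add: square_integrable_def)

lemma square_integrable_continuous:
  assumes "compact S" "continuous_on S u"
  shows "square_integrable S u"
  unfolding square_integrable_def
  using integrable_on_compact_continuous[OF assms]
  by (auto intro!: integrable_on_compact_continuous assms continuous_intros)

lemma square_integrable_subset:
  assumes u: "square_integrable S u" and S: "S \<in> sets lebesgue" "S' \<in> sets lebesgue" "S' \<subseteq> S"
  shows "square_integrable S' u"
proof -
  have m: "u \<in> borel_measurable (lebesgue_on S')"
    using u S by (auto simp: square_integrable_def intro: measurable_restrict_mono)
  have "integrable lebesgue (\<lambda>x. indicator S x *\<^sub>R (norm (u x))\<^sup>2)"
    using u S by (simp add: square_integrable_def integrable_restrict_space)
  then have "integrable lebesgue (\<lambda>x. indicator S' x *\<^sub>R (norm (u x))\<^sup>2)"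
    using set_integrable_subset[of lebesgue S "\<lambda>x. (norm (u x))\<^sup>2" S'] S unfolding set_integrable_def by blast
  then show ?thesis using m S by (simp add: square_integrable_def integrable_restrict_space)
qed

lemma square_integrable_cong_negligible:
  assumes "S \<in> sets lebesgue" "S' \<in> sets lebesgue" "negligible (S - S')" "negligible (S' - S)"
  shows "square_integrable S u \<longleftrightarrow> square_integrable S' u"
  unfolding square_integrable_def
  using borel_measurable_lebesgue_on_cong_negligible[OF assms, of u]
    integrable_lebesgue_on_cong_negligible[OF assms, of "\<lambda>x. (norm (u x))\<^sup>2"] by simp

lemma L2_norm_sq: "(L2_norm S u)\<^sup>2 = (LINT x|lebesgue_on S. (norm (u x))\<^sup>2)"
  unfolding L2_norm_def by (intro real_sqrt_pow2 integral_nonneg_AE) auto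

lemma L2_norm_nonneg: "0 \<le> L2_norm S u"
  unfolding L2_norm_def by (intro real_sqrt_ge_zero integral_nonneg_AE) auto

text \<open>The discriminant of the nonnegative quadratic form \<open>q\<close> in s and t. The
  choice s = - B, t = A settles the case A \<noteq> 0; for A = 0 a nonzero B would allow s to be
  taken so large that the form turns negative.\<close>

lemma L2_Cauchy_Schwarz:
  assumes u: "square_integrable S u" and v: "square_integrable S v"
  shows "\<bar>LINT x|lebesgue_on S. u x \<bullet> v x\<bar> \<le> L2_norm S u * L2_norm S v"
proof -
  let ?A = "LINT x|lebesgue_on S. (norm (u x))\<^sup>2" and ?B = "LINT x|lebesgue_on S. u x \<bullet> v x"
    and ?C = "LINT x|lebesgue_on S. (norm (v x))\<^sup>2"
  have iu: "integrable (lebesgue_on S) (\<lambda>x. (norm (u x))\<^sup>2)" and iv: "integrable (lebesgue_on S) (\<lambda>x. (norm (v x))\<^sup>2)"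
    using u v by (auto simp: square_integrable_def)
  note iuv = square_integrable_inner[OF u v]
  have q: "0 \<le> s\<^sup>2 * ?A + 2 * s * t * ?B + t\<^sup>2 * ?C" for s t
  proof -
    have "0 \<le> (LINT x|lebesgue_on S. (norm (s *\<^sub>R u x + t *\<^sub>R v x))\<^sup>2)"
      by (intro integral_nonneg_AE) auto
    also have "(\<lambda>x. (norm (s *\<^sub>R u x + t *\<^sub>R v x))\<^sup>2) = (\<lambda>x. s\<^sup>2 * (norm (u x))\<^sup>2 + 2 * s * t * (u x \<bullet> v x) + t\<^sup>2 * (norm (v x))\<^sup>2)"
      by (auto simp: power2_norm_eq_inner inner_simps inner_commute power2_eq_square[of s] power2_eq_square[of t] algebra_simps)
    also have "(LINT x|lebesgue_on S. s\<^sup>2 * (norm (u x))\<^sup>2 + 2 * s * t * (u x \<bullet> v x) + t\<^sup>2 * (norm (v x))\<^sup>2)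
       = s\<^sup>2 * ?A + 2 * s * t * ?B + t\<^sup>2 * ?C"
      using iu iv iuv by simp
    finally show ?thesis .
  qed
  have A0: "?A \<ge> 0" and C0: "?C \<ge> 0" by (intro integral_nonneg_AE; simp)+
  have "?B\<^sup>2 \<le> ?A * ?C"
  proof (cases "?A = 0")
    case True
    show ?thesis
    proof (rule ccontr)
      assume n: "\<not> ?B\<^sup>2 \<le> ?A * ?C"
      then have B: "?B \<noteq> 0" using True by auto
      have "0 \<le> 2 * (- (?C + 1) / ?B) * ?B + ?C" using q[of "- (?C + 1) / ?B" 1] True by simp
      then have "0 \<le> - 2 * (?C + 1) + ?C" using B by simp
      then show False using C0 by simp
    qed
  next
    case False
    then have "?A > 0" using A0 by linarith
    have "0 \<le> ?B\<^sup>2 * ?A - 2 * ?B * ?A * ?B + ?A\<^sup>2 * ?C" using q[of "- ?B" ?A] by simp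
    then have "0 \<le> ?A * (?A * ?C - ?B\<^sup>2)" by (simp add: power2_eq_square algebra_simps)
    then show ?thesis using \<open>?A > 0\<close> by (simp add: zero_le_mult_iff)
  qed
  then have "sqrt (?B\<^sup>2) \<le> sqrt (?A * ?C)" by (rule real_sqrt_le_mono)
  then show ?thesis by (simp add: L2_norm_def real_sqrt_mult)
qed

lemma L2_tendsto_integral:
  assumes \<phi>: "\<And>j. square_integrable S (\<phi> j)" and u: "square_integrable S u" and w: "square_integrable S w"
    and lim: "(\<lambda>j::nat. L2_norm S (\<lambda>x. \<phi> j x - u x)) \<longlonglongrightarrow> 0"
  shows "(\<lambda>j. LINT x|lebesgue_on S. \<phi> j x \<bullet> w x) \<longlonglongrightarrow> (LINT x|lebesgue_on S. u x \<bullet> w x)"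
proof -
  have "(\<lambda>j. (LINT x|lebesgue_on S. \<phi> j x \<bullet> w x) - (LINT x|lebesgue_on S. u x \<bullet> w x)) \<longlonglongrightarrow> 0"
  proof (rule Lim_null_comparison)
    show "\<forall>\<^sub>F j in sequentially. norm ((LINT x|lebesgue_on S. \<phi> j x \<bullet> w x) - (LINT x|lebesgue_on S. u x \<bullet> w x))
      \<le> L2_norm S (\<lambda>x. \<phi> j x - u x) * L2_norm S w"
    proof (intro always_eventually allI)
      fix j
      have "(LINT x|lebesgue_on S. \<phi> j x \<bullet> w x) - (LINT x|lebesgue_on S. u x \<bullet> w x) = (LINT x|lebesgue_on S. (\<phi> j x - u x) \<bullet> w x)"
        using square_integrable_inner[OF \<phi> w] square_integrable_inner[OF u w] by (simp add: inner_diff_left)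
      then show "norm ((LINT x|lebesgue_on S. \<phi> j x \<bullet> w x) - (LINT x|lebesgue_on S. u x \<bullet> w x))
        \<le> L2_norm S (\<lambda>x. \<phi> j x - u x) * L2_norm S w"
        using L2_Cauchy_Schwarz[OF square_integrable_diff[OF \<phi> u] w] by simp
    qed
    show "(\<lambda>j. L2_norm S (\<lambda>x. \<phi> j x - u x) * L2_norm S w) \<longlonglongrightarrow> 0"
      using tendsto_mult_left_zero[OF lim] .
  qed
  then show ?thesis using LIM_zero_iff by blast
qed

lemma L2_norm_add_le:
  assumes u: "square_integrable S u" and v: "square_integrable S v"
  shows "L2_norm S (\<lambda>x. u x + c *\<^sub>R v x) \<le> L2_norm S u + \<bar>c\<bar> * L2_norm S v"
proof (rule power2_le_imp_le)
  have iu: "integrable (lebesgue_on S) (\<lambda>x. (norm (u x))\<^sup>2)" and iv: "integrable (lebesgue_on S) (\<lambda>x. (norm (v x))\<^sup>2)"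
    using u v by (auto simp: square_integrable_def)
  note iuv = square_integrable_inner[OF u v]
  have "(\<lambda>x. (norm (u x + c *\<^sub>R v x))\<^sup>2) = (\<lambda>x. (norm (u x))\<^sup>2 + 2 * c * (u x \<bullet> v x) + c\<^sup>2 * (norm (v x))\<^sup>2)"
    by (auto simp: power2_norm_eq_inner inner_simps inner_commute power2_eq_square[of c] algebra_simps)
  then have "(L2_norm S (\<lambda>x. u x + c *\<^sub>R v x))\<^sup>2 = (L2_norm S u)\<^sup>2 + 2 * (c * (LINT x|lebesgue_on S. u x \<bullet> v x)) + c\<^sup>2 * (L2_norm S v)\<^sup>2"
    unfolding L2_norm_sq using iu iv iuv by simp
  also have "c * (LINT x|lebesgue_on S. u x \<bullet> v x) \<le> \<bar>c\<bar> * (L2_norm S u * L2_norm S v)"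
  proof -
    have "c * (LINT x|lebesgue_on S. u x \<bullet> v x) \<le> \<bar>c\<bar> * \<bar>LINT x|lebesgue_on S. u x \<bullet> v x\<bar>"
      by (metis abs_ge_self abs_mult)
    also have "\<dots> \<le> \<bar>c\<bar> * (L2_norm S u * L2_norm S v)"
      by (intro mult_left_mono L2_Cauchy_Schwarz u v) simp
    finally show ?thesis .
  qed
  finally show "(L2_norm S (\<lambda>x. u x + c *\<^sub>R v x))\<^sup>2 \<le> (L2_norm S u + \<bar>c\<bar> * L2_norm S v)\<^sup>2"
    by (simp add: power2_sum power_mult_distrib mult_ac)
qed (simp add: L2_norm_nonneg)

lemma L2_norm_subset:
  assumes u: "square_integrable S u" and S: "S \<in> sets lebesgue" "S' \<in> sets lebesgue" "S' \<subseteq> S"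
  shows "L2_norm S' u \<le> L2_norm S u"
proof -
  have i: "integrable lebesgue (\<lambda>x. indicator S x *\<^sub>R (norm (u x))\<^sup>2)"
    using u S by (simp add: square_integrable_def integrable_restrict_space)
  have i': "integrable lebesgue (\<lambda>x. indicator S' x *\<^sub>R (norm (u x))\<^sup>2)"
    using square_integrable_subset[OF assms] S by (simp add: square_integrable_def integrable_restrict_space)
  have "(LINT x|lebesgue. indicator S' x *\<^sub>R (norm (u x))\<^sup>2) \<le> (LINT x|lebesgue. indicator S x *\<^sub>R (norm (u x))\<^sup>2)"
    using i' i S(3) by (intro integral_mono) (auto simp: indicator_def)
  then show ?thesis unfolding L2_norm_def using S by (simp add: integral_restrict_space)
qed

lemma L2_norm_cong_negligible:
  assumes "S \<in> sets lebesgue" "S' \<in> sets lebesgue" "negligible (S - S')" "negligible (S' - S)"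
  shows "L2_norm S u = L2_norm S' u"
  unfolding L2_norm_def using integral_lebesgue_on_cong_negligible[OF assms, of "\<lambda>x. (norm (u x))\<^sup>2"] by simp

section \<open>Classical gradients and test functions\<close>

lemma gradient_eqI:
  assumes "(f has_derivative (\<lambda>v. D \<bullet> v)) (at x)"
  shows "gradient f x = D"
  unfolding gradient_def
proof (rule the_equality)
  show "GDERIV f x :> D" using assms by (simp add: gderiv_def inner_commute)
  fix E assume "GDERIV f x :> E"
  then have "(f has_derivative (\<lambda>v. E \<bullet> v)) (at x)" by (simp add: gderiv_def inner_commute)
  then have "(\<lambda>v. E \<bullet> v) = (\<lambda>v. D \<bullet> v)" using has_derivative_unique assms by blast
  then have "(E - D) \<bullet> (E - D) = 0" by (metis inner_diff_left right_minus_eq)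
  then show "E = D" by simp
qed

lemma has_derivative_gradient:
  fixes f :: "'a::euclidean_space \<Rightarrow> real"
  assumes "f differentiable (at x)"
  shows "(f has_derivative (\<lambda>v. gradient f x \<bullet> v)) (at x)"
proof -
  obtain f' where f': "(f has_derivative f') (at x)" using assms by (auto simp: differentiable_def)
  then have lin: "linear f'" using has_derivative_linear by blast
  define D where "D = (\<Sum>b\<in>Basis. f' b *\<^sub>R b)"
  have "f' v = D \<bullet> v" for v
  proof -
    have "f' v = f' (\<Sum>b\<in>Basis. (v \<bullet> b) *\<^sub>R b)" by (simp add: euclidean_representation)
    also have "\<dots> = (\<Sum>b\<in>Basis. (v \<bullet> b) * f' b)"
      using lin by (simp add: linear_sum linear_scale)
    also have "\<dots> = D \<bullet> v" by (simp add: D_def inner_sum_left inner_commute[of v] mult.commute)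
    finally show ?thesis .
  qed
  then have "f' = (\<lambda>v. D \<bullet> v)" by (rule ext)
  then have d: "(f has_derivative (\<lambda>v. D \<bullet> v)) (at x)" using f' by simp
  then show ?thesis using gradient_eqI[OF d] by simp
qed

text \<open>Gradients are local, so inside a simplex the gradient of a discrete function is that of
  its polynomial, whatever the function does on the skeleton.\<close>

lemma gradient_cong:
  assumes "open S" "x \<in> S" "\<And>y. y \<in> S \<Longrightarrow> f y = g y" "(g has_derivative (\<lambda>v. D \<bullet> v)) (at x)"
  shows "gradient f x = D"
  using has_derivative_transform_within_open[OF assms(4,1,2), of f] assms(3) by (intro gradient_eqI) auto

lemma gradient_add_cmult:
  fixes f g :: "'a::euclidean_space \<Rightarrow> real"
  assumes "f differentiable (at x)" "g differentiable (at x)"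
  shows "gradient (\<lambda>x. f x + c * g x) x = gradient f x + c *\<^sub>R gradient g x"
  by (rule gradient_eqI)
    (rule has_derivative_eq_rhs[OF has_derivative_add[OF has_derivative_gradient[OF assms(1)]
        has_derivative_mult_right[OF has_derivative_gradient[OF assms(2)]]]], simp add: inner_simps)

lemma times_cont_diff_add_cmult:
  assumes "times_cont_diff k f" "times_cont_diff k g"
  shows "times_cont_diff k (\<lambda>x. f x + c * g x)"
  using assms
proof (induction k arbitrary: f g)
  case 0
  then show ?case by (auto intro!: continuous_intros)
next
  case (Suc k)
  then have d: "f differentiable (at x)" "g differentiable (at x)" for x by auto
  have "(\<lambda>x. gradient (\<lambda>x. f x + c * g x) x \<bullet> b) = (\<lambda>x. gradient f x \<bullet> b + c * (gradient g x \<bullet> b))" for b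
    using d by (simp add: gradient_add_cmult inner_simps)
  then show ?case using Suc d by auto
qed

lemma test_function_add_cmult:
  assumes "test_function \<Omega> \<phi>" "test_function \<Omega> \<psi>"
  shows "test_function \<Omega> (\<lambda>x. \<phi> x + c * \<psi> x)"
proof -
  have sub: "{x. \<phi> x + c * \<psi> x \<noteq> 0} \<subseteq> {x. \<phi> x \<noteq> 0} \<union> {x. \<psi> x \<noteq> 0}" by auto
  have cl: "closure {x. \<phi> x + c * \<psi> x \<noteq> 0} \<subseteq> closure {x. \<phi> x \<noteq> 0} \<union> closure {x. \<psi> x \<noteq> 0}"
    using closure_mono[OF sub] by simp
  have "compact (closure {x. \<phi> x \<noteq> 0} \<union> closure {x. \<psi> x \<noteq> 0})"
    using assms by (auto simp: test_function_def)
  from compact_Int_closed[OF this closed_closure[of "{x. \<phi> x + c * \<psi> x \<noteq> 0}"]]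
  have "compact (closure {x. \<phi> x + c * \<psi> x \<noteq> 0})"
    using cl by (simp only: Int_absorb1)
  then show ?thesis
    using assms cl times_cont_diff_add_cmult unfolding test_function_def by blast
qed

lemma test_function_differentiable:
  assumes "test_function \<Omega> \<phi>"
  shows test_function_derivative: "(\<phi> has_derivative (\<lambda>v. gradient \<phi> x \<bullet> v)) (at x)"
    and continuous_gradient: "continuous_on UNIV (gradient \<phi>)"
    and test_function_continuous: "continuous_on UNIV \<phi>"
    and test_function_diff: "\<phi> differentiable (at x)"
proof -
  have t: "times_cont_diff (Suc 0) \<phi>" "times_cont_diff 0 \<phi>" using assms unfolding test_function_def by blast+
  then have d: "\<phi> differentiable (at x)" for x by auto
  show "\<phi> differentiable (at x)" by (rule d)
  show "(\<phi> has_derivative (\<lambda>v. gradient \<phi> x \<bullet> v)) (at x)" by (rule has_derivative_gradient[OF d])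
  show "continuous_on UNIV (gradient \<phi>)"
    using t by (intro continuous_on_componentwise[THEN iffD2]) auto
  show "continuous_on UNIV \<phi>" using t by auto
qed

lemma square_integrable_test_function:
  assumes "test_function \<Omega> \<phi>" "bounded S" "S \<in> sets lebesgue"
  shows "square_integrable S \<phi>" "square_integrable S (gradient \<phi>)"
proof -
  have c: "compact (closure S)" using assms by auto
  have "square_integrable (closure S) \<phi>" "square_integrable (closure S) (gradient \<phi>)"
    using test_function_continuous[OF assms(1)] continuous_gradient[OF assms(1)]
    by (auto intro!: square_integrable_continuous c intro: continuous_on_subset)
  then show "square_integrable S \<phi>" "square_integrable S (gradient \<phi>)"
    using assms(3) closure_subset by (auto intro!: square_integrable_subset[of "closure S"])
qed

section \<open>Integration over the mesh\<close>

context mesh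
begin

lemma \<Omega>_sets[simp]: "\<Omega> \<in> sets lebesgue"
  using open_\<Omega> by (simp add: borel_open)

lemma simplex_sets[simp]: "T \<in> \<T> \<Longrightarrow> T \<in> sets lebesgue"
  using compact_simplex by (simp add: borel_compact)

lemma test_square_integrable:
  assumes "test_function \<Omega> \<phi>" shows "square_integrable \<Omega> \<phi>" "square_integrable \<Omega> (gradient \<phi>)"
  using square_integrable_test_function[OF assms bounded_\<Omega>] by simp_all

lemma simplex_interior_cong:
  assumes "T \<in> \<T>"
  shows "T \<in> sets lebesgue" "interior T \<in> sets lebesgue" "negligible (T - interior T)" "negligible (interior T - T)"
proof -
  have "interior T - T = {}" using interior_subset by blast
  then show "negligible (interior T - T)" by simp
qed (use assms negligible_frontier_simplex in \<open>auto simp: borel_open\<close>)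

lemma \<Omega>_interiors_cong:
  shows "\<Omega> \<in> sets lebesgue" "(\<Union>T\<in>\<T>. interior T) \<in> sets lebesgue" "negligible (\<Omega> - (\<Union>T\<in>\<T>. interior T))"
    "negligible ((\<Union>T\<in>\<T>. interior T) - \<Omega>)"
proof -
  have "(\<Union>T\<in>\<T>. interior T) - \<Omega> = {}" using interior_subset_\<Omega> by blast
  then show "negligible ((\<Union>T\<in>\<T>. interior T) - \<Omega>)" by simp
qed (use negligible_skeleton in \<open>auto intro!: sets.finite_UN simp: borel_open\<close>)

lemma square_integrable_simplex: "square_integrable \<Omega> u \<Longrightarrow> T \<in> \<T> \<Longrightarrow> square_integrable T u"
  using square_integrable_cong_negligible[OF simplex_interior_cong, of T u]
    square_integrable_subset[of \<Omega> u "interior T"] interior_subset_\<Omega> by (simp add: borel_open)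

lemma L2_norm_simplex: "square_integrable \<Omega> u \<Longrightarrow> T \<in> \<T> \<Longrightarrow> L2_norm T u \<le> L2_norm \<Omega> u"
  using L2_norm_cong_negligible[OF simplex_interior_cong, of T u]
    L2_norm_subset[of \<Omega> u "interior T"] interior_subset_\<Omega> by (simp add: borel_open)

lemma interiors_indicator:
  fixes f :: "'a \<Rightarrow> 'b::real_vector"
  shows "indicator (\<Union>T\<in>\<T>. interior T) x *\<^sub>R f x = (\<Sum>T\<in>\<T>. indicator (interior T) x *\<^sub>R f x)"
proof (cases "\<exists>T\<in>\<T>. x \<in> interior T")
  case True
  then obtain T where T: "T \<in> \<T>" "x \<in> interior T" by blast
  have "(\<Sum>T\<in>\<T>. indicator (interior T) x *\<^sub>R f x) = (\<Sum>T'\<in>\<T>. if T' = T then f x else 0)"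
  proof (intro sum.cong refl)
    fix T' assume "T' \<in> \<T>"
    then have "x \<notin> interior T'" if "T' \<noteq> T"
      using interior_disjoint[of T' T x] that T interior_subset by blast
    then show "indicator (interior T') x *\<^sub>R f x = (if T' = T then f x else 0)"
      using T by (auto simp: indicator_def)
  qed
  also have "\<dots> = f x" using T by simp
  finally have "(\<Sum>T\<in>\<T>. indicator (interior T) x *\<^sub>R f x) = f x" .
  moreover have "x \<in> (\<Union>T\<in>\<T>. interior T)" using T by blast
  ultimately show ?thesis by (simp only: indicator_simps scaleR_one)
next
  case False
  then show ?thesis by (auto simp: indicator_def)
qed

lemma mesh_borel_measurable:
  fixes f :: "'a \<Rightarrow> 'b::euclidean_space"
  assumes "\<And>T. T \<in> \<T> \<Longrightarrow> f \<in> borel_measurable (lebesgue_on T)"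
  shows "f \<in> borel_measurable (lebesgue_on \<Omega>)"
proof -
  have "(\<lambda>x. indicator (interior T) x *\<^sub>R f x) \<in> borel_measurable lebesgue" if "T \<in> \<T>" for T
    using borel_measurable_lebesgue_on_cong_negligible[OF simplex_interior_cong[OF that], of f] assms[OF that]
    by (simp add: borel_measurable_restrict_space_iff borel_open)
  then have "(\<lambda>x. \<Sum>T\<in>\<T>. indicator (interior T) x *\<^sub>R f x) \<in> borel_measurable lebesgue"
    by (intro borel_measurable_sum) auto
  then show ?thesis
    unfolding borel_measurable_lebesgue_on_cong_negligible[OF \<Omega>_interiors_cong] interiors_indicator[symmetric]
    using \<Omega>_interiors_cong(2) by (simp add: borel_measurable_restrict_space_iff)
qed

text \<open>The skeleton is negligible, so \<Omega> may be replaced by the disjoint union of the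
  open simplices, and each of these by its closed simplex.\<close>

lemma mesh_integral:
  fixes f :: "'a \<Rightarrow> real"
  assumes "\<And>T. T \<in> \<T> \<Longrightarrow> integrable (lebesgue_on T) f"
  shows mesh_integrable: "integrable (lebesgue_on \<Omega>) f"
    and mesh_integral_sum: "(LINT x|lebesgue_on \<Omega>. f x) = (\<Sum>T\<in>\<T>. LINT x|lebesgue_on T. f x)"
proof -
  have i: "integrable lebesgue (\<lambda>x. indicator (interior T) x *\<^sub>R f x)" if "T \<in> \<T>" for T
    using integrable_lebesgue_on_cong_negligible[OF simplex_interior_cong[OF that], of f] assms[OF that]
    by (simp add: integrable_restrict_space borel_open)
  have e: "(LINT x|lebesgue. indicator (interior T) x *\<^sub>R f x) = (LINT x|lebesgue_on T. f x)" if "T \<in> \<T>" for T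
    using integral_lebesgue_on_cong_negligible[OF simplex_interior_cong[OF that], of f]
    by (simp add: integral_restrict_space borel_open)
  have ii: "integrable lebesgue (\<lambda>x. \<Sum>T\<in>\<T>. indicator (interior T) x *\<^sub>R f x)"
    using i by (intro Bochner_Integration.integrable_sum) auto
  then show "integrable (lebesgue_on \<Omega>) f"
    unfolding integrable_lebesgue_on_cong_negligible[OF \<Omega>_interiors_cong] interiors_indicator[symmetric]
    using \<Omega>_interiors_cong(2) by (simp add: integrable_restrict_space)
  have "(LINT x|lebesgue_on \<Omega>. f x) = (LINT x|lebesgue. (\<Sum>T\<in>\<T>. indicator (interior T) x *\<^sub>R f x))"
    unfolding integral_lebesgue_on_cong_negligible[OF \<Omega>_interiors_cong] interiors_indicator[symmetric]
    using \<Omega>_interiors_cong(2) by (simp add: integral_restrict_space)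
  also have "\<dots> = (\<Sum>T\<in>\<T>. LINT x|lebesgue_on T. f x)"
    using i e by (subst Bochner_Integration.integral_sum) auto
  finally show "(LINT x|lebesgue_on \<Omega>. f x) = (\<Sum>T\<in>\<T>. LINT x|lebesgue_on T. f x)" .
qed

lemma mesh_square_integrable:
  fixes f :: "'a \<Rightarrow> 'b::euclidean_space"
  assumes "\<And>T. T \<in> \<T> \<Longrightarrow> square_integrable T f"
  shows "square_integrable \<Omega> f"
  using assms mesh_borel_measurable[of f] mesh_integrable[of "\<lambda>x. (norm (f x))\<^sup>2"]
  unfolding square_integrable_def by blast

lemma mesh_inner_split:
  assumes "square_integrable \<Omega> u" "square_integrable \<Omega> v"
  shows "(LINT x|lebesgue_on \<Omega>. u x \<bullet> v x) = (\<Sum>T\<in>\<T>. LINT x|lebesgue_on T. u x \<bullet> v x)"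
  using square_integrable_simplex[OF assms(1)] square_integrable_simplex[OF assms(2)]
  by (intro mesh_integral_sum square_integrable_inner)

end

section \<open>Face integrals and interpolation\<close>

lemma L2_norm_tendsto_add_cmult:
  assumes "\<And>j::nat. square_integrable S (a j)" "\<And>j. square_integrable S (b j)"
    and "(\<lambda>j. L2_norm S (a j)) \<longlonglongrightarrow> 0" "(\<lambda>j. L2_norm S (b j)) \<longlonglongrightarrow> 0"
  shows "(\<lambda>j. L2_norm S (\<lambda>x. a j x + c *\<^sub>R b j x)) \<longlonglongrightarrow> 0"
proof (rule Lim_null_comparison)
  show "\<forall>\<^sub>F j in sequentially. norm (L2_norm S (\<lambda>x. a j x + c *\<^sub>R b j x)) \<le> L2_norm S (a j) + \<bar>c\<bar> * L2_norm S (b j)"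
    using L2_norm_add_le[OF assms(1,2)] by (simp add: L2_norm_nonneg)
  show "(\<lambda>j. L2_norm S (a j) + \<bar>c\<bar> * L2_norm S (b j)) \<longlonglongrightarrow> 0"
    using tendsto_add[OF assms(3) tendsto_mult[OF tendsto_const[of "\<bar>c\<bar>"] assms(4)]] by simp
qed

lemma test_function_zero: "test_function \<Omega> (\<lambda>x. 0)"
proof -
  have g: "gradient (\<lambda>x::'a. 0) x = 0" for x by (rule gradient_eqI) (auto intro!: derivative_eq_intros)
  have "times_cont_diff k (\<lambda>x::'a. 0)" for k
    by (induction k) (auto simp: g)
  then show ?thesis by (simp add: test_function_def)
qed

section \<open>Linear structure of the Sobolev space\<close>

context mesh
begin

lemma test_functions_tendsto_add_cmult:
  assumes u: "square_integrable \<Omega> u" "square_integrable \<Omega> g" "test_functions_tendsto \<Omega> \<phi> u g"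
    and v: "square_integrable \<Omega> v" "square_integrable \<Omega> h" "test_functions_tendsto \<Omega> \<psi> v h"
  shows "test_functions_tendsto \<Omega> (\<lambda>j x. \<phi> j x + c * \<psi> j x) (\<lambda>x. u x + c * v x) (\<lambda>x. g x + c *\<^sub>R h x)"
  unfolding test_functions_tendsto_def
proof (intro conjI allI)
  have t: "test_function \<Omega> (\<phi> j)" "test_function \<Omega> (\<psi> j)" for j
    using u v by (auto simp: test_functions_tendsto_def)
  show "test_function \<Omega> (\<lambda>x. \<phi> j x + c * \<psi> j x)" for j by (intro test_function_add_cmult t)
  have "(\<lambda>j. L2_norm \<Omega> (\<lambda>x. (\<phi> j x - u x) + c *\<^sub>R (\<psi> j x - v x))) \<longlonglongrightarrow> 0"
    using u v
    by (intro L2_norm_tendsto_add_cmult square_integrable_diff[OF test_square_integrable(1)[OF t(1)] u(1)]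
        square_integrable_diff[OF test_square_integrable(1)[OF t(2)] v(1)])
      (auto simp: test_functions_tendsto_def)
  then show "(\<lambda>j. L2_norm \<Omega> (\<lambda>x. \<phi> j x + c * \<psi> j x - (u x + c * v x))) \<longlonglongrightarrow> 0"
    by (simp add: algebra_simps)
  have "(\<lambda>j. L2_norm \<Omega> (\<lambda>x. (gradient (\<phi> j) x - g x) + c *\<^sub>R (gradient (\<psi> j) x - h x))) \<longlonglongrightarrow> 0"
    using u v
    by (intro L2_norm_tendsto_add_cmult square_integrable_diff[OF test_square_integrable(2)[OF t(1)] u(2)]
        square_integrable_diff[OF test_square_integrable(2)[OF t(2)] v(2)])
      (auto simp: test_functions_tendsto_def)
  moreover have "gradient (\<lambda>x. \<phi> j x + c * \<psi> j x) x = gradient (\<phi> j) x + c *\<^sub>R gradient (\<psi> j) x" for j x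
    by (rule gradient_add_cmult[OF test_function_diff[OF t(1)] test_function_diff[OF t(2)]])
  ultimately show "(\<lambda>j. L2_norm \<Omega> (\<lambda>x. gradient (\<lambda>x. \<phi> j x + c * \<psi> j x) x - (g x + c *\<^sub>R h x))) \<longlonglongrightarrow> 0"
    by (simp add: algebra_simps)
qed

lemma H01D:
  assumes "H01 \<Omega> u g"
  shows "square_integrable \<Omega> u" "square_integrable \<Omega> g" "weak_gradient \<Omega> u g" "\<exists>\<phi>. test_functions_tendsto \<Omega> \<phi> u g"
  using assms by (auto simp: H01_def H1_def)

lemma H01_add_cmult:
  assumes u: "H01 \<Omega> u g" and v: "H01 \<Omega> v h"
  shows "H01 \<Omega> (\<lambda>x. u x + c * v x) (\<lambda>x. g x + c *\<^sub>R h x)"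
  unfolding H01_def H1_def
proof (intro conjI)
  note u' = H01D[OF u] and v' = H01D[OF v]
  show "square_integrable \<Omega> (\<lambda>x. u x + c * v x)"
    using square_integrable_add[OF u'(1) square_integrable_scaleR[OF v'(1), of c]] by simp
  show "square_integrable \<Omega> (\<lambda>x. g x + c *\<^sub>R h x)"
    using square_integrable_add[OF u'(2) square_integrable_scaleR[OF v'(2), of c]] by simp
  obtain \<phi> \<psi> where "test_functions_tendsto \<Omega> \<phi> u g" "test_functions_tendsto \<Omega> \<psi> v h" using u' v' by blast
  then show "\<exists>\<phi>. test_functions_tendsto \<Omega> \<phi> (\<lambda>x. u x + c * v x) (\<lambda>x. g x + c *\<^sub>R h x)"
    using test_functions_tendsto_add_cmult u' v' by blast
  show "weak_gradient \<Omega> (\<lambda>x. u x + c * v x) (\<lambda>x. g x + c *\<^sub>R h x)"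
    unfolding weak_gradient_def
  proof (intro allI impI ballI)
    fix \<phi> b assume t: "test_function \<Omega> \<phi>" and b: "(b::'a) \<in> Basis"
    have s: "square_integrable \<Omega> (\<lambda>x. gradient \<phi> x \<bullet> b)" "square_integrable \<Omega> \<phi>"
    proof -
      have "compact (closure \<Omega>)" using bounded_\<Omega> by simp
      then have "square_integrable (closure \<Omega>) (\<lambda>x. gradient \<phi> x \<bullet> b)"
        by (rule square_integrable_continuous) (intro continuous_intros continuous_on_subset[OF continuous_gradient[OF t]] subset_UNIV)
      then show "square_integrable \<Omega> (\<lambda>x. gradient \<phi> x \<bullet> b)"
        by (rule square_integrable_subset) (auto simp: closure_subset)
      show "square_integrable \<Omega> \<phi>" by (rule test_square_integrable[OF t])
    qed
    have sb: "square_integrable \<Omega> (\<lambda>x. \<phi> x *\<^sub>R b)"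
      using s(2) by (auto simp: square_integrable_def power_mult_distrib)
    have i: "integrable (lebesgue_on \<Omega>) (\<lambda>x. u x * (gradient \<phi> x \<bullet> b))" "integrable (lebesgue_on \<Omega>) (\<lambda>x. v x * (gradient \<phi> x \<bullet> b))"
      "integrable (lebesgue_on \<Omega>) (\<lambda>x. (g x \<bullet> b) * \<phi> x)" "integrable (lebesgue_on \<Omega>) (\<lambda>x. (h x \<bullet> b) * \<phi> x)"
      using square_integrable_mult[OF u'(1) s(1)] square_integrable_mult[OF v'(1) s(1)]
        square_integrable_inner[OF u'(2) sb] square_integrable_inner[OF v'(2) sb] by (simp_all add: mult.commute)
    have "(LINT x|lebesgue_on \<Omega>. (u x + c * v x) * (gradient \<phi> x \<bullet> b))
        = (LINT x|lebesgue_on \<Omega>. u x * (gradient \<phi> x \<bullet> b)) + c * (LINT x|lebesgue_on \<Omega>. v x * (gradient \<phi> x \<bullet> b))"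
      using i by (simp add: algebra_simps)
    also have "\<dots> = - (LINT x|lebesgue_on \<Omega>. (g x \<bullet> b) * \<phi> x) + c * - (LINT x|lebesgue_on \<Omega>. (h x \<bullet> b) * \<phi> x)"
      using u'(3) v'(3) t b by (simp add: weak_gradient_def)
    also have "\<dots> = - (LINT x|lebesgue_on \<Omega>. ((g x + c *\<^sub>R h x) \<bullet> b) * \<phi> x)"
      using i by (simp add: inner_simps algebra_simps)
    finally show "(LINT x|lebesgue_on \<Omega>. (u x + c * v x) * (gradient \<phi> x \<bullet> b)) = - (LINT x|lebesgue_on \<Omega>. ((g x + c *\<^sub>R h x) \<bullet> b) * \<phi> x)" .
  qed
qed

lemma H01_zero: "H01 \<Omega> (\<lambda>x. 0) (\<lambda>x. 0)"
proof -
  have g: "gradient (\<lambda>x::'a. 0) = (\<lambda>x. 0)"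
    by (rule ext, rule gradient_eqI) (auto intro!: derivative_eq_intros)
  have "test_functions_tendsto \<Omega> (\<lambda>j x. 0) (\<lambda>x. 0) (\<lambda>x. 0)"
    by (auto simp: test_functions_tendsto_def test_function_zero g L2_norm_def)
  then show ?thesis
    by (auto simp: H01_def H1_def weak_gradient_def square_integrable_zero)
qed

text \<open>
  For m = 0 the integrand is the divergence of \<open>u(x) (x - P)\<close>, and the flux is a multiple of the
  integral of the trace of u over the face opposite to P.
\<close>

definition "flux T P m u g = (LINT x|lebesgue_on T.
   (1 - full_simplex.bary (vertices T) P x) ^ m * (g x \<bullet> (x - P))
   + (DIM('a) + m) * ((1 - full_simplex.bary (vertices T) P x) ^ m * u x))"

text \<open>The divergence formula for the product of \<phi> and the weight. The weight is 1 on the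
  face, so the boundary term is the same for every m. It is homogeneous of degree m about P, so that
  its derivative along \<open>x - P\<close> merely turns the factor \<open>DIM('a)\<close> into
  \<open>DIM('a) + m\<close>.\<close>

lemma flux_test:
  assumes T: "T \<in> \<T>" and P: "P \<in> vertices T" and t: "test_function \<Omega> \<phi>"
  shows "flux T P m \<phi> (gradient \<phi>) = (1 / norm (full_simplex.slope (vertices T) P)) *
    (LINT y|face_measure (full_simplex.face (vertices T) P). \<phi> y)"
proof -
  interpret S: full_simplex "vertices T" by (rule full_simplex[OF T])
  let ?s = "\<lambda>x. 1 - S.bary P x"
  let ?f = "\<lambda>x. \<phi> x * ?s x ^ m"
  let ?g = "\<lambda>x. ?s x ^ m *\<^sub>R gradient \<phi> x - (m * \<phi> x * ?s x ^ (m - 1)) *\<^sub>R S.slope P"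
  note cont = test_function_continuous[OF t] continuous_gradient[OF t]
  have d: "(?f has_derivative (\<lambda>v. ?g x \<bullet> v)) (at x)" for x
    by (rule has_derivative_eq_rhs[OF has_derivative_mult[OF test_function_derivative[OF t]
       has_derivative_power[OF has_derivative_diff[OF has_derivative_const S.bary_derivative]]]])
      (auto simp: inner_simps algebra_simps)
  have cg: "continuous_on UNIV ?g" by (intro continuous_intros cont S.cont_bary)
  have "?g x \<bullet> (x - P) + DIM('a) * ?f x = ?s x ^ m * (gradient \<phi> x \<bullet> (x - P)) + (DIM('a) + m) * (?s x ^ m * \<phi> x)" for x
  proof -
    have "S.slope P \<bullet> (x - P) = - ?s x" using P unfolding S.slope_diff by (simp add: S.bary_vertex)
    then have A: "?g x \<bullet> (x - P) = ?s x ^ m * (gradient \<phi> x \<bullet> (x - P)) + m * \<phi> x * (?s x ^ (m - 1) * ?s x)"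
      by (simp only: inner_diff_left inner_scaleR_left)
    \<comment> \<open>For m = 0 the truncated exponent \<open>m - 1\<close> does no harm, because
      the factor m vanishes.\<close>
    have B: "m * \<phi> x * (?s x ^ (m - 1) * ?s x) = m * \<phi> x * ?s x ^ m" by (cases m) auto
    show ?thesis unfolding A B by (simp add: algebra_simps)
  qed
  then have "flux T P m \<phi> (gradient \<phi>) = (LINT x|lebesgue_on S.T. ?g x \<bullet> (x - P) + DIM('a) * ?f x)"
    unfolding flux_def using simplex_eq[OF T] by simp
  also have "\<dots> = (1 / norm (S.slope P)) * (LINT y|face_measure (S.face P). ?f y)"
    by (rule S.vertex_divergence[OF P d cg])
  also have "(LINT y|face_measure (S.face P). ?f y) = (LINT y|face_measure (S.face P). \<phi> y)"
    by (intro integral_face_measure_cong S.closest_point_face_borel P borel_measurable_continuous_onI continuous_intros cont S.cont_bary)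
      (simp add: S.face_iff P)
  finally show ?thesis .
qed

lemma square_integrable_poly:
  assumes "T \<in> \<T>" "continuous_on UNIV w" shows "square_integrable T w"
  using assms compact_simplex by (auto intro!: square_integrable_continuous intro: continuous_on_subset)

text \<open>The flux pairs u and g with fixed polynomials on T and is therefore continuous with
  respect to L2 convergence of both.\<close>

lemma flux_tendsto:
  assumes T: "T \<in> \<T>" and P: "P \<in> vertices T" and u: "H01 \<Omega> u g" and t: "test_functions_tendsto \<Omega> \<phi> u g"
  shows "(\<lambda>j. flux T P m (\<phi> j) (gradient (\<phi> j))) \<longlonglongrightarrow> flux T P m u g"
proof -
  interpret S: full_simplex "vertices T" by (rule full_simplex[OF T])
  let ?s = "\<lambda>x. 1 - S.bary P x"
  let ?w1 = "\<lambda>x. ?s x ^ m *\<^sub>R (x - P)" and ?w2 = "\<lambda>x. (DIM('a) + m) * ?s x ^ m"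
  have w: "square_integrable T ?w1" "square_integrable T ?w2"
    by (intro square_integrable_poly T continuous_intros S.cont_bary)+
  have tj: "test_function \<Omega> (\<phi> j)" for j using t by (auto simp: test_functions_tendsto_def)
  have sq: "square_integrable T u" "square_integrable T g" "square_integrable T (\<phi> j)" "square_integrable T (gradient (\<phi> j))" for j
    using H01D[OF u] test_square_integrable[OF tj[of j]] T square_integrable_simplex by auto
  have split: "flux T P m v h = (LINT x|lebesgue_on T. h x \<bullet> ?w1 x) + (LINT x|lebesgue_on T. v x \<bullet> ?w2 x)"
    if "square_integrable T v" "square_integrable T h" for v h
  proof -
    have "flux T P m v h = (LINT x|lebesgue_on T. h x \<bullet> ?w1 x + v x \<bullet> ?w2 x)"
      unfolding flux_def by (intro Bochner_Integration.integral_cong) (auto simp: algebra_simps)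
    then show ?thesis
      using square_integrable_inner[OF that(2) w(1)] square_integrable_inner[OF that(1) w(2)] by simp
  qed
  have lim: "(\<lambda>j. L2_norm T (\<lambda>x. \<phi> j x - u x)) \<longlonglongrightarrow> 0" "(\<lambda>j. L2_norm T (\<lambda>x. gradient (\<phi> j) x - g x)) \<longlonglongrightarrow> 0"
  proof -
    have a: "(\<lambda>j. L2_norm \<Omega> (\<lambda>x. \<phi> j x - u x)) \<longlonglongrightarrow> 0" "(\<lambda>j. L2_norm \<Omega> (\<lambda>x. gradient (\<phi> j) x - g x)) \<longlonglongrightarrow> 0"
      using t by (auto simp: test_functions_tendsto_def)
    show "(\<lambda>j. L2_norm T (\<lambda>x. \<phi> j x - u x)) \<longlonglongrightarrow> 0"
      using test_square_integrable(1)[OF tj] H01D(1)[OF u] T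
      by (intro Lim_null_comparison[OF _ a(1)] always_eventually allI)
        (auto simp: L2_norm_nonneg intro!: L2_norm_simplex square_integrable_diff)
    show "(\<lambda>j. L2_norm T (\<lambda>x. gradient (\<phi> j) x - g x)) \<longlonglongrightarrow> 0"
      using test_square_integrable(2)[OF tj] H01D(2)[OF u] T
      by (intro Lim_null_comparison[OF _ a(2)] always_eventually allI)
        (auto simp: L2_norm_nonneg intro!: L2_norm_simplex square_integrable_diff)
  qed
  show ?thesis
    unfolding split[OF sq(1,2)] split[OF sq(3,4)]
    by (intro tendsto_add L2_tendsto_integral sq w lim)
qed

lemma AE_simplex_interior: "T \<in> \<T> \<Longrightarrow> AE x in lebesgue_on T. x \<in> interior T"
proof -
  assume T: "T \<in> \<T>"
  have "T - interior T \<in> null_sets lebesgue"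
    using negligible_frontier_simplex[OF T] by (simp add: negligible_iff_null_sets)
  then have "AE x in lebesgue. x \<notin> T - interior T" by (rule AE_not_in)
  then show ?thesis using T by (subst AE_restrict_space_iff) auto
qed

text \<open>
  The weight \<open>(1 - bary P) ^ m\<close> does not change the flux, and the contribution of the gradient
  vanishes for large m.  This avoids the uniqueness of weak gradients.
\<close>

lemma flux_unique:
  assumes T: "T \<in> \<T>" and P: "P \<in> vertices T" and u: "H01 \<Omega> u g" "H01 \<Omega> u g'"
  shows "flux T P 0 u g = flux T P 0 u g'"
proof -
  interpret S: full_simplex "vertices T" by (rule full_simplex[OF T])
  let ?s = "\<lambda>x. 1 - S.bary P x"
  \<comment> \<open>For test functions all fluxes are the same surface integral; the equality
    survives the limit.\<close>
  have const: "flux T P m u h = flux T P 0 u h" if uh: "H01 \<Omega> u h" for h m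
  proof -
    obtain \<phi> where \<phi>: "test_functions_tendsto \<Omega> \<phi> u h" using H01D[OF uh] by blast
    then have "test_function \<Omega> (\<phi> j)" for j by (auto simp: test_functions_tendsto_def)
    then have "flux T P m (\<phi> j) (gradient (\<phi> j)) = flux T P 0 (\<phi> j) (gradient (\<phi> j))" for j
      by (simp add: flux_test[OF T P])
    then show ?thesis
      using flux_tendsto[OF T P uh \<phi>, of m] flux_tendsto[OF T P uh \<phi>, of 0] LIMSEQ_unique by auto
  qed
  have sq: "square_integrable T u" "square_integrable T g" "square_integrable T g'"
    using u H01D T square_integrable_simplex by blast+
  let ?D = "\<lambda>x. (g x - g' x) \<bullet> (x - P)"
  have D: "integrable (lebesgue_on T) ?D"
    by (intro square_integrable_inner square_integrable_diff sq square_integrable_poly T continuous_intros)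
  \<comment> \<open>The terms with u cancel, and the difference of the gradients is left with the
    weight. On the interior of T the weight base lies in \<open>{0..<1}\<close>, so its powers tend
    to 0 while the difference of the fluxes does not change with m.\<close>
  have diff: "flux T P m u g - flux T P m u g' = (LINT x|lebesgue_on T. ?s x ^ m * ?D x)" for m
  proof -
    have i: "integrable (lebesgue_on T) (\<lambda>x. ?s x ^ m * (h x \<bullet> (x - P)))" if "square_integrable T h" for h
    proof -
      have "integrable (lebesgue_on T) (\<lambda>x. h x \<bullet> (?s x ^ m *\<^sub>R (x - P)))"
        by (intro square_integrable_inner that square_integrable_poly T continuous_intros S.cont_bary)
      then show ?thesis by simp
    qed
    have "integrable (lebesgue_on T) (\<lambda>x. ?s x ^ m * u x)"
      by (intro square_integrable_mult sq square_integrable_poly T continuous_intros S.cont_bary)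
    then have j: "integrable (lebesgue_on T) (\<lambda>x. (DIM('a) + m) * (?s x ^ m * u x))" by (rule integrable_mult_right)
    have "flux T P m u g - flux T P m u g' = (LINT x|lebesgue_on T. ?s x ^ m * (g x \<bullet> (x - P))) - (LINT x|lebesgue_on T. ?s x ^ m * (g' x \<bullet> (x - P)))"
      unfolding flux_def Bochner_Integration.integral_add[OF i[OF sq(2)] j] Bochner_Integration.integral_add[OF i[OF sq(3)] j] by simp
    also have "\<dots> = (LINT x|lebesgue_on T. ?s x ^ m * (g x \<bullet> (x - P)) - ?s x ^ m * (g' x \<bullet> (x - P)))"
      by (rule Bochner_Integration.integral_diff[OF i[OF sq(2)] i[OF sq(3)], symmetric])
    also have "\<dots> = (LINT x|lebesgue_on T. ?s x ^ m * ?D x)"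
      by (simp only: inner_diff_left right_diff_distrib)
    finally show ?thesis .
  qed
  have "(\<lambda>m. LINT x|lebesgue_on T. ?s x ^ m * ?D x) \<longlonglongrightarrow> (LINT x|lebesgue_on T. 0)"
  proof (rule integral_dominated_convergence[where w = "\<lambda>x. \<bar>?D x\<bar>"])
    have [measurable]: "?D \<in> borel_measurable (lebesgue_on T)" using D by auto
    have [measurable]: "?s \<in> borel_measurable (lebesgue_on T)"
    proof -
      have "continuous_on UNIV ?s" by (intro continuous_intros S.cont_bary)
      then show ?thesis using square_integrable_poly[OF T, of ?s] by (simp add: square_integrable_def)
    qed
    show "(\<lambda>x. ?s x ^ m * ?D x) \<in> borel_measurable (lebesgue_on T)" for m by measurable
    show "integrable (lebesgue_on T) (\<lambda>x. \<bar>?D x\<bar>)" using D by (rule integrable_abs)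
    have s: "0 \<le> ?s x \<and> ?s x < 1" if "x \<in> interior T" for x
    proof -
      have pos: "S.bary Q x > 0" if "Q \<in> vertices T" for Q
        using S.interior_T_iff[of x] simplex_eq[OF T] that \<open>x \<in> interior T\<close> by simp
      have "S.bary P x \<le> (\<Sum>Q\<in>vertices T. S.bary Q x)" using pos P by (intro member_le_sum) (auto intro: less_imp_le)
      then show ?thesis using pos[OF P] by (simp add: S.bary_sum)
    qed
    show "AE x in lebesgue_on T. norm (?s x ^ m * ?D x) \<le> \<bar>?D x\<bar>" for m
      using AE_simplex_interior[OF T]
    proof (rule AE_mp, intro AE_I2 impI)
      fix x assume "x \<in> interior T"
      then have "\<bar>?s x ^ m\<bar> \<le> 1" using s[of x] by (simp add: power_abs power_le_one)
      then show "norm (?s x ^ m * ?D x) \<le> \<bar>?D x\<bar>" by (simp add: abs_mult mult_left_le_one_le)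
    qed
    show "AE x in lebesgue_on T. (\<lambda>m. ?s x ^ m * ?D x) \<longlonglongrightarrow> 0"
      using AE_simplex_interior[OF T]
    proof (rule AE_mp, intro AE_I2 impI)
      fix x assume "x \<in> interior T"
      then have "(\<lambda>m. ?s x ^ m) \<longlonglongrightarrow> 0" using s[of x] by (intro LIMSEQ_power_zero) auto
      then show "(\<lambda>m. ?s x ^ m * ?D x) \<longlonglongrightarrow> 0" by (rule tendsto_mult_left_zero)
    qed
  qed simp
  moreover have "(LINT x|lebesgue_on T. ?s x ^ m * ?D x) = flux T P 0 u g - flux T P 0 u g'" for m
    unfolding diff[of m, symmetric] const[OF u(1), of m] const[OF u(2), of m] by (rule refl)
  ultimately show ?thesis using LIMSEQ_const_iff[of "flux T P 0 u g - flux T P 0 u g'" 0] by simp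
qed

text \<open>Justifies the definite description in \<open>face_integral\<close>: surface integrals of
  test functions are multiples of fluxes, fluxes converge, and the limit depends neither on the
  approximating sequence nor on the representative of the weak gradient.\<close>

lemma face_integral_eq:
  assumes T: "T \<in> \<T>" and P: "P \<in> vertices T" and u: "H01 \<Omega> u g"
  shows "face_integral \<Omega> (full_simplex.face (vertices T) P) u = norm (full_simplex.slope (vertices T) P) * flux T P 0 u g"
proof -
  interpret S: full_simplex "vertices T" by (rule full_simplex[OF T])
  have n: "norm (S.slope P) \<noteq> 0" using S.slope_ne[OF P] by simp
  have lim: "(\<lambda>j. LINT x|face_measure (S.face P). \<phi> j x) \<longlonglongrightarrow> norm (S.slope P) * flux T P 0 u g"
    if h: "H01 \<Omega> u h" and t: "test_functions_tendsto \<Omega> \<phi> u h" for \<phi> h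
  proof -
    have "test_function \<Omega> (\<phi> j)" for j using t by (auto simp: test_functions_tendsto_def)
    then have "(LINT x|face_measure (S.face P). \<phi> j x) = norm (S.slope P) * flux T P 0 (\<phi> j) (gradient (\<phi> j))" for j
      using flux_test[OF T P, of "\<phi> j" 0] n by simp
    then show ?thesis
      using tendsto_mult_left[OF flux_tendsto[OF T P h t, of 0], of "norm (S.slope P)"] flux_unique[OF T P h u] by simp
  qed
  obtain \<phi> where \<phi>: "test_functions_tendsto \<Omega> \<phi> u g" using H01D[OF u] by blast
  show ?thesis unfolding face_integral_def
  proof (rule the_equality)
    show "\<forall>\<phi> h. H01 \<Omega> u h \<and> test_functions_tendsto \<Omega> \<phi> u h \<longrightarrow>
      (\<lambda>j. LINT x|face_measure (S.face P). \<phi> j x) \<longlonglongrightarrow> norm (S.slope P) * flux T P 0 u g" using lim by blast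
    fix m assume "\<forall>\<phi> h. H01 \<Omega> u h \<and> test_functions_tendsto \<Omega> \<phi> u h \<longrightarrow> (\<lambda>j. LINT x|face_measure (S.face P). \<phi> j x) \<longlonglongrightarrow> m"
    then have "(\<lambda>j. LINT x|face_measure (S.face P). \<phi> j x) \<longlonglongrightarrow> m" using u \<phi> by blast
    then show "m = norm (S.slope P) * flux T P 0 u g" using LIMSEQ_unique lim[OF u \<phi>] by blast
  qed
qed

text \<open>Test functions are supported in the open set \<Omega> and vanish on its frontier, so the
  flux is 0 along every approximating sequence.\<close>

lemma flux_boundary:
  assumes T: "T \<in> \<T>" and P: "P \<in> vertices T" and u: "H01 \<Omega> u g"
    and F: "full_simplex.face (vertices T) P \<subseteq> frontier \<Omega>"
  shows "flux T P 0 u g = 0"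
proof -
  interpret S: full_simplex "vertices T" by (rule full_simplex[OF T])
  obtain \<phi> where \<phi>: "test_functions_tendsto \<Omega> \<phi> u g" using H01D[OF u] by blast
  have "flux T P 0 (\<phi> j) (gradient (\<phi> j)) = 0" for j
  proof -
    have t: "test_function \<Omega> (\<phi> j)" using \<phi> by (auto simp: test_functions_tendsto_def)
    have "\<phi> j x = 0" if "x \<in> S.face P" for x
    proof (rule ccontr)
      assume "\<phi> j x \<noteq> 0"
      then have "x \<in> \<Omega>" using t closure_subset[of "{x. \<phi> j x \<noteq> 0}"] by (auto simp: test_function_def)
      then show False using that F open_\<Omega> by (auto simp: frontier_def interior_open)
    qed
    then have "(LINT y|face_measure (S.face P). \<phi> j y) = (LINT y|face_measure (S.face P). 0)"
      by (intro integral_face_measure_cong S.closest_point_face_borel P borel_measurable_continuous_onI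
          test_function_continuous[OF t]) auto
    then show ?thesis using flux_test[OF T P t, of 0] by simp
  qed
  then show ?thesis using flux_tendsto[OF T P u \<phi>, of 0] LIMSEQ_const_iff[of 0 "flux T P 0 u g"] by simp
qed

section \<open>Crouzeix-Raviart basis functions and interpolation\<close>

definition "pw q x = (\<Sum>T\<in>\<T>. indicator (interior T) x * (q T x :: real))"

lemma pw_eq: "T \<in> \<T> \<Longrightarrow> x \<in> interior T \<Longrightarrow> pw q x = q T x"
proof -
  assume T: "T \<in> \<T>" "x \<in> interior T"
  have "pw q x = (\<Sum>T'\<in>\<T>. if T' = T then q T x else 0)"
    unfolding pw_def
  proof (intro sum.cong refl)
    fix T' assume "T' \<in> \<T>"
    then have "x \<notin> interior T'" if "T' \<noteq> T"
      using interior_disjoint[of T' T x] that T interior_subset by blast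
    then show "indicator (interior T') x * q T' x = (if T' = T then q T x else 0)"
      using T by (auto simp: indicator_def)
  qed
  then show ?thesis using T by simp
qed

lemma finite_faces: "finite (faces \<T>)"
proof -
  have "faces \<T> = (\<Union>T\<in>\<T>. {F. F facet_of T})" by (auto simp: faces_def)
  moreover have "finite {F. F facet_of T}" if "T \<in> \<T>" for T
  proof -
    have "{F. F facet_of T} = full_simplex.face (vertices T) ` vertices T" using facet_simplex[OF that] by auto
    then show ?thesis using full_simplex.finite_C[OF full_simplex[OF that]] by simp
  qed
  ultimately show ?thesis by simp
qed

lemma finite_interior_faces: "finite (interior_faces \<Omega> \<T>)"
  using finite_faces by (auto simp: interior_faces_def)

text \<open>A witness for the choice in \<open>psi\<close>: on each simplex with facet F it is 1
  minus the dimension times the barycentric coordinate of the vertex opposite to F, and 0 on all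
  other simplices. That coordinate is 0 at the centroid of F and the reciprocal of the dimension at
  the centroids of the other facets.\<close>

lemma psi:
  assumes F: "F \<in> interior_faces \<Omega> \<T>"
  shows psi_CR01: "psi \<Omega> \<T> F \<in> CR01 \<Omega> \<T>"
    and psi_trace: "F' facet_of T \<Longrightarrow> T \<in> \<T> \<Longrightarrow> simplex_trace T (psi \<Omega> \<T> F) (mid F') = (if F' = F then 1 else 0)"
proof -
  define V where "V T = (SOME P. P \<in> vertices T \<and> F = full_simplex.face (vertices T) P)" for T
  have V: "V T \<in> vertices T" "F = full_simplex.face (vertices T) (V T)" if "T \<in> \<T>" "F facet_of T" for T
    using someI_ex[of "\<lambda>P. P \<in> vertices T \<and> F = full_simplex.face (vertices T) P"] facet_simplex[OF that(1), of F] that(2)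
    unfolding V_def by blast+
  define b where "b T = (if F facet_of T then - real DIM('a) *\<^sub>R full_simplex.slope (vertices T) (V T) else 0)" for T
  define e where "e T = (if F facet_of T then 1 - real DIM('a) * full_simplex.offset (vertices T) (V T) else 0)" for T
  define v where "v = pw (\<lambda>T x. b T \<bullet> x + e T)"
  have ve: "v x = b T \<bullet> x + e T" if "T \<in> \<T>" "x \<in> interior T" for T x
    using pw_eq[OF that] by (simp add: v_def)
  have tr: "simplex_trace T v (mid F') = (if F' = F then 1 else 0)" if T: "T \<in> \<T>" and F': "F' facet_of T" for T F'
  proof -
    interpret S: full_simplex "vertices T" by (rule full_simplex[OF T])
    obtain P' where P': "P' \<in> vertices T" "F' = S.face P'" using F' facet_simplex[OF T] by blast
    have "simplex_trace T v (mid F') = b T \<bullet> mid F' + e T"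
      by (rule simplex_trace_eq[OF T]) (auto intro: ve T mid_facet F')
    also have "\<dots> = (if F' = F then 1 else 0)"
    proof (cases "F facet_of T")
      case True
      have "b T \<bullet> mid F' + e T = 1 - real DIM('a) * S.bary (V T) (S.face_centroid P')"
        using True P' by (simp add: b_def e_def S.mid_face S.bary_def algebra_simps)
      also have "\<dots> = (if F' = F then 1 else 0)"
        using S.bary_face_centroid[OF P'(1) V(1)[OF T True]] S.face_inj[OF V(1)[OF T True] P'(1)] V(2)[OF T True] P'(2) by auto
      finally show ?thesis .
    next
      case False
      then show ?thesis using F' by (auto simp: b_def e_def)
    qed
    finally show ?thesis .
  qed
  have "v \<in> P1 \<T>" using ve by (auto simp: P1_def)
  moreover have "F' \<noteq> F" if "F' \<in> faces \<T> - interior_faces \<Omega> \<T>" for F' using F that by blast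
  ultimately have "v \<in> CR01 \<Omega> \<T>" unfolding CR01_def using tr by auto
  then have "\<exists>v. v \<in> CR01 \<Omega> \<T> \<and> (\<forall>F'\<in>faces \<T>. \<forall>T\<in>\<T>. F' facet_of T \<longrightarrow> simplex_trace T v (mid F') = (if F' = F then 1 else 0))"
    using tr by blast
  from someI_ex[OF this] show "psi \<Omega> \<T> F \<in> CR01 \<Omega> \<T>"
    "F' facet_of T \<Longrightarrow> T \<in> \<T> \<Longrightarrow> simplex_trace T (psi \<Omega> \<T> F) (mid F') = (if F' = F then 1 else 0)"
    using face_mem_faces unfolding psi_def[symmetric] by blast+
qed

lemma I_CR_local:
  assumes T: "T \<in> \<T>"
  obtains b e where "\<And>x. x \<in> interior T \<Longrightarrow> I_CR \<Omega> \<T> u x = b \<bullet> x + e"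
    "\<And>F. F facet_of T \<Longrightarrow> b \<bullet> mid F + e = (if F \<in> interior_faces \<Omega> \<T> then face_integral \<Omega> F u / measure (face_measure F) F else 0)"
proof -
  let ?I = "interior_faces \<Omega> \<T>" and ?m = "\<lambda>F. face_integral \<Omega> F u / measure (face_measure F) F"
  have "\<exists>a c. \<forall>x\<in>interior T. psi \<Omega> \<T> F x = a \<bullet> x + c" if "F \<in> ?I" for F
    using psi_CR01[OF that] T by (auto simp: CR01_def P1_def)
  then obtain a c where ac: "\<And>F x. F \<in> ?I \<Longrightarrow> x \<in> interior T \<Longrightarrow> psi \<Omega> \<T> F x = a F \<bullet> x + c F" by metis
  have tr: "a F \<bullet> mid F' + c F = (if F' = F then 1 else 0)" if "F \<in> ?I" "F' facet_of T" for F F'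
    using simplex_trace_eq[OF T, of "psi \<Omega> \<T> F" "a F" "c F" "mid F'"] ac[OF that(1)] psi_trace[OF that T] mid_facet(2)[OF T that(2)] by simp
  show ?thesis
  proof (rule that[of "\<Sum>F\<in>?I. ?m F *\<^sub>R a F" "\<Sum>F\<in>?I. ?m F * c F"])
    show "I_CR \<Omega> \<T> u x = (\<Sum>F\<in>?I. ?m F *\<^sub>R a F) \<bullet> x + (\<Sum>F\<in>?I. ?m F * c F)" if "x \<in> interior T" for x
      unfolding I_CR_def inner_sum_left sum.distrib[symmetric]
      using ac that by (intro sum.cong) (auto simp: algebra_simps add_divide_distrib)
    fix F' assume F': "F' facet_of T"
    have "(\<Sum>F\<in>?I. ?m F *\<^sub>R a F) \<bullet> mid F' + (\<Sum>F\<in>?I. ?m F * c F) = (\<Sum>F\<in>?I. ?m F * (a F \<bullet> mid F' + c F))"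
      unfolding inner_sum_left sum.distrib[symmetric] by (intro sum.cong) (auto simp: algebra_simps add_divide_distrib)
    also have "\<dots> = (\<Sum>F\<in>?I. if F' = F then ?m F else 0)" using tr F' by (intro sum.cong) auto
    also have "\<dots> = (if F' \<in> ?I then ?m F' else 0)" using finite_interior_faces by simp
    finally show "(\<Sum>F\<in>?I. ?m F *\<^sub>R a F) \<bullet> mid F' + (\<Sum>F\<in>?I. ?m F * c F) = (if F' \<in> ?I then ?m F' else 0)" .
  qed
qed

lemma I_CR_CR01: "I_CR \<Omega> \<T> u \<in> CR01 \<Omega> \<T>"
proof -
  let ?m = "\<lambda>F. if F \<in> interior_faces \<Omega> \<T> then face_integral \<Omega> F u / measure (face_measure F) F else 0"
  have tr: "simplex_trace T (I_CR \<Omega> \<T> u) (mid F) = ?m F" if TF: "T \<in> \<T>" "F facet_of T" for T F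
  proof -
    obtain b e where be: "\<And>x. x \<in> interior T \<Longrightarrow> I_CR \<Omega> \<T> u x = b \<bullet> x + e"
      and mid: "\<And>F. F facet_of T \<Longrightarrow> b \<bullet> mid F + e = ?m F"
      using I_CR_local[OF TF(1), of u] by blast
    show ?thesis
      using simplex_trace_eq[OF TF(1) be mid_facet(2)[OF TF]] mid[OF TF(2)] by simp
  qed
  have "\<exists>b e. \<forall>x\<in>interior T. I_CR \<Omega> \<T> u x = b \<bullet> x + e" if T: "T \<in> \<T>" for T
    using I_CR_local[OF T, of u] by metis
  then have "I_CR \<Omega> \<T> u \<in> P1 \<T>" unfolding P1_def by simp
  then show ?thesis unfolding CR01_def using tr by auto
qed

lemma I_eCR_V_nc: "I_eCR \<Omega> \<T> u \<in> V_nc \<Omega> \<T>"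
proof -
  define w where "w x = (\<Sum>T\<in>\<T>. (LINT y|lebesgue_on T. u y - I_CR \<Omega> \<T> u y) / measure lebesgue T * bubble T x)" for x
  have "I_eCR \<Omega> \<T> u = (\<lambda>x. I_CR \<Omega> \<T> u x + w x)" by (auto simp: I_eCR_def w_def)
  moreover have "w \<in> bubbles \<T>" unfolding bubbles_def w_def[abs_def] by (rule CollectI, rule exI, rule conjI[OF refl TrueI])
  ultimately show ?thesis unfolding V_nc_def using I_CR_CR01 by blast
qed

lemma bubble_sum_local:
  assumes T: "T \<in> \<T>" and x: "x \<in> interior T"
  shows "(\<Sum>T\<in>\<T>. c T * bubble T x) = c T * full_simplex.bub (vertices T) x"
proof -
  have xT: "x \<in> T" using x interior_subset by blast
  have "(\<Sum>T'\<in>\<T>. c T' * bubble T' x) = (\<Sum>T'\<in>\<T>. if T' = T then c T * bubble T x else 0)"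
  proof (intro sum.cong refl)
    fix T' assume "T' \<in> \<T>"
    then have "x \<notin> T'" if "T' \<noteq> T" using interior_disjoint[of T' T x] that T x by blast
    then have "bubble T' x = 0" if "T' \<noteq> T" using that by (simp add: bubble_def Let_def)
    then show "c T' * bubble T' x = (if T' = T then c T * bubble T x else 0)" by auto
  qed
  also have "\<dots> = c T * bubble T x" using T by simp
  also have "bubble T x = full_simplex.bub (vertices T) x"
    using full_simplex.bubble_eq[OF full_simplex[OF T], of x] simplex_eq[OF T] xT by simp
  finally show ?thesis .
qed

lemma integral_interior_cong:
  fixes f h :: "'a \<Rightarrow> real"
  assumes T: "T \<in> \<T>" and e: "\<And>x. x \<in> interior T \<Longrightarrow> f x = h x"
  shows "(LINT x|lebesgue_on T. f x) = (LINT x|lebesgue_on T. h x)"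
    and "integrable (lebesgue_on T) f \<longleftrightarrow> integrable (lebesgue_on T) h"
proof -
  show "(LINT x|lebesgue_on T. f x) = (LINT x|lebesgue_on T. h x)"
    unfolding integral_lebesgue_on_cong_negligible[OF simplex_interior_cong[OF T]]
    using e by (intro Bochner_Integration.integral_cong) auto
  show "integrable (lebesgue_on T) f \<longleftrightarrow> integrable (lebesgue_on T) h"
    unfolding integrable_lebesgue_on_cong_negligible[OF simplex_interior_cong[OF T]]
    using e by (intro Bochner_Integration.integrable_cong) auto
qed

text \<open>The affine part reproduces the face means of u, and t repairs the mean over T without
  disturbing them, since the bubble has mean 1 on T and mean 0 on the faces. The third property is
  tested with all fields \<open>w + \<alpha> *\<^sub>R x\<close>, among which are the gradients of
  the local space itself.\<close>

lemma I_eCR_local: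
  assumes T: "T \<in> \<T>" and u: "H01 \<Omega> u g"
  obtains b e t where
    "\<And>x. x \<in> interior T \<Longrightarrow> I_eCR \<Omega> \<T> u x = b \<bullet> x + e + t * full_simplex.bub (vertices T) x"
    "(LINT x|lebesgue_on T. u x - (b \<bullet> x + e + t * full_simplex.bub (vertices T) x)) = 0"
    "\<And>w \<alpha>. (LINT x|lebesgue_on T. (g x - (b + t *\<^sub>R full_simplex.gbub (vertices T) x)) \<bullet> (w + \<alpha> *\<^sub>R x)) = 0"
proof -
  interpret S: full_simplex "vertices T" by (rule full_simplex[OF T])
  note eq = simplex_eq[OF T]
  obtain b e where be: "\<And>x. x \<in> interior T \<Longrightarrow> I_CR \<Omega> \<T> u x = b \<bullet> x + e"
    and mid: "\<And>F. F facet_of T \<Longrightarrow> b \<bullet> mid F + e = (if F \<in> interior_faces \<Omega> \<T> then face_integral \<Omega> F u / measure (face_measure F) F else 0)"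
    using I_CR_local[OF T] by blast
  define t where "t = (LINT y|lebesgue_on T. u y - I_CR \<Omega> \<T> u y) / measure lebesgue T"
  have vol: "measure lebesgue T = S.vol" by (simp add: S.vol_def eq)
  have sq: "square_integrable T u" "square_integrable T g"
    using H01D[OF u] T square_integrable_simplex by blast+
  have sb: "square_integrable T (\<lambda>x. b \<bullet> x + e)" "square_integrable T S.bub" "square_integrable T S.gbub" "square_integrable T (\<lambda>x. 1::real)"
    by (intro square_integrable_poly T continuous_intros S.cont_bub S.cont_gbub)+
  have iu: "integrable (lebesgue_on T) u" and ib: "integrable (lebesgue_on T) (\<lambda>x. b \<bullet> x + e)" and ibub: "integrable (lebesgue_on T) S.bub"
    using square_integrable_mult[OF sq(1) sb(4)] square_integrable_mult[OF sb(1) sb(4)] square_integrable_mult[OF sb(2) sb(4)] by simp_all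
  have tt: "t * S.vol = (LINT y|lebesgue_on T. u y - (b \<bullet> y + e))"
    using S.vol_pos integral_interior_cong(1)[OF T, of "\<lambda>y. u y - I_CR \<Omega> \<T> u y" "\<lambda>y. u y - (b \<bullet> y + e)"] be
    by (simp add: t_def vol)
  let ?J = "\<lambda>x. b \<bullet> x + e + t * S.bub x" and ?G = "\<lambda>x. b + t *\<^sub>R S.gbub x"
  have mean: "(LINT x|lebesgue_on T. u x - ?J x) = 0"
  proof -
    have "(LINT x|lebesgue_on T. u x - ?J x) = (LINT x|lebesgue_on T. (u x - (b \<bullet> x + e)) - t * S.bub x)"
      by (intro Bochner_Integration.integral_cong) auto
    also have "\<dots> = (LINT x|lebesgue_on T. u x - (b \<bullet> x + e)) - t * (LINT x|lebesgue_on T. S.bub x)"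
      using iu ib ibub by simp
    also have "(LINT x|lebesgue_on T. S.bub x) = S.vol" using S.integral_bub eq by simp
    finally show ?thesis using tt by simp
  qed
  have iP: "integrable (lebesgue_on T) (\<lambda>x. h x \<bullet> (x - P))" if "square_integrable T h" for h P
    by (intro square_integrable_inner that square_integrable_poly T continuous_intros)
  have sG: "square_integrable T (\<lambda>x. g x - ?G x)"
    by (intro square_integrable_diff sq square_integrable_poly T continuous_intros S.cont_gbub)
  \<comment> \<open>The divergence formula expresses the integral against \<open>x - P\<close>
    through a face mean and the mean over T; both agree for u and its interpolant, so the difference
    vanishes.\<close>
  have vertex: "(LINT x|lebesgue_on T. (g x - ?G x) \<bullet> (x - P)) = 0" if P: "P \<in> vertices T" for P
  proof -
    let ?F = "S.face P"
    have F: "?F facet_of T" using facet_simplex[OF T] P by blast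
    \<comment> \<open>On a boundary face both sides are 0. On an interior face the value of the
      affine part at the centroid is, by construction, the mean of u over the face.\<close>
    have "flux T P 0 u g = real DIM('a) * S.vol * (b \<bullet> S.face_centroid P + e)"
    proof (cases "?F \<subseteq> frontier \<Omega>")
      case True
      then have "b \<bullet> mid ?F + e = 0" using mid[OF F] by (simp add: interior_faces_def)
      then show ?thesis using flux_boundary[OF T P u True] S.mid_face[OF P] by simp
    next
      case False
      then have "?F \<in> interior_faces \<Omega> \<T>" using face_mem_faces[OF T F] by (simp add: interior_faces_def)
      then have "b \<bullet> mid ?F + e = norm (S.slope P) * flux T P 0 u g / measure (face_measure ?F) ?F"
        using mid[OF F] face_integral_eq[OF T P u] by simp
      moreover have "f = (1 / n * m) * v" if "v = n * f / m" "m > 0" "n \<noteq> 0" for f m n v :: real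
        using that by (simp add: field_simps)
      ultimately show ?thesis
        using S.face_area[OF P] S.slope_ne[OF P] S.mid_face[OF P] by (metis norm_eq_zero)
    qed
    moreover have "flux T P 0 u g = (LINT x|lebesgue_on T. g x \<bullet> (x - P)) + DIM('a) * (LINT x|lebesgue_on T. u x)"
      unfolding flux_def using iP[OF sq(2)] iu by simp
    moreover have "(LINT x|lebesgue_on T. b \<bullet> (x - P)) + DIM('a) * (LINT x|lebesgue_on T. b \<bullet> x + e) = real DIM('a) * S.vol * (b \<bullet> S.face_centroid P + e)"
    proof -
      have "integrable (lebesgue_on T) (\<lambda>x. b \<bullet> (x - P))" using iP[of "\<lambda>_. b"] square_integrable_poly[OF T, of "\<lambda>_. b"] by simp
      then show ?thesis using S.vertex_divergence_affine[OF P, of b e] ib eq by simp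
    qed
    moreover have "(LINT x|lebesgue_on T. S.gbub x \<bullet> (x - P)) + DIM('a) * (LINT x|lebesgue_on T. S.bub x) = 0"
      using S.vertex_divergence_bub[of P] iP[OF sb(3)] ibub eq by simp
    moreover have "(LINT x|lebesgue_on T. u x) - (LINT x|lebesgue_on T. b \<bullet> x + e) = t * (LINT x|lebesgue_on T. S.bub x)"
      using tt S.integral_bub eq iu ib by simp
    moreover have "(LINT x|lebesgue_on T. (g x - ?G x) \<bullet> (x - P)) = (LINT x|lebesgue_on T. g x \<bullet> (x - P)) - (LINT x|lebesgue_on T. b \<bullet> (x - P)) - t * (LINT x|lebesgue_on T. S.gbub x \<bullet> (x - P))"
    proof -
      have "(LINT x|lebesgue_on T. (g x - ?G x) \<bullet> (x - P)) = (LINT x|lebesgue_on T. g x \<bullet> (x - P) - b \<bullet> (x - P) - t * (S.gbub x \<bullet> (x - P)))"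
        by (simp only: inner_diff_left inner_add_left inner_scaleR_left diff_diff_eq)
      moreover have "integrable (lebesgue_on T) (\<lambda>x. b \<bullet> (x - P))" using iP[of "\<lambda>_. b"] square_integrable_poly[OF T, of "\<lambda>_. b"] by simp
      ultimately show ?thesis using iP[OF sq(2), of P] iP[OF sb(3), of P] by simp
    qed
    moreover have "X - Y - t * Z = 0" if "X + n * U = Q" "Y + n * W = Q" "Z + n * R = 0" "U - W = t * R" for X Y Z U W R Q n :: real
    proof -
      have "X - Y = - n * (U - W)" using that(1,2) by (simp add: algebra_simps)
      also have "\<dots> = t * - (n * R)" using that(4) by simp
      also have "n * R = - Z" using that(3) by simp
      also have "t * - (- Z) = t * Z" by simp
      finally show ?thesis by simp
    qed
    ultimately show ?thesis by (smt (verit))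
  qed
  show ?thesis
  proof (rule that[of b e t])
    show "I_eCR \<Omega> \<T> u x = ?J x" if "x \<in> interior T" for x
      using bubble_sum_local[OF T that, of "\<lambda>T. (LINT y|lebesgue_on T. u y - I_CR \<Omega> \<T> u y) / measure lebesgue T"] be[OF that]
      by (simp add: I_eCR_def t_def)
    show "(LINT x|lebesgue_on T. u x - ?J x) = 0" by (rule mean)
    fix w \<alpha>
    obtain c where c: "\<And>x. w + \<alpha> *\<^sub>R x = (\<Sum>P\<in>vertices T. c P *\<^sub>R (x - P))" using S.affine_field_rep by blast
    have "(LINT x|lebesgue_on T. (g x - ?G x) \<bullet> (w + \<alpha> *\<^sub>R x)) = (LINT x|lebesgue_on T. (\<Sum>P\<in>vertices T. c P * ((g x - ?G x) \<bullet> (x - P))))"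
      unfolding c inner_sum_right inner_scaleR_right ..
    also have "\<dots> = (\<Sum>P\<in>vertices T. c P * (LINT x|lebesgue_on T. (g x - ?G x) \<bullet> (x - P)))"
      using iP[OF sG] by (subst Bochner_Integration.integral_sum) auto
    also have "\<dots> = 0" using vertex by simp
    finally show "(LINT x|lebesgue_on T. (g x - ?G x) \<bullet> (w + \<alpha> *\<^sub>R x)) = 0" .
  qed
qed

end

section \<open>Symmetric eigenvalue problems\<close>

text \<open>Gaussian elimination: a nonzero entry of row j serves as pivot and removes one equation
  together with one unknown, so the gap between the two numbers persists.\<close>

lemma underdetermined_system:
  fixes A :: "'j \<Rightarrow> 'i \<Rightarrow> real"
  assumes "finite J" "finite I" "card J < card I"
  shows "\<exists>c. (\<exists>i\<in>I. c i \<noteq> 0) \<and> (\<forall>j\<in>J. (\<Sum>i\<in>I. c i * A j i) = 0)"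
  using assms
proof (induction J arbitrary: I A rule: finite_induct)
  case empty
  then obtain i where "i \<in> I" by fastforce
  then show ?case by (intro exI[of _ "\<lambda>_. 1"]) auto
next
  case (insert j J)
  show ?case
  proof (cases "\<forall>i\<in>I. A j i = 0")
    case True
    have "card J < card I" using insert by simp
    then obtain c where "(\<exists>i\<in>I. c i \<noteq> 0) \<and> (\<forall>j\<in>J. (\<Sum>i\<in>I. c i * A j i) = 0)"
      using insert.IH[OF insert.prems(1), of A] by blast
    then show ?thesis using True by (intro exI[of _ c]) auto
  next
    case False
    then obtain p where p: "p \<in> I" "A j p \<noteq> 0" by blast
    let ?I = "I - {p}"
    have "card J < card ?I" using insert p by simp
    then obtain c where c: "\<exists>i\<in>?I. c i \<noteq> 0" "\<forall>j'\<in>J. (\<Sum>i\<in>?I. c i * (A j' i - A j i / A j p * A j' p)) = 0"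
      using insert.IH[of ?I "\<lambda>j' i. A j' i - A j i / A j p * A j' p"] insert.prems by blast
    define d where "d i = (if i = p then - (\<Sum>i\<in>?I. c i * A j i) / A j p else c i)" for i
    have s: "(\<Sum>i\<in>I. d i * A j' i) = d p * A j' p + (\<Sum>i\<in>?I. c i * A j' i)" for j'
    proof -
      have "(\<Sum>i\<in>?I. d i * A j' i) = (\<Sum>i\<in>?I. c i * A j' i)" by (intro sum.cong) (auto simp: d_def)
      then show ?thesis using insert.prems p by (simp add: sum.remove)
    qed
    have "(\<Sum>i\<in>I. d i * A j' i) = 0" if "j' \<in> insert j J" for j'
    proof (cases "j' = j")
      case True
      then show ?thesis unfolding s using p by (simp add: d_def)
    next
      case False
      then have "(\<Sum>i\<in>?I. c i * (A j' i - A j i / A j p * A j' p)) = 0" using c that by blast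
      moreover have "(\<Sum>i\<in>?I. c i * (A j' i - A j i / A j p * A j' p))
          = (\<Sum>i\<in>?I. c i * A j' i) - (\<Sum>i\<in>?I. c i * A j i) / A j p * A j' p"
        by (simp add: algebra_simps sum_subtractf sum_distrib_left sum_divide_distrib)
      ultimately show ?thesis unfolding s by (simp add: d_def)
    qed
    moreover have "\<exists>i\<in>I. d i \<noteq> 0" using c(1) by (auto simp: d_def)
    ultimately show ?thesis by blast
  qed
qed

text \<open>Coefficients are functions on all natural numbers. Pinning those beyond d to 0 puts the
  unit sphere into a product of compact sets, where a continuous function attains its maximum. This
  is the only compactness behind the construction of eigenvectors.\<close>

lemma quadratic_form_max_sphere:
  fixes B :: "nat \<Rightarrow> nat \<Rightarrow> real"
  assumes "d \<ge> 1"
  obtains c where "(\<Sum>i<d. (c i)\<^sup>2) = 1"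
    "\<And>c'. (\<Sum>i<d. (c' i)\<^sup>2) = 1 \<Longrightarrow> (\<Sum>i<d. \<Sum>j<d. c' i * c' j * B i j) \<le> (\<Sum>i<d. \<Sum>j<d. c i * c j * B i j)"
proof -
  define S where "S = (\<lambda>i::nat. if i < d then {-1..1::real} else {0})"
  have "compactin (product_topology (\<lambda>i. euclidean) UNIV) (PiE UNIV S)"
    unfolding compactin_PiE by (auto simp: S_def)
  then have K: "compact (PiE UNIV S)"
    by (simp add: euclidean_product_topology)
  have coord: "continuous_on X (\<lambda>c::nat \<Rightarrow> real. c i)" for X i
    by (rule continuous_on_subset[OF continuous_on_product_coordinates]) simp
  define Z where "Z = PiE UNIV S \<inter> {c. (\<Sum>i<d. (c i)\<^sup>2) = 1}"
  have "closed {c::nat \<Rightarrow> real. (\<Sum>i<d. (c i)\<^sup>2) = 1}"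
    by (intro closed_Collect_eq continuous_intros coord)
  then have Z: "compact Z" unfolding Z_def using K by (rule compact_Int_closed[rotated])
  have "(\<lambda>i. if i = 0 then 1 else 0) \<in> Z"
  proof -
    have "(\<Sum>i<d. (if i = 0 then 1 else 0 :: real)\<^sup>2) = (\<Sum>i<d. if i = 0 then 1 else 0)" by (intro sum.cong) auto
    then show ?thesis using assms by (auto simp: Z_def S_def PiE_def Pi_def extensional_def)
  qed
  then have "Z \<noteq> {}" by blast
  moreover have "continuous_on Z (\<lambda>c. \<Sum>i<d. \<Sum>j<d. c i * c j * B i j)"
    by (intro continuous_intros coord)
  ultimately obtain c where c: "c \<in> Z" "\<And>c'. c' \<in> Z \<Longrightarrow> (\<Sum>i<d. \<Sum>j<d. c' i * c' j * B i j) \<le> (\<Sum>i<d. \<Sum>j<d. c i * c j * B i j)"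
    using continuous_attains_sup[OF Z] by blast
  show ?thesis
  proof (rule that[of c])
    show "(\<Sum>i<d. (c i)\<^sup>2) = 1" using c(1) by (simp add: Z_def)
    fix c' :: "nat \<Rightarrow> real" assume c': "(\<Sum>i<d. (c' i)\<^sup>2) = 1"
    define e where "e i = (if i < d then c' i else 0)" for i
    have "\<bar>c' i\<bar> \<le> 1" if "i < d" for i
    proof -
      have "(c' i)\<^sup>2 \<le> (\<Sum>i<d. (c' i)\<^sup>2)" using that by (intro member_le_sum) auto
      then show ?thesis using c' by (simp add: abs_square_le_1)
    qed
    then have "e \<in> Z" using c' by (auto simp: Z_def S_def e_def abs_le_iff minus_le_iff)
    from c(2)[OF this] show "(\<Sum>i<d. \<Sum>j<d. c' i * c' j * B i j) \<le> (\<Sum>i<d. \<Sum>j<d. c i * c j * B i j)"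
      by (simp add: e_def)
  qed
qed

section \<open>Semidefinite forms and the maximal quotient of two forms\<close>

locale function_space =
  fixes X :: "('x \<Rightarrow> 'b::real_vector) set"
  assumes zero: "(\<lambda>x. 0) \<in> X"
    and comb: "u \<in> X \<Longrightarrow> v \<in> X \<Longrightarrow> (\<lambda>x. u x + c *\<^sub>R v x) \<in> X"
begin

lemma sum_closed: "(\<And>i. i < m \<Longrightarrow> f i \<in> X) \<Longrightarrow> (\<lambda>x. \<Sum>i<m. c i *\<^sub>R f i x) \<in> X" for m :: nat
proof (induction m)
  case (Suc m)
  then show ?case using comb[of "\<lambda>x. \<Sum>i<m. c i *\<^sub>R f i x" "f m" "c m"] by simp
qed (simp add: zero)

end

text \<open>Only semidefinite, because functions that differ on a null set are not
  identified.\<close>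

locale psd_form = function_space X for X :: "('x \<Rightarrow> 'b::real_vector) set" +
  fixes q :: "('x \<Rightarrow> 'b) \<Rightarrow> ('x \<Rightarrow> 'b) \<Rightarrow> real"
  assumes sym: "u \<in> X \<Longrightarrow> v \<in> X \<Longrightarrow> q u v = q v u"
    and lin: "u \<in> X \<Longrightarrow> v \<in> X \<Longrightarrow> w \<in> X \<Longrightarrow> q (\<lambda>x. u x + c *\<^sub>R v x) w = q u w + c * q v w"
    and nonneg: "u \<in> X \<Longrightarrow> 0 \<le> q u u"
begin

lemma zero_left: "w \<in> X \<Longrightarrow> q (\<lambda>x. 0) w = 0"
  using lin[OF zero zero, of w 1] by simp

lemma lin_right:
  assumes "u \<in> X" "v \<in> X" "w \<in> X"
  shows "q w (\<lambda>x. u x + c *\<^sub>R v x) = q w u + c * q w v"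
  using lin[OF assms, of c] sym[OF assms(3) comb[OF assms(1,2)], of c] sym[OF assms(3,1)] sym[OF assms(3,2)] by simp

lemma sum_left: "(\<And>i. i < m \<Longrightarrow> f i \<in> X) \<Longrightarrow> w \<in> X \<Longrightarrow> q (\<lambda>x. \<Sum>i<m. c i *\<^sub>R f i x) w = (\<Sum>i<m. c i * q (f i) w)" for m :: nat
proof (induction m)
  case (Suc m)
  then show ?case
    using lin[of "\<lambda>x. \<Sum>i<m. c i *\<^sub>R f i x" "f m" w "c m"] sum_closed[of m f c] by simp
qed (simp add: zero_left)

lemma sum_right:
  fixes m :: nat
  assumes f: "\<And>i. i < m \<Longrightarrow> f i \<in> X" and w: "w \<in> X"
  shows "q w (\<lambda>x. \<Sum>i<m. c i *\<^sub>R f i x) = (\<Sum>i<m. c i * q w (f i))"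
proof -
  have "q w (\<lambda>x. \<Sum>i<m. c i *\<^sub>R f i x) = q (\<lambda>x. \<Sum>i<m. c i *\<^sub>R f i x) w"
    by (rule sym[OF w sum_closed[OF f]])
  also have "\<dots> = (\<Sum>i<m. c i * q (f i) w)" by (rule sum_left[OF f w])
  also have "\<dots> = (\<Sum>i<m. c i * q w (f i))" using sym[OF f w] by (intro sum.cong) auto
  finally show ?thesis .
qed

lemma quadratic: "u \<in> X \<Longrightarrow> v \<in> X \<Longrightarrow> q (\<lambda>x. u x + c *\<^sub>R v x) (\<lambda>x. u x + c *\<^sub>R v x) = q u u + 2 * c * q u v + c\<^sup>2 * q v v"
  by (simp add: lin lin_right comb sym[of v u] power2_eq_square algebra_simps)

text \<open>The degenerate case of the Cauchy-Schwarz inequality: if \<open>q u v\<close> were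
  nonzero, adding a suitable multiple of u to v would make the form negative.\<close>

lemma null_left:
  assumes "u \<in> X" "v \<in> X" "q u u = 0" shows "q u v = 0"
proof (rule ccontr)
  assume n: "q u v \<noteq> 0"
  define c where "c = - (q v v + 1) / (2 * q u v)"
  have "0 \<le> q (\<lambda>x. v x + c *\<^sub>R u x) (\<lambda>x. v x + c *\<^sub>R u x)" using assms by (intro nonneg comb)
  also have "\<dots> = q v v + 2 * c * q u v" using assms by (simp add: quadratic sym[of v u])
  also have "2 * c * q u v = - (q v v + 1)" using n by (simp add: c_def)
  finally show False by simp
qed

end

text \<open>Finite dimension modulo the kernel of a, stated as a common bound N on the length of
  a-orthonormal families. The kernel of b may be larger than that of a, so the quotient b/a is the
  meaningful one and its maxima are reciprocals of eigenvalues.\<close>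

locale finite_pencil = a: psd_form X a + b: psd_form X b
  for X :: "('x \<Rightarrow> 'b::real_vector) set" and a b +
  fixes N :: nat
  assumes null: "u \<in> X \<Longrightarrow> a u u = 0 \<Longrightarrow> b u u = 0"
    and bound: "(\<And>i. i < m \<Longrightarrow> f i \<in> X) \<Longrightarrow> (\<And>i j. i < m \<Longrightarrow> j < m \<Longrightarrow> a (f i) (f j) = (if i = j then 1 else 0)) \<Longrightarrow> m \<le> N"
begin

text \<open>A longest a-orthonormal family in Y spans Y up to remainders r with
  \<open>a r r = 0\<close>, and then also \<open>b r r = 0\<close>. Both forms thus depend on the
  coefficients only, and b/a is a quadratic form on the unit sphere of the coefficient
  space.\<close>

lemma maximizer:
  assumes Y: "function_space Y" "Y \<subseteq> X" and u: "u \<in> Y" "b u u > 0"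
  obtains v where "v \<in> Y" "a v v = 1" "\<And>w. w \<in> Y \<Longrightarrow> b w w \<le> b v v * a w w"
proof -
  interpret Y: function_space Y by (rule Y(1))
  define ON where "ON m f \<longleftrightarrow> (\<forall>i<m. f i \<in> Y) \<and> (\<forall>i<m. \<forall>j<m. a (f i) (f j) = (if i = j then 1 else 0))" for m :: nat and f
  have "\<exists>m. (\<exists>f. ON m f) \<and> (\<forall>m'. (\<exists>f. ON m' f) \<longrightarrow> m' \<le> m)"
  proof -
    have "\<exists>f. ON 0 f" by (simp add: ON_def)
    moreover have "m \<le> N" if ex: "\<exists>f. ON m f" for m
    proof -
      obtain f where "ON m f" using ex by blast
      then show ?thesis using Y(2) unfolding ON_def by (intro bound[of m f]) auto
    qed
    ultimately show ?thesis
      using GreatestI_nat[of "\<lambda>m. \<exists>f. ON m f" 0 N] Greatest_le_nat[of "\<lambda>m. \<exists>f. ON m f" _ N] by blast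
  qed
  then obtain d f where ON: "ON d f" and max: "\<And>m f'. ON m f' \<Longrightarrow> m \<le> d" by blast
  have fY: "i < d \<Longrightarrow> f i \<in> Y" and fX: "i < d \<Longrightarrow> f i \<in> X" for i using ON Y(2) by (auto simp: ON_def)
  have ff: "i < d \<Longrightarrow> j < d \<Longrightarrow> a (f i) (f j) = (if i = j then 1 else 0)" for i j using ON by (auto simp: ON_def)
  have res: "\<exists>r. r \<in> Y \<and> a r r = 0 \<and> w = (\<lambda>x. (\<Sum>i<d. a w (f i) *\<^sub>R f i x) + 1 *\<^sub>R r x)" if w: "w \<in> Y" for w
  proof -
    let ?s = "\<lambda>x. \<Sum>i<d. a w (f i) *\<^sub>R f i x"
    let ?r = "\<lambda>x. w x + (-1) *\<^sub>R ?s x"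
    have wX: "w \<in> X" using w Y by blast
    have sX: "?s \<in> X" by (rule a.sum_closed[OF fX])
    have sY: "?s \<in> Y" by (rule Y.sum_closed[OF fY])
    have rY: "?r \<in> Y" by (rule Y.comb[OF w sY])
    then have rX: "?r \<in> X" using Y by blast
    have rf: "a ?r (f j) = 0" if j: "j < d" for j
    proof -
      have "a ?s (f j) = (\<Sum>i<d. a w (f i) * a (f i) (f j))" by (intro a.sum_left fX j)
      also have "\<dots> = (\<Sum>i<d. if i = j then a w (f i) else 0)" using j by (intro sum.cong) (auto simp: ff)
      finally have "a ?s (f j) = a w (f j)" using j by simp
      then show ?thesis using a.lin[OF wX sX fX[OF j], of "-1"] by simp
    qed
    \<comment> \<open>Otherwise the normalised remainder would prolong a family of maximal
      length.\<close>
    have "a ?r ?r = 0"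
    proof (rule ccontr)
      assume n: "a ?r ?r \<noteq> 0"
      define \<rho> where "\<rho> = a ?r ?r"
      have \<rho>: "\<rho> > 0" using n a.nonneg[OF rX] by (simp add: \<rho>_def)
      define e where "e = (\<lambda>x. 0 + (1 / sqrt \<rho>) *\<^sub>R ?r x)"
      have eY: "e \<in> Y" unfolding e_def by (rule Y.comb[OF Y.zero rY])
      then have eX: "e \<in> X" using Y by blast
      have ew: "a e v = (1 / sqrt \<rho>) * a ?r v" if "v \<in> X" for v
        unfolding e_def using a.lin[OF a.zero rX that, of "1 / sqrt \<rho>"] a.zero_left[OF that] by simp
      have ef: "a e (f j) = 0" "a (f j) e = 0" if "j < d" for j
        using ew[OF fX[OF that]] rf[OF that] a.sym[OF eX fX[OF that]] by auto
      have "a e e = 1"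
      proof -
        have "a e e = (1 / sqrt \<rho>) * a e ?r" using ew[OF eX] a.sym[OF rX eX] by simp
        also have "\<dots> = (1 / sqrt \<rho>) * ((1 / sqrt \<rho>) * \<rho>)" using ew[OF rX] by (simp add: \<rho>_def)
        also have "\<dots> = 1" using \<rho> by (simp add: real_divide_square_eq)
        finally show ?thesis .
      qed
      then have "ON (Suc d) (\<lambda>i. if i < d then f i else e)"
        unfolding ON_def using fY eY ff ef by (auto simp: less_Suc_eq)
      then show False using max by fastforce
    qed
    moreover have "w = (\<lambda>x. ?s x + 1 *\<^sub>R ?r x)" by auto
    ultimately show ?thesis using rY by blast
  qed
  define B where "B i j = b (f i) (f j)" for i j
  have aY: "a w w = (\<Sum>i<d. (a w (f i))\<^sup>2)" and bY: "b w w = (\<Sum>i<d. \<Sum>j<d. a w (f i) * a w (f j) * B i j)" if w: "w \<in> Y" for w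
  proof -
    let ?s = "\<lambda>x. \<Sum>i<d. a w (f i) *\<^sub>R f i x"
    obtain r where r: "r \<in> Y" "a r r = 0" "w = (\<lambda>x. ?s x + 1 *\<^sub>R r x)" using res[OF w] by blast
    have rX: "r \<in> X" and wX: "w \<in> X" using r w Y by auto
    have sX: "?s \<in> X" by (rule a.sum_closed[OF fX])
    have "a ?s r = 0" using a.null_left[OF rX sX r(2)] a.sym[OF rX sX] by simp
    moreover have "a w w = a (\<lambda>x. ?s x + 1 *\<^sub>R r x) (\<lambda>x. ?s x + 1 *\<^sub>R r x)" by (rule arg_cong2[OF r(3) r(3)])
    ultimately have "a w w = a ?s ?s" using a.quadratic[OF sX rX, of 1] r(2) by simp
    also have "\<dots> = (\<Sum>i<d. a w (f i) * a (f i) ?s)" by (rule a.sum_left[OF fX sX])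
    also have "\<dots> = (\<Sum>i<d. (a w (f i))\<^sup>2)"
    proof (intro sum.cong refl)
      fix i assume i: "i \<in> {..<d}"
      have "a (f i) ?s = (\<Sum>j<d. a w (f j) * a (f i) (f j))" using i by (intro a.sum_right fX) auto
      also have "\<dots> = (\<Sum>j<d. if j = i then a w (f j) else 0)" using i by (intro sum.cong) (auto simp: ff)
      finally show "a w (f i) * a (f i) ?s = (a w (f i))\<^sup>2" using i by (simp add: power2_eq_square)
    qed
    finally show "a w w = (\<Sum>i<d. (a w (f i))\<^sup>2)" .
    have rb: "b r r = 0" by (rule null[OF rX r(2)])
    have "b ?s r = 0" using b.null_left[OF rX sX rb] b.sym[OF rX sX] by simp
    moreover have "b w w = b (\<lambda>x. ?s x + 1 *\<^sub>R r x) (\<lambda>x. ?s x + 1 *\<^sub>R r x)" by (rule arg_cong2[OF r(3) r(3)])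
    ultimately have "b w w = b ?s ?s" using b.quadratic[OF sX rX, of 1] rb by simp
    also have "\<dots> = (\<Sum>i<d. a w (f i) * b (f i) ?s)" by (rule b.sum_left[OF fX sX])
    also have "\<dots> = (\<Sum>i<d. \<Sum>j<d. a w (f i) * a w (f j) * B i j)"
    proof (intro sum.cong refl)
      fix i assume i: "i \<in> {..<d}"
      then have "b (f i) ?s = (\<Sum>j<d. a w (f j) * b (f i) (f j))" by (intro b.sum_right fX) auto
      then show "a w (f i) * b (f i) ?s = (\<Sum>j<d. a w (f i) * a w (f j) * B i j)"
        by (simp add: sum_distrib_left B_def mult.assoc)
    qed
    finally show "b w w = (\<Sum>i<d. \<Sum>j<d. a w (f i) * a w (f j) * B i j)" .
  qed
  have "d \<ge> 1" using bY[OF u(1)] u(2) by (cases d) auto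
  then obtain c where c: "(\<Sum>i<d. (c i)\<^sup>2) = 1"
    "\<And>c'. (\<Sum>i<d. (c' i)\<^sup>2) = 1 \<Longrightarrow> (\<Sum>i<d. \<Sum>j<d. c' i * c' j * B i j) \<le> (\<Sum>i<d. \<Sum>j<d. c i * c j * B i j)"
    using quadratic_form_max_sphere[of d B] by blast
  define v where "v = (\<lambda>x. \<Sum>i<d. c i *\<^sub>R f i x)"
  have vY: "v \<in> Y" unfolding v_def by (rule Y.sum_closed[OF fY])
  have vc: "a v (f j) = c j" if j: "j < d" for j
  proof -
    have "a v (f j) = (\<Sum>i<d. c i * a (f i) (f j))" unfolding v_def by (intro a.sum_left fX j)
    also have "\<dots> = (\<Sum>i<d. if i = j then c i else 0)" using j by (intro sum.cong) (auto simp: ff)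
    finally show ?thesis using j by simp
  qed
  have av: "a v v = 1" using aY[OF vY] c(1) vc by simp
  have bv: "b v v = (\<Sum>i<d. \<Sum>j<d. c i * c j * B i j)" using bY[OF vY] vc by simp
  have "b w w \<le> b v v * a w w" if w: "w \<in> Y" for w
  proof (cases "a w w = 0")
    case True
    then show ?thesis using null w Y by auto
  next
    case False
    define s where "s = sqrt (a w w)"
    have s: "s > 0" "s\<^sup>2 = a w w" using False a.nonneg[of w] w Y by (auto simp: s_def)
    have "(\<Sum>i<d. (a w (f i) / s)\<^sup>2) = 1"
      using aY[OF w] s False by (simp add: power_divide sum_divide_distrib[symmetric])
    from c(2)[OF this] have "(\<Sum>i<d. \<Sum>j<d. (a w (f i) / s) * (a w (f j) / s) * B i j) \<le> b v v" using bv by simp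
    also have "(\<Sum>i<d. \<Sum>j<d. (a w (f i) / s) * (a w (f j) / s) * B i j) = b w w / s\<^sup>2"
      unfolding bY[OF w] sum_divide_distrib by (intro sum.cong refl) (simp add: power2_eq_square)
    finally have "b w w / s\<^sup>2 \<le> b v v" .
    then have "b w w \<le> b v v * s\<^sup>2" using s(1) by (simp add: pos_divide_le_eq)
    then show ?thesis using s(2) by simp
  qed
  with that vY av show ?thesis by blast
qed

text \<open>
  Eigenvectors are constructed one after the other by maximizing b/a on the b-orthogonal complement
  of the previous ones.
\<close>

lemma eigenvectors:
  fixes k :: nat
  assumes test: "\<And>m w. m < k \<Longrightarrow> (\<And>j. j < m \<Longrightarrow> w j \<in> X) \<Longrightarrow> \<exists>u\<in>X. (\<forall>j<m. b u (w j) = 0) \<and> b u u > 0 \<and> a u u \<le> \<mu> * b u u"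
  shows "\<exists>w l. (\<forall>j<k. w j \<in> X \<and> 0 < l j \<and> l j \<le> \<mu> \<and> (\<forall>v\<in>X. a (w j) v = l j * b (w j) v)) \<and>
    (\<forall>i<k. \<forall>j<k. b (w i) (w j) = (if i = j then 1 else 0))"
proof -
  have "m \<le> k \<Longrightarrow> \<exists>w l. (\<forall>j<m. w j \<in> X \<and> 0 < l j \<and> l j \<le> \<mu> \<and> (\<forall>v\<in>X. a (w j) v = l j * b (w j) v)) \<and>
    (\<forall>i<m. \<forall>j<m. b (w i) (w j) = (if i = j then 1 else 0))" for m
  proof (induction m)
    case (Suc m)
    from Suc.prems have "m \<le> k" by simp
    from Suc.IH[OF this] obtain w l where
      IH: "\<forall>j<m. w j \<in> X \<and> 0 < l j \<and> l j \<le> \<mu> \<and> (\<forall>v\<in>X. a (w j) v = l j * b (w j) v)"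
      and IH': "\<forall>i<m. \<forall>j<m. b (w i) (w j) = (if i = j then 1 else 0)"
      by (elim exE conjE) (rule that; assumption)
    have wX: "\<And>j. j < m \<Longrightarrow> w j \<in> X" and l: "\<And>j. j < m \<Longrightarrow> 0 < l j \<and> l j \<le> \<mu>"
      and ev: "\<And>j v. j < m \<Longrightarrow> v \<in> X \<Longrightarrow> a (w j) v = l j * b (w j) v"
      and on: "\<And>i j. i < m \<Longrightarrow> j < m \<Longrightarrow> b (w i) (w j) = (if i = j then 1 else 0)"
      using IH IH' by blast+
    obtain u where u: "u \<in> X" "\<And>j. j < m \<Longrightarrow> b u (w j) = 0" "b u u > 0" "a u u \<le> \<mu> * b u u"
      using test[of m w] Suc.prems wX by auto
    define Y where "Y = {v \<in> X. \<forall>j<m. b v (w j) = 0}"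
    have Y: "function_space Y"
      by unfold_locales (auto simp: Y_def a.zero a.comb b.zero_left b.lin wX)
    have YX: "Y \<subseteq> X" by (auto simp: Y_def)
    have uY: "u \<in> Y" using u by (auto simp: Y_def)
    obtain v where v: "v \<in> Y" "a v v = 1" and max: "\<And>w. w \<in> Y \<Longrightarrow> b w w \<le> b v v * a w w"
      using maximizer[OF Y YX uY u(3)] by blast
    have vX: "v \<in> X" using v YX by blast
    define \<beta> where "\<beta> = b v v"
    have au: "a u u > 0" using null[OF u(1)] u(3) a.nonneg[OF u(1)] by (cases "a u u = 0") auto
    have "0 < \<mu> * b u u" using au u(4) by simp
    then have \<mu>: "\<mu> > 0" using u(3) by (simp add: zero_less_mult_iff)
    \<comment> \<open>The test vector bounds the maximal quotient \<beta> from below by 1 / \<mu>,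
      so the new eigenvalue 1 / \<beta> does not exceed \<mu>.\<close>
    have "b u u \<le> \<beta> * a u u" using max[OF uY] by (simp add: \<beta>_def)
    then have \<beta>u: "\<beta> * a u u > 0" using u(3) by simp
    then have \<beta>: "\<beta> > 0" using au by (simp add: zero_less_mult_iff)
    have "a u u \<le> \<mu> * (\<beta> * a u u)"
      using u(4) mult_left_mono[OF \<open>b u u \<le> \<beta> * a u u\<close>, of \<mu>] \<mu> by linarith
    then have "1 \<le> \<mu> * \<beta>" using au by (simp add: mult.assoc[symmetric])
    then have l\<mu>: "1 / \<beta> \<le> \<mu>" using \<beta> by (simp add: divide_le_eq)
    \<comment> \<open>Maximality of \<beta> says that \<open>\<beta> * a x y - b x y\<close> is
      semidefinite on Y, and v is a null vector of it. By \<open>null_left\<close> the form then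
      vanishes between v and all of Y: the Euler-Lagrange equation without differentiation.\<close>
    have form: "psd_form Y (\<lambda>x y. \<beta> * a x y - b x y)"
    proof (intro psd_form.intro Y psd_form_axioms.intro)
      fix x y z c assume xyz: "x \<in> Y" "y \<in> Y" "z \<in> Y"
      then have X: "x \<in> X" "y \<in> X" "z \<in> X" using YX by auto
      show "\<beta> * a x y - b x y = \<beta> * a y x - b y x" using a.sym[OF X(1,2)] b.sym[OF X(1,2)] by simp
      show "\<beta> * a (\<lambda>t. x t + c *\<^sub>R y t) z - b (\<lambda>t. x t + c *\<^sub>R y t) z = \<beta> * a x z - b x z + c * (\<beta> * a y z - b y z)"
        by (simp add: a.lin[OF X] b.lin[OF X] algebra_simps)
      show "0 \<le> \<beta> * a x x - b x x" using max[OF xyz(1)] by (simp add: \<beta>_def)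
    qed
    have vY: "\<beta> * a v y - b v y = 0" if "y \<in> Y" for y
      using psd_form.null_left[OF form v(1) that] v(2) by (simp add: \<beta>_def)
    \<comment> \<open>Passage from Y to X: the part of y along the earlier eigenvectors is removed.
      It does not contribute, since v is orthogonal to these in b and, by their eigenvalue equation,
      also in a.\<close>
    have vev: "a v y = 1 / \<beta> * b v y" if y: "y \<in> X" for y
    proof -
      let ?s = "\<lambda>x. \<Sum>j<m. b y (w j) *\<^sub>R w j x"
      let ?r = "\<lambda>x. y x + (-1) *\<^sub>R ?s x"
      have sX: "?s \<in> X" by (rule a.sum_closed[OF wX])
      have rX: "?r \<in> X" by (rule a.comb[OF y sX])
      have "b ?r (w j) = 0" if j: "j < m" for j
      proof -
        have "b ?s (w j) = (\<Sum>i<m. b y (w i) * b (w i) (w j))" by (intro b.sum_left wX j)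
        also have "\<dots> = (\<Sum>i<m. if i = j then b y (w i) else 0)" using j by (intro sum.cong) (auto simp: on)
        finally have "b ?s (w j) = b y (w j)" using j by simp
        then show ?thesis using b.lin[OF y sX wX[OF j], of "-1"] by simp
      qed
      then have rY: "?r \<in> Y" using rX by (simp add: Y_def)
      have bvw: "b v (w j) = 0" if "j < m" for j using v that by (simp add: Y_def)
      have avw: "a v (w j) = 0" if "j < m" for j
        using ev[OF that vX] bvw[OF that] a.sym[OF vX wX[OF that]] b.sym[OF vX wX[OF that]] by simp
      have "a v ?s = 0" "b v ?s = 0"
        using a.sum_right[OF wX vX] b.sum_right[OF wX vX] avw bvw by simp_all
      then have "a v ?r = a v y" "b v ?r = b v y"
        using a.lin_right[OF y sX vX, of "-1"] b.lin_right[OF y sX vX, of "-1"] by simp_all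
      then show ?thesis using vY[OF rY] \<beta> by (simp add: field_simps)
    qed
    define e where "e = (\<lambda>x. 0 + (1 / sqrt \<beta>) *\<^sub>R v x)"
    have eX: "e \<in> X" unfolding e_def by (rule a.comb[OF a.zero vX])
    have be: "b e y = 1 / sqrt \<beta> * b v y" and ae: "a e y = 1 / sqrt \<beta> * a v y" if "y \<in> X" for y
      unfolding e_def using a.lin[OF a.zero vX that] b.lin[OF a.zero vX that] a.zero_left[OF that] b.zero_left[OF that] by simp_all
    have "a e y = 1 / \<beta> * b e y" if "y \<in> X" for y using vev[OF that] be[OF that] ae[OF that] by simp
    moreover have "b e e = 1"
    proof -
      have "b e e = 1 / sqrt \<beta> * b e v" using be[OF eX] b.sym[OF vX eX] by simp
      also have "\<dots> = 1 / sqrt \<beta> * (1 / sqrt \<beta> * \<beta>)" using be[OF vX] by (simp add: \<beta>_def)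
      also have "\<dots> = 1" using \<beta> by (simp add: real_divide_square_eq)
      finally show ?thesis .
    qed
    moreover have "b e (w j) = 0 \<and> b (w j) e = 0" if "j < m" for j
      using be[OF wX[OF that]] v that b.sym[OF eX wX[OF that]] by (simp add: Y_def)
    ultimately show ?case
      using wX l ev on eX l\<mu> \<beta>
      by (intro exI[of _ "\<lambda>j. if j < m then w j else e"] exI[of _ "\<lambda>j. if j < m then l j else 1 / \<beta>"])
        (auto simp: less_Suc_eq)
  qed simp
  then show ?thesis by blast
qed

end

section \<open>Dimensions modulo equality almost everywhere\<close>

lemma ae_dim_ge:
  assumes "\<And>i. i < m \<Longrightarrow> u i \<in> E"
    "\<And>c :: nat \<Rightarrow> real. (AE x in lebesgue_on \<Omega>. (\<Sum>i<m. c i *\<^sub>R u i x) = 0) \<Longrightarrow> \<forall>i<m. c i = 0"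
  shows "enat m \<le> ae_dim \<Omega> E"
  unfolding ae_dim_def using assms by (intro Sup_upper) blast

text \<open>The supremum may be infinite and need not be attained, but it exceeds m - 1, which
  yields an independent family of at least m members; a prefix of it is still independent.\<close>

lemma ae_dim_family:
  assumes "enat m \<le> ae_dim \<Omega> E"
  obtains u where "\<And>i. i < m \<Longrightarrow> u i \<in> E"
    "\<And>c :: nat \<Rightarrow> real. (AE x in lebesgue_on \<Omega>. (\<Sum>i<m. c i *\<^sub>R u i x) = 0) \<Longrightarrow> \<forall>i<m. c i = 0"
proof (cases "m = 0")
  case True
  then show ?thesis using that by simp
next
  case False
  let ?S = "{enat m | m. \<exists>u. (\<forall>i<m. u i \<in> E) \<and>
     (\<forall>c::nat \<Rightarrow> real. (AE x in lebesgue_on \<Omega>. (\<Sum>i<m. c i *\<^sub>R u i x) = 0) \<longrightarrow> (\<forall>i<m. c i = 0))}"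
  have "\<not> Sup ?S \<le> enat (m - 1)"
    using assms False unfolding ae_dim_def[symmetric] by (meson diff_less enat_ord_simps(2) less_one linorder_not_less neq0_conv order_trans)
  then obtain n where n: "n \<in> ?S" "\<not> n \<le> enat (m - 1)" by (meson Sup_least)
  then obtain M u where M: "n = enat M" and u: "\<forall>i<M. u i \<in> E"
    "\<forall>c::nat \<Rightarrow> real. (AE x in lebesgue_on \<Omega>. (\<Sum>i<M. c i *\<^sub>R u i x) = 0) \<longrightarrow> (\<forall>i<M. c i = 0)" by blast
  have mM: "m \<le> M" using n M False by simp
  show ?thesis
  proof (rule that[of u])
    show "u i \<in> E" if "i < m" for i using u that mM by simp
    fix c :: "nat \<Rightarrow> real" assume c: "AE x in lebesgue_on \<Omega>. (\<Sum>i<m. c i *\<^sub>R u i x) = 0"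
    define c' where "c' i = (if i < m then c i else 0)" for i
    have "(\<Sum>i<M. c' i *\<^sub>R u i x) = (\<Sum>i<m. c i *\<^sub>R u i x)" for x
      using mM by (intro sum.mono_neutral_cong_right) (auto simp: c'_def)
    then have "\<forall>i<M. c' i = 0" using u(2) c by simp
    then have "c' i = 0" if "i < m" for i using that mM by simp
    then show "\<forall>i<m. c i = 0" by (simp add: c'_def)
  qed
qed

text \<open>Multiplicities are not known to be finite here; finite shares that add up to exactly k
  are extracted from them.\<close>

lemma enat_sum_split:
  fixes d :: "'i \<Rightarrow> enat"
  assumes "finite \<Lambda>" "enat k \<le> (\<Sum>l\<in>\<Lambda>. d l)"
  shows "\<exists>n. (\<forall>l\<in>\<Lambda>. enat (n l) \<le> d l) \<and> (\<Sum>l\<in>\<Lambda>. n l) = k"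
  using assms
proof (induction \<Lambda> arbitrary: k rule: finite_induct)
  case empty
  then show ?case by (simp add: zero_enat_def)
next
  case (insert l \<Lambda>)
  obtain k1 k2 where k: "k = k1 + k2" "enat k1 \<le> d l" "enat k2 \<le> (\<Sum>l\<in>\<Lambda>. d l)"
  proof (cases "d l")
    case (enat n)
    show ?thesis
    proof (cases "k \<le> n")
      case True
      then show ?thesis using that[of k 0] enat by (simp add: zero_enat_def[symmetric])
    next
      case False
      have "enat k \<le> enat n + (\<Sum>l\<in>\<Lambda>. d l)" using insert enat by simp
      then have "enat (k - n) \<le> (\<Sum>l\<in>\<Lambda>. d l)"
        by (cases "\<Sum>l\<in>\<Lambda>. d l") auto
      then show ?thesis using that[of n "k - n"] False enat by simp
    qed
  next
    case infinity
    then show ?thesis using that[of k 0] by (simp add: zero_enat_def[symmetric])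
  qed
  obtain n where n: "\<forall>l\<in>\<Lambda>. enat (n l) \<le> d l" "(\<Sum>l\<in>\<Lambda>. n l) = k2" using insert.IH[OF k(3)] by blast
  have "(\<Sum>l'\<in>\<Lambda>. if l' = l then k1 else n l') = (\<Sum>l'\<in>\<Lambda>. n l')" using insert by (intro sum.cong) auto
  then show ?case using n k insert by (intro exI[of _ "\<lambda>l'. if l' = l then k1 else n l'"]) auto
qed

section \<open>The discrete problem\<close>

context psd_form
begin

text \<open>Gram-Schmidt for a semidefinite form: the new function is first made orthogonal to the
  previous ones, leaving ?r. If its square is 0, the division by zero sets \<alpha> = 0, which is
  right because ?r is then orthogonal to everything.\<close>

lemma projection:
  fixes m :: nat
  assumes "\<And>i. i < m \<Longrightarrow> f i \<in> X" "u \<in> X"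
  shows "\<exists>c. \<forall>i<m. q (\<lambda>x. u x + (-1) *\<^sub>R (\<Sum>j<m. c j *\<^sub>R f j x)) (f i) = 0"
  using assms
proof (induction m arbitrary: u)
  case (Suc m)
  have fX: "f i \<in> X" if "i < m" for i using Suc.prems that by simp
  have eX: "f m \<in> X" and uX: "u \<in> X" using Suc.prems by auto
  obtain c where c: "\<And>i. i < m \<Longrightarrow> q (\<lambda>x. u x + (-1) *\<^sub>R (\<Sum>j<m. c j *\<^sub>R f j x)) (f i) = 0"
    using Suc.IH[OF fX uX] by blast
  obtain d where d: "\<And>i. i < m \<Longrightarrow> q (\<lambda>x. f m x + (-1) *\<^sub>R (\<Sum>j<m. d j *\<^sub>R f j x)) (f i) = 0"
    using Suc.IH[OF fX eX] by blast
  let ?w = "\<lambda>x. u x + (-1) *\<^sub>R (\<Sum>j<m. c j *\<^sub>R f j x)" and ?r = "\<lambda>x. f m x + (-1) *\<^sub>R (\<Sum>j<m. d j *\<^sub>R f j x)"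
  have wX: "?w \<in> X" by (rule comb[OF uX sum_closed[OF fX]])
  have rX: "?r \<in> X" by (rule comb[OF eX sum_closed[OF fX]])
  define \<alpha> where "\<alpha> = q ?w ?r / q ?r ?r"
  define c' where "c' j = (if j = m then \<alpha> else c j - \<alpha> * d j)" for j
  let ?v = "\<lambda>x. ?w x + (- \<alpha>) *\<^sub>R ?r x"
  have s: "(\<Sum>j<m. c' j *\<^sub>R f j x) = (\<Sum>j<m. c j *\<^sub>R f j x) - \<alpha> *\<^sub>R (\<Sum>j<m. d j *\<^sub>R f j x)" for x
    by (simp add: c'_def algebra_simps scaleR_sum_right sum_subtractf)
  have c'm: "c' m = \<alpha>" by (simp add: c'_def)
  have v: "(\<lambda>x. u x + (-1) *\<^sub>R (\<Sum>j<Suc m. c' j *\<^sub>R f j x)) = ?v"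
    unfolding sum.lessThan_Suc s c'm by (simp add: algebra_simps)
  have vf: "q ?v (f i) = 0" if "i < m" for i
    using lin[OF wX rX fX[OF that], of "- \<alpha>"] c[OF that] d[OF that] by simp
  have vX: "?v \<in> X" by (rule comb[OF wX rX])
  have vr: "q ?v ?r = 0"
  proof (cases "q ?r ?r = 0")
    case True
    then have "q ?r ?v = 0" by (rule null_left[OF rX vX])
    then show ?thesis using sym[OF rX vX] by simp
  next
    case False
    then show ?thesis using lin[OF wX rX rX, of "- \<alpha>"] by (simp add: \<alpha>_def)
  qed
  have sX: "(\<lambda>x. \<Sum>j<m. d j *\<^sub>R f j x) \<in> X" by (rule sum_closed[OF fX])
  have "q ?v (\<lambda>x. \<Sum>j<m. d j *\<^sub>R f j x) = 0" using sum_right[OF fX vX, where c = d] vf by simp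
  then have "q ?v (f m) = 0"
    using vr lin_right[OF eX sX vX, of "-1"] by simp
  then show ?case using v vf by (intro exI[of _ c']) (auto simp: less_Suc_eq)
qed simp

end

section \<open>Local coordinates of discrete functions\<close>

context mesh
begin

text \<open>The triple \<gamma> holds the gradient of the affine part, its constant and the bubble
  coefficient. As a vector in a Euclidean space it brings a basis and a dimension along.\<close>

definition "ev T \<gamma> x = fst \<gamma> \<bullet> x + fst (snd \<gamma>) + snd (snd \<gamma>) * full_simplex.bub (vertices T) x"
  for \<gamma> :: "'a \<times> real \<times> real"
definition "gev T \<gamma> x = fst \<gamma> + snd (snd \<gamma>) *\<^sub>R full_simplex.gbub (vertices T) x"
  for \<gamma> :: "'a \<times> real \<times> real"

lemma linear_ev: "linear (\<lambda>\<gamma>. ev T \<gamma> x)"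
  by (rule linearI) (auto simp: ev_def inner_simps algebra_simps)

lemma ev_add_cmult: "ev T (\<gamma> + c *\<^sub>R \<delta>) x = ev T \<gamma> x + c * ev T \<delta> x"
  using linear_add[OF linear_ev] linear_scale[OF linear_ev] by (metis real_scaleR_def)

lemma ev_continuous: "T \<in> \<T> \<Longrightarrow> continuous_on S (ev T \<gamma>)"
  and gev_continuous: "T \<in> \<T> \<Longrightarrow> continuous_on S (gev T \<gamma>)"
proof -
  assume T: "T \<in> \<T>"
  interpret S: full_simplex "vertices T" by (rule full_simplex[OF T])
  show "continuous_on S (ev T \<gamma>)" unfolding ev_def[abs_def] by (intro continuous_intros S.cont_bub)
  show "continuous_on S (gev T \<gamma>)" unfolding gev_def[abs_def] by (intro continuous_intros S.cont_gbub)
qed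

lemma ev_derivative: "T \<in> \<T> \<Longrightarrow> (ev T \<gamma> has_derivative (\<lambda>v. gev T \<gamma> x \<bullet> v)) (at x)"
proof -
  assume T: "T \<in> \<T>"
  interpret S: full_simplex "vertices T" by (rule full_simplex[OF T])
  show ?thesis unfolding ev_def[abs_def] gev_def
    by (auto intro!: derivative_eq_intros S.bub_derivative simp: inner_simps)
qed

text \<open>Only interiors are constrained, in accordance with discrete functions being arbitrary on
  the skeleton.\<close>

definition "loc v \<gamma> \<longleftrightarrow> (\<forall>T\<in>\<T>. \<forall>x\<in>interior T. v x = ev T (\<gamma> T) x)"

lemma loc_derivative:
  assumes "loc v \<gamma>" "T \<in> \<T>" "x \<in> interior T"
  shows "(v has_derivative (\<lambda>w. gev T (\<gamma> T) x \<bullet> w)) (at x)" "gradient v x = gev T (\<gamma> T) x"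
proof -
  show "(v has_derivative (\<lambda>w. gev T (\<gamma> T) x \<bullet> w)) (at x)"
    using assms by (intro has_derivative_transform_within_open[OF ev_derivative[OF assms(2)] open_interior assms(3)])
      (auto simp: loc_def)
  then show "gradient v x = gev T (\<gamma> T) x" by (rule gradient_eqI)
qed

lemma P1_local: "v \<in> P1 \<T> \<Longrightarrow> \<exists>b e. \<forall>T\<in>\<T>. \<forall>x\<in>interior T. v x = b T \<bullet> x + e T"
proof -
  assume v: "v \<in> P1 \<T>"
  have "\<forall>T\<in>\<T>. \<exists>p. \<forall>x\<in>interior T. v x = fst p \<bullet> x + snd p"
  proof
    fix T assume "T \<in> \<T>"
    then obtain b e where "\<forall>x\<in>interior T. v x = b \<bullet> x + e" using v unfolding P1_def by blast
    then show "\<exists>p. \<forall>x\<in>interior T. v x = fst p \<bullet> x + snd p" by (intro exI[of _ "(b, e)"]) simp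
  qed
  from bchoice[OF this] obtain p where "\<forall>T\<in>\<T>. \<forall>x\<in>interior T. v x = fst (p T) \<bullet> x + snd (p T)" ..
  then show ?thesis by (intro exI[of _ "\<lambda>T. fst (p T)"] exI[of _ "\<lambda>T. snd (p T)"])
qed

lemma bubbles_local: "w \<in> bubbles \<T> \<Longrightarrow> \<exists>t. \<forall>T\<in>\<T>. \<forall>x\<in>interior T. w x = t T * full_simplex.bub (vertices T) x"
  unfolding bubbles_def using bubble_sum_local by auto

lemma V_pw_loc: "v \<in> V_pw \<T> \<Longrightarrow> \<exists>\<gamma>. loc v \<gamma>"
proof -
  assume "v \<in> V_pw \<T>"
  then obtain p w where "v = (\<lambda>x. p x + w x)" "p \<in> P1 \<T>" "w \<in> bubbles \<T>" by (auto simp: V_pw_def)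
  obtain b e where "\<forall>T\<in>\<T>. \<forall>x\<in>interior T. p x = b T \<bullet> x + e T" using P1_local[OF \<open>p \<in> P1 \<T>\<close>] by blast
  moreover obtain t where "\<forall>T\<in>\<T>. \<forall>x\<in>interior T. w x = t T * full_simplex.bub (vertices T) x"
    using bubbles_local[OF \<open>w \<in> bubbles \<T>\<close>] by blast
  ultimately show ?thesis using \<open>v = _\<close> by (intro exI[of _ "\<lambda>T. (b T, e T, t T)"]) (simp add: loc_def ev_def)
qed

lemma V_nc_loc:
  assumes "v \<in> V_nc \<Omega> \<T>"
  obtains p \<gamma> where "p \<in> CR01 \<Omega> \<T>" "loc v \<gamma>" "\<And>T x. T \<in> \<T> \<Longrightarrow> x \<in> interior T \<Longrightarrow> p x = fst (\<gamma> T) \<bullet> x + fst (snd (\<gamma> T))"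
proof -
  obtain p w where v: "v = (\<lambda>x. p x + w x)" "p \<in> CR01 \<Omega> \<T>" "w \<in> bubbles \<T>" using assms by (auto simp: V_nc_def)
  then have "p \<in> P1 \<T>" by (simp add: CR01_def)
  obtain b e where be: "\<forall>T\<in>\<T>. \<forall>x\<in>interior T. p x = b T \<bullet> x + e T" using P1_local[OF \<open>p \<in> P1 \<T>\<close>] by blast
  obtain t where t: "\<forall>T\<in>\<T>. \<forall>x\<in>interior T. w x = t T * full_simplex.bub (vertices T) x"
    using bubbles_local[OF v(3)] by blast
  show ?thesis
    by (rule that[of p "\<lambda>T. (b T, e T, t T)"]) (use v be t in \<open>auto simp: loc_def ev_def\<close>)
qed

lemma V_nc_subset_V_pw: "V_nc \<Omega> \<T> \<subseteq> V_pw \<T>"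
  by (auto simp: V_nc_def V_pw_def CR01_def)

lemma P1_add_cmult: "u \<in> P1 \<T> \<Longrightarrow> v \<in> P1 \<T> \<Longrightarrow> (\<lambda>x. u x + c * v x) \<in> P1 \<T>"
proof -
  assume "u \<in> P1 \<T>" "v \<in> P1 \<T>"
  then obtain b e b' e' where uv: "\<forall>T\<in>\<T>. \<forall>x\<in>interior T. u x = b T \<bullet> x + e T" "\<forall>T\<in>\<T>. \<forall>x\<in>interior T. v x = b' T \<bullet> x + e' T"
    using P1_local[of u] P1_local[of v] by auto
  then have "\<forall>T\<in>\<T>. \<forall>x\<in>interior T. u x + c * v x = (b T + c *\<^sub>R b' T) \<bullet> x + (e T + c * e' T)"
    by (simp add: inner_simps algebra_simps)
  then show ?thesis unfolding P1_def by blast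
qed

lemma CR01_add_cmult:
  assumes u: "u \<in> CR01 \<Omega> \<T>" and v: "v \<in> CR01 \<Omega> \<T>"
  shows "(\<lambda>x. u x + c * v x) \<in> CR01 \<Omega> \<T>"
proof -
  have P1: "u \<in> P1 \<T>" "v \<in> P1 \<T>" using assms by (auto simp: CR01_def)
  have tr: "simplex_trace T (\<lambda>x. u x + c * v x) (mid F) = simplex_trace T u (mid F) + c * simplex_trace T v (mid F)"
    if T: "T \<in> \<T>" and F: "F facet_of T" for T F
  proof -
    obtain b e b' e' where be: "\<And>x. x \<in> interior T \<Longrightarrow> u x = b \<bullet> x + e" "\<And>x. x \<in> interior T \<Longrightarrow> v x = b' \<bullet> x + e'"
      using P1 T unfolding P1_def by blast
    have "u x + c * v x = (b + c *\<^sub>R b') \<bullet> x + (e + c * e')" if "x \<in> interior T" for x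
      using be[OF that] by (simp add: inner_simps algebra_simps)
    from simplex_trace_eq[OF T this mid_facet(2)[OF T F]] show ?thesis
      using simplex_trace_eq[OF T be(1) mid_facet(2)[OF T F]] simplex_trace_eq[OF T be(2) mid_facet(2)[OF T F]]
      by (simp add: inner_simps algebra_simps)
  qed
  have "simplex_trace T (\<lambda>x. u x + c * v x) (mid F) - simplex_trace T' (\<lambda>x. u x + c * v x) (mid F) = 0"
    if "F \<in> interior_faces \<Omega> \<T>" "T \<in> \<T>" "T' \<in> \<T>" "F facet_of T" "F facet_of T'" for F T T'
  proof -
    have "simplex_trace T u (mid F) - simplex_trace T' u (mid F) = 0" "simplex_trace T v (mid F) - simplex_trace T' v (mid F) = 0"
      using u v that unfolding CR01_def by blast+
    then show ?thesis using tr that by simp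
  qed
  moreover have "simplex_trace T (\<lambda>x. u x + c * v x) (mid F) = 0"
    if "F \<in> faces \<T> - interior_faces \<Omega> \<T>" "T \<in> \<T>" "F facet_of T" for F T
  proof -
    have "simplex_trace T u (mid F) = 0" "simplex_trace T v (mid F) = 0"
      using u v that unfolding CR01_def by blast+
    then show ?thesis using tr that by simp
  qed
  ultimately show ?thesis using P1_add_cmult[OF P1, of c] unfolding CR01_def by blast
qed

lemma bubbles_add_cmult: "u \<in> bubbles \<T> \<Longrightarrow> v \<in> bubbles \<T> \<Longrightarrow> (\<lambda>x. u x + c * v x) \<in> bubbles \<T>"
proof -
  assume "u \<in> bubbles \<T>" "v \<in> bubbles \<T>"
  then obtain s t where "u = (\<lambda>x. \<Sum>T\<in>\<T>. s T * bubble T x)" "v = (\<lambda>x. \<Sum>T\<in>\<T>. t T * bubble T x)"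
    by (auto simp: bubbles_def)
  then have "(\<lambda>x. u x + c * v x) = (\<lambda>x. \<Sum>T\<in>\<T>. (s T + c * t T) * bubble T x)"
    by (simp add: distrib_right sum.distrib sum_distrib_left mult.assoc)
  then show ?thesis unfolding bubbles_def by (intro CollectI exI[of _ "\<lambda>T. s T + c * t T"]) simp
qed

lemma V_pw_add_cmult:
  assumes "u \<in> V_pw \<T>" "v \<in> V_pw \<T>" shows "(\<lambda>x. u x + c * v x) \<in> V_pw \<T>"
proof -
  obtain p w p' w' where "u = (\<lambda>x. p x + w x)" "p \<in> P1 \<T>" "w \<in> bubbles \<T>" "v = (\<lambda>x. p' x + w' x)" "p' \<in> P1 \<T>" "w' \<in> bubbles \<T>"
    using assms by (auto simp: V_pw_def)
  then show ?thesis unfolding V_pw_def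
    by (intro CollectI exI[of _ "\<lambda>x. p x + c * p' x"] exI[of _ "\<lambda>x. w x + c * w' x"])
      (auto simp: algebra_simps intro: P1_add_cmult bubbles_add_cmult)
qed

lemma V_nc_add_cmult:
  assumes "u \<in> V_nc \<Omega> \<T>" "v \<in> V_nc \<Omega> \<T>" shows "(\<lambda>x. u x + c * v x) \<in> V_nc \<Omega> \<T>"
proof -
  obtain p w p' w' where "u = (\<lambda>x. p x + w x)" "p \<in> CR01 \<Omega> \<T>" "w \<in> bubbles \<T>" "v = (\<lambda>x. p' x + w' x)" "p' \<in> CR01 \<Omega> \<T>" "w' \<in> bubbles \<T>"
    using assms by (auto simp: V_nc_def)
  then show ?thesis unfolding V_nc_def
    by (intro CollectI exI[of _ "\<lambda>x. p x + c * p' x"] exI[of _ "\<lambda>x. w x + c * w' x"])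
      (auto simp: algebra_simps intro: CR01_add_cmult bubbles_add_cmult)
qed

lemma V_es_add_cmult:
  assumes "u \<in> V_es \<Omega> \<T>" "v \<in> V_es \<Omega> \<T>" shows "(\<lambda>x. u x + c *\<^sub>R v x) \<in> V_es \<Omega> \<T>"
proof -
  have "fst \<circ> (\<lambda>x. u x + c *\<^sub>R v x) = (\<lambda>x. (fst \<circ> u) x + c * (fst \<circ> v) x)"
    "snd \<circ> (\<lambda>x. u x + c *\<^sub>R v x) = (\<lambda>x. (snd \<circ> u) x + c * (snd \<circ> v) x)" by auto
  then show ?thesis
    using assms V_pw_add_cmult[of "fst \<circ> u" "fst \<circ> v" c] V_nc_add_cmult[of "snd \<circ> u" "snd \<circ> v" c]
    unfolding V_es_def by simp
qed

lemma V_es_zero: "(\<lambda>x. 0) \<in> V_es \<Omega> \<T>"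
proof -
  have b: "(\<lambda>x. 0) \<in> bubbles \<T>" unfolding bubbles_def by (intro CollectI exI[of _ "\<lambda>T. 0"]) simp
  have p: "(\<lambda>x. 0) \<in> P1 \<T>" unfolding P1_def by (auto intro!: exI[of _ 0])
  have "simplex_trace T (\<lambda>x. 0) (mid F) = 0" if "T \<in> \<T>" "F facet_of T" for T F
    using simplex_trace_eq[OF that(1), of "\<lambda>x. 0" 0 0] mid_facet[OF that] by simp
  then have c: "(\<lambda>x. 0) \<in> CR01 \<Omega> \<T>" using p unfolding CR01_def by auto
  have "(\<lambda>x. 0) \<in> V_pw \<T>" unfolding V_pw_def using b p by (auto intro!: exI[of _ "\<lambda>x. 0"])
  moreover have "(\<lambda>x. 0) \<in> V_nc \<Omega> \<T>" unfolding V_nc_def using b c by (auto intro!: exI[of _ "\<lambda>x. 0"])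
  ultimately show ?thesis by (simp add: V_es_def comp_def)
qed

lemma square_integrable_interior_cong:
  fixes f h :: "'a \<Rightarrow> 'b::euclidean_space"
  assumes T: "T \<in> \<T>" and e: "\<And>x. x \<in> interior T \<Longrightarrow> f x = h x"
  shows "square_integrable T f \<longleftrightarrow> square_integrable T h"
  unfolding square_integrable_cong_negligible[OF simplex_interior_cong[OF T]]
  unfolding square_integrable_def
  using e by (intro arg_cong2[of _ _ _ _ conj] measurable_cong Bochner_Integration.integrable_cong) auto

lemma loc_square_integrable:
  assumes "loc v \<gamma>" "T \<in> \<T>"
  shows "square_integrable T v" "square_integrable T (gradient v)"
  using assms loc_derivative(2)[OF assms]
    square_integrable_interior_cong[of T v "ev T (\<gamma> T)"] square_integrable_interior_cong[of T "gradient v" "gev T (\<gamma> T)"]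
  by (auto simp: loc_def square_integrable_poly ev_continuous gev_continuous)

lemma loc_square_integrable_\<Omega>: "loc v \<gamma> \<Longrightarrow> square_integrable \<Omega> v"
  using loc_square_integrable mesh_square_integrable by blast

definition "mean T v = (LINT x|lebesgue_on T. v x) / measure lebesgue T" for v :: "'a \<Rightarrow> real"

lemma measure_simplex_pos: "T \<in> \<T> \<Longrightarrow> measure lebesgue T > 0"
  using full_simplex.vol_pos[OF full_simplex] full_simplex.vol_def[OF full_simplex] simplex_eq by metis

lemma square_integrable_const: "T \<in> \<T> \<Longrightarrow> square_integrable T (\<lambda>x. c)"
  by (intro square_integrable_poly) auto

lemma square_integrable_imp_integrable:
  fixes v :: "'a \<Rightarrow> real"
  shows "T \<in> \<T> \<Longrightarrow> square_integrable T v \<Longrightarrow> integrable (lebesgue_on T) v"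
  using square_integrable_mult[OF _ square_integrable_const[of T 1], of v] by simp

lemma integral_simplex_const: "T \<in> \<T> \<Longrightarrow> (LINT x|lebesgue_on T. c) = c * measure lebesgue T" for c :: real
  by (simp add: measure_restrict_space)

lemma mean_add_cmult:
  assumes "T \<in> \<T>" "square_integrable T u" "square_integrable T v"
  shows "mean T (\<lambda>x. u x + c * v x) = mean T u + c * mean T v"
  using assms square_integrable_imp_integrable[of T u] square_integrable_imp_integrable[of T v]
  by (simp add: mean_def add_divide_distrib)

text \<open>\<open>Pi0\<close> is chosen among functions that satisfy the orthogonality relations.
  The piecewise mean shows that there is one; testing with the characteristic function of the
  interior of T determines the value on this interior for whichever was chosen.\<close>

lemma Pi0_eq:
  assumes v: "square_integrable \<Omega> v" and T: "T \<in> \<T>" "x \<in> interior T"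
  shows "Pi0 \<Omega> \<T> v x = mean T v"
proof -
  have sv: "square_integrable T v" if "T \<in> \<T>" for T using v that square_integrable_simplex by blast
  have main: "integrable (lebesgue_on T) (\<lambda>x. (v x - p x) * q x)"
      "(LINT x|lebesgue_on T. (v x - p x) * q x) = (mean T v - P) * Q * measure lebesgue T"
    if T: "T \<in> \<T>" and p: "\<And>x. x \<in> interior T \<Longrightarrow> p x = P" and q: "\<And>x. x \<in> interior T \<Longrightarrow> q x = Q" for T p q P Q
  proof -
    have i: "integrable (lebesgue_on T) v" "integrable (lebesgue_on T) (\<lambda>x. P)"
      using square_integrable_imp_integrable[OF T] sv[OF T] square_integrable_const[OF T] by auto
    then have ii: "integrable (lebesgue_on T) (\<lambda>x. (v x - P) * Q)" by auto
    then show "integrable (lebesgue_on T) (\<lambda>x. (v x - p x) * q x)"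
      using integral_interior_cong(2)[OF T, of "\<lambda>x. (v x - p x) * q x" "\<lambda>x. (v x - P) * Q"] p q by simp
    have "(LINT x|lebesgue_on T. (v x - p x) * q x) = (LINT x|lebesgue_on T. (v x - P) * Q)"
      by (rule integral_interior_cong(1)[OF T]) (simp add: p q)
    also have "\<dots> = ((LINT x|lebesgue_on T. v x) - P * measure lebesgue T) * Q"
      using i integral_simplex_const[OF T, of P] by simp
    also have "\<dots> = (mean T v - P) * Q * measure lebesgue T"
      using measure_simplex_pos[OF T] by (simp add: mean_def field_simps)
    finally show "(LINT x|lebesgue_on T. (v x - p x) * q x) = (mean T v - P) * Q * measure lebesgue T" .
  qed
  have P0: "\<exists>P. \<forall>T\<in>\<T>. \<forall>x\<in>interior T. p x = P T" if "p \<in> P0 \<T>" for p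
    using that unfolding P0_def by (intro bchoice) blast
  define p0 where "p0 = pw (\<lambda>T x. mean T v)"
  have p0: "p0 x = mean T v" if "T \<in> \<T>" "x \<in> interior T" for T x using pw_eq[OF that] by (simp add: p0_def)
  have "p0 \<in> P0 \<T>" using p0 by (auto simp: P0_def)
  moreover have "(LINT x|lebesgue_on \<Omega>. (v x - p0 x) * q x) = 0" if qP: "q \<in> P0 \<T>" for q
  proof -
    obtain Q where Q: "\<And>T x. T \<in> \<T> \<Longrightarrow> x \<in> interior T \<Longrightarrow> q x = Q T" using P0[OF qP] by blast
    show ?thesis using mesh_integral_sum[OF main(1)[OF _ p0 Q]] main(2)[OF _ p0 Q] by simp
  qed
  ultimately have ex: "\<exists>p. p \<in> P0 \<T> \<and> (\<forall>q\<in>P0 \<T>. (LINT x|lebesgue_on \<Omega>. (v x - p x) * q x) = 0)" by blast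
  define p where "p = Pi0 \<Omega> \<T> v"
  have p: "p \<in> P0 \<T>" "\<And>q. q \<in> P0 \<T> \<Longrightarrow> (LINT x|lebesgue_on \<Omega>. (v x - p x) * q x) = 0"
    using someI_ex[OF ex] unfolding p_def Pi0_def by blast+
  obtain P where P: "\<And>T x. T \<in> \<T> \<Longrightarrow> x \<in> interior T \<Longrightarrow> p x = P T" using P0[OF p(1)] by blast
  define q where "q = pw (\<lambda>T' x. if T' = T then 1 else 0)"
  have q: "q x = (if T' = T then 1 else 0)" if "T' \<in> \<T>" "x \<in> interior T'" for T' x
    using pw_eq[OF that] by (simp add: q_def)
  have "q \<in> P0 \<T>" using q unfolding P0_def by blast
  then have "0 = (LINT x|lebesgue_on \<Omega>. (v x - p x) * q x)" using p(2) by simp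
  also have "\<dots> = (\<Sum>T'\<in>\<T>. (mean T' v - P T') * (if T' = T then 1 else 0) * measure lebesgue T')"
    using mesh_integral_sum[OF main(1)[OF _ P q]] main(2)[OF _ P q] by simp
  also have "\<dots> = (\<Sum>T'\<in>\<T>. if T' = T then (mean T v - P T) * measure lebesgue T else 0)"
    by (intro sum.cong) auto
  also have "\<dots> = (mean T v - P T) * measure lebesgue T" using T by simp
  finally have "P T = mean T v" using measure_simplex_pos[OF T(1)] by simp
  then show ?thesis using P[OF T] by (simp add: p_def)
qed

end

section \<open>The discrete forms, simplex by simplex\<close>

locale scheme = mesh +
  fixes V :: "'a \<Rightarrow> real" and \<kappa> :: real
  assumes V_P0: "V \<in> P0 \<T>" and V_inf: "essinf \<Omega> V = 0" and eCR: "eCR_constant \<Omega> \<T> \<kappa>"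
begin

definition "VT T = (SOME c. \<forall>x\<in>interior T. V x = c)"

lemma V_eq: "T \<in> \<T> \<Longrightarrow> x \<in> interior T \<Longrightarrow> V x = VT T"
  using V_P0 someI_ex[of "\<lambda>c. \<forall>x\<in>interior T. V x = c"] unfolding P0_def VT_def by blast

lemma \<kappa>_pos: "\<kappa> > 0" using eCR by (simp add: eCR_constant_def)

lemma interior_not_negligible: "T \<in> \<T> \<Longrightarrow> \<not> negligible (interior T)"
proof -
  assume T: "T \<in> \<T>"
  have "\<not> negligible T" using measure_simplex_pos[OF T] negligible_iff_measure[of T] by auto
  then have "interior T \<noteq> {}" using negligible_convex_interior[OF convex_simplex[OF T]] by blast
  then show ?thesis by (intro open_not_negligible) auto
qed

text \<open>The essential infimum bounds V only almost everywhere, but the interior of a simplex is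
  not a null set and V is constant on it.\<close>

lemma VT_nonneg: "T \<in> \<T> \<Longrightarrow> 0 \<le> VT T"
proof (rule ccontr)
  assume T: "T \<in> \<T>" and n: "\<not> 0 \<le> VT T"
  have "esssup (lebesgue_on \<Omega>) (\<lambda>x. - ereal (V x)) = 0" using V_inf by (simp add: essinf_def)
  moreover have "AE x in lebesgue_on \<Omega>. - ereal (V x) \<le> esssup (lebesgue_on \<Omega>) (\<lambda>x. - ereal (V x))"
    by (rule esssup_AE)
  ultimately have "AE x in lebesgue_on \<Omega>. 0 \<le> V x" by simp
  then have "AE x in lebesgue. x \<in> \<Omega> \<longrightarrow> 0 \<le> V x"
    by (subst (asm) AE_restrict_space_iff) auto
  then obtain N where N: "N \<in> null_sets lebesgue" "{x. \<not> (x \<in> \<Omega> \<longrightarrow> 0 \<le> V x)} \<subseteq> N"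
    by (auto simp: eventually_ae_filter)
  have "interior T \<subseteq> N" using N(2) V_eq[OF T] n interior_subset_\<Omega>[OF T] by auto
  then have "negligible (interior T)" using N(1) negligible_subset negligible_iff_null_sets by blast
  then show False using interior_not_negligible[OF T] by blast
qed

lemma diameter_pos: "T \<in> \<T> \<Longrightarrow> diameter T > 0"
proof -
  assume T: "T \<in> \<T>"
  have "negligible {z}" for z :: 'a by simp
  then have "interior T \<noteq> {}" "\<And>z. \<not> interior T \<subseteq> {z}"
    using interior_not_negligible[OF T] negligible_subset by blast+
  then obtain x y where "x \<in> T" "y \<in> T" "x \<noteq> y" using interior_subset by blast
  moreover have "dist x y \<le> diameter T"
    using calculation compact_simplex[OF T] compact_imp_bounded diameter_bounded_bound by blast
  ultimately show ?thesis by (metis dist_pos_lt order_less_le_trans)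
qed

text \<open>The contribution of T to \<open>a_es\<close>, with V replaced by its constant and the
  projections by mean values.\<close>

definition "aT T u w = (LINT x|lebesgue_on T. gradient (snd \<circ> u) x \<bullet> gradient (snd \<circ> w) x)
   + VT T * measure lebesgue T * mean T (snd \<circ> u) * mean T (snd \<circ> w)
   + 1 / \<kappa>\<^sup>2 * (1 / (diameter T)\<^sup>2) * (LINT x|lebesgue_on T. (fst (u x) - snd (u x)) * (fst (w x) - snd (w x)))"

lemma V_es_loc:
  assumes "u \<in> V_es \<Omega> \<T>"
  obtains \<gamma> \<delta> where "loc (fst \<circ> u) \<gamma>" "loc (snd \<circ> u) \<delta>"
  using assms V_pw_loc V_nc_subset_V_pw unfolding V_es_def by blast

lemma a_es_eq:
  assumes u: "u \<in> V_es \<Omega> \<T>" and w: "w \<in> V_es \<Omega> \<T>"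
  shows "a_es \<Omega> \<T> V \<kappa> u w = (\<Sum>T\<in>\<T>. aT T u w)"
proof -
  obtain \<gamma> \<delta> where l: "loc (fst \<circ> u) \<gamma>" "loc (snd \<circ> u) \<delta>" by (rule V_es_loc[OF u])
  obtain \<gamma>' \<delta>' where l': "loc (fst \<circ> w) \<gamma>'" "loc (snd \<circ> w) \<delta>'" by (rule V_es_loc[OF w])
  let ?f = "\<lambda>x. V x * Pi0 \<Omega> \<T> (snd \<circ> u) x * Pi0 \<Omega> \<T> (snd \<circ> w) x"
  have e: "?f x = VT T * mean T (snd \<circ> u) * mean T (snd \<circ> w)" if "T \<in> \<T>" "x \<in> interior T" for T x
    using V_eq[OF that] Pi0_eq[OF loc_square_integrable_\<Omega>[OF l(2)] that] Pi0_eq[OF loc_square_integrable_\<Omega>[OF l'(2)] that] by simp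
  have i: "integrable (lebesgue_on T) ?f" if T: "T \<in> \<T>" for T
    using integral_interior_cong(2)[OF T e[OF T]] square_integrable_imp_integrable[OF T square_integrable_const[OF T]] by simp
  have "(LINT x|lebesgue_on \<Omega>. ?f x) = (\<Sum>T\<in>\<T>. LINT x|lebesgue_on T. ?f x)" by (rule mesh_integral_sum[OF i])
  also have "\<dots> = (\<Sum>T\<in>\<T>. VT T * measure lebesgue T * mean T (snd \<circ> u) * mean T (snd \<circ> w))"
  proof (intro sum.cong refl)
    fix T assume T: "T \<in> \<T>"
    show "(LINT x|lebesgue_on T. ?f x) = VT T * measure lebesgue T * mean T (snd \<circ> u) * mean T (snd \<circ> w)"
      (is "?l = ?r")
    proof -
      have "?l = (LINT x|lebesgue_on T. VT T * mean T (snd \<circ> u) * mean T (snd \<circ> w))"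
        by (rule integral_interior_cong(1)[OF T e[OF T]])
      then show ?thesis by (simp only: integral_simplex_const[OF T] mult_ac)
    qed
  qed
  finally have "(LINT x|lebesgue_on \<Omega>. ?f x) = (\<Sum>T\<in>\<T>. VT T * measure lebesgue T * mean T (snd \<circ> u) * mean T (snd \<circ> w))" .
  then show ?thesis unfolding a_es_def a_pw_def aT_def
    by (simp add: sum.distrib sum_distrib_left mult.assoc)
qed

lemma b_es_eq:
  assumes u: "u \<in> V_es \<Omega> \<T>" and w: "w \<in> V_es \<Omega> \<T>"
  shows "b_es \<Omega> u w = (\<Sum>T\<in>\<T>. LINT x|lebesgue_on T. fst (u x) * fst (w x))"
proof -
  obtain \<gamma> \<delta> where l: "loc (fst \<circ> u) \<gamma>" "loc (snd \<circ> u) \<delta>" by (rule V_es_loc[OF u])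
  obtain \<gamma>' \<delta>' where l': "loc (fst \<circ> w) \<gamma>'" "loc (snd \<circ> w) \<delta>'" by (rule V_es_loc[OF w])
  show ?thesis unfolding b_es_def
    using mesh_inner_split[OF loc_square_integrable_\<Omega>[OF l(1)] loc_square_integrable_\<Omega>[OF l'(1)]] by (simp add: comp_def)
qed

end

context scheme
begin

abbreviation "X \<equiv> V_es \<Omega> \<T>"
abbreviation "ah \<equiv> a_es \<Omega> \<T> V \<kappa>"
abbreviation "bh \<equiv> b_es \<Omega>"

lemma components_add_cmult:
  fixes u v :: "'a \<Rightarrow> real \<times> real"
  shows "fst \<circ> (\<lambda>x. u x + c *\<^sub>R v x) = (\<lambda>x. (fst \<circ> u) x + c * (fst \<circ> v) x)"
    "snd \<circ> (\<lambda>x. u x + c *\<^sub>R v x) = (\<lambda>x. (snd \<circ> u) x + c * (snd \<circ> v) x)"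
  by auto

lemma components_square_integrable:
  assumes "u \<in> X" "T \<in> \<T>"
  shows "square_integrable T (fst \<circ> u)" "square_integrable T (snd \<circ> u)" "square_integrable T (gradient (snd \<circ> u))"
    "square_integrable T (\<lambda>x. fst (u x) - snd (u x))"
proof -
  obtain \<gamma> \<delta> where l: "loc (fst \<circ> u) \<gamma>" "loc (snd \<circ> u) \<delta>" by (rule V_es_loc[OF assms(1)])
  show f: "square_integrable T (fst \<circ> u)" and s: "square_integrable T (snd \<circ> u)" "square_integrable T (gradient (snd \<circ> u))"
    using loc_square_integrable[OF l(1) assms(2)] loc_square_integrable[OF l(2) assms(2)] by auto
  show "square_integrable T (\<lambda>x. fst (u x) - snd (u x))"
    using square_integrable_diff[OF f s(1)] by (simp add: comp_def)
qed

lemma aT_sym: "aT T u w = aT T w u"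
  unfolding aT_def by (simp add: inner_commute mult_ac)

lemma aT_lin:
  assumes T: "T \<in> \<T>" and u: "u \<in> X" and v: "v \<in> X" and w: "w \<in> X"
  shows "aT T (\<lambda>x. u x + c *\<^sub>R v x) w = aT T u w + c * aT T v w"
proof -
  obtain \<gamma> \<delta> where lu: "loc (fst \<circ> u) \<gamma>" "loc (snd \<circ> u) \<delta>" by (rule V_es_loc[OF u])
  obtain \<gamma>' \<delta>' where lv: "loc (fst \<circ> v) \<gamma>'" "loc (snd \<circ> v) \<delta>'" by (rule V_es_loc[OF v])
  note su = components_square_integrable[OF u T] and sv = components_square_integrable[OF v T]
    and sw = components_square_integrable[OF w T]
  let ?s = "\<lambda>x. (snd \<circ> u) x + c * (snd \<circ> v) x"
  have g: "gradient ?s x = gradient (snd \<circ> u) x + c *\<^sub>R gradient (snd \<circ> v) x" if x: "x \<in> interior T" for x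
    by (rule gradient_add_cmult[OF differentiableI[OF loc_derivative(1)[OF lu(2) T x]]
          differentiableI[OF loc_derivative(1)[OF lv(2) T x]]])
  have "(LINT x|lebesgue_on T. gradient ?s x \<bullet> gradient (snd \<circ> w) x)
     = (LINT x|lebesgue_on T. (gradient (snd \<circ> u) x + c *\<^sub>R gradient (snd \<circ> v) x) \<bullet> gradient (snd \<circ> w) x)"
    by (rule integral_interior_cong(1)[OF T]) (simp only: g)
  also have "\<dots> = (LINT x|lebesgue_on T. gradient (snd \<circ> u) x \<bullet> gradient (snd \<circ> w) x) + c * (LINT x|lebesgue_on T. gradient (snd \<circ> v) x \<bullet> gradient (snd \<circ> w) x)"
    using square_integrable_inner[OF su(3) sw(3)] square_integrable_inner[OF sv(3) sw(3)] by (simp add: inner_simps)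
  finally have 1: "(LINT x|lebesgue_on T. gradient ?s x \<bullet> gradient (snd \<circ> w) x) = \<dots>" .
  have 2: "mean T ?s = mean T (snd \<circ> u) + c * mean T (snd \<circ> v)" by (rule mean_add_cmult[OF T su(2) sv(2)])
  have 3: "(LINT x|lebesgue_on T. (fst (u x + c *\<^sub>R v x) - snd (u x + c *\<^sub>R v x)) * (fst (w x) - snd (w x)))
    = (LINT x|lebesgue_on T. (fst (u x) - snd (u x)) * (fst (w x) - snd (w x))) + c * (LINT x|lebesgue_on T. (fst (v x) - snd (v x)) * (fst (w x) - snd (w x)))"
  proof -
    have "(LINT x|lebesgue_on T. (fst (u x + c *\<^sub>R v x) - snd (u x + c *\<^sub>R v x)) * (fst (w x) - snd (w x)))
      = (LINT x|lebesgue_on T. (fst (u x) - snd (u x)) * (fst (w x) - snd (w x)) + c * ((fst (v x) - snd (v x)) * (fst (w x) - snd (w x))))"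
      by (intro Bochner_Integration.integral_cong) (auto simp: algebra_simps)
    then show ?thesis
      using square_integrable_mult[OF su(4) sw(4)] square_integrable_mult[OF sv(4) sw(4)] by simp
  qed
  show ?thesis
    unfolding aT_def components_add_cmult 1 2 3 by (simp only: distrib_left distrib_right mult_ac add_ac)
qed

lemma aT_terms_nonneg:
  assumes T: "T \<in> \<T>"
  shows "0 \<le> (LINT x|lebesgue_on T. gradient (snd \<circ> u) x \<bullet> gradient (snd \<circ> u) x)"
    "0 \<le> VT T * measure lebesgue T * mean T (snd \<circ> u) * mean T (snd \<circ> u)"
    "0 \<le> 1 / \<kappa>\<^sup>2 * (1 / (diameter T)\<^sup>2) * (LINT x|lebesgue_on T. (fst (u x) - snd (u x)) * (fst (u x) - snd (u x)))"
  using VT_nonneg[OF T] by (auto simp: mult.assoc intro!: integral_nonneg_AE mult_nonneg_nonneg)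

lemma aT_nonneg: "T \<in> \<T> \<Longrightarrow> 0 \<le> aT T u u"
  unfolding aT_def using aT_terms_nonneg[of T u] by linarith

lemma a_form: "psd_form X ah"
proof (intro psd_form.intro function_space.intro psd_form_axioms.intro)
  show "(\<lambda>x. 0) \<in> X" by (rule V_es_zero)
  fix u v w :: "'a \<Rightarrow> real \<times> real" and c :: real
  assume u: "u \<in> X"
  show "0 \<le> ah u u" unfolding a_es_eq[OF u u] by (intro sum_nonneg aT_nonneg)
  assume v: "v \<in> X"
  show uv: "(\<lambda>x. u x + c *\<^sub>R v x) \<in> X" by (rule V_es_add_cmult[OF u v])
  show "ah u v = ah v u" unfolding a_es_eq[OF u v] a_es_eq[OF v u] by (intro sum.cong refl aT_sym)
  assume w: "w \<in> X"
  show "ah (\<lambda>x. u x + c *\<^sub>R v x) w = ah u w + c * ah v w"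
    unfolding a_es_eq[OF u w] a_es_eq[OF v w] a_es_eq[OF uv w] sum_distrib_left sum.distrib[symmetric]
    by (intro sum.cong refl aT_lin u v w)
qed

lemma b_form: "psd_form X bh"
proof (intro psd_form.intro function_space.intro psd_form_axioms.intro)
  show "(\<lambda>x. 0) \<in> X" by (rule V_es_zero)
  fix u v w :: "'a \<Rightarrow> real \<times> real" and c :: real
  assume u: "u \<in> X"
  show "0 \<le> bh u u" unfolding b_es_def by (intro integral_nonneg_AE) auto
  assume v: "v \<in> X"
  show uv: "(\<lambda>x. u x + c *\<^sub>R v x) \<in> X" by (rule V_es_add_cmult[OF u v])
  show "bh u v = bh v u" unfolding b_es_def by (simp add: mult.commute)
  assume w: "w \<in> X"
  have s: "square_integrable \<Omega> (fst \<circ> z)" if "z \<in> X" for z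
    using components_square_integrable(1)[OF that] mesh_square_integrable by blast
  have i: "integrable (lebesgue_on \<Omega>) (\<lambda>x. fst (y x) * fst (z x))" if "y \<in> X" "z \<in> X" for y z
    using square_integrable_mult[OF s[OF that(1)] s[OF that(2)]] by simp
  show "bh (\<lambda>x. u x + c *\<^sub>R v x) w = bh u w + c * bh v w"
    unfolding b_es_def using i[OF u w] i[OF v w] by (simp add: distrib_right mult.assoc)
qed

text \<open>The gradients at two distinct interior points differ by a nonzero multiple of the bubble
  coefficient times the difference of the points.\<close>

lemma gev_eq_0:
  assumes T: "T \<in> \<T>" and z: "\<And>x. x \<in> interior T \<Longrightarrow> gev T \<gamma> x = 0"
  shows "fst \<gamma> = 0" "snd (snd \<gamma>) = 0"
proof -
  interpret S: full_simplex "vertices T" by (rule full_simplex[OF T])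
  have "\<not> interior T \<subseteq> {z}" for z
    using interior_not_negligible[OF T] negligible_subset[of "{z}" "interior T"] by auto
  moreover have "interior T \<noteq> {}" using interior_not_negligible[OF T] by auto
  ultimately obtain x y where xy: "x \<in> interior T" "y \<in> interior T" "x \<noteq> y" by blast
  have "gev T \<gamma> x - gev T \<gamma> y = - (snd (snd \<gamma>) * (2 * S.bcoef)) *\<^sub>R (x - y)"
    by (simp add: gev_def S.gbub_def algebra_simps)
  then have "(snd (snd \<gamma>) * (2 * S.bcoef)) *\<^sub>R (x - y) = 0" using z xy by simp
  then show s: "snd (snd \<gamma>) = 0" using xy S.bcoef_pos by simp
  then show "fst \<gamma> = 0" using z[OF xy(1)] by (simp add: gev_def)
qed

lemma integral_zero_imp_interior_zero:
  fixes f :: "'a \<Rightarrow> 'b::euclidean_space"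
  assumes T: "T \<in> \<T>" and f: "continuous_on UNIV f" and z: "(LINT x|lebesgue_on T. f x \<bullet> f x) = 0" and x: "x \<in> interior T"
  shows "f x = 0"
proof (rule ccontr)
  assume n: "f x \<noteq> 0"
  have "integrable (lebesgue_on T) (\<lambda>x. f x \<bullet> f x)"
    by (intro square_integrable_inner square_integrable_poly T f)
  then have "AE x in lebesgue_on T. f x \<bullet> f x = 0"
    using z by (subst (asm) integral_nonneg_eq_0_iff_AE) auto
  then have "AE x in lebesgue. x \<in> T \<longrightarrow> f x = 0" using T by (subst (asm) AE_restrict_space_iff) auto
  then obtain N where N: "N \<in> null_sets lebesgue" "{x. \<not> (x \<in> T \<longrightarrow> f x = 0)} \<subseteq> N"
    by (auto simp: eventually_ae_filter)
  let ?U = "interior T \<inter> {x. f x \<noteq> 0}"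
  have "?U \<subseteq> N" using N(2) interior_subset by blast
  then have "negligible ?U" using N(1) negligible_subset negligible_iff_null_sets by blast
  moreover have "open ?U"
    by (intro open_Int open_interior open_Collect_neq f continuous_on_const)
  moreover have "x \<in> ?U" using x n by simp
  ultimately show False using open_not_negligible by blast
qed

text \<open>Vanishing energy makes the nonconforming component constant on each simplex and removes
  its bubbles; the conditions at the face centroids then force it to be 0, and the stabilisation
  carries this over to the component that b sees. It is a qualitative form of a discrete Friedrichs
  inequality.\<close>

lemma a_null:
  assumes u: "u \<in> X" and z: "ah u u = 0"
  shows "bh u u = 0"
proof -
  obtain \<gamma> where fl: "loc (fst \<circ> u) \<gamma>" using V_es_loc[OF u] by blast
  obtain p \<delta> where p: "p \<in> CR01 \<Omega> \<T>" and sl: "loc (snd \<circ> u) \<delta>"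
    and pe: "\<And>T x. T \<in> \<T> \<Longrightarrow> x \<in> interior T \<Longrightarrow> p x = fst (\<delta> T) \<bullet> x + fst (snd (\<delta> T))"
    using V_nc_loc[of "snd \<circ> u"] u unfolding V_es_def by blast
  have aT0: "aT T u u = 0" if "T \<in> \<T>" for T
    using z that unfolding a_es_eq[OF u u] by (subst (asm) sum_nonneg_eq_0_iff) (auto intro: aT_nonneg)
  have g: "fst (\<delta> T) = 0" "snd (snd (\<delta> T)) = 0" if T: "T \<in> \<T>" for T
  proof -
    have "(LINT x|lebesgue_on T. gradient (snd \<circ> u) x \<bullet> gradient (snd \<circ> u) x) = 0"
      using aT0[OF T] aT_terms_nonneg[OF T, of u] unfolding aT_def by linarith
    moreover have "(LINT x|lebesgue_on T. gradient (snd \<circ> u) x \<bullet> gradient (snd \<circ> u) x) = (LINT x|lebesgue_on T. gev T (\<delta> T) x \<bullet> gev T (\<delta> T) x)"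
      by (rule integral_interior_cong(1)[OF T]) (simp only: loc_derivative(2)[OF sl T])
    ultimately have "gev T (\<delta> T) x = 0" if "x \<in> interior T" for x
      using integral_zero_imp_interior_zero[OF T gev_continuous[OF T] _ that] by simp
    then show "fst (\<delta> T) = 0" "snd (snd (\<delta> T)) = 0" using gev_eq_0[OF T] by blast+
  qed
  have "fst (snd (\<delta> T)) = 0" if "T \<in> \<T>" for T
    by (rule CR01_const_zero[OF p _ that]) (simp add: pe g)
  then have s0: "snd (u x) = 0" if "T \<in> \<T>" "x \<in> interior T" for T x
    using sl g that by (simp add: loc_def ev_def)
  have "(LINT x|lebesgue_on T. fst (u x) * fst (u x)) = 0" if T: "T \<in> \<T>" for T
  proof -
    have "1 / \<kappa>\<^sup>2 * (1 / (diameter T)\<^sup>2) * (LINT x|lebesgue_on T. (fst (u x) - snd (u x)) * (fst (u x) - snd (u x))) = 0"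
      using aT0[OF T] aT_terms_nonneg[OF T, of u] unfolding aT_def by linarith
    then have "(LINT x|lebesgue_on T. (fst (u x) - snd (u x)) * (fst (u x) - snd (u x))) = 0"
      using \<kappa>_pos diameter_pos[OF T] by simp
    moreover have "(LINT x|lebesgue_on T. (fst (u x) - snd (u x)) * (fst (u x) - snd (u x))) = (LINT x|lebesgue_on T. fst (u x) * fst (u x))"
      by (rule integral_interior_cong(1)[OF T]) (simp add: s0[OF T])
    ultimately show ?thesis by simp
  qed
  then show ?thesis unfolding b_es_eq[OF u u] by simp
qed

text \<open>Pairs concentrated on the skeleton are nonzero functions without energy; they must not
  count in the dimension bound.\<close>

lemma a_vanishing:
  assumes u: "u \<in> X" and z: "\<And>T x. T \<in> \<T> \<Longrightarrow> x \<in> interior T \<Longrightarrow> u x = 0"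
  shows "ah u u = 0"
proof -
  have "aT T u u = 0" if T: "T \<in> \<T>" for T
  proof -
    have g: "gradient (snd \<circ> u) x = 0" if "x \<in> interior T" for x
      by (rule gradient_cong[OF open_interior that, of _ "\<lambda>x. 0"]) (auto simp: z[OF T])
    have "(LINT x|lebesgue_on T. gradient (snd \<circ> u) x \<bullet> gradient (snd \<circ> u) x) = (LINT x|lebesgue_on T. 0)"
      by (rule integral_interior_cong(1)[OF T]) (simp add: g)
    moreover have "mean T (snd \<circ> u) = 0"
      unfolding mean_def using integral_interior_cong(1)[OF T, of "snd \<circ> u" "\<lambda>x. 0"] z[OF T] by (simp add: comp_def)
    moreover have "(LINT x|lebesgue_on T. (fst (u x) - snd (u x)) * (fst (u x) - snd (u x))) = (LINT x|lebesgue_on T. 0)"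
      by (rule integral_interior_cong(1)[OF T]) (simp add: z[OF T])
    ultimately show ?thesis unfolding aT_def by simp
  qed
  then show ?thesis unfolding a_es_eq[OF u u] by simp
qed

definition "evp T \<gamma> x = (ev T (fst \<gamma>) x, ev T (snd \<gamma>) x)" for \<gamma> :: "('a \<times> real \<times> real) \<times> ('a \<times> real \<times> real)"

lemma linear_evp: "linear (\<lambda>\<gamma>. evp T \<gamma> x)"
  by (rule linearI) (auto simp: evp_def linear_add[OF linear_ev] linear_scale[OF linear_ev])

text \<open>The number of local coordinates of a pair over all simplices. It ignores the conditions
  at the faces; any finite bound serves.\<close>

definition "es_bound = card (\<T> \<times> (Basis :: (('a \<times> real \<times> real) \<times> ('a \<times> real \<times> real)) set))"

text \<open>More functions than coordinates admit a nontrivial combination all of whose coordinates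
  are 0. It vanishes on the interiors and has no energy, whereas orthonormality makes its energy the
  sum of the squared coefficients.\<close>

lemma pencil: "finite_pencil X ah bh es_bound"
proof (intro finite_pencil.intro a_form b_form finite_pencil_axioms.intro a_null)
  interpret a: psd_form X ah by (rule a_form)
  fix m :: nat and f
  assume fX: "\<And>i. i < m \<Longrightarrow> f i \<in> X"
    and on: "\<And>i j. i < m \<Longrightarrow> j < m \<Longrightarrow> ah (f i) (f j) = (if i = j then 1 else 0)"
  have "\<forall>i\<in>{..<m}. \<exists>\<gamma>. \<forall>T\<in>\<T>. \<forall>x\<in>interior T. f i x = evp T (\<gamma> T) x"
  proof
    fix i assume "i \<in> {..<m}"
    then obtain \<gamma> \<delta> where "loc (fst \<circ> f i) \<gamma>" "loc (snd \<circ> f i) \<delta>" using V_es_loc[OF fX] by blast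
    then show "\<exists>\<gamma>. \<forall>T\<in>\<T>. \<forall>x\<in>interior T. f i x = evp T (\<gamma> T) x"
      by (intro exI[of _ "\<lambda>T. (\<gamma> T, \<delta> T)"]) (simp add: loc_def evp_def prod_eq_iff)
  qed
  from bchoice[OF this] obtain \<gamma> where \<gamma>: "\<And>i T x. i < m \<Longrightarrow> T \<in> \<T> \<Longrightarrow> x \<in> interior T \<Longrightarrow> f i x = evp T (\<gamma> i T) x"
    by auto
  show "m \<le> es_bound"
  proof (rule ccontr)
    assume "\<not> m \<le> es_bound"
    then have "card (\<T> \<times> (Basis :: (('a \<times> real \<times> real) \<times> ('a \<times> real \<times> real)) set)) < card {..<m}" by (simp add: es_bound_def)
    from underdetermined_system[OF _ _ this, of "\<lambda>(T, \<beta>) i. \<gamma> i T \<bullet> \<beta>"]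
    obtain c where c: "\<exists>i<m. c i \<noteq> 0" "\<And>T \<beta>. T \<in> \<T> \<Longrightarrow> \<beta> \<in> Basis \<Longrightarrow> (\<Sum>i<m. c i * (\<gamma> i T \<bullet> \<beta>)) = 0"
      by auto
    let ?s = "\<lambda>x. \<Sum>i<m. c i *\<^sub>R f i x"
    have sX: "?s \<in> X" by (rule a.sum_closed[OF fX])
    have "?s x = 0" if T: "T \<in> \<T>" and x: "x \<in> interior T" for T x
    proof -
      have "(\<Sum>i<m. c i *\<^sub>R \<gamma> i T) = 0"
        by (rule euclidean_eqI) (simp add: inner_sum_left c(2)[OF T])
      moreover have "?s x = (\<Sum>i<m. c i *\<^sub>R evp T (\<gamma> i T) x)" using \<gamma>[OF _ T x] by (intro sum.cong) auto
      moreover have "\<dots> = evp T (\<Sum>i<m. c i *\<^sub>R \<gamma> i T) x"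
        by (simp add: linear_sum[OF linear_evp] linear_scale[OF linear_evp])
      ultimately show ?thesis using linear_0[OF linear_evp] by simp
    qed
    then have "ah ?s ?s = 0" by (rule a_vanishing[OF sX])
    moreover have "ah ?s ?s = (\<Sum>i<m. (c i)\<^sup>2)"
    proof -
      have "ah ?s ?s = (\<Sum>i<m. c i * ah (f i) ?s)" by (rule a.sum_left[OF fX sX])
      also have "\<dots> = (\<Sum>i<m. (c i)\<^sup>2)"
      proof (intro sum.cong refl)
        fix i assume i: "i \<in> {..<m}"
        have "ah (f i) ?s = (\<Sum>j<m. c j * ah (f i) (f j))" using i by (intro a.sum_right fX) auto
        also have "\<dots> = (\<Sum>j<m. if j = i then c j else 0)" using i by (intro sum.cong) (auto simp: on)
        finally show "c i * ah (f i) ?s = (c i)\<^sup>2" using i by (simp add: power2_eq_square)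
      qed
      finally show ?thesis .
    qed
    ultimately have "(\<Sum>i<m. (c i)\<^sup>2) = 0" by simp
    then have "\<forall>i\<in>{..<m}. (c i)\<^sup>2 = 0" by (subst (asm) sum_nonneg_eq_0_iff) auto
    then show False using c(1) by auto
  qed
qed

lemma L2_projection:
  assumes T: "T \<in> \<T>" and u: "square_integrable T u"
  obtains \<gamma> where "\<And>\<delta>. (LINT x|lebesgue_on T. (u x - ev T \<gamma> x) * ev T \<delta> x) = 0"
proof -
  interpret q: psd_form "{v. square_integrable T v}" "\<lambda>v w. LINT x|lebesgue_on T. v x * w x"
  proof (unfold_locales, goal_cases)
    case 1 show ?case by (simp add: square_integrable_zero)
  next
    case (2 u v c) then show ?case using square_integrable_add[of T u "\<lambda>x. c * v x"] square_integrable_cmult[of T v c] by simp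
  next
    case (3 u v) show ?case by (simp add: mult.commute)
  next
    case (4 u v w c)
    then show ?case using square_integrable_mult[of T u w] square_integrable_mult[of T v w] by (simp add: distrib_right mult.assoc)
  next
    case (5 u) show ?case by (intro integral_nonneg_AE) auto
  qed
  define D where "D = DIM('a \<times> real \<times> real)"
  obtain h where h: "bij_betw h {..<D} (Basis :: ('a \<times> real \<times> real) set)"
    using ex_bij_betw_nat_finite[OF finite_Basis] unfolding D_def by (metis atLeast0LessThan)
  have e: "square_integrable T (ev T \<delta>)" for \<delta> by (intro square_integrable_poly T ev_continuous)
  obtain c where c: "\<And>i. i < D \<Longrightarrow> (LINT x|lebesgue_on T. (u x + (-1) *\<^sub>R (\<Sum>j<D. c j *\<^sub>R ev T (h j) x)) * ev T (h i) x) = 0"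
    using q.projection[of D "\<lambda>i. ev T (h i)" u] e u by blast
  define \<gamma> where "\<gamma> = (\<Sum>j<D. c j *\<^sub>R h j)"
  have g: "ev T \<gamma> x = (\<Sum>j<D. c j *\<^sub>R ev T (h j) x)" for x
    unfolding \<gamma>_def by (simp add: linear_sum[OF linear_ev] linear_scale[OF linear_ev])
  have s: "square_integrable T (\<lambda>x. u x - ev T \<gamma> x)" by (intro square_integrable_diff u e)
  show ?thesis
  proof (rule that[of \<gamma>])
    fix \<delta> :: "'a \<times> real \<times> real"
    have "\<delta> = (\<Sum>\<beta>\<in>Basis. (\<delta> \<bullet> \<beta>) *\<^sub>R \<beta>)" by (simp add: euclidean_representation)
    also have "\<dots> = (\<Sum>i<D. (\<delta> \<bullet> h i) *\<^sub>R h i)" by (rule sum.reindex_bij_betw[OF h, symmetric])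
    finally have d: "\<delta> = (\<Sum>i<D. (\<delta> \<bullet> h i) *\<^sub>R h i)" .
    have "ev T \<delta> x = (\<Sum>i<D. (\<delta> \<bullet> h i) * ev T (h i) x)" for x
    proof -
      have "ev T \<delta> x = ev T (\<Sum>i<D. (\<delta> \<bullet> h i) *\<^sub>R h i) x" by (rule arg_cong[OF d])
      then show ?thesis by (simp add: linear_sum[OF linear_ev] linear_scale[OF linear_ev])
    qed
    then have "(LINT x|lebesgue_on T. (u x - ev T \<gamma> x) * ev T \<delta> x) = (LINT x|lebesgue_on T. (\<Sum>i<D. (\<delta> \<bullet> h i) * ((u x - ev T \<gamma> x) * ev T (h i) x)))"
      by (simp add: sum_distrib_left mult_ac)
    also have "\<dots> = (\<Sum>i<D. (\<delta> \<bullet> h i) * (LINT x|lebesgue_on T. (u x - ev T \<gamma> x) * ev T (h i) x))"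
      using square_integrable_mult[OF s e] by (subst Bochner_Integration.integral_sum) auto
    also have "\<dots> = 0" using c by (simp add: g)
    finally show "(LINT x|lebesgue_on T. (u x - ev T \<gamma> x) * ev T \<delta> x) = 0" .
  qed
qed

end

section \<open>The energy estimate for the test pair\<close>

lemma L2_Pythagoras:
  fixes u v :: "'a::euclidean_space \<Rightarrow> 'b::euclidean_space"
  assumes u: "square_integrable S u" and v: "square_integrable S v" and z: "(LINT x|lebesgue_on S. u x \<bullet> v x) = 0"
  shows "(LINT x|lebesgue_on S. (u x + v x) \<bullet> (u x + v x)) = (LINT x|lebesgue_on S. u x \<bullet> u x) + (LINT x|lebesgue_on S. v x \<bullet> v x)"
proof -
  have "(LINT x|lebesgue_on S. (u x + v x) \<bullet> (u x + v x)) = (LINT x|lebesgue_on S. u x \<bullet> u x + 2 * (u x \<bullet> v x) + v x \<bullet> v x)"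
    by (intro Bochner_Integration.integral_cong) (auto simp: inner_simps inner_commute)
  also have "\<dots> = (LINT x|lebesgue_on S. u x \<bullet> u x) + 2 * (LINT x|lebesgue_on S. u x \<bullet> v x) + (LINT x|lebesgue_on S. v x \<bullet> v x)"
    using square_integrable_inner[OF u v] square_integrable_inner[OF u u] square_integrable_inner[OF v v] by simp
  finally show ?thesis using z by simp
qed

context mesh
begin

lemma gev_affine:
  assumes "T \<in> \<T>"
  obtains w \<alpha> where "\<And>x. gev T \<gamma> x = w + \<alpha> *\<^sub>R x"
proof -
  interpret S: full_simplex "vertices T" by (rule full_simplex[OF assms])
  show ?thesis
    by (rule that[of "fst \<gamma> + (snd (snd \<gamma>) * (2 * S.bcoef)) *\<^sub>R S.centroid" "- (snd (snd \<gamma>) * (2 * S.bcoef))"])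
      (simp add: gev_def S.gbub_def algebra_simps)
qed

text \<open>The variance of u on T is nonnegative.\<close>

lemma mean_square_le:
  assumes T: "T \<in> \<T>" and u: "square_integrable T u"
  shows "measure lebesgue T * mean T u * mean T u \<le> (LINT x|lebesgue_on T. u x * u x)"
proof -
  let ?m = "mean T u"
  have i: "integrable (lebesgue_on T) u" by (rule square_integrable_imp_integrable[OF T u])
  have "integrable (lebesgue_on T) (\<lambda>x. ?m * ?m)" by (rule square_integrable_imp_integrable[OF T square_integrable_const[OF T]])
  moreover have "0 \<le> (LINT x|lebesgue_on T. (u x - ?m) * (u x - ?m))" by (intro integral_nonneg_AE) auto
  moreover have "(LINT x|lebesgue_on T. (u x - ?m) * (u x - ?m)) = (LINT x|lebesgue_on T. u x * u x - 2 * ?m * u x + ?m * ?m)"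
    by (intro Bochner_Integration.integral_cong) (auto simp: algebra_simps)
  moreover have "(LINT x|lebesgue_on T. u x) = ?m * measure lebesgue T"
    using measure_simplex_pos[OF T] by (simp add: mean_def)
  moreover have "measure (lebesgue_on T) T = measure lebesgue T"
    using T by (simp add: measure_restrict_space)
  ultimately show ?thesis
    using i square_integrable_mult[OF u u] by (simp add: algebra_simps)
qed

lemma diameter_le_h_max: "T \<in> \<T> \<Longrightarrow> diameter T \<le> h_max \<T>"
  unfolding h_max_def by (intro Max_ge) auto

lemma H01_sum:
  assumes "\<And>l. l \<in> \<Lambda> \<Longrightarrow> H01 \<Omega> (u l) (g l)"
  shows "H01 \<Omega> (\<lambda>x. \<Sum>l\<in>\<Lambda>. u l x) (\<lambda>x. \<Sum>l\<in>\<Lambda>. g l x)"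
  using assms
proof (induction \<Lambda> rule: infinite_finite_induct)
  case (insert l \<Lambda>)
  then have "H01 \<Omega> (\<lambda>x. (\<Sum>l\<in>\<Lambda>. u l x) + 1 * u l x) (\<lambda>x. (\<Sum>l\<in>\<Lambda>. g l x) + 1 *\<^sub>R g l x)"
    by (intro H01_add_cmult) auto
  then show ?case using insert by (simp add: add.commute)
qed (simp_all add: H01_zero)

end

context scheme
begin

lemma V_integral:
  assumes u: "square_integrable \<Omega> u" and v: "square_integrable \<Omega> v"
  shows V_integrable: "integrable (lebesgue_on \<Omega>) (\<lambda>x. V x * u x * v x)"
    and V_integral_eq: "(LINT x|lebesgue_on \<Omega>. V x * u x * v x) = (\<Sum>T\<in>\<T>. VT T * (LINT x|lebesgue_on T. u x * v x))"
proof -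
  have e: "V x * u x * v x = VT T * (u x * v x)" if "T \<in> \<T>" "x \<in> interior T" for T x
    using V_eq[OF that] by simp
  have i: "integrable (lebesgue_on T) (\<lambda>x. V x * u x * v x)" if T: "T \<in> \<T>" for T
  proof -
    have "integrable (lebesgue_on T) (\<lambda>x. VT T * (u x * v x))"
      using square_integrable_mult[OF square_integrable_simplex[OF u T] square_integrable_simplex[OF v T]] by (rule integrable_mult_right)
    then show ?thesis using integral_interior_cong(2)[OF T e[OF T]] by simp
  qed
  show "integrable (lebesgue_on \<Omega>) (\<lambda>x. V x * u x * v x)" by (rule mesh_integrable[OF i])
  have "(LINT x|lebesgue_on T. V x * u x * v x) = VT T * (LINT x|lebesgue_on T. u x * v x)" if T: "T \<in> \<T>" for T
  proof -
    have "(LINT x|lebesgue_on T. V x * u x * v x) = (LINT x|lebesgue_on T. VT T * (u x * v x))"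
      by (rule integral_interior_cong(1)[OF T e[OF T]])
    then show ?thesis by simp
  qed
  then have "(\<Sum>T\<in>\<T>. LINT x|lebesgue_on T. V x * u x * v x) = (\<Sum>T\<in>\<T>. VT T * (LINT x|lebesgue_on T. u x * v x))"
    by (intro sum.cong refl)
  with mesh_integral_sum[OF i] show "(LINT x|lebesgue_on \<Omega>. V x * u x * v x) = (\<Sum>T\<in>\<T>. VT T * (LINT x|lebesgue_on T. u x * v x))"
    by (rule trans)
qed

lemma h_max_pos: "h_max \<T> > 0"
  using \<T>_ne diameter_pos diameter_le_h_max by (metis all_not_in_conv order_less_le_trans)

text \<open>The second property lets w take the place of u in all b-products, so orthogonality
  conditions imposed on u are inherited. The last one states that the projection does not annihilate
  u: otherwise the energy of w would be at most \<open>\<mu> - 1 / \<epsilon>\<close> times a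
  positive number, hence negative.\<close>

lemma test_pair:
  assumes u: "H01 \<Omega> u g"
    and energy: "(LINT x|lebesgue_on \<Omega>. g x \<bullet> g x) + (LINT x|lebesgue_on \<Omega>. V x * u x * u x) \<le> \<mu> * (LINT x|lebesgue_on \<Omega>. u x * u x)"
    and pos: "(LINT x|lebesgue_on \<Omega>. u x * u x) > 0" and \<mu>: "\<mu> < 1 / (\<kappa>\<^sup>2 * (h_max \<T>)\<^sup>2)"
  obtains w where "w \<in> X" "\<And>z. z \<in> X \<Longrightarrow> bh w z = (LINT x|lebesgue_on \<Omega>. u x * fst (z x))"
    "ah w w \<le> \<mu> * bh w w" "bh w w > 0"
proof -
  define \<epsilon> where "\<epsilon> = \<kappa>\<^sup>2 * (h_max \<T>)\<^sup>2"
  have \<epsilon>: "\<epsilon> > 0" using \<kappa>_pos h_max_pos by (simp add: \<epsilon>_def)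
  have suO: "square_integrable \<Omega> u" and sgO: "square_integrable \<Omega> g" using H01D[OF u] by auto
  have su: "square_integrable T u" and sg: "square_integrable T g" if "T \<in> \<T>" for T
    using square_integrable_simplex[OF suO that] square_integrable_simplex[OF sgO that] by auto
  have "\<forall>T\<in>\<T>. \<exists>\<gamma>. \<forall>\<delta>. (LINT x|lebesgue_on T. (u x - ev T \<gamma> x) * ev T \<delta> x) = 0"
    using L2_projection[OF _ su] by metis
  from bchoice[OF this] obtain \<gamma> where orth: "\<And>T \<delta>. T \<in> \<T> \<Longrightarrow> (LINT x|lebesgue_on T. (u x - ev T (\<gamma> T) x) * ev T \<delta> x) = 0"
    by blast
  define p where "p x = pw (\<lambda>T x. fst (\<gamma> T) \<bullet> x + fst (snd (\<gamma> T))) x + (\<Sum>T\<in>\<T>. snd (snd (\<gamma> T)) * bubble T x)" for x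
  have pl: "loc p \<gamma>"
    unfolding loc_def p_def using pw_eq bubble_sum_local by (auto simp: ev_def)
  have "p \<in> V_pw \<T>"
    unfolding V_pw_def p_def[abs_def]
    by (intro CollectI exI conjI, rule refl) (auto simp: P1_def bubbles_def pw_eq)
  define w where "w x = (p x, I_eCR \<Omega> \<T> u x)" for x
  have fw: "fst \<circ> w = p" and sw: "snd \<circ> w = I_eCR \<Omega> \<T> u" by (auto simp: w_def)
  have wX: "w \<in> X" unfolding V_es_def using \<open>p \<in> V_pw \<T>\<close> I_eCR_V_nc fw sw by simp
  have pe: "p x = ev T (\<gamma> T) x" if "T \<in> \<T>" "x \<in> interior T" for T x using pl that by (simp add: loc_def)
  have se: "square_integrable T (ev T \<delta>)" if "T \<in> \<T>" for T \<delta> by (intro square_integrable_poly ev_continuous that)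
  have bw: "bh w z = (LINT x|lebesgue_on \<Omega>. u x * fst (z x))" if z: "z \<in> X" for z
  proof -
    obtain \<delta> where l: "loc (fst \<circ> z) \<delta>" using V_es_loc[OF z] by blast
    have "(LINT x|lebesgue_on T. fst (w x) * fst (z x)) = (LINT x|lebesgue_on T. u x * fst (z x))" if T: "T \<in> \<T>" for T
    proof -
      have ze: "fst (z x) = ev T (\<delta> T) x" if "x \<in> interior T" for x using l T that by (simp add: loc_def)
      have "(LINT x|lebesgue_on T. fst (w x) * fst (z x)) = (LINT x|lebesgue_on T. ev T (\<gamma> T) x * ev T (\<delta> T) x)"
        by (rule integral_interior_cong(1)[OF T]) (simp add: w_def pe[OF T] ze)
      moreover have "(LINT x|lebesgue_on T. u x * fst (z x)) = (LINT x|lebesgue_on T. u x * ev T (\<delta> T) x)"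
        by (rule integral_interior_cong(1)[OF T]) (simp add: ze)
      moreover have "(LINT x|lebesgue_on T. u x * ev T (\<delta> T) x) - (LINT x|lebesgue_on T. ev T (\<gamma> T) x * ev T (\<delta> T) x) = 0"
        using orth[OF T, of "\<delta> T"] square_integrable_mult[OF su[OF T] se[OF T]] square_integrable_mult[OF se[OF T] se[OF T]]
        by (simp add: left_diff_distrib)
      ultimately show ?thesis by simp
    qed
    moreover have "square_integrable \<Omega> (fst \<circ> z)" by (rule loc_square_integrable_\<Omega>[OF l])
    ultimately show ?thesis
      using b_es_eq[OF wX z] mesh_inner_split[OF suO, of "fst \<circ> z"] by simp
  qed
  \<comment> \<open>By orthogonality this is the squared L2 distance on T between u and its
    projection.\<close>
  define D where "D T = (LINT x|lebesgue_on T. u x * u x) - (LINT x|lebesgue_on T. fst (w x) * fst (w x))" for T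
  have local: "aT T w w \<le> (LINT x|lebesgue_on T. g x \<bullet> g x) + VT T * (LINT x|lebesgue_on T. u x * u x) - D T / \<epsilon>" "0 \<le> D T"
    if T: "T \<in> \<T>" for T
  proof -
    interpret S: full_simplex "vertices T" by (rule full_simplex[OF T])
    note suT = su[OF T] and sgT = sg[OF T]
    obtain b e t where Ie: "\<And>x. x \<in> interior T \<Longrightarrow> I_eCR \<Omega> \<T> u x = b \<bullet> x + e + t * S.bub x"
      and mean0: "(LINT x|lebesgue_on T. u x - (b \<bullet> x + e + t * S.bub x)) = 0"
      and grad0: "\<And>w \<alpha>. (LINT x|lebesgue_on T. (g x - (b + t *\<^sub>R S.gbub x)) \<bullet> (w + \<alpha> *\<^sub>R x)) = 0"
      using I_eCR_local[OF T u] by blast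
    define \<delta> where "\<delta> = (b, e, t)"
    have Ie: "I_eCR \<Omega> \<T> u x = ev T \<delta> x" if "x \<in> interior T" for x using Ie[OF that] by (simp add: ev_def \<delta>_def)
    have mean0: "(LINT x|lebesgue_on T. u x - ev T \<delta> x) = 0" using mean0 by (simp add: ev_def \<delta>_def)
    have grad0: "(LINT x|lebesgue_on T. (g x - gev T \<delta> x) \<bullet> (w + \<alpha> *\<^sub>R x)) = 0" for w \<alpha>
      using grad0[of w \<alpha>] by (simp add: gev_def \<delta>_def)
    have Igrad: "gradient (I_eCR \<Omega> \<T> u) x = gev T \<delta> x" if "x \<in> interior T" for x
      by (rule gradient_cong[OF open_interior that Ie ev_derivative[OF T]])
    have sG: "square_integrable T (gev T \<delta>)" by (intro square_integrable_poly gev_continuous T)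
    let ?GG = "LINT x|lebesgue_on T. gev T \<delta> x \<bullet> gev T \<delta> x"
    let ?EE = "LINT x|lebesgue_on T. (g x - gev T \<delta> x) \<bullet> (g x - gev T \<delta> x)"
    let ?Q = "LINT x|lebesgue_on T. (u x - ev T \<delta> x) * (u x - ev T \<delta> x)"
    let ?R = "LINT x|lebesgue_on T. (u x - ev T (\<gamma> T) x) * (u x - ev T (\<gamma> T) x)"
    let ?W = "LINT x|lebesgue_on T. (ev T (\<gamma> T) x - ev T \<delta> x) * (ev T (\<gamma> T) x - ev T \<delta> x)"
    let ?uu = "LINT x|lebesgue_on T. u x * u x"
    let ?pp = "LINT x|lebesgue_on T. ev T (\<gamma> T) x * ev T (\<gamma> T) x"
    \<comment> \<open>The gradient of the interpolant is itself one of the affine fields to which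
      the gradient error is orthogonal.\<close>
    have "(LINT x|lebesgue_on T. (g x - gev T \<delta> x) \<bullet> gev T \<delta> x) = 0"
    proof -
      obtain w \<alpha> where "\<And>x. gev T \<delta> x = w + \<alpha> *\<^sub>R x" using gev_affine[OF T, of \<delta>] by blast
      then have "(LINT x|lebesgue_on T. (g x - gev T \<delta> x) \<bullet> gev T \<delta> x) = (LINT x|lebesgue_on T. (g x - gev T \<delta> x) \<bullet> (w + \<alpha> *\<^sub>R x))" by presburger
      then show ?thesis using grad0[of w \<alpha>] by (rule trans)
    qed
    from L2_Pythagoras[OF square_integrable_diff[OF sgT sG] sG this]
    have gg: "(LINT x|lebesgue_on T. g x \<bullet> g x) = ?EE + ?GG" by simp
    have sr: "square_integrable T (\<lambda>x. u x - ev T (\<gamma> T) x)" by (rule square_integrable_diff[OF suT se[OF T]])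
    have uu: "?uu = ?R + ?pp"
      using L2_Pythagoras[OF sr se[OF T, of "\<gamma> T"]] orth[OF T, of "\<gamma> T"] by simp
    \<comment> \<open>The difference between projection and interpolant lies in the local space, to
      which u minus its projection is orthogonal.\<close>
    have QW: "?Q = ?R + ?W"
    proof -
      have d: "ev T (\<gamma> T) x - ev T \<delta> x = ev T (\<gamma> T + (-1) *\<^sub>R \<delta>) x" for x
        by (simp only: ev_add_cmult)
      have "(LINT x|lebesgue_on T. (u x - ev T (\<gamma> T) x) \<bullet> (ev T (\<gamma> T) x - ev T \<delta> x)) = 0"
        unfolding d using orth[OF T] by simp
      from L2_Pythagoras[OF sr square_integrable_diff[OF se[OF T] se[OF T]] this] show ?thesis by simp
    qed
    have R0: "?R \<ge> 0" by (intro integral_nonneg_AE) auto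
    have ww: "(LINT x|lebesgue_on T. fst (w x) * fst (w x)) = ?pp"
      by (rule integral_interior_cong(1)[OF T]) (simp add: w_def pe[OF T])
    have DR: "D T = ?R" using uu ww by (simp add: D_def)
    then show "0 \<le> D T" using R0 by simp
    have d: "diameter T > 0" by (rule diameter_pos[OF T])
    have QE: "?Q \<le> \<kappa>\<^sup>2 * (diameter T)\<^sup>2 * ?EE"
    proof -
      have "L2_norm T (\<lambda>x. u x - I_eCR \<Omega> \<T> u x) \<le> \<kappa> * diameter T * L2_norm T (\<lambda>x. g x - gradient (I_eCR \<Omega> \<T> u) x)"
        using eCR u T unfolding eCR_constant_def by blast
      then have "(L2_norm T (\<lambda>x. u x - I_eCR \<Omega> \<T> u x))\<^sup>2 \<le> (\<kappa> * diameter T * L2_norm T (\<lambda>x. g x - gradient (I_eCR \<Omega> \<T> u) x))\<^sup>2"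
        by (intro power_mono L2_norm_nonneg)
      also have "\<dots> = \<kappa>\<^sup>2 * (diameter T)\<^sup>2 * (L2_norm T (\<lambda>x. g x - gradient (I_eCR \<Omega> \<T> u) x))\<^sup>2"
        by (simp add: power_mult_distrib)
      also have "(L2_norm T (\<lambda>x. g x - gradient (I_eCR \<Omega> \<T> u) x))\<^sup>2 = ?EE"
        unfolding L2_norm_sq power2_norm_eq_inner by (rule integral_interior_cong(1)[OF T]) (simp only: Igrad)
      also have "(L2_norm T (\<lambda>x. u x - I_eCR \<Omega> \<T> u x))\<^sup>2 = ?Q"
        unfolding L2_norm_sq power2_norm_eq_inner by (rule integral_interior_cong(1)[OF T]) (simp add: Ie)
      finally show ?thesis .
    qed
    have m: "mean T (snd \<circ> w) = mean T u"
    proof -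
      have "integrable (lebesgue_on T) u" "integrable (lebesgue_on T) (ev T \<delta>)"
        using square_integrable_imp_integrable[OF T] suT se[OF T] by auto
      then have "(LINT x|lebesgue_on T. ev T \<delta> x) = (LINT x|lebesgue_on T. u x)" using mean0 by simp
      moreover have "(LINT x|lebesgue_on T. (snd \<circ> w) x) = (LINT x|lebesgue_on T. ev T \<delta> x)"
        by (rule integral_interior_cong(1)[OF T]) (simp add: Ie w_def)
      ultimately show ?thesis unfolding mean_def by (simp only:)
    qed
    have aTe: "aT T w w = ?GG + VT T * (measure lebesgue T * mean T u * mean T u) + 1 / \<kappa>\<^sup>2 * (1 / (diameter T)\<^sup>2) * ?W"
    proof -
      have "(LINT x|lebesgue_on T. gradient (snd \<circ> w) x \<bullet> gradient (snd \<circ> w) x) = ?GG"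
        unfolding sw by (rule integral_interior_cong(1)[OF T]) (simp only: Igrad)
      moreover have "(LINT x|lebesgue_on T. (fst (w x) - snd (w x)) * (fst (w x) - snd (w x))) = ?W"
        by (rule integral_interior_cong(1)[OF T]) (simp add: w_def Ie pe[OF T])
      ultimately show ?thesis unfolding aT_def m by (simp add: mult.assoc)
    qed
    have 1: "VT T * (measure lebesgue T * mean T u * mean T u) \<le> VT T * ?uu"
      using mean_square_le[OF T suT] VT_nonneg[OF T] by (rule mult_left_mono)
    define k where "k = \<kappa>\<^sup>2 * (diameter T)\<^sup>2"
    have k: "k > 0" "k \<le> \<epsilon>"
      using \<kappa>_pos d diameter_le_h_max[OF T] by (auto simp: k_def \<epsilon>_def intro!: mult_left_mono power_mono)
    \<comment> \<open>The stabilisation is (Q - R) / k. The defining inequality of \<kappa> lets the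
      gradient error absorb Q / k, and this error is what the discrete gradient energy falls short
      of the exact one. The gain R / k is weakened to R / \<epsilon>, which is uniform over the
      mesh.\<close>
    have "1 / \<kappa>\<^sup>2 * (1 / (diameter T)\<^sup>2) * ?W = (?Q - ?R) / k" using QW by (simp add: k_def)
    also have "\<dots> \<le> ?EE - D T / \<epsilon>"
    proof -
      have "?Q / k \<le> ?EE" using QE k(1) by (simp add: k_def divide_le_eq mult.commute)
      moreover have "?R / \<epsilon> \<le> ?R / k" using R0 k by (intro divide_left_mono) auto
      ultimately show ?thesis unfolding DR by (simp add: diff_divide_distrib)
    qed
    finally show "aT T w w \<le> (LINT x|lebesgue_on T. g x \<bullet> g x) + VT T * ?uu - D T / \<epsilon>"
      unfolding aTe gg using 1 by linarith
  qed
  let ?U = "LINT x|lebesgue_on \<Omega>. u x * u x" and ?B = "bh w w"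
  have Usum: "?U = (\<Sum>T\<in>\<T>. LINT x|lebesgue_on T. u x * u x)" using mesh_inner_split[OF suO suO] by simp
  have DU: "(\<Sum>T\<in>\<T>. D T) = ?U - ?B" unfolding D_def sum_subtractf Usum b_es_eq[OF wX wX] ..
  have D0: "?U - ?B \<ge> 0" unfolding DU[symmetric] using local(2) by (rule sum_nonneg)
  have "ah w w \<le> (\<Sum>T\<in>\<T>. (LINT x|lebesgue_on T. g x \<bullet> g x) + VT T * (LINT x|lebesgue_on T. u x * u x) - D T / \<epsilon>)"
    unfolding a_es_eq[OF wX wX] using local(1) by (rule sum_mono)
  also have "\<dots> = (LINT x|lebesgue_on \<Omega>. g x \<bullet> g x) + (LINT x|lebesgue_on \<Omega>. V x * u x * u x) - (?U - ?B) / \<epsilon>"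
    unfolding sum_subtractf sum.distrib DU[symmetric] sum_divide_distrib mesh_inner_split[OF sgO sgO] V_integral_eq[OF suO suO] ..
  also have "\<dots> \<le> \<mu> * ?U - (?U - ?B) / \<epsilon>" using energy by linarith
  \<comment> \<open>Regrouped so that the defect \<open>?U - ?B\<close>, which is nonnegative,
    carries the negative factor \<open>\<mu> - 1 / \<epsilon>\<close>.\<close>
  also have "\<dots> = \<mu> * ?B + (\<mu> - 1 / \<epsilon>) * (?U - ?B)" by (simp add: algebra_simps diff_divide_distrib)
  finally have main: "ah w w \<le> \<mu> * ?B + (\<mu> - 1 / \<epsilon>) * (?U - ?B)" .
  have neg: "\<mu> - 1 / \<epsilon> < 0" using \<mu> by (simp add: \<epsilon>_def)
  have B0: "?B \<ge> 0" using psd_form.nonneg[OF b_form wX] .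
  have "?B > 0"
  proof (rule ccontr)
    assume "\<not> ?B > 0"
    then have "?B = 0" using B0 by simp
    then have "ah w w \<le> (\<mu> - 1 / \<epsilon>) * ?U" using main by simp
    also have "\<dots> < 0" using neg pos by (rule mult_neg_pos)
    finally show False using psd_form.nonneg[OF a_form wX] by simp
  qed
  moreover have "(\<mu> - 1 / \<epsilon>) * (?U - ?B) \<le> 0" using neg D0 by (intro mult_nonpos_nonneg) auto
  then have "ah w w \<le> \<mu> * ?B" using main by linarith
  ultimately show ?thesis using that[OF wX bw] by blast
qed

section \<open>From exact eigenfunctions to discrete multiplicities\<close>

lemma eigenspace_function_space: "function_space (schroedinger_eigenspace \<Omega> V l)"
proof
  show "(\<lambda>x. 0) \<in> schroedinger_eigenspace \<Omega> V l"
    unfolding schroedinger_eigenspace_def using H01_zero by (intro CollectI exI[of _ "\<lambda>x. 0"]) simp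
  fix u v and c :: real assume "u \<in> schroedinger_eigenspace \<Omega> V l" "v \<in> schroedinger_eigenspace \<Omega> V l"
  then obtain g h where u: "H01 \<Omega> u g" "\<And>z k. H01 \<Omega> z k \<Longrightarrow> (LINT x|lebesgue_on \<Omega>. g x \<bullet> k x) + (LINT x|lebesgue_on \<Omega>. V x * u x * z x) = l * (LINT x|lebesgue_on \<Omega>. u x * z x)"
    and v: "H01 \<Omega> v h" "\<And>z k. H01 \<Omega> z k \<Longrightarrow> (LINT x|lebesgue_on \<Omega>. h x \<bullet> k x) + (LINT x|lebesgue_on \<Omega>. V x * v x * z x) = l * (LINT x|lebesgue_on \<Omega>. v x * z x)"
    unfolding schroedinger_eigenspace_def by blast
  have "(LINT x|lebesgue_on \<Omega>. (g x + c *\<^sub>R h x) \<bullet> k x) + (LINT x|lebesgue_on \<Omega>. V x * (u x + c * v x) * z x) = l * (LINT x|lebesgue_on \<Omega>. (u x + c * v x) * z x)"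
    if z: "H01 \<Omega> z k" for z k
  proof -
    note s = H01D(1)[OF u(1)] H01D(2)[OF u(1)] H01D(1)[OF v(1)] H01D(2)[OF v(1)] H01D(1)[OF z] H01D(2)[OF z]
    have "(LINT x|lebesgue_on \<Omega>. (g x + c *\<^sub>R h x) \<bullet> k x) = (LINT x|lebesgue_on \<Omega>. g x \<bullet> k x) + c * (LINT x|lebesgue_on \<Omega>. h x \<bullet> k x)"
      using square_integrable_inner[OF s(2) s(6)] square_integrable_inner[OF s(4) s(6)] by (simp add: inner_add_left)
    moreover have "(LINT x|lebesgue_on \<Omega>. V x * (u x + c * v x) * z x) = (LINT x|lebesgue_on \<Omega>. V x * u x * z x + c * (V x * v x * z x))"
      by (intro Bochner_Integration.integral_cong) (auto simp: algebra_simps)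
    moreover have "(LINT x|lebesgue_on \<Omega>. (u x + c * v x) * z x) = (LINT x|lebesgue_on \<Omega>. u x * z x + c * (v x * z x))"
      by (intro Bochner_Integration.integral_cong) (auto simp: algebra_simps)
    ultimately show ?thesis
      using V_integrable[OF s(1) s(5)] V_integrable[OF s(3) s(5)] square_integrable_mult[OF s(1) s(5)] square_integrable_mult[OF s(3) s(5)]
        arg_cong2[OF u(2)[OF z] v(2)[OF z], of "\<lambda>a b. a + c * b"] by (simp add: algebra_simps)
  qed
  then show "(\<lambda>x. u x + c *\<^sub>R v x) \<in> schroedinger_eigenspace \<Omega> V l"
    unfolding schroedinger_eigenspace_def using H01_add_cmult[OF u(1) v(1), of c] by auto
qed

text \<open>Out of k eigenfunctions, fewer than k linear conditions leave a nontrivial combination.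
  Components with different eigenvalues are L2-orthogonal, so the energy is the sum of l times the
  squared norm of each component, and independence within a single eigenspace is enough for u to be
  nonzero.\<close>

lemma eigenfunction_combination:
  assumes \<Lambda>: "finite \<Lambda>" "\<Lambda> \<subseteq> {0<..\<mu>}" "enat k \<le> (\<Sum>l\<in>\<Lambda>. ae_dim \<Omega> (schroedinger_eigenspace \<Omega> V l))"
    and m: "m < k" and w: "\<And>j. j < m \<Longrightarrow> square_integrable \<Omega> (w j)"
  obtains u g where "H01 \<Omega> u g" "\<And>j. j < m \<Longrightarrow> (LINT x|lebesgue_on \<Omega>. u x * w j x) = 0"
    "(LINT x|lebesgue_on \<Omega>. g x \<bullet> g x) + (LINT x|lebesgue_on \<Omega>. V x * u x * u x) \<le> \<mu> * (LINT x|lebesgue_on \<Omega>. u x * u x)"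
    "(LINT x|lebesgue_on \<Omega>. u x * u x) > 0"
proof -
  let ?E = "schroedinger_eigenspace \<Omega> V"
  obtain n where n: "\<And>l. l \<in> \<Lambda> \<Longrightarrow> enat (n l) \<le> ae_dim \<Omega> (?E l)" "(\<Sum>l\<in>\<Lambda>. n l) = k"
    using enat_sum_split[OF \<Lambda>(1,3)] by blast
  have "\<forall>l\<in>\<Lambda>. \<exists>U. (\<forall>i<n l. U i \<in> ?E l) \<and> (\<forall>c::nat \<Rightarrow> real. (AE x in lebesgue_on \<Omega>. (\<Sum>i<n l. c i *\<^sub>R U i x) = 0) \<longrightarrow> (\<forall>i<n l. c i = 0))"
  proof
    fix l assume l: "l \<in> \<Lambda>"
    obtain U where "\<And>i. i < n l \<Longrightarrow> U i \<in> ?E l"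
      "\<And>c :: nat \<Rightarrow> real. (AE x in lebesgue_on \<Omega>. (\<Sum>i<n l. c i *\<^sub>R U i x) = 0) \<Longrightarrow> \<forall>i<n l. c i = 0"
      by (rule ae_dim_family[OF n(1)[OF l]]) (rule that)
    then show "\<exists>U. (\<forall>i<n l. U i \<in> ?E l) \<and> (\<forall>c::nat \<Rightarrow> real. (AE x in lebesgue_on \<Omega>. (\<Sum>i<n l. c i *\<^sub>R U i x) = 0) \<longrightarrow> (\<forall>i<n l. c i = 0))"
      by (intro exI[of _ U]) simp
  qed
  from bchoice[OF this] obtain U where UE: "\<And>l i. l \<in> \<Lambda> \<Longrightarrow> i < n l \<Longrightarrow> U l i \<in> ?E l"
    and indep: "\<And>l c. l \<in> \<Lambda> \<Longrightarrow> AE x in lebesgue_on \<Omega>. (\<Sum>i<n l. c i *\<^sub>R U l i x) = 0 \<Longrightarrow> \<forall>i<n l. c i = 0"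
    by blast
  have sU: "square_integrable \<Omega> (U l i)" if "l \<in> \<Lambda>" "i < n l" for l i
    using UE[OF that] H01D(1) unfolding schroedinger_eigenspace_def by blast
  define I where "I = Sigma \<Lambda> (\<lambda>l. {..<n l})"
  have I: "finite I" "card {..<m} < card I"
    using \<Lambda>(1) m n(2) by (auto simp: I_def card_SigmaI)
  obtain c where c: "\<exists>i\<in>I. c i \<noteq> 0" "\<And>j. j < m \<Longrightarrow> (\<Sum>i\<in>I. c i * (LINT x|lebesgue_on \<Omega>. U (fst i) (snd i) x * w j x)) = 0"
    using underdetermined_system[OF _ I, of "\<lambda>j i. LINT x|lebesgue_on \<Omega>. U (fst i) (snd i) x * w j x"] by auto
  define ul where "ul l x = (\<Sum>i<n l. c (l, i) *\<^sub>R U l i x)" for l x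
  have ulE: "ul l \<in> ?E l" if "l \<in> \<Lambda>" for l
    unfolding ul_def[abs_def] by (rule function_space.sum_closed[OF eigenspace_function_space UE[OF that]])
  then have "\<forall>l\<in>\<Lambda>. \<exists>g. H01 \<Omega> (ul l) g \<and> (\<forall>v h. H01 \<Omega> v h \<longrightarrow> (LINT x|lebesgue_on \<Omega>. g x \<bullet> h x) + (LINT x|lebesgue_on \<Omega>. V x * ul l x * v x) = l * (LINT x|lebesgue_on \<Omega>. ul l x * v x))"
    unfolding schroedinger_eigenspace_def by blast
  from bchoice[OF this] obtain gl where H: "\<And>l. l \<in> \<Lambda> \<Longrightarrow> H01 \<Omega> (ul l) (gl l)"
    and eq: "\<And>l v h. l \<in> \<Lambda> \<Longrightarrow> H01 \<Omega> v h \<Longrightarrow> (LINT x|lebesgue_on \<Omega>. gl l x \<bullet> h x) + (LINT x|lebesgue_on \<Omega>. V x * ul l x * v x) = l * (LINT x|lebesgue_on \<Omega>. ul l x * v x)"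
    by blast
  define u where "u x = (\<Sum>l\<in>\<Lambda>. ul l x)" for x
  define g where "g x = (\<Sum>l\<in>\<Lambda>. gl l x)" for x
  have Hu: "H01 \<Omega> u g" unfolding u_def[abs_def] g_def[abs_def] by (rule H01_sum[OF H])
  note su = H01D(1)[OF Hu] and sg = H01D(2)[OF Hu]
  have sul: "square_integrable \<Omega> (ul l)" and sgl: "square_integrable \<Omega> (gl l)" if "l \<in> \<Lambda>" for l
    using H01D[OF H[OF that]] by auto
  \<comment> \<open>Each equation is tested with the other eigenfunction. The weak gradients
    \<open>gl\<close> are fixed once per component, so the two left-hand sides coincide by
    symmetry.\<close>
  have ortho: "(LINT x|lebesgue_on \<Omega>. ul l x * ul l' x) = 0" if "l \<in> \<Lambda>" "l' \<in> \<Lambda>" "l \<noteq> l'" for l l'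
  proof -
    have "l * (LINT x|lebesgue_on \<Omega>. ul l x * ul l' x) = l' * (LINT x|lebesgue_on \<Omega>. ul l x * ul l' x)"
      using eq[OF that(1) H[OF that(2)]] eq[OF that(2) H[OF that(1)]] by (simp add: inner_commute mult_ac)
    then show ?thesis using that(3) by simp
  qed
  have ulu: "(LINT x|lebesgue_on \<Omega>. ul l x * u x) = (LINT x|lebesgue_on \<Omega>. ul l x * ul l x)" if l: "l \<in> \<Lambda>" for l
  proof -
    have "(LINT x|lebesgue_on \<Omega>. ul l x * u x) = (LINT x|lebesgue_on \<Omega>. (\<Sum>l'\<in>\<Lambda>. ul l x * ul l' x))"
      by (simp add: u_def sum_distrib_left)
    also have "\<dots> = (\<Sum>l'\<in>\<Lambda>. LINT x|lebesgue_on \<Omega>. ul l x * ul l' x)"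
      using square_integrable_mult[OF sul[OF l] sul] by (rule Bochner_Integration.integral_sum)
    also have "\<dots> = (\<Sum>l'\<in>\<Lambda>. if l' = l then LINT x|lebesgue_on \<Omega>. ul l x * ul l x else 0)"
      using ortho[OF l] by (intro sum.cong) auto
    finally show ?thesis using l \<Lambda>(1) by simp
  qed
  have uu: "(LINT x|lebesgue_on \<Omega>. u x * u x) = (\<Sum>l\<in>\<Lambda>. LINT x|lebesgue_on \<Omega>. ul l x * ul l x)"
  proof -
    have "(LINT x|lebesgue_on \<Omega>. u x * u x) = (LINT x|lebesgue_on \<Omega>. (\<Sum>l\<in>\<Lambda>. ul l x * u x))"
      by (simp add: u_def sum_distrib_right)
    also have "\<dots> = (\<Sum>l\<in>\<Lambda>. LINT x|lebesgue_on \<Omega>. ul l x * u x)"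
      using square_integrable_mult[OF sul su] by (rule Bochner_Integration.integral_sum)
    finally show ?thesis using ulu by simp
  qed
  have gg: "(LINT x|lebesgue_on \<Omega>. g x \<bullet> g x) = (\<Sum>l\<in>\<Lambda>. LINT x|lebesgue_on \<Omega>. gl l x \<bullet> g x)"
  proof -
    have "(LINT x|lebesgue_on \<Omega>. g x \<bullet> g x) = (LINT x|lebesgue_on \<Omega>. (\<Sum>l\<in>\<Lambda>. gl l x \<bullet> g x))"
      by (intro Bochner_Integration.integral_cong refl) (simp add: g_def inner_sum_left)
    also have "\<dots> = (\<Sum>l\<in>\<Lambda>. LINT x|lebesgue_on \<Omega>. gl l x \<bullet> g x)"
      using square_integrable_inner[OF sgl sg] by (rule Bochner_Integration.integral_sum)
    finally show ?thesis .
  qed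
  have Vuu: "(LINT x|lebesgue_on \<Omega>. V x * u x * u x) = (\<Sum>l\<in>\<Lambda>. LINT x|lebesgue_on \<Omega>. V x * ul l x * u x)"
  proof -
    have "(LINT x|lebesgue_on \<Omega>. V x * u x * u x) = (LINT x|lebesgue_on \<Omega>. (\<Sum>l\<in>\<Lambda>. V x * ul l x * u x))"
    proof (intro Bochner_Integration.integral_cong refl)
      fix x
      have "V x * (\<Sum>l\<in>\<Lambda>. ul l x) * u x = (\<Sum>l\<in>\<Lambda>. V x * ul l x * u x)"
        by (simp only: sum_distrib_left sum_distrib_right)
      then show "V x * u x * u x = (\<Sum>l\<in>\<Lambda>. V x * ul l x * u x)" by (simp only: u_def[symmetric])
    qed
    also have "\<dots> = (\<Sum>l\<in>\<Lambda>. LINT x|lebesgue_on \<Omega>. V x * ul l x * u x)"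
      using V_integrable[OF sul su] by (rule Bochner_Integration.integral_sum)
    finally show ?thesis .
  qed
  have nn: "0 \<le> (LINT x|lebesgue_on \<Omega>. ul l x * ul l x)" for l by (intro integral_nonneg_AE) auto
  have "(LINT x|lebesgue_on \<Omega>. g x \<bullet> g x) + (LINT x|lebesgue_on \<Omega>. V x * u x * u x) = (\<Sum>l\<in>\<Lambda>. l * (LINT x|lebesgue_on \<Omega>. ul l x * ul l x))"
    unfolding gg Vuu sum.distrib[symmetric] using eq[OF _ Hu] ulu by simp
  also have "\<dots> \<le> (\<Sum>l\<in>\<Lambda>. \<mu> * (LINT x|lebesgue_on \<Omega>. ul l x * ul l x))"
    using \<Lambda>(2) nn by (intro sum_mono mult_right_mono) auto
  also have "\<dots> = \<mu> * (LINT x|lebesgue_on \<Omega>. u x * u x)" unfolding uu sum_distrib_left ..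
  finally have en: "(LINT x|lebesgue_on \<Omega>. g x \<bullet> g x) + (LINT x|lebesgue_on \<Omega>. V x * u x * u x) \<le> \<mu> * (LINT x|lebesgue_on \<Omega>. u x * u x)" .
  \<comment> \<open>Some coefficient is nonzero; independence almost everywhere of the family for
    its eigenvalue keeps the corresponding component from vanishing.\<close>
  obtain l i where li: "l \<in> \<Lambda>" "i < n l" "c (l, i) \<noteq> 0" using c(1) by (auto simp: I_def)
  have "(LINT x|lebesgue_on \<Omega>. ul l x * ul l x) \<noteq> 0"
  proof
    assume "(LINT x|lebesgue_on \<Omega>. ul l x * ul l x) = 0"
    then have "AE x in lebesgue_on \<Omega>. ul l x * ul l x = 0"
      using square_integrable_mult[OF sul[OF li(1)] sul[OF li(1)]] by (subst (asm) integral_nonneg_eq_0_iff_AE) auto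
    then have "AE x in lebesgue_on \<Omega>. (\<Sum>i<n l. c (l, i) *\<^sub>R U l i x) = 0" by (simp add: ul_def)
    then show False using indep[OF li(1), of "\<lambda>i. c (l, i)"] li by blast
  qed
  then have "0 < (LINT x|lebesgue_on \<Omega>. ul l x * ul l x)" using nn[of l] by linarith
  also have "\<dots> \<le> (LINT x|lebesgue_on \<Omega>. u x * u x)"
    unfolding uu using li(1) \<Lambda>(1) nn by (intro member_le_sum) auto
  finally have pos: "0 < (LINT x|lebesgue_on \<Omega>. u x * u x)" .
  have "(LINT x|lebesgue_on \<Omega>. u x * w j x) = 0" if j: "j < m" for j
  proof -
    have iU: "integrable (lebesgue_on \<Omega>) (\<lambda>x. c (l, i) * (U l i x * w j x))" if "l \<in> \<Lambda>" "i < n l" for l i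
      using square_integrable_mult[OF sU[OF that] w[OF j]] by (rule integrable_mult_right)
    have "(LINT x|lebesgue_on \<Omega>. u x * w j x) = (LINT x|lebesgue_on \<Omega>. (\<Sum>l\<in>\<Lambda>. \<Sum>i<n l. c (l, i) * (U l i x * w j x)))"
      by (simp add: u_def ul_def sum_distrib_right mult.assoc)
    also have "\<dots> = (\<Sum>l\<in>\<Lambda>. \<Sum>i<n l. LINT x|lebesgue_on \<Omega>. c (l, i) * (U l i x * w j x))"
    proof -
      have "(LINT x|lebesgue_on \<Omega>. (\<Sum>l\<in>\<Lambda>. \<Sum>i<n l. c (l, i) * (U l i x * w j x))) = (\<Sum>l\<in>\<Lambda>. LINT x|lebesgue_on \<Omega>. (\<Sum>i<n l. c (l, i) * (U l i x * w j x)))"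
        by (rule Bochner_Integration.integral_sum) (intro Bochner_Integration.integrable_sum iU, auto)
      also have "\<dots> = (\<Sum>l\<in>\<Lambda>. \<Sum>i<n l. LINT x|lebesgue_on \<Omega>. c (l, i) * (U l i x * w j x))"
        by (intro sum.cong refl Bochner_Integration.integral_sum iU) auto
      finally show ?thesis .
    qed
    also have "\<dots> = (\<Sum>i\<in>I. c i * (LINT x|lebesgue_on \<Omega>. U (fst i) (snd i) x * w j x))"
      unfolding I_def using \<Lambda>(1) by (subst sum.Sigma) (auto intro!: sum.cong)
    also have "\<dots> = 0" by (rule c(2)[OF j])
    finally show ?thesis .
  qed
  with that Hu en pos show ?thesis by blast
qed

text \<open>The k eigenvectors of the pencil are grouped by eigenvalue. Since b depends only on
  classes modulo null sets, b-orthonormality makes each group independent almost everywhere, and the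
  sizes of the groups add up to k.\<close>

lemma kth_eigenvalue_sCR_le:
  assumes \<Lambda>: "finite \<Lambda>" "\<Lambda> \<subseteq> {0<..\<mu>}" "enat k \<le> (\<Sum>l\<in>\<Lambda>. ae_dim \<Omega> (schroedinger_eigenspace \<Omega> V l))"
    and \<mu>: "\<mu> < 1 / (\<kappa>\<^sup>2 * (h_max \<T>)\<^sup>2)"
  shows "kth_eigenvalue \<Omega> (sCR_eigenspace \<Omega> \<T> V \<kappa>) k \<le> ereal \<mu>"
proof -
  interpret P: finite_pencil X ah bh es_bound by (rule pencil)
  have sX: "square_integrable \<Omega> (fst \<circ> z)" if "z \<in> X" for z
    using components_square_integrable(1)[OF that] mesh_square_integrable by blast
  have test: "\<exists>u\<in>X. (\<forall>j<m. bh u (w j) = 0) \<and> bh u u > 0 \<and> ah u u \<le> \<mu> * bh u u"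
    if m: "m < k" and w: "\<And>j. j < m \<Longrightarrow> w j \<in> X" for m w
  proof -
    obtain u g where u: "H01 \<Omega> u g" "\<And>j. j < m \<Longrightarrow> (LINT x|lebesgue_on \<Omega>. u x * (fst \<circ> w j) x) = 0"
      "(LINT x|lebesgue_on \<Omega>. g x \<bullet> g x) + (LINT x|lebesgue_on \<Omega>. V x * u x * u x) \<le> \<mu> * (LINT x|lebesgue_on \<Omega>. u x * u x)"
      "(LINT x|lebesgue_on \<Omega>. u x * u x) > 0"
      using eigenfunction_combination[OF \<Lambda> m, of "\<lambda>j. fst \<circ> w j"] sX[OF w] by blast
    obtain v where "v \<in> X" "\<And>z. z \<in> X \<Longrightarrow> bh v z = (LINT x|lebesgue_on \<Omega>. u x * fst (z x))" "ah v v \<le> \<mu> * bh v v" "bh v v > 0"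
      using test_pair[OF u(1,3,4) \<mu>] by blast
    then show ?thesis using u(2) w by (intro bexI[of _ v]) auto
  qed
  have "\<exists>w l. (\<forall>j<k. w j \<in> X \<and> 0 < l j \<and> l j \<le> \<mu> \<and> (\<forall>v\<in>X. ah (w j) v = l j * bh (w j) v)) \<and>
    (\<forall>i<k. \<forall>j<k. bh (w i) (w j) = (if i = j then 1 else 0))"
    by (rule P.eigenvectors) (rule test)
  then obtain w l where ew: "\<forall>j<k. w j \<in> X \<and> 0 < l j \<and> l j \<le> \<mu> \<and> (\<forall>v\<in>X. ah (w j) v = l j * bh (w j) v)"
    and on': "\<forall>i<k. \<forall>j<k. bh (w i) (w j) = (if i = j then 1 else 0)"
    by (elim exE conjE) (rule that)
  have wX: "\<And>j. j < k \<Longrightarrow> w j \<in> X" and l: "\<And>j. j < k \<Longrightarrow> 0 < l j \<and> l j \<le> \<mu>"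
    and ev: "\<And>j v. j < k \<Longrightarrow> v \<in> X \<Longrightarrow> ah (w j) v = l j * bh (w j) v"
    and on: "\<And>i j. i < k \<Longrightarrow> j < k \<Longrightarrow> bh (w i) (w j) = (if i = j then 1 else 0)"
    using ew on' by blast+
  let ?L = "l ` {..<k}" and ?E = "sCR_eigenspace \<Omega> \<T> V \<kappa>"
  define J where "J \<rho> = {j\<in>{..<k}. l j = \<rho>}" for \<rho>
  have dim: "enat (card (J \<rho>)) \<le> ae_dim \<Omega> (?E \<rho>)" for \<rho>
  proof -
    have fin: "finite (J \<rho>)" by (simp add: J_def)
    obtain h where h: "bij_betw h {..<card (J \<rho>)} (J \<rho>)"
      using ex_bij_betw_nat_finite[OF fin] by (metis atLeast0LessThan)
    have hJ: "h i < k \<and> l (h i) = \<rho>" if "i < card (J \<rho>)" for i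
      using bij_betwE[OF h] that by (auto simp: J_def)
    show ?thesis
    proof (rule ae_dim_ge[of _ "\<lambda>i. w (h i)"])
      show "w (h i) \<in> ?E \<rho>" if "i < card (J \<rho>)" for i
        using hJ[OF that] wX ev unfolding sCR_eigenspace_def by auto
      fix c :: "nat \<Rightarrow> real"
      assume ae: "AE x in lebesgue_on \<Omega>. (\<Sum>i<card (J \<rho>). c i *\<^sub>R w (h i) x) = 0"
      let ?s = "\<lambda>x. \<Sum>i<card (J \<rho>). c i *\<^sub>R w (h i) x"
      have hX: "w (h i) \<in> X" if "i < card (J \<rho>)" for i using hJ[OF that] wX by blast
      have sX': "?s \<in> X" by (rule P.a.sum_closed[OF hX])
      have "bh ?s z = 0" if z: "z \<in> X" for z
      proof -
        have "(LINT x|lebesgue_on \<Omega>. fst (?s x) * fst (z x)) = (LINT x|lebesgue_on \<Omega>. 0)"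
        proof (rule integral_cong_AE)
          show "(\<lambda>x. fst (?s x) * fst (z x)) \<in> borel_measurable (lebesgue_on \<Omega>)"
            using borel_measurable_integrable[OF square_integrable_mult[OF sX[OF sX'] sX[OF z]]] by simp
          show "AE x in lebesgue_on \<Omega>. fst (?s x) * fst (z x) = 0"
            using ae by (rule AE_mp) (intro AE_I2 impI, simp)
        qed simp
        then show ?thesis by (simp add: b_es_def)
      qed
      show "\<forall>i<card (J \<rho>). c i = 0"
      proof (intro allI impI)
        fix j assume j: "j < card (J \<rho>)"
        have "bh ?s (w (h j)) = (\<Sum>i<card (J \<rho>). c i * bh (w (h i)) (w (h j)))" by (intro P.b.sum_left hX j)
        also have "\<dots> = (\<Sum>i<card (J \<rho>). if i = j then c i else 0)"
        proof (intro sum.cong refl)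
          fix i assume i: "i \<in> {..<card (J \<rho>)}"
          have "h i = h j \<longleftrightarrow> i = j" using h i j by (metis bij_betw_imp_inj_on inj_on_eq_iff lessThan_iff)
          then show "c i * bh (w (h i)) (w (h j)) = (if i = j then c i else 0)"
            using on[of "h i" "h j"] hJ[of i] hJ[OF j] i by auto
        qed
        finally show "c j = 0" using \<open>\<And>z. z \<in> X \<Longrightarrow> bh ?s z = 0\<close>[OF hX[OF j]] j by simp
      qed
    qed
  qed
  have "card (\<Union>(J ` ?L)) = (\<Sum>\<rho>\<in>?L. card (J \<rho>))"
    by (rule card_UN_disjoint) (auto simp: J_def)
  moreover have "\<Union>(J ` ?L) = {..<k}" by (auto simp: J_def)
  ultimately have "k = (\<Sum>\<rho>\<in>?L. card (J \<rho>))" by simp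
  then have "enat k = enat (\<Sum>\<rho>\<in>?L. card (J \<rho>))" by (rule arg_cong)
  also have "\<dots> = (\<Sum>\<rho>\<in>?L. enat (card (J \<rho>)))"
    by (simp only: of_nat_eq_enat[symmetric] of_nat_sum)
  also have "\<dots> \<le> (\<Sum>\<rho>\<in>?L. ae_dim \<Omega> (?E \<rho>))" by (intro sum_mono dim)
  finally have "enat k \<le> (\<Sum>\<rho>\<in>?L. ae_dim \<Omega> (?E \<rho>))" .
  moreover have "finite ?L" "?L \<subseteq> {0<..\<mu>}" using l by auto
  ultimately show ?thesis unfolding kth_eigenvalue_def by (intro Inf_lower) blast
qed

end

text \<open>\<open>GLB \<epsilon> l\<close> is the minimum of l and 1 / \<epsilon>: the positive
  part acts exactly when \<epsilon> l exceeds 1, and then it cancels l. For infinite l the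
  definition prescribes 1 / \<epsilon>.\<close>

lemma GLB_le:
  assumes \<epsilon>: "\<epsilon> > 0" and l: "0 \<le> l"
  shows "GLB \<epsilon> l \<le> ereal (1 / \<epsilon>)" "GLB \<epsilon> l \<le> l"
proof -
  have "GLB \<epsilon> l \<le> ereal (1 / \<epsilon>) \<and> GLB \<epsilon> l \<le> l"
  proof (cases l)
    case (real r)
    then have r: "r \<ge> 0" using l by simp
    have m: "max 0 (ereal \<epsilon> * ereal r - 1) = ereal (max 0 (\<epsilon> * r - 1))"
      by (simp add: one_ereal_def max_def zero_ereal_def)
    have "GLB \<epsilon> l = ereal r / (1 + max 0 (ereal \<epsilon> * ereal r - 1))" by (simp add: GLB_def real)
    also have "\<dots> = ereal r / ereal (1 + max 0 (\<epsilon> * r - 1))"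
      unfolding m by (simp only: one_ereal_def plus_ereal.simps)
    also have "\<dots> = ereal (r / (1 + max 0 (\<epsilon> * r - 1)))"
    proof -
      have "1 + max 0 (\<epsilon> * r - 1) \<noteq> 0" by linarith
      then show ?thesis by (simp only: ereal_divide if_False)
    qed
    finally have G: "GLB \<epsilon> l = ereal (r / (1 + max 0 (\<epsilon> * r - 1)))" .
    have "r / (1 + max 0 (\<epsilon> * r - 1)) \<le> 1 / \<epsilon> \<and> r / (1 + max 0 (\<epsilon> * r - 1)) \<le> r"
    proof (cases "\<epsilon> * r \<le> 1")
      case True
      then show ?thesis using \<epsilon> by (simp add: field_simps)
    next
      case False
      then have "r / (1 + max 0 (\<epsilon> * r - 1)) = 1 / \<epsilon>" using \<epsilon> r by (cases "r = 0") auto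
      moreover have "1 / \<epsilon> \<le> r" using False \<epsilon> by (simp add: field_simps)
      ultimately show ?thesis by simp
    qed
    then show ?thesis unfolding G unfolding real by simp
  next
    case PInf
    then show ?thesis by (simp add: GLB_def)
  next
    case MInf
    then show ?thesis using l by simp
  qed
  then show "GLB \<epsilon> l \<le> ereal (1 / \<epsilon>)" "GLB \<epsilon> l \<le> l" by auto
qed

theorem theorem5p2:
  fixes \<Omega> :: "'a::euclidean_space set" and \<T> :: "'a set set"
    and V :: "'a \<Rightarrow> real" and \<kappa> :: real and k :: nat
  assumes "2 \<le> DIM('a)"
    and "polyhedral_lipschitz_domain \<Omega>"
    and "regular_triangulation \<T> \<Omega>"
    and "ess_bounded \<Omega> V"
    and "essinf \<Omega> V = 0"
    and "V \<in> P0 \<T>"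
    and "eCR_constant \<Omega> \<T> \<kappa>"
    and "1 \<le> k"
  shows "GLB (\<kappa>\<^sup>2 * (h_max \<T>)\<^sup>2) (kth_eigenvalue \<Omega> (sCR_eigenspace \<Omega> \<T> V \<kappa>) k)
           \<le> kth_eigenvalue \<Omega> (schroedinger_eigenspace \<Omega> V) k"
proof -
  interpret scheme \<Omega> \<T> V \<kappa>
    using assms by unfold_locales
  let ?\<epsilon> = "\<kappa>\<^sup>2 * (h_max \<T>)\<^sup>2" and ?l = "kth_eigenvalue \<Omega> (sCR_eigenspace \<Omega> \<T> V \<kappa>) k"
  have \<epsilon>: "?\<epsilon> > 0" using \<kappa>_pos h_max_pos by simp
  have l0: "0 \<le> ?l"
    unfolding kth_eigenvalue_def
  proof (rule Inf_greatest, clarify)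
    fix \<mu> and \<Lambda> :: "real set"
    assume L: "\<Lambda> \<subseteq> {0<..\<mu>}" "enat k \<le> (\<Sum>l\<in>\<Lambda>. ae_dim \<Omega> (sCR_eigenspace \<Omega> \<T> V \<kappa> l))"
    \<comment> \<open>Positivity of k rules out the empty set of eigenvalues, which would place no
      sign on \<mu>.\<close>
    have "\<Lambda> \<noteq> {}" using L(2) assms(8) by (auto simp: zero_enat_def)
    then show "0 \<le> ereal \<mu>" using L(1) by fastforce
  qed
  show ?thesis
    unfolding kth_eigenvalue_def[of \<Omega> "schroedinger_eigenspace \<Omega> V"]
  proof (rule Inf_greatest, clarify)
    fix \<mu> and \<Lambda> :: "real set"
    assume L: "finite \<Lambda>" "\<Lambda> \<subseteq> {0<..\<mu>}" "enat k \<le> (\<Sum>l\<in>\<Lambda>. ae_dim \<Omega> (schroedinger_eigenspace \<Omega> V l))"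
    show "GLB ?\<epsilon> ?l \<le> ereal \<mu>"
    \<comment> \<open>From 1 / \<epsilon> on, the bound holds for free because \<open>GLB\<close>
      never exceeds this value; the comparison of the two spectra is needed only below.\<close>
    proof (cases "\<mu> < 1 / ?\<epsilon>")
      case True
      show ?thesis by (rule order_trans[OF GLB_le(2)[OF \<epsilon> l0] kth_eigenvalue_sCR_le[OF L True]])
    next
      case False
      then have "ereal (1 / ?\<epsilon>) \<le> ereal \<mu>" by simp
      with GLB_le(1)[OF \<epsilon> l0] show ?thesis by (rule order_trans)
    qed
  qed
qed

end
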